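(* Let $\rho^{A_1\ldots A_m}$ be an $m$-partite quantum state. Then $$D(\rho)\ \ge\ \max_{i\in[m]}\ \min_{\emptyset\ne J\subseteq[m]\setminus\{i\}}\frac{I(A_J\rangle A_{[m]\setminus J})_\rho}{|J|}.$$
   Context: $[m]=\{1,\ldots,m\}$, $A_J$ denotes the joint system $(A_j:j\in J)$. The coherent information is $I(A\rangle B)_\rho=S(B)_\rho-S(AB)_\rho$ with $S$ the von Neumann entropy; so $I(A_J\rangle A_{[m]\setminus J})_\rho=S(A_{[m]\setminus J})_\rho-S(A_{[m]})_\rho$. $\log$ base 2. GHZ distillation capacity: let $|\Gamma_m\rangle=\frac1{\sqrt2}(|0\rangle^{\otimes m}+|1\rangle^{\otimes m})$. An $(n,\varepsilon)$-protocol of rate $k/n$ is an $m$-partite channel $\Lambda$ on $A_1^n\ldots A_m^n$ implementable by local operations and classical communication (LOCC) with $F(|\Gamma_m\rangle\langle\Gamma_m|^{\otimes k},\Lambda(\rho^{\otimes n}))\ge1-\varepsilon$, where $F(\rho,\sigma)=\|\sqrt\rho\sqrt\sigma\|_1$ is the fidelity and the $i$-th qubit of each GHZ state is held by party $i$. $R$ is achievable if for every $n$ there are $(n,\varepsilon_n)$-protocols with $\varepsilon_n\to0$ and $k/n\to R$; $D(\rho)=\sup\{R:R\text{ achievable}\}$. *)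

theory Defs
  imports "Jordan_Normal_Form.Schur_Decomposition" "Jordan_Normal_Form.Char_Poly" "HOL-Library.Extended_Real"
begin

definition mtrace :: "complex mat \<Rightarrow> complex" where
  "mtrace A = (\<Sum>i<dim_row A. A $$ (i,i))"

definition hermitian :: "complex mat \<Rightarrow> bool" where
  "hermitian A \<longleftrightarrow> A \<in> carrier_mat (dim_row A) (dim_row A) \<and> mat_adjoint A = A"

definition psd :: "complex mat \<Rightarrow> bool" where
  "psd A \<longleftrightarrow> hermitian A \<and>
     (\<forall>v \<in> carrier_vec (dim_row A). Re ((A *\<^sub>v v) \<bullet>c v) \<ge> 0)"

definition msqrt :: "complex mat \<Rightarrow> complex mat" where
  "msqrt A = (THE B. psd B \<and> B * B = A)"

definition trace_norm :: "complex mat \<Rightarrow> real" where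
  "trace_norm X = Re (mtrace (msqrt (mat_adjoint X * X)))"

definition fidelity :: "complex mat \<Rightarrow> complex mat \<Rightarrow> real" where
  "fidelity \<rho> \<sigma> = trace_norm (msqrt \<rho> * msqrt \<sigma>)"

text \<open>Von Neumann entropy (base 2): minus the sum over the eigenvalues, counted with
  algebraic multiplicity (as roots of the characteristic polynomial), of lambda log lambda;
  note that in Isabelle 0 * log 2 0 = 0.\<close>
definition vn_entropy :: "complex mat \<Rightarrow> real" where
  "vn_entropy A = - (\<Sum>e \<in> {e. poly (char_poly A) e = 0}.
      real (order e (char_poly A)) * (Re e * log 2 (Re e)))"

text \<open>An m-partite system with local dimensions d 0, ..., d (m-1) (parties are indexed by
  0..m-1).  Computational basis vectors are tuples x with x i < d i for i < m, encoded
  in mixed radix (party 0 least significant).\<close>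

definition tdim :: "nat \<Rightarrow> (nat \<Rightarrow> nat) \<Rightarrow> nat" where
  "tdim m d = (\<Prod>i<m. d i)"

definition enc :: "nat \<Rightarrow> (nat \<Rightarrow> nat) \<Rightarrow> (nat \<Rightarrow> nat) \<Rightarrow> nat" where
  "enc m d x = (\<Sum>i<m. x i * (\<Prod>j<i. d j))"

definition dec :: "nat \<Rightarrow> (nat \<Rightarrow> nat) \<Rightarrow> nat \<Rightarrow> (nat \<Rightarrow> nat)" where
  "dec m d a = (\<lambda>i. if i < m then (a div (\<Prod>j<i. d j)) mod d i else 0)"

definition tuples :: "nat \<Rightarrow> (nat \<Rightarrow> nat) \<Rightarrow> (nat \<Rightarrow> nat) set" where
  "tuples m d = {x. (\<forall>i<m. x i < d i) \<and> (\<forall>i\<ge>m. x i = 0)}"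

definition is_state :: "nat \<Rightarrow> (nat \<Rightarrow> nat) \<Rightarrow> complex mat \<Rightarrow> bool" where
  "is_state m d \<rho> \<longleftrightarrow> (\<forall>i<m. d i \<ge> 1) \<and> \<rho> \<in> carrier_mat (tdim m d) (tdim m d)
      \<and> psd \<rho> \<and> mtrace \<rho> = 1"

text \<open>Reduced state on the parties in K (a subset of {..<m}): the parties outside K are
  traced out; the result lives on the system whose local dimensions are d i for i in K
  and 1 for i outside K (so the same mixed-radix encoding is used).\<close>
definition sub_dims :: "nat set \<Rightarrow> (nat \<Rightarrow> nat) \<Rightarrow> (nat \<Rightarrow> nat)" where
  "sub_dims K d = (\<lambda>i. if i \<in> K then d i else 1)"

definition ptrace_keep :: "nat \<Rightarrow> (nat \<Rightarrow> nat) \<Rightarrow> nat set \<Rightarrow> complex mat \<Rightarrow> complex mat" where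
  "ptrace_keep m d K \<rho> =
     mat (tdim m (sub_dims K d)) (tdim m (sub_dims K d))
       (\<lambda>(a,b). \<Sum>z \<in> tuples m (sub_dims ({..<m} - K) d).
          \<rho> $$ (enc m d (\<lambda>i. if i \<in> K then dec m (sub_dims K d) a i else z i),
                enc m d (\<lambda>i. if i \<in> K then dec m (sub_dims K d) b i else z i)))"

definition entropy_of :: "nat \<Rightarrow> (nat \<Rightarrow> nat) \<Rightarrow> nat set \<Rightarrow> complex mat \<Rightarrow> real" where
  "entropy_of m d K \<rho> = vn_entropy (ptrace_keep m d K \<rho>)"

definition coh_info :: "nat \<Rightarrow> (nat \<Rightarrow> nat) \<Rightarrow> nat set \<Rightarrow> complex mat \<Rightarrow> real" where
  "coh_info m d J \<rho> = entropy_of m d ({..<m} - J) \<rho> - entropy_of m d {..<m} \<rho>"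

text \<open>rho^{\<otimes>n} viewed as an m-partite state where party i holds A_i^n of dimension
  (d i)^n; the t-th copy of party i is the t-th base-(d i) digit of its index.\<close>
definition tensor_pow :: "nat \<Rightarrow> (nat \<Rightarrow> nat) \<Rightarrow> nat \<Rightarrow> complex mat \<Rightarrow> complex mat" where
  "tensor_pow m d n \<rho> =
     mat (tdim m (\<lambda>i. d i ^ n)) (tdim m (\<lambda>i. d i ^ n))
       (\<lambda>(a,b). \<Prod>t<n.
          \<rho> $$ (enc m d (\<lambda>i. (dec m (\<lambda>i. d i ^ n) a i div d i ^ t) mod d i),
                enc m d (\<lambda>i. (dec m (\<lambda>i. d i ^ n) b i div d i ^ t) mod d i)))"

text \<open>|Gamma_m><Gamma_m| with Gamma_m = (|0...0> + |1...1>)/sqrt 2 on m qubits.\<close>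
definition ghz :: "nat \<Rightarrow> complex mat" where
  "ghz m = mat (2^m) (2^m) (\<lambda>(a,b).
      if (a = 0 \<or> a = 2^m - 1) \<and> (b = 0 \<or> b = 2^m - 1) then 1/2 else 0)"

text \<open>Finite sum F 0 + ... + F (N-1) of r x c matrices (matrices do not form a
  comm_monoid_add type, so the big-sum operator is not available).\<close>
fun msum :: "nat \<Rightarrow> nat \<Rightarrow> (nat \<Rightarrow> complex mat) \<Rightarrow> nat \<Rightarrow> complex mat" where
  "msum r c F 0 = 0\<^sub>m r c"
| "msum r c F (Suc N) = msum r c F N + F N"

text \<open>The operator I \<otimes> E \<otimes> I where E : C^{dI i} \<rightarrow> C^{dO i} acts on party i and
  the other parties are untouched (dO j = dI j for j \<noteq> i).\<close>
definition local_op :: "nat \<Rightarrow> (nat \<Rightarrow> nat) \<Rightarrow> (nat \<Rightarrow> nat) \<Rightarrow> nat \<Rightarrow> complex mat \<Rightarrow> complex mat" where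
  "local_op m dI dO i E =
     mat (tdim m dO) (tdim m dI) (\<lambda>(a,b).
        let x = dec m dO a; y = dec m dI b in
        if (\<forall>j<m. j \<noteq> i \<longrightarrow> x j = y j) then E $$ (x i, y i) else 0)"

text \<open>locc m dI dO \<Lambda>: \<Lambda> is an m-partite channel from local dimensions dI to dO
  implementable by a finite-round LOCC protocol: in each round some party i applies a
  local instrument with Kraus operators E_0,...,E_{N-1} (possibly changing its local
  dimension), broadcasts the outcome x, and the remaining protocol may depend on x.\<close>
inductive locc :: "nat \<Rightarrow> (nat \<Rightarrow> nat) \<Rightarrow> (nat \<Rightarrow> nat) \<Rightarrow> (complex mat \<Rightarrow> complex mat) \<Rightarrow> bool"
  for m :: nat where
  locc_id: "(\<forall>i<m. dI i = dO i) \<Longrightarrow> locc m dI dO (\<lambda>\<rho>. \<rho>)"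
| locc_step: "\<lbrakk> i < m; \<forall>j<m. j \<noteq> i \<longrightarrow> dN j = dI j; dN i \<ge> 1;
      \<forall>x<N. E x \<in> carrier_mat (dN i) (dI i);
      msum (dI i) (dI i) (\<lambda>x. mat_adjoint (E x) * E x) N = 1\<^sub>m (dI i);
      \<forall>x<N. locc m dN dO (\<Lambda>s x) \<rbrakk>
   \<Longrightarrow> locc m dI dO (\<lambda>\<rho>. msum (tdim m dO) (tdim m dO)
          (\<lambda>x. \<Lambda>s x (local_op m dI dN i (E x) * \<rho> * mat_adjoint (local_op m dI dN i (E x)))) N)"

definition ghz_achievable :: "nat \<Rightarrow> (nat \<Rightarrow> nat) \<Rightarrow> complex mat \<Rightarrow> real \<Rightarrow> bool" where
  "ghz_achievable m d \<rho> R \<longleftrightarrow>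
     (\<exists>k :: nat \<Rightarrow> nat. \<exists>\<epsilon> :: nat \<Rightarrow> real. \<exists>\<Lambda> :: nat \<Rightarrow> complex mat \<Rightarrow> complex mat.
        (\<forall>n. locc m (\<lambda>i. d i ^ n) (\<lambda>i. 2 ^ k n) (\<Lambda> n) \<and>
             fidelity (tensor_pow m (\<lambda>_. 2) (k n) (ghz m)) (\<Lambda> n (tensor_pow m d n \<rho>))
               \<ge> 1 - \<epsilon> n) \<and>
        \<epsilon> \<longlonglongrightarrow> 0 \<and>
        (\<lambda>n. real (k n) / real n) \<longlonglongrightarrow> R)"

definition ghz_capacity :: "nat \<Rightarrow> (nat \<Rightarrow> nat) \<Rightarrow> complex mat \<Rightarrow> ereal" where
  "ghz_capacity m d \<rho> = Sup (ereal ` {R. ghz_achievable m d \<rho> R})"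

end

theory Submission
  imports Defs "HOL-Analysis.L2_Norm"
begin

text \<open>Fix the party \<open>i0\<close> and purify \<open>\<rho>\<close>. Every other party applies the same kind of random measurement:
  it multiplies the amplitudes by pseudorandom signs (a finite family with the first four moments of
  independent signs) and keeps \<open>K\<close> of the resulting amplitudes. If the kept
  systems and the environment were left in a product state that is maximally mixed on the kept systems,
  then \<open>i0\<close> could decode, coherently, all the indices kept by the other parties. The second moment of the deviation from
  this ideal splits into a sum over the nonempty sets \<open>J\<close> of measuring parties, the \<open>J\<close>-term being governed
  by the purity of the reduced state on the complement of \<open>J\<close> and being multiplied by \<open>K ^ card J\<close>.
  Splitting off the atypical part separately for each \<open>J\<close> turns this purity into the entropy of the
  complement, which gives the rate condition \<open>R * card J < I(J \<rangle> complement)\<close> for all \<open>J\<close> at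
  once. The Powers--St{\o}rmer inequality converts the deviation into a decoder, and measuring the
  differences of the decoded indices leaves a GHZ state.\<close>

section \<open>Mixed-radix indices\<close>

text \<open>The obstacle is to decouple every \<open>J\<close> at the same time: the typical part of
  the marginal on \<open>J\<close> and the environment depends on \<open>J\<close>, and cutting the
  state down for one \<open>J\<close> would disturb the marginals for the others. So only kernels
  are split. The deviation is linear in the marginal kernel, hence each \<open>J\<close> may use its
  own splitting, while the state is cut only in the environment label, to eigenvalues at least
  \<open>a\<close>; this leaves at most \<open>1 / a\<close> labels. If \<open>g\<close> bounds the
  eigenvalues kept in the complement of \<open>J\<close>, the \<open>J\<close>-term is about
  \<open>sqrt ((2 * K) ^ card J * g / a)\<close>, and for \<open>n\<close> copies
  \<open>g / a\<close> is about 2 to the power \<open>- n * I(J \<rangle> complement)\<close>. Signs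
  take the place of Haar random unitaries because an LOCC round needs a finite instrument, and
  because their fourth moments merely pair indices, so that the second moment factorises over the
  parties. Nothing is derandomised: the outcomes are broadcast, each one has its own decoder, and
  only the average is estimated.\<close>

lemma tuplesD: "x \<in> tuples m d \<Longrightarrow> i < m \<Longrightarrow> x i < d i"
  "x \<in> tuples m d \<Longrightarrow> i \<ge> m \<Longrightarrow> x i = 0"
  by (auto simp: tuples_def)

lemma tuples_0: "tuples 0 d = {\<lambda>_. 0}"
  by (auto simp: tuples_def)

lemma tuples_cong: "(\<And>i. i < m \<Longrightarrow> d i = d' i) \<Longrightarrow> tuples m d = tuples m d'"
  by (auto simp: tuples_def)

lemma bij_tuples_Suc:
  "bij_betw (\<lambda>(x,s). x(m:=s)) (tuples m d \<times> {..<d m}) (tuples (Suc m) d)"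
proof (rule bij_betwI[where g="\<lambda>y. (y(m:=0), y m)"])
  show "(\<lambda>(x,s). x(m:=s)) \<in> tuples m d \<times> {..<d m} \<rightarrow> tuples (Suc m) d"
    by (auto simp: tuples_def less_Suc_eq)
  show "(\<lambda>y. (y(m:=0), y m)) \<in> tuples (Suc m) d \<rightarrow> tuples m d \<times> {..<d m}"
    by (auto simp: tuples_def less_Suc_eq)
  show "\<And>x. x \<in> tuples m d \<times> {..<d m} \<Longrightarrow> (\<lambda>y. (y(m:=0), y m)) ((\<lambda>(x,s). x(m:=s)) x) = x"
    by (auto simp: tuples_def fun_eq_iff)
qed auto

lemma sum_tuples_Suc:
  "(\<Sum>x\<in>tuples (Suc m) d. h x) = (\<Sum>x\<in>tuples m d. \<Sum>s<d m. h (x(m:=s)))"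
proof -
  have "(\<Sum>x\<in>tuples (Suc m) d. h x) = (\<Sum>p\<in>tuples m d \<times> {..<d m}. h ((\<lambda>(x,s). x(m:=s)) p))"
    using bij_tuples_Suc by (rule sum.reindex_bij_betw[symmetric])
  then show ?thesis by (simp add: sum.cartesian_product case_prod_unfold)
qed

lemma finite_tuples [simp]: "finite (tuples m d)"
proof (induction m)
  case (Suc m)
  then show ?case using bij_betw_finite[OF bij_tuples_Suc[of m d]] by auto
qed (simp add: tuples_0)

text \<open>The distributive law behind every factorisation over the parties. With constant
  dimensions it also sums over strings of \<open>n\<close> labels, one per copy.\<close>

lemma sum_tuples_prod:
  fixes f :: "nat \<Rightarrow> nat \<Rightarrow> 'a :: comm_semiring_1"
  shows "(\<Sum>x\<in>tuples m d. \<Prod>i<m. f i (x i)) = (\<Prod>i<m. \<Sum>s<d i. f i s)"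
proof (induction m)
  case (Suc m)
  have "(\<Sum>x\<in>tuples (Suc m) d. \<Prod>i<Suc m. f i (x i))
      = (\<Sum>x\<in>tuples m d. \<Sum>s<d m. (\<Prod>i<m. f i (x i)) * f m s)"
    unfolding sum_tuples_Suc by (intro sum.cong refl) simp
  also have "\<dots> = (\<Sum>x\<in>tuples m d. \<Prod>i<m. f i (x i)) * (\<Sum>s<d m. f m s)"
    by (simp add: sum_product)
  finally show ?case using Suc by simp
qed (simp add: tuples_0)

lemma card_tuples: "card (tuples m d) = tdim m d"
  using sum_tuples_prod[of "\<lambda>_ _. 1::nat" m d] by (simp add: tdim_def)

definition merge :: "nat set \<Rightarrow> (nat \<Rightarrow> nat) \<Rightarrow> (nat \<Rightarrow> nat) \<Rightarrow> nat \<Rightarrow> nat" where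
  "merge J a z = (\<lambda>i. if i \<in> J then a i else z i)"

text \<open>A party outside \<open>J\<close> keeps a one-dimensional system, whose only index is 0.
  Marginals on different sets \<open>J\<close> thus share one index type, and the parties are never
  relabelled.\<close>

lemma tuples_sub_dims:
  assumes "J \<subseteq> {..<m}"
  shows "tuples m (sub_dims J d) = {x. (\<forall>i\<in>J. x i < d i) \<and> (\<forall>i. i \<notin> J \<longrightarrow> x i = 0)}"
proof (intro Set.set_eqI iffI)
  fix x assume x: "x \<in> tuples m (sub_dims J d)"
  have "x i < d i" if "i \<in> J" for i
    using tuplesD(1)[OF x, of i] assms that by (auto simp: sub_dims_def)
  moreover have "x i = 0" if "i \<notin> J" for i
    using tuplesD[OF x, of i] that by (cases "i < m") (auto simp: sub_dims_def)
  ultimately show "x \<in> {x. (\<forall>i\<in>J. x i < d i) \<and> (\<forall>i. i \<notin> J \<longrightarrow> x i = 0)}" by simp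
next
  fix x assume "x \<in> {x. (\<forall>i\<in>J. x i < d i) \<and> (\<forall>i. i \<notin> J \<longrightarrow> x i = 0)}"
  then show "x \<in> tuples m (sub_dims J d)" using assms by (auto simp: tuples_def sub_dims_def)
qed

lemma merge_in_tuples:
  assumes "J \<subseteq> {..<m}" "a \<in> tuples m (sub_dims J d)" "z \<in> tuples m (sub_dims ({..<m} - J) d)"
  shows "merge J a z \<in> tuples m d"
  using assms(2,3) unfolding tuples_sub_dims[OF assms(1)] tuples_sub_dims[OF Diff_subset]
  using assms(1) by (auto simp: tuples_def merge_def)

lemma sum_tuples_merge:
  assumes "J \<subseteq> {..<m}"
  shows "(\<Sum>x\<in>tuples m d. h x) = (\<Sum>a\<in>tuples m (sub_dims J d).
           \<Sum>z\<in>tuples m (sub_dims ({..<m} - J) d). h (merge J a z))"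
proof -
  let ?A = "tuples m (sub_dims J d)" and ?Z = "tuples m (sub_dims ({..<m} - J) d)"
  let ?g = "\<lambda>x. (\<lambda>i. if i \<in> J then x i else 0, \<lambda>i. if i \<in> J then 0 else x i)"
  have "bij_betw (\<lambda>(a,z). merge J a z) (?A \<times> ?Z) (tuples m d)"
  proof (rule bij_betwI[where g="?g"])
    show "(\<lambda>(a,z). merge J a z) \<in> ?A \<times> ?Z \<rightarrow> tuples m d"
      using merge_in_tuples[OF assms] by auto
    show "?g \<in> tuples m d \<rightarrow> ?A \<times> ?Z"
      by (auto simp: tuples_def sub_dims_def)
    fix p assume "p \<in> ?A \<times> ?Z"
    then show "?g ((\<lambda>(a,z). merge J a z) p) = p"
      unfolding tuples_sub_dims[OF assms] tuples_sub_dims[OF Diff_subset]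
      using assms by (cases p) (auto simp: merge_def fun_eq_iff)
  qed (auto simp: merge_def fun_eq_iff)
  from sum.reindex_bij_betw[OF this, of h] show ?thesis
    by (simp add: sum.cartesian_product case_prod_unfold)
qed

text \<open>The index of copy \<open>t\<close>, in the digit convention of
  \<open>tensor_pow\<close>.\<close>

definition dig :: "(nat \<Rightarrow> nat) \<Rightarrow> nat \<Rightarrow> (nat \<Rightarrow> nat) \<Rightarrow> nat \<Rightarrow> nat" where
  "dig d t x = (\<lambda>i. x i div d i ^ t mod d i)"

lemma digit_add_low:
  fixes D :: nat assumes "t < n"
  shows "(x + y * D ^ n) div D ^ t mod D = x div D ^ t mod D"
proof (cases "D = 0")
  case False
  have "n = t + Suc (n - t - 1)" using assms by simp
  then have "D ^ n = D ^ t * (D * D ^ (n - t - 1))" by (metis power_add power_Suc)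
  then have e: "x + y * D ^ n = x + D ^ t * (D * (y * D ^ (n - t - 1)))" by (metis mult.assoc mult.commute)
  have "(x + D ^ t * (D * (y * D ^ (n - t - 1)))) div D ^ t = x div D ^ t + D * (y * D ^ (n - t - 1))"
    using False by simp
  then show ?thesis unfolding e by simp
qed (use assms in \<open>cases n; auto\<close>)

lemma bij_tuples_power_Suc:
  "bij_betw (\<lambda>(x,y) i. x i + y i * d i ^ n) (tuples m (\<lambda>i. d i ^ n) \<times> tuples m d)
     (tuples m (\<lambda>i. d i ^ Suc n))"
proof (rule bij_betwI[where g="\<lambda>w. (\<lambda>i. w i mod d i ^ n, \<lambda>i. w i div d i ^ n)"])
  show "(\<lambda>(x,y) i. x i + y i * d i ^ n) \<in> (tuples m (\<lambda>i. d i ^ n) \<times> tuples m d) \<rightarrow> tuples m (\<lambda>i. d i ^ Suc n)"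
  proof (clarsimp simp: tuples_def)
    fix x y i assume "\<forall>i<m. x i < d i ^ n" "\<forall>i<m. y i < d i" "i < m"
    then have "x i < d i ^ n" "y i + 1 \<le> d i" by auto
    then have "x i + y i * d i ^ n < (y i + 1) * d i ^ n" by simp
    also have "\<dots> \<le> d i * d i ^ n" using \<open>y i + 1 \<le> d i\<close> by (rule mult_le_mono1)
    finally show "x i + y i * d i ^ n < d i * d i ^ n" .
  qed
  show "(\<lambda>w. (\<lambda>i. w i mod d i ^ n, \<lambda>i. w i div d i ^ n)) \<in> tuples m (\<lambda>i. d i ^ Suc n) \<rightarrow> (tuples m (\<lambda>i. d i ^ n) \<times> tuples m d)"
  proof (clarsimp simp: tuples_def less_mult_imp_div_less)
    fix w i assume "\<forall>i<m. w i < d i * d i ^ n" "i < m"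
    then have "w i < d i * d i ^ n" by blast
    then have "0 < d i * d i ^ n" by linarith
    then show "w i mod d i ^ n < d i ^ n" by simp
  qed
  fix p assume "p \<in> tuples m (\<lambda>i. d i ^ n) \<times> tuples m d"
  then obtain x y where p: "p = (x,y)" and x: "x \<in> tuples m (\<lambda>i. d i ^ n)" and y: "y \<in> tuples m d" by auto
  have "(x i + y i * d i ^ n) mod d i ^ n = x i \<and> (x i + y i * d i ^ n) div d i ^ n = y i" for i
  proof (cases "i < m")
    case True
    then have "x i < d i ^ n" using x by (auto simp: tuples_def)
    moreover from this have "d i ^ n > 0" by linarith
    ultimately show ?thesis by auto
  qed (use x y in \<open>auto simp: tuples_def\<close>)
  then show "(\<lambda>w. (\<lambda>i. w i mod d i ^ n, \<lambda>i. w i div d i ^ n)) ((\<lambda>(x,y) i. x i + y i * d i ^ n) p) = p"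
    by (simp add: p)
qed (simp add: fun_eq_iff mod_div_mult_eq)

text \<open>Counterpart of \<open>sum_tuples_prod\<close> for copies: the index of a party on
  \<open>n\<close> copies is a numeral in base \<open>d i\<close>, and summing over numerals is
  summing over each digit independently. The induction adds the most significant digit.\<close>

lemma sum_tuples_digits:
  fixes h :: "nat \<Rightarrow> (nat \<Rightarrow> nat) \<Rightarrow> 'a :: comm_semiring_1"
  shows "(\<Sum>x\<in>tuples m (\<lambda>i. d i ^ n). \<Prod>t<n. h t (dig d t x)) = (\<Prod>t<n. \<Sum>y\<in>tuples m d. h t y)"
proof (induction n)
  case 0
  have "x = (\<lambda>_. 0)" if "x \<in> tuples m (\<lambda>i. d i ^ 0)" for x
  proof
    fix i
    show "x i = 0" using tuplesD[OF that, of i] by (cases "i < m") auto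
  qed
  then have "tuples m (\<lambda>i. d i ^ 0) = {\<lambda>_. 0}" by (auto simp: tuples_def)
  then show ?case by simp
next
  case (Suc n)
  have low: "dig d t (\<lambda>i. x i + y i * d i ^ n) = dig d t x" if "t < n" for t x y
    using digit_add_low[OF that] by (simp add: dig_def)
  have top: "dig d n (\<lambda>i. x i + y i * d i ^ n) = y"
    if "x \<in> tuples m (\<lambda>i. d i ^ n)" "y \<in> tuples m d" for x y
  proof
    fix i
    show "dig d n (\<lambda>i. x i + y i * d i ^ n) i = y i"
    proof (cases "i < m")
      case True
      then have "x i < d i ^ n" "y i < d i" using that by (auto simp: tuples_def)
      then show ?thesis by (auto simp: dig_def)
    qed (use that in \<open>auto simp: tuples_def dig_def\<close>)
  qed
  have "(\<Sum>x\<in>tuples m (\<lambda>i. d i ^ Suc n). \<Prod>t<Suc n. h t (dig d t x))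
     = (\<Sum>p\<in>tuples m (\<lambda>i. d i ^ n) \<times> tuples m d. \<Prod>t<Suc n. h t (dig d t ((\<lambda>(x,y) i. x i + y i * d i ^ n) p)))"
    by (rule sum.reindex_bij_betw[OF bij_tuples_power_Suc, symmetric])
  also have "\<dots> = (\<Sum>p\<in>tuples m (\<lambda>i. d i ^ n) \<times> tuples m d. (\<Prod>t<n. h t (dig d t (fst p))) * h n (snd p))"
  proof (rule sum.cong[OF refl])
    fix p assume "p \<in> tuples m (\<lambda>i. d i ^ n) \<times> tuples m d"
    then show "(\<Prod>t<Suc n. h t (dig d t ((\<lambda>(x,y) i. x i + y i * d i ^ n) p))) = (\<Prod>t<n. h t (dig d t (fst p))) * h n (snd p)"
      by (cases p) (auto simp: low top intro!: arg_cong2[where f="(*)"] prod.cong)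
  qed
  also have "\<dots> = (\<Sum>x\<in>tuples m (\<lambda>i. d i ^ n). \<Prod>t<n. h t (dig d t x)) * (\<Sum>y\<in>tuples m d. h n y)"
    by (simp add: sum_product sum.cartesian_product case_prod_unfold)
  finally show ?case using Suc by simp
qed

lemma dig_in_tuples: "(\<And>i. i < m \<Longrightarrow> d i \<ge> 1) \<Longrightarrow> x \<in> tuples m (\<lambda>i. d i ^ n) \<Longrightarrow> dig d t x \<in> tuples m d"
  by (auto simp: tuples_def dig_def Suc_le_eq)

lemma dig_eqD:
  assumes "x \<in> tuples m (\<lambda>i. d i ^ n)" "y \<in> tuples m (\<lambda>i. d i ^ n)"
    "\<And>t. t < n \<Longrightarrow> dig d t x = dig d t y"
  shows "x = y"
proof -
  have key: "(a::nat) = b" if "a < D ^ n" "b < D ^ n" "\<And>t. t < n \<Longrightarrow> a div D ^ t mod D = b div D ^ t mod D" for a b D n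
    using that
  proof (induction n arbitrary: a b)
    case (Suc n)
    have m: "a mod D = b mod D" using Suc.prems(3)[of 0] by simp
    have "a div D < D ^ n" "b div D < D ^ n"
      using Suc.prems by (simp_all add: less_mult_imp_div_less mult.commute)
    moreover have "a div D div D ^ t mod D = b div D div D ^ t mod D" if "t < n" for t
      using Suc.prems(3)[of "Suc t"] that by (simp add: div_mult2_eq)
    ultimately have "a div D = b div D" by (rule Suc.IH)
    then have "a div D * D + a mod D = b div D * D + b mod D" by (simp only: m)
    then show ?case by (simp only: div_mult_mod_eq)
  qed simp
  show ?thesis
  proof
    fix i
    show "x i = y i"
    proof (cases "i < m")
      case True
      have "x i div d i ^ t mod d i = y i div d i ^ t mod d i" if "t < n" for t
        using fun_cong[OF assms(3)[OF that], of i] by (simp add: dig_def)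
      then show ?thesis by (rule key[OF tuplesD(1)[OF assms(1) True] tuplesD(1)[OF assms(2) True]])
    qed (use assms in \<open>auto simp: tuples_def\<close>)
  qed
qed

lemma tdim_Suc: "tdim (Suc m) d = tdim m d * d m"
  by (simp add: tdim_def)

lemma enc_Suc: "enc (Suc m) d x = enc m d x + x m * tdim m d"
  by (simp add: enc_def tdim_def)

lemma enc_cong: "(\<And>i. i < m \<Longrightarrow> x i = y i) \<Longrightarrow> (\<And>i. i < m \<Longrightarrow> d i = d' i) \<Longrightarrow> enc m d x = enc m d' y"
  unfolding enc_def by (intro sum.cong arg_cong2[where f="(*)"] prod.cong) auto

lemma enc_less: "(\<And>i. i < m \<Longrightarrow> x i < d i) \<Longrightarrow> enc m d x < tdim m d"
proof (induction m)
  case (Suc m)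
  then have "enc m d x < tdim m d" "x m + 1 \<le> d m" by (auto simp: Suc_le_eq)
  then have "enc (Suc m) d x < (x m + 1) * tdim m d" by (simp add: enc_Suc)
  also have "\<dots> \<le> d m * tdim m d" using \<open>x m + 1 \<le> d m\<close> by (rule mult_le_mono1)
  finally show ?case by (simp add: tdim_Suc mult.commute)
qed (simp add: enc_def tdim_def)

lemma dec_enc: "x \<in> tuples m d \<Longrightarrow> dec m d (enc m d x) = x"
proof (induction m arbitrary: x)
  case (Suc m)
  let ?x = "x(m := 0)"
  have x': "?x \<in> tuples m d" using Suc.prems by (auto simp: tuples_def)
  have e: "enc (Suc m) d x = enc m d ?x + x m * tdim m d"
    unfolding enc_Suc by (simp add: enc_cong[of m x ?x])
  have lt: "enc m d ?x < tdim m d" by (rule enc_less) (use x' in \<open>auto simp: tuples_def\<close>)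
  have pd: "tdim m d = (\<Prod>j<i. d j) * (d i * (\<Prod>j\<in>{Suc i..<m}. d j))" if "i < m" for i
  proof -
    have s: "{..<m} = {..<i} \<union> insert i {Suc i..<m}" using that by auto
    show ?thesis unfolding tdim_def s by (subst prod.union_disjoint) auto
  qed
  show ?case
  proof
    fix i
    consider "i < m" | "i = m" | "i > m" by linarith
    then show "dec (Suc m) d (enc (Suc m) d x) i = x i"
    proof cases
      case 1
      let ?p = "\<Prod>j<i. d j"
      have pos: "?p > 0" using lt pd[OF 1] by (metis bot_nat_0.extremum_strict gr0I mult_is_0)
      \<comment> \<open>The contribution of digit \<open>m\<close> is a multiple of
        \<open>?p * d i\<close>, so it does not reach digit \<open>i\<close>.\<close>
      have "enc (Suc m) d x = enc m d ?x + ?p * (d i * (x m * (\<Prod>j\<in>{Suc i..<m}. d j)))"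
        unfolding e by (simp add: pd[OF 1])
      then have "enc (Suc m) d x div ?p mod d i = enc m d ?x div ?p mod d i" using pos by simp
      moreover have "dec m d (enc m d ?x) i = ?x i" unfolding Suc.IH[OF x'] ..
      ultimately show ?thesis using 1 by (simp add: dec_def del: fun_upd_apply) simp
    next
      case 2
      have "enc (Suc m) d x div tdim m d = x m" unfolding e using lt by simp
      then show ?thesis using 2 Suc.prems by (simp add: dec_def tdim_def tuples_def)
    next
      case 3
      then show ?thesis using Suc.prems by (simp add: dec_def tuples_def)
    qed
  qed
qed (simp add: tuples_def dec_def fun_eq_iff)

text \<open>\<open>dec\<close> inverts \<open>enc\<close> on tuples, and there are
  \<open>tdim m d\<close> tuples; surjectivity follows by counting, which spares the arithmetic of
  the other composition.\<close>

lemma bij_betw_enc: "bij_betw (enc m d) (tuples m d) {..<tdim m d}"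
proof -
  have inj: "inj_on (enc m d) (tuples m d)" by (rule inj_on_inverseI[of _ "dec m d"]) (rule dec_enc)
  have "enc m d ` tuples m d \<subseteq> {..<tdim m d}" by (auto intro: enc_less tuplesD)
  moreover have "card (enc m d ` tuples m d) = card {..<tdim m d}"
    using card_image[OF inj] by (simp add: card_tuples)
  ultimately have "enc m d ` tuples m d = {..<tdim m d}" by (intro card_subset_eq) auto
  with inj show ?thesis by (simp add: bij_betw_def)
qed

lemma enc_lt: "x \<in> tuples m d \<Longrightarrow> enc m d x < tdim m d"
  by (auto intro: enc_less tuplesD)

lemma dec_in_tuples: "a < tdim m d \<Longrightarrow> dec m d a \<in> tuples m d"
  using bij_betw_enc[of m d] by (metis bij_betw_def dec_enc imageE lessThan_iff)

lemma enc_dec: "a < tdim m d \<Longrightarrow> enc m d (dec m d a) = a"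
  using bij_betw_enc[of m d] by (metis bij_betw_def dec_enc imageE lessThan_iff)

lemma sum_enc: "(\<Sum>a<tdim m d. h a) = (\<Sum>x\<in>tuples m d. h (enc m d x))"
  by (rule sum.reindex_bij_betw[OF bij_betw_enc, symmetric])

lemma enc_eq_iff: "x \<in> tuples m d \<Longrightarrow> y \<in> tuples m d \<Longrightarrow> enc m d x = enc m d y \<longleftrightarrow> x = y"
  by (metis dec_enc)

section \<open>The spectral theorem for Hermitian matrices\<close>

lemma sum_delta_mult:
  fixes f :: "'i \<Rightarrow> 'a :: semiring_1"
  assumes "finite I"
  shows "(\<Sum>j\<in>I. (if j = i then 1 else 0) * f j) = (if i \<in> I then f i else 0)"
    "(\<Sum>j\<in>I. (if i = j then 1 else 0) * f j) = (if i \<in> I then f i else 0)"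
    "(\<Sum>j\<in>I. f j * (if j = i then 1 else 0)) = (if i \<in> I then f i else 0)"
    "(\<Sum>j\<in>I. f j * (if i = j then 1 else 0)) = (if i \<in> I then f i else 0)"
  using assms by (simp_all add: if_distrib[of "\<lambda>x. x * _"] if_distrib[of "\<lambda>x. _ * x"] cong: if_cong)

lemma index_mult_sum:
  assumes "A \<in> carrier_mat n k" "B \<in> carrier_mat k l" "i < n" "j < l"
  shows "(A * B) $$ (i,j) = (\<Sum>x<k. A $$ (i,x) * B $$ (x,j))"
  using assms by (simp add: scalar_prod_def atLeast0LessThan)

lemma index_mult_vec_sum:
  assumes "A \<in> carrier_mat n k" "v \<in> carrier_vec k" "i < n"
  shows "(A *\<^sub>v v) $ i = (\<Sum>x<k. A $$ (i,x) * v $ x)"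
  using assms by (simp add: scalar_prod_def atLeast0LessThan)

lemma mult_cnj_eq: "z * cnj z = of_real ((cmod z)\<^sup>2)" "cnj z * z = of_real ((cmod z)\<^sup>2)"
  by (simp_all add: complex_norm_square mult.commute del: of_real_power)

lemma mtrace_comm:
  assumes "A \<in> carrier_mat n k" "B \<in> carrier_mat k n"
  shows "mtrace (A * B) = mtrace (B * A)"
proof -
  have "mtrace (A * B) = (\<Sum>i<n. \<Sum>x<k. A $$ (i,x) * B $$ (x,i))"
    using assms by (auto simp: mtrace_def index_mult_sum[OF assms] simp del: index_mult_mat(1) intro!: sum.cong)
  also have "\<dots> = (\<Sum>x<k. \<Sum>i<n. B $$ (x,i) * A $$ (i,x))"
    by (subst sum.swap) (simp add: mult.commute)
  also have "\<dots> = mtrace (B * A)"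
    using assms by (auto simp: mtrace_def index_mult_sum[OF assms(2,1)] simp del: index_mult_mat(1) intro!: sum.cong)
  finally show ?thesis .
qed

text \<open>Otherwise its Schur form is strictly upper triangular, so \<open>tr C\<^sup>2\<close>, the sum of the squared
  moduli of the entries, vanishes.\<close>

lemma hermitian_nonzero_eigenvalue:
  fixes C :: "complex mat"
  assumes C: "C \<in> carrier_mat n n"
    and herm: "\<And>i j. i < n \<Longrightarrow> j < n \<Longrightarrow> C $$ (j,i) = cnj (C $$ (i,j))"
    and nz: "i0 < n" "j0 < n" "C $$ (i0,j0) \<noteq> 0"
  shows "\<exists>c w. c \<noteq> 0 \<and> w \<in> carrier_vec n \<and> w \<noteq> 0\<^sub>v n \<and> C *\<^sub>v w = c \<cdot>\<^sub>v w"
proof -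
  from char_poly_factorized[OF C] obtain es where es: "char_poly C = (\<Prod>a\<leftarrow>es. [:- a, 1:])" by blast
  obtain B P Q where BPQ: "schur_decomposition C es = (B,P,Q)" by (cases "schur_decomposition C es") auto
  from schur_decomposition[OF C es BPQ]
  have sim: "similar_mat_wit C B P Q" and ut: "upper_triangular B" and dB: "diag_mat B = es" by auto
  from similar_mat_witD2[OF C sim] have PQ: "P * Q = 1\<^sub>m n" "Q * P = 1\<^sub>m n" "C = P * B * Q"
    and car: "B \<in> carrier_mat n n" "P \<in> carrier_mat n n" "Q \<in> carrier_mat n n" by auto
  have "\<exists>c\<in>set es. c \<noteq> 0"
  proof (rule ccontr)
    assume "\<not> ?thesis"
    then have z: "B $$ (i,i) = 0" if "i < n" for i
      using that car dB by (force simp: diag_mat_def)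
    have CC: "C * C = P * (B * B * Q)"
    proof -
      have "C * C = P * B * (Q * P) * B * Q"
        unfolding PQ(3) using car by (simp add: assoc_mult_mat[of _ n n _ n _ n])
      then show ?thesis using car by (simp add: PQ assoc_mult_mat[of _ n n _ n _ n])
    qed
    have "mtrace (C * C) = mtrace (B * B * Q * P)"
      unfolding CC using car by (intro mtrace_comm[of _ n n]) auto
    also have "B * B * Q * P = B * B" using car PQ by (simp add: assoc_mult_mat[of _ n n _ n _ n])
    also have "mtrace (B * B) = (\<Sum>i<n. \<Sum>x<n. B $$ (i,x) * B $$ (x,i))"
      using car by (auto simp: mtrace_def index_mult_sum[OF car(1,1)] simp del: index_mult_mat(1) intro!: sum.cong)
    also have "\<dots> = 0"
    proof (intro sum.neutral ballI)
      fix i x assume "i \<in> {..<n}" "x \<in> {..<n}"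
      then have ix: "i < n" "x < n" by simp_all
      consider "i < x" | "i = x" | "x < i" by linarith
      then show "B $$ (i,x) * B $$ (x,i) = 0"
      proof cases
        case 1
        then have "B $$ (x,i) = 0" using upper_triangularD[OF ut] ix car by simp
        then show ?thesis by simp
      next
        case 2
        then show ?thesis using z[OF ix(1)] by simp
      next
        case 3
        then have "B $$ (i,x) = 0" using upper_triangularD[OF ut] ix car by simp
        then show ?thesis by simp
      qed
    qed
    finally have "mtrace (C * C) = 0" .
    moreover have "mtrace (C * C) = (\<Sum>i<n. \<Sum>x<n. C $$ (i,x) * C $$ (x,i))"
      using C by (auto simp: mtrace_def index_mult_sum[OF C C] simp del: index_mult_mat(1) intro!: sum.cong)
    moreover have "\<dots> = (\<Sum>i<n. \<Sum>x<n. of_real ((cmod (C $$ (i,x)))\<^sup>2))"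
    proof (intro sum.cong refl)
      fix i x assume "i \<in> {..<n}" "x \<in> {..<n}"
      then have e: "C $$ (x,i) = cnj (C $$ (i,x))" by (intro herm) simp_all
      show "C $$ (i,x) * C $$ (x,i) = of_real ((cmod (C $$ (i,x)))\<^sup>2)"
        unfolding e by (rule mult_cnj_eq(1))
    qed
    ultimately have "complex_of_real (\<Sum>i<n. \<Sum>x<n. (cmod (C $$ (i,x)))\<^sup>2) = 0" by simp
    then have "(\<Sum>i<n. \<Sum>x<n. (cmod (C $$ (i,x)))\<^sup>2) = 0" by (simp only: of_real_eq_0_iff)
    then have "(\<Sum>x<n. (cmod (C $$ (i0,x)))\<^sup>2) = 0"
      using nz by (subst (asm) sum_nonneg_eq_0_iff) (auto intro: sum_nonneg)
    then have "(cmod (C $$ (i0,j0)))\<^sup>2 = 0"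
      using nz by (subst (asm) sum_nonneg_eq_0_iff) auto
    then show False using nz by simp
  qed
  then obtain c where c: "c \<in> set es" "c \<noteq> 0" by blast
  then have "poly (char_poly C) c = 0" unfolding es by (auto simp: poly_prod_list prod_list_zero_iff)
  then have "eigenvalue C c" using eigenvalue_root_char_poly[OF C] by simp
  then obtain w where "eigenvector C w c" unfolding eigenvalue_def by blast
  then have "w \<in> carrier_vec n \<and> w \<noteq> 0\<^sub>v n \<and> C *\<^sub>v w = c \<cdot>\<^sub>v w"
    using C unfolding eigenvector_def carrier_mat_def by simp
  then show ?thesis using c(2) by (intro exI[of _ c] exI[of _ w] conjI) simp_all
qed

text \<open>Evaluating the quadratic form of \<open>C\<close> at an eigenvector in two ways forces
  the eigenvalue to be real. The eigenvector is then scaled to norm 1.\<close>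

lemma hermitian_eigenpair:
  fixes C :: "nat \<Rightarrow> nat \<Rightarrow> complex"
  assumes herm: "\<And>i j. i < n \<Longrightarrow> j < n \<Longrightarrow> C j i = cnj (C i j)"
    and nz: "i0 < n" "j0 < n" "C i0 j0 \<noteq> 0"
  shows "\<exists>(c::real) w. c \<noteq> 0 \<and> (\<Sum>i<n. cnj (w i) * w i) = 1 \<and>
           (\<forall>i<n. (\<Sum>j<n. C i j * w j) = of_real c * w i)"
proof -
  define M where "M = mat n n (\<lambda>(i,j). C i j)"
  have M: "M \<in> carrier_mat n n" by (simp add: M_def)
  have Mi: "M $$ (i,j) = C i j" if "i < n" "j < n" for i j using that by (simp add: M_def)
  have "M $$ (j,i) = cnj (M $$ (i,j))" if "i < n" "j < n" for i j
    unfolding Mi[OF that] Mi[OF that(2,1)] by (rule herm[OF that])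
  moreover have "M $$ (i0,j0) \<noteq> 0" unfolding Mi[OF nz(1,2)] by (rule nz(3))
  ultimately have "\<exists>c w. c \<noteq> 0 \<and> w \<in> carrier_vec n \<and> w \<noteq> 0\<^sub>v n \<and> M *\<^sub>v w = c \<cdot>\<^sub>v w"
    by (rule hermitian_nonzero_eigenvalue[OF M _ nz(1,2)])
  then obtain c w where c: "c \<noteq> 0" and w: "w \<in> carrier_vec n" "w \<noteq> 0\<^sub>v n" and e: "M *\<^sub>v w = c \<cdot>\<^sub>v w"
    by (elim exE conjE)
  define v where "v i = w $ i" for i
  have ev: "(\<Sum>j<n. C i j * v j) = c * v i" if "i < n" for i
  proof -
    have "(M *\<^sub>v w) $ i = c * v i" unfolding e using w that by (simp add: v_def)
    moreover have "(M *\<^sub>v w) $ i = (\<Sum>j<n. C i j * v j)"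
      unfolding index_mult_vec_sum[OF M w(1) that] using that by (simp add: v_def M_def)
    ultimately show ?thesis by simp
  qed
  define N where "N = (\<Sum>i<n. (cmod (v i))\<^sup>2)"
  have N: "N > 0"
  proof -
    have "\<exists>i<n. w $ i \<noteq> 0"
    proof (rule ccontr)
      assume "\<not> ?thesis"
      then have "w = 0\<^sub>v n" using w(1) by (intro eq_vecI) auto
      with w(2) show False by contradiction
    qed
    then obtain i where "i < n" "w $ i \<noteq> 0" by blast
    then show ?thesis unfolding N_def by (intro sum_pos2[of _ i]) (auto simp: v_def)
  qed
  have NN: "(\<Sum>i<n. cnj (v i) * v i) = of_real N" by (simp add: N_def mult_cnj_eq)
  have "cnj c * of_real N = (\<Sum>i<n. cnj (c * v i) * v i)"
    unfolding NN[symmetric] sum_distrib_left by (simp add: mult.assoc)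
  also have "\<dots> = (\<Sum>i<n. cnj (\<Sum>j<n. C i j * v j) * v i)" using ev by simp
  also have "\<dots> = (\<Sum>i<n. \<Sum>j<n. cnj (v j) * (C j i * v i))"
  proof (intro sum.cong refl)
    fix i assume i: "i \<in> {..<n}"
    have "cnj (\<Sum>j<n. C i j * v j) = (\<Sum>j<n. cnj (v j) * C j i)"
      unfolding cnj_sum
    proof (intro sum.cong refl)
      fix j assume j: "j \<in> {..<n}"
      have "C j i = cnj (C i j)" using i j by (intro herm) auto
      then show "cnj (C i j * v j) = cnj (v j) * C j i" by (simp only: complex_cnj_mult mult.commute)
    qed
    then show "cnj (\<Sum>j<n. C i j * v j) * v i = (\<Sum>j<n. cnj (v j) * (C j i * v i))"
      by (simp add: sum_distrib_right mult.assoc)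
  qed
  also have "\<dots> = (\<Sum>j<n. cnj (v j) * (\<Sum>i<n. C j i * v i))"
    by (subst sum.swap) (simp add: sum_distrib_left)
  also have "\<dots> = (\<Sum>j<n. cnj (v j) * (c * v j))" using ev by simp
  also have "\<dots> = c * of_real N"
    unfolding NN[symmetric] sum_distrib_left by (simp add: mult.left_commute)
  finally have "cnj c = c" using N by simp
  then have cr: "c = of_real (Re c)" by (simp add: complex_eq_iff)
  define u where "u i = v i / of_real (sqrt N)" for i
  have "(\<Sum>i<n. cnj (u i) * u i) = (\<Sum>i<n. cnj (v i) * v i) / of_real N"
  proof -
    have s: "complex_of_real (sqrt N) * of_real (sqrt N) = of_real N"
      using N by (metis abs_of_pos of_real_mult real_sqrt_mult_self)
    show ?thesis unfolding sum_divide_distrib u_def complex_cnj_divide complex_cnj_complex_of_real times_divide_times_eq s ..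
  qed
  then have 1: "(\<Sum>i<n. cnj (u i) * u i) = 1" using N NN by simp
  have 2: "(\<Sum>j<n. C i j * u j) = of_real (Re c) * u i" if "i < n" for i
    using ev[OF that] unfolding cr[symmetric] u_def times_divide_eq_right sum_divide_distrib[symmetric] by simp
  have 3: "Re c \<noteq> 0" using cr c by (metis of_real_0)
  from 1 2 3 show ?thesis by (intro exI[of _ "Re c"] exI[of _ u] conjI allI impI)
qed

text \<open>Take an orthonormal family of eigenvectors of the largest possible size
  \<open>k\<close>. If \<open>A\<close> minus its part on the family were nonzero, it would have an
  eigenvector for a nonzero eigenvalue; that vector is orthogonal to the family and an eigenvector
  of \<open>A\<close>, against maximality. So \<open>A\<close> vanishes on the orthogonal
  complement, and a nonzero projection \<open>Pi\<close> onto the complement would yield one more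
  eigenvector, now for the eigenvalue 0. Hence \<open>Pi\<close> is zero, and so is its trace
  \<open>n - k\<close>.\<close>

lemma spectral_nat:
  fixes A :: "nat \<Rightarrow> nat \<Rightarrow> complex"
  assumes herm: "\<And>i j. i < n \<Longrightarrow> j < n \<Longrightarrow> A j i = cnj (A i j)"
  obtains v and l :: "nat \<Rightarrow> real" where
    "\<And>i j. i < n \<Longrightarrow> j < n \<Longrightarrow> (\<Sum>x<n. cnj (v i x) * v j x) = (if i = j then 1 else 0)"
    "\<And>x y. x < n \<Longrightarrow> y < n \<Longrightarrow> (\<Sum>i<n. v i x * cnj (v i y)) = (if x = y then 1 else 0)"
    "\<And>x y. x < n \<Longrightarrow> y < n \<Longrightarrow> A x y = (\<Sum>i<n. of_real (l i) * v i x * cnj (v i y))"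
proof -
  define on where "on k v \<longleftrightarrow> (\<forall>i<k. \<forall>j<k. (\<Sum>x<n. cnj (v i x) * v j x) = (if i = j then 1 else 0 :: complex))"
    for k and v :: "nat \<Rightarrow> nat \<Rightarrow> complex"
  define ev where "ev k v l \<longleftrightarrow> (\<forall>i<k. \<forall>x<n. (\<Sum>y<n. A x y * v i y) = complex_of_real (l i) * v i x)"
    for k and v :: "nat \<Rightarrow> nat \<Rightarrow> complex" and l
  define Pi where "Pi k v x y = (if x = y then 1 else 0) - (\<Sum>i<k. v i x * cnj (v i y))"
    for k and v :: "nat \<Rightarrow> nat \<Rightarrow> complex" and x y
  have Pi_herm: "Pi k v y x = cnj (Pi k v x y)" for k v x y
    by (simp add: Pi_def mult.commute)
  have Pi_v: "(\<Sum>y<n. Pi k v x y * v i y) = 0" if "on k v" "i < k" "x < n" for k v i x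
  proof -
    have "(\<Sum>y<n. \<Sum>j<k. v j x * cnj (v j y) * v i y) = (\<Sum>j<k. v j x * (\<Sum>y<n. cnj (v j y) * v i y))"
      by (subst sum.swap) (simp add: sum_distrib_left mult.assoc)
    also have "\<dots> = (\<Sum>j<k. v j x * (if j = i then 1 else 0))"
      using that by (intro sum.cong refl) (simp add: on_def)
    also have "\<dots> = v i x" using that by (simp add: sum_delta_mult)
    finally show ?thesis
      using that by (simp add: Pi_def left_diff_distrib sum_subtractf sum_distrib_right sum_delta_mult)
  qed
  have Pi_idem: "(\<Sum>z<n. Pi k v x z * Pi k v z y) = Pi k v x y" if "on k v" "x < n" "y < n" for k v x y
  proof -
    have "(\<Sum>z<n. Pi k v x z * Pi k v z y)
      = (\<Sum>z<n. Pi k v x z * (if z = y then 1 else 0)) - (\<Sum>z<n. \<Sum>i<k. Pi k v x z * v i z * cnj (v i y))"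
      by (simp add: Pi_def[of k v _ y] right_diff_distrib sum_subtractf sum_distrib_left mult.assoc)
    also have "(\<Sum>z<n. \<Sum>i<k. Pi k v x z * v i z * cnj (v i y))
       = (\<Sum>i<k. (\<Sum>z<n. Pi k v x z * v i z) * cnj (v i y))"
      by (subst sum.swap) (simp add: sum_distrib_right)
    also have "\<dots> = 0" using Pi_v that by simp
    finally show ?thesis using that by (simp add: sum_delta_mult)
  qed
  \<comment> \<open>The squared Hilbert-Schmidt norm of a projection is its trace, here
    \<open>n - k\<close>. The bound makes the maximal family exist.\<close>
  have bound: "k \<le> n" if "on k v" for k v
  proof -
    have "of_real (\<Sum>x<n. \<Sum>z<n. (cmod (Pi k v x z))\<^sup>2) = (\<Sum>x<n. \<Sum>z<n. Pi k v x z * Pi k v z x)"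
      unfolding of_real_sum
    proof (intro sum.cong refl)
      fix x z
      show "of_real ((cmod (Pi k v x z))\<^sup>2) = Pi k v x z * Pi k v z x"
        unfolding Pi_herm[of k v z x] by (rule mult_cnj_eq(1)[symmetric])
    qed
    also have "\<dots> = (\<Sum>x<n. Pi k v x x)" using Pi_idem[OF that] by simp
    also have "\<dots> = of_nat n - (\<Sum>i<k. \<Sum>x<n. cnj (v i x) * v i x)"
      by (subst sum.swap) (simp add: Pi_def sum_subtractf mult.commute)
    also have "\<dots> = of_nat n - of_nat k" using that by (simp add: on_def)
    also have "\<dots> = of_real (real n - real k)" by simp
    finally have "(\<Sum>x<n. \<Sum>z<n. (cmod (Pi k v x z))\<^sup>2) = real n - real k" by (simp only: of_real_eq_iff)
    moreover have "(\<Sum>x<n. \<Sum>z<n. (cmod (Pi k v x z))\<^sup>2) \<ge> 0" by (intro sum_nonneg) auto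
    ultimately show ?thesis by simp
  qed
  define P where "P k \<longleftrightarrow> (\<exists>v l. on k v \<and> ev k v l)" for k
  have "P 0" by (simp add: P_def on_def ev_def)
  define k where "k = (GREATEST k. P k)"
  have "P k" unfolding k_def using \<open>P 0\<close> bound by (intro GreatestI_nat[of P 0 n]) (auto simp: P_def)
  then obtain v l where ov: "on k v" and el: "ev k v l" by (auto simp: P_def)
  have max: "\<not> P (Suc k)"
    using Greatest_le_nat[of P "Suc k" n] bound unfolding k_def P_def by (auto simp: not_less_eq_eq[symmetric])
  have extend: False if "(\<Sum>x<n. cnj (w x) * w x) = 1" "\<And>i. i < k \<Longrightarrow> (\<Sum>x<n. cnj (v i x) * w x) = 0"
    "\<And>x. x < n \<Longrightarrow> (\<Sum>y<n. A x y * w y) = complex_of_real c * w x" for w c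
  proof -
    have sym: "(\<Sum>x<n. cnj (w x) * v i x) = 0" if "i < k" for i
    proof -
      have "(\<Sum>x<n. cnj (w x) * v i x) = cnj (\<Sum>x<n. cnj (v i x) * w x)" by (simp add: mult.commute)
      then show ?thesis using \<open>\<And>i. i < k \<Longrightarrow> (\<Sum>x<n. cnj (v i x) * w x) = 0\<close>[OF that] by simp
    qed
    have "on (Suc k) (v(k := w))" using ov that(1,2) sym by (auto simp: on_def less_Suc_eq)
    moreover have "ev (Suc k) (v(k := w)) (l(k := c))" using el that(3) by (auto simp: ev_def less_Suc_eq)
    ultimately show False using max by (auto simp: P_def)
  qed
  define C where "C x y = A x y - (\<Sum>i<k. of_real (l i) * v i x * cnj (v i y))" for x y
  have C_herm: "C y x = cnj (C x y)" if "x < n" "y < n" for x y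
    using herm[OF that] by (simp add: C_def mult_ac)
  have vC: "(\<Sum>x<n. cnj (v i x) * C x y) = 0" if "i < k" "y < n" for i y
  proof -
    have "(\<Sum>x<n. cnj (v i x) * A x y) = cnj (\<Sum>x<n. A y x * v i x)"
      unfolding cnj_sum
    proof (intro sum.cong refl)
      fix x assume "x \<in> {..<n}"
      then have "A x y = cnj (A y x)" using that by (intro herm) auto
      then show "cnj (v i x) * A x y = cnj (A y x * v i x)" by (simp only: complex_cnj_mult mult.commute)
    qed
    also have "\<dots> = of_real (l i) * cnj (v i y)" using el that by (simp add: ev_def)
    finally have 1: "(\<Sum>x<n. cnj (v i x) * A x y) = of_real (l i) * cnj (v i y)" .
    have "(\<Sum>x<n. \<Sum>j<k. cnj (v i x) * (of_real (l j) * v j x * cnj (v j y)))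
        = (\<Sum>j<k. (\<Sum>x<n. cnj (v i x) * v j x) * (of_real (l j) * cnj (v j y)))"
      by (subst sum.swap) (simp add: sum_distrib_left sum_distrib_right mult_ac)
    also have "\<dots> = (\<Sum>j<k. (if j = i then 1 else 0) * (of_real (l j) * cnj (v j y)))"
      using ov that by (intro sum.cong refl arg_cong2[where f="(*)"]) (auto simp: on_def)
    also have "\<dots> = of_real (l i) * cnj (v i y)" using that by (simp add: sum_delta_mult)
    finally show ?thesis using 1 by (simp add: C_def right_diff_distrib sum_subtractf sum_distrib_left)
  qed
  \<comment> \<open>An eigenvector for a nonzero eigenvalue lies in the range of the kernel, hence
    is orthogonal to every \<open>v i\<close> that annihilates the kernel from the left. This is
    applied to \<open>C\<close> and to \<open>Pi\<close>.\<close>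
  have perp: "(\<Sum>x<n. cnj (v i x) * w x) = 0"
    if "i < k" "c \<noteq> (0::real)" "\<And>x. x < n \<Longrightarrow> (\<Sum>y<n. D x y * w y) = of_real c * w x"
      "\<And>y. y < n \<Longrightarrow> (\<Sum>x<n. cnj (v i x) * D x y) = 0" for i c w D
  proof -
    have "of_real c * (\<Sum>x<n. cnj (v i x) * w x) = (\<Sum>x<n. cnj (v i x) * (\<Sum>y<n. D x y * w y))"
      using that(3) by (auto simp: sum_distrib_left mult_ac intro!: sum.cong)
    also have "\<dots> = (\<Sum>y<n. (\<Sum>x<n. cnj (v i x) * D x y) * w y)"
      unfolding sum_distrib_left sum_distrib_right by (subst sum.swap) (simp add: mult.assoc)
    also have "\<dots> = 0" using that(4) by simp
    finally show ?thesis using that(2) by simp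
  qed
  have Aw: "(\<Sum>y<n. A x y * w y) = (\<Sum>y<n. C x y * w y)"
    if "\<And>i. i < k \<Longrightarrow> (\<Sum>x<n. cnj (v i x) * w x) = 0" for x w
  proof -
    have "(\<Sum>y<n. \<Sum>i<k. of_real (l i) * v i x * cnj (v i y) * w y)
        = (\<Sum>i<k. of_real (l i) * v i x * (\<Sum>y<n. cnj (v i y) * w y))"
      by (subst sum.swap) (simp add: sum_distrib_left mult_ac)
    also have "\<dots> = 0" using that by simp
    finally show ?thesis by (simp add: C_def left_diff_distrib sum_subtractf sum_distrib_right)
  qed
  have C0: "C x y = 0" if "x < n" "y < n" for x y
  proof (rule ccontr)
    assume "C x y \<noteq> 0"
    then have "\<exists>(c::real) w. c \<noteq> 0 \<and> (\<Sum>i<n. cnj (w i) * w i) = 1 \<and>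
           (\<forall>i<n. (\<Sum>j<n. C i j * w j) = of_real c * w i)"
      using that by (intro hermitian_eigenpair[of n C x y] C_herm)
    then obtain c w where "c \<noteq> 0 \<and> (\<Sum>i<n. cnj (w i) * w i) = 1 \<and> (\<forall>i<n. (\<Sum>j<n. C i j * w j) = complex_of_real c * w i)"
      by (elim exE)
    then have cw: "c \<noteq> 0" "(\<Sum>i<n. cnj (w i) * w i) = 1"
      "\<And>i. i < n \<Longrightarrow> (\<Sum>j<n. C i j * w j) = complex_of_real c * w i" by simp_all
    have p: "i < k \<Longrightarrow> (\<Sum>x<n. cnj (v i x) * w x) = 0" for i
      by (rule perp[OF _ cw(1,3) vC])
    have e: "(\<Sum>y<n. A x y * w y) = complex_of_real c * w x" if "x < n" for x
      using that by (simp only: Aw[of w x, OF p] cw(3))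
    show False by (rule extend[of w c, OF cw(2)]) (rule p e; assumption)+
  qed
  have Pi0: "Pi k v x y = 0" if "x < n" "y < n" for x y
  proof (rule ccontr)
    assume "Pi k v x y \<noteq> 0"
    then have "\<exists>(c::real) w. c \<noteq> 0 \<and> (\<Sum>i<n. cnj (w i) * w i) = 1 \<and>
           (\<forall>i<n. (\<Sum>j<n. Pi k v i j * w j) = of_real c * w i)"
      by (rule hermitian_eigenpair[of n "Pi k v", OF Pi_herm that])
    then obtain c w where "c \<noteq> 0 \<and> (\<Sum>i<n. cnj (w i) * w i) = 1 \<and> (\<forall>i<n. (\<Sum>j<n. Pi k v i j * w j) = complex_of_real c * w i)"
      by (elim exE)
    then have cw: "c \<noteq> 0" "(\<Sum>i<n. cnj (w i) * w i) = 1"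
      "\<And>i. i < n \<Longrightarrow> (\<Sum>j<n. Pi k v i j * w j) = complex_of_real c * w i" by simp_all
    have vPi: "(\<Sum>x<n. cnj (v i x) * Pi k v x y) = 0" if "i < k" "y < n" for i y
    proof -
      have "(\<Sum>x<n. cnj (v i x) * Pi k v x y) = cnj (\<Sum>x<n. Pi k v y x * v i x)"
        by (simp add: Pi_herm[of k v _ y] mult.commute)
      then show ?thesis using Pi_v[OF ov that] by simp
    qed
    have p: "i < k \<Longrightarrow> (\<Sum>x<n. cnj (v i x) * w x) = 0" for i
      by (rule perp[OF _ cw(1,3) vPi])
    \<comment> \<open>\<open>C\<close> is already known to vanish, so on the orthogonal complement
      \<open>A\<close> acts as 0.\<close>
    have e: "(\<Sum>y<n. A x y * w y) = complex_of_real 0 * w x" if "x < n" for x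
      using that by (simp add: Aw[of w x, OF p] C0)
    show False by (rule extend[of w 0, OF cw(2)]) (rule p e; assumption)+
  qed
  have "(\<Sum>x<n. Pi k v x x) = of_nat n - (\<Sum>i<k. \<Sum>x<n. cnj (v i x) * v i x)"
    by (subst sum.swap) (simp add: Pi_def sum_subtractf mult.commute)
  also have "\<dots> = of_nat n - of_nat k" using ov by (simp add: on_def)
  finally have "of_nat n = (of_nat k :: complex)" using Pi0 by simp
  then have kn: "k = n" by simp
  show thesis
  proof (rule that[of v l])
    fix i j assume "i < n" "j < n"
    then show "(\<Sum>x<n. cnj (v i x) * v j x) = (if i = j then 1 else 0)"
      using ov unfolding kn on_def by blast
  next
    fix x y assume xy: "x < n" "y < n"
    have "(if x = y then 1 else 0) = (\<Sum>i<k. v i x * cnj (v i y))"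
      using Pi0[OF xy] by (simp only: Pi_def right_minus_eq)
    then show "(\<Sum>i<n. v i x * cnj (v i y)) = (if x = y then 1 else 0)"
      unfolding kn by (rule sym)
    have "A x y = (\<Sum>i<k. of_real (l i) * v i x * cnj (v i y))"
      using C0[OF xy] by (simp only: C_def right_minus_eq)
    then show "A x y = (\<Sum>i<n. of_real (l i) * v i x * cnj (v i y))"
      unfolding kn .
  qed
qed

lemma spectral_set:
  fixes A :: "'i \<Rightarrow> 'i \<Rightarrow> complex"
  assumes "finite I" and herm: "\<And>i j. i \<in> I \<Longrightarrow> j \<in> I \<Longrightarrow> A j i = cnj (A i j)"
  obtains v and l :: "nat \<Rightarrow> real" where
    "\<And>i j. i < card I \<Longrightarrow> j < card I \<Longrightarrow> (\<Sum>x\<in>I. cnj (v i x) * v j x) = (if i = j then 1 else 0)"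
    "\<And>x y. x \<in> I \<Longrightarrow> y \<in> I \<Longrightarrow> (\<Sum>i<card I. v i x * cnj (v i y)) = (if x = y then 1 else 0)"
    "\<And>x y. x \<in> I \<Longrightarrow> y \<in> I \<Longrightarrow> A x y = (\<Sum>i<card I. of_real (l i) * v i x * cnj (v i y))"
proof -
  obtain h where h: "bij_betw h I {..<card I}"
    using ex_bij_betw_finite_nat[OF assms(1)] by (auto simp: atLeast0LessThan)
  let ?g = "inv_into I h"
  have g: "?g a \<in> I" "h (?g a) = a" if "a < card I" for a
    using that h by (auto simp: bij_betw_def intro!: inv_into_into f_inv_into_f)
  have hg: "?g (h x) = x" "h x < card I" if "x \<in> I" for x
    using that h by (auto simp: bij_betw_def)
  have hA: "A (?g j) (?g i) = cnj (A (?g i) (?g j))" if "i < card I" "j < card I" for i j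
    using that by (intro herm g)
  obtain v l where v:
    "\<And>i j. i < card I \<Longrightarrow> j < card I \<Longrightarrow> (\<Sum>x<card I. cnj (v i x) * v j x) = (if i = j then 1 else 0)"
    "\<And>x y. x < card I \<Longrightarrow> y < card I \<Longrightarrow> (\<Sum>i<card I. v i x * cnj (v i y)) = (if x = y then 1 else 0)"
    "\<And>x y. x < card I \<Longrightarrow> y < card I \<Longrightarrow> A (?g x) (?g y) = (\<Sum>i<card I. complex_of_real (l i) * v i x * cnj (v i y))"
    by (rule spectral_nat[of "card I" "\<lambda>x y. A (?g x) (?g y)", OF hA]) (assumption | rule that)+
  show thesis
  proof (rule that[of "\<lambda>i x. v i (h x)" l])
    fix i j assume ij: "i < card I" "j < card I"
    have "(\<Sum>x\<in>I. cnj (v i (h x)) * v j (h x)) = (\<Sum>x<card I. cnj (v i x) * v j x)"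
      by (rule sum.reindex_bij_betw[OF h])
    then show "(\<Sum>x\<in>I. cnj (v i (h x)) * v j (h x)) = (if i = j then 1 else 0)" using v(1) ij by simp
  next
    fix x y assume xy: "x \<in> I" "y \<in> I"
    then have "h x = h y \<longleftrightarrow> x = y" using h by (auto simp: bij_betw_def inj_on_def)
    then show "(\<Sum>i<card I. v i (h x) * cnj (v i (h y))) = (if x = y then 1 else 0)"
      using v(2) hg(2)[OF xy(1)] hg(2)[OF xy(2)] by simp
    show "A x y = (\<Sum>i<card I. of_real (l i) * v i (h x) * cnj (v i (h y)))"
      using v(3)[OF hg(2)[OF xy(1)] hg(2)[OF xy(2)]] by (simp add: hg xy)
  qed
qed

section \<open>Hermitian kernels\<close>

definition ip :: "'i set \<Rightarrow> ('i \<Rightarrow> complex) \<Rightarrow> ('i \<Rightarrow> complex) \<Rightarrow> complex" where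
  "ip I u v = (\<Sum>x\<in>I. cnj (u x) * v x)"

definition app :: "'i set \<Rightarrow> ('i \<Rightarrow> 'i \<Rightarrow> complex) \<Rightarrow> ('i \<Rightarrow> complex) \<Rightarrow> 'i \<Rightarrow> complex" where
  "app I A v = (\<lambda>x. \<Sum>y\<in>I. A x y * v y)"

definition herk :: "'i set \<Rightarrow> ('i \<Rightarrow> 'i \<Rightarrow> complex) \<Rightarrow> bool" where
  "herk I A \<longleftrightarrow> (\<forall>x\<in>I. \<forall>y\<in>I. A y x = cnj (A x y))"

definition psdk :: "'i set \<Rightarrow> ('i \<Rightarrow> 'i \<Rightarrow> complex) \<Rightarrow> bool" where
  "psdk I A \<longleftrightarrow> herk I A \<and> (\<forall>u. 0 \<le> Re (ip I u (app I A u)))"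

text \<open>Completeness is built in next to orthonormality, so that sums over indices and sums over
  basis vectors are exchanged without a dimension count.\<close>

definition ons :: "'i set \<Rightarrow> (nat \<Rightarrow> 'i \<Rightarrow> complex) \<Rightarrow> bool" where
  "ons I v \<longleftrightarrow> (\<forall>i<card I. \<forall>j<card I. ip I (v i) (v j) = (if i = j then 1 else 0)) \<and>
     (\<forall>x\<in>I. \<forall>y\<in>I. (\<Sum>i<card I. v i x * cnj (v i y)) = (if x = y then 1 else 0))"

definition spec :: "'i set \<Rightarrow> (nat \<Rightarrow> 'i \<Rightarrow> complex) \<Rightarrow> (nat \<Rightarrow> real) \<Rightarrow> 'i \<Rightarrow> 'i \<Rightarrow> complex" where
  "spec I v l = (\<lambda>x y. \<Sum>k<card I. of_real (l k) * v k x * cnj (v k y))"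

lemma herk_spectral:
  assumes "finite I" "herk I A"
  obtains v l where "ons I v" "\<And>x y. x \<in> I \<Longrightarrow> y \<in> I \<Longrightarrow> A x y = spec I v l x y"
proof -
  have h: "A j i = cnj (A i j)" if "i \<in> I" "j \<in> I" for i j
    using assms(2) that unfolding herk_def by blast
  show thesis
  proof (rule spectral_set[of I A, OF assms(1) h])
    fix v and l :: "nat \<Rightarrow> real"
    assume 1: "\<And>i j. i < card I \<Longrightarrow> j < card I \<Longrightarrow> (\<Sum>x\<in>I. cnj (v i x) * v j x) = (if i = j then 1 else 0)"
      and 2: "\<And>x y. x \<in> I \<Longrightarrow> y \<in> I \<Longrightarrow> (\<Sum>i<card I. v i x * cnj (v i y)) = (if x = y then 1 else 0)"
      and 3: "\<And>x y. x \<in> I \<Longrightarrow> y \<in> I \<Longrightarrow> A x y = (\<Sum>i<card I. of_real (l i) * v i x * cnj (v i y))"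
    have "ons I v" unfolding ons_def ip_def by (intro conjI allI impI ballI 1 2)
    moreover have "A x y = spec I v l x y" if "x \<in> I" "y \<in> I" for x y
      unfolding spec_def using that by (rule 3)
    ultimately show thesis by (rule that)
  qed
qed

lemma ip_self: "ip I u u = of_real (\<Sum>x\<in>I. (cmod (u x))\<^sup>2)"
  unfolding ip_def of_real_sum by (intro sum.cong refl mult_cnj_eq(2))

lemma ip_cnj: "cnj (ip I u v) = ip I v u"
  unfolding ip_def by (simp add: mult.commute)

lemma ip_cong: "(\<And>x. x \<in> I \<Longrightarrow> u x = u' x) \<Longrightarrow> (\<And>x. x \<in> I \<Longrightarrow> v x = v' x) \<Longrightarrow> ip I u v = ip I u' v'"
  unfolding ip_def by (intro sum.cong refl) simp

lemma ip_linear: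
  "ip I u (\<lambda>x. v x + w x) = ip I u v + ip I u w"
  "ip I u (\<lambda>x. v x - w x) = ip I u v - ip I u w"
  "ip I u (\<lambda>x. c * v x) = c * ip I u v"
  "ip I (\<lambda>x. v x + w x) u = ip I v u + ip I w u"
  "ip I (\<lambda>x. v x - w x) u = ip I v u - ip I w u"
  "ip I (\<lambda>x. c * v x) u = cnj c * ip I v u"
  unfolding ip_def by (simp_all add: sum.distrib sum_subtractf sum_distrib_left algebra_simps)

lemma ip_sum: "ip I u (\<lambda>x. \<Sum>k\<in>S. f k x) = (\<Sum>k\<in>S. ip I u (f k))"
  "ip I (\<lambda>x. \<Sum>k\<in>S. f k x) u = (\<Sum>k\<in>S. ip I (f k) u)"
  unfolding ip_def by (subst sum.swap, simp add: sum_distrib_left sum_distrib_right)+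

lemma app_linear:
  "app I A (\<lambda>x. c * v x) = (\<lambda>x. c * app I A v x)"
  "app I (\<lambda>x y. A x y - B x y) v = (\<lambda>x. app I A v x - app I B v x)"
  unfolding app_def by (simp_all add: sum_distrib_left sum_subtractf algebra_simps)

lemma herk_ip:
  assumes "herk I A"
  shows "ip I u (app I A v) = ip I (app I A u) v"
proof -
  have "ip I u (app I A v) = (\<Sum>x\<in>I. \<Sum>y\<in>I. cnj (u x) * A x y * v y)"
    unfolding ip_def app_def by (simp add: sum_distrib_left mult.assoc)
  also have "\<dots> = (\<Sum>y\<in>I. \<Sum>x\<in>I. cnj (u x) * A x y * v y)" by (rule sum.swap)
  also have "\<dots> = (\<Sum>y\<in>I. cnj (\<Sum>x\<in>I. A y x * u x) * v y)"
  proof (intro sum.cong refl)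
    fix y assume y: "y \<in> I"
    have "(\<Sum>x\<in>I. cnj (u x) * A x y) = cnj (\<Sum>x\<in>I. A y x * u x)"
      unfolding cnj_sum
    proof (intro sum.cong refl)
      fix x assume "x \<in> I"
      then have "A x y = cnj (A y x)" using assms y unfolding herk_def by blast
      then show "cnj (u x) * A x y = cnj (A y x * u x)" by (simp only: complex_cnj_mult mult.commute)
    qed
    then show "(\<Sum>x\<in>I. cnj (u x) * A x y * v y) = cnj (\<Sum>x\<in>I. A y x * u x) * v y"
      by (simp only: sum_distrib_right[symmetric])
  qed
  finally show ?thesis unfolding ip_def app_def .
qed

lemma app_spec: "app I (spec I v l) u x = (\<Sum>k<card I. of_real (l k) * ip I (v k) u * v k x)"
proof -
  have "app I (spec I v l) u x = (\<Sum>y\<in>I. \<Sum>k<card I. of_real (l k) * v k x * (cnj (v k y) * u y))"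
    unfolding app_def spec_def by (simp add: sum_distrib_right mult.assoc)
  also have "\<dots> = (\<Sum>k<card I. of_real (l k) * v k x * ip I (v k) u)"
    by (subst sum.swap) (simp add: ip_def sum_distrib_left)
  finally show ?thesis by (simp add: mult_ac)
qed

lemma ip_spec: "ip I u (app I (spec I v l) w) = (\<Sum>k<card I. of_real (l k) * (ip I u (v k) * ip I (v k) w))"
proof -
  have "ip I u (app I (spec I v l) w) = ip I u (\<lambda>x. \<Sum>k<card I. of_real (l k) * ip I (v k) w * v k x)"
    by (intro ip_cong app_spec refl)
  then show ?thesis unfolding ip_sum ip_linear by (simp add: mult_ac)
qed

lemma ip_spec_self: "ip I u (app I (spec I v l) u) = of_real (\<Sum>k<card I. l k * (cmod (ip I (v k) u))\<^sup>2)"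
proof -
  have "ip I u (v k) * ip I (v k) u = of_real ((cmod (ip I (v k) u))\<^sup>2)" for k
    unfolding ip_cnj[of I "v k" u, symmetric] by (rule mult_cnj_eq(2))
  then show ?thesis unfolding ip_spec by simp
qed

lemma onsD:
  assumes "ons I v"
  shows "i < card I \<Longrightarrow> j < card I \<Longrightarrow> ip I (v i) (v j) = (if i = j then 1 else 0)"
    "x \<in> I \<Longrightarrow> y \<in> I \<Longrightarrow> (\<Sum>i<card I. v i x * cnj (v i y)) = (if x = y then 1 else 0)"
  using assms by (auto simp: ons_def)

lemma parseval:
  assumes "finite I" "ons I v"
  shows "(\<Sum>k<card I. (cmod (ip I (v k) u))\<^sup>2) = (\<Sum>x\<in>I. (cmod (u x))\<^sup>2)"
proof -
  have one: "app I (spec I v (\<lambda>_. 1)) u x = u x" if "x \<in> I" for x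
    unfolding app_def spec_def using that assms(1) by (simp add: onsD(2)[OF assms(2)] sum_delta_mult)
  have "complex_of_real (\<Sum>k<card I. (cmod (ip I (v k) u))\<^sup>2) = ip I u (app I (spec I v (\<lambda>_. 1)) u)"
    unfolding ip_spec_self by simp
  also have "\<dots> = ip I u u" by (intro ip_cong one refl)
  also have "\<dots> = of_real (\<Sum>x\<in>I. (cmod (u x))\<^sup>2)" by (rule ip_self)
  finally show ?thesis by (simp only: of_real_eq_iff)
qed

lemma herk_spec: "herk I (spec I v l)"
  unfolding herk_def spec_def by (simp add: mult_ac)

lemma psdk_spec: "(\<And>k. k < card I \<Longrightarrow> 0 \<le> l k) \<Longrightarrow> psdk I (spec I v l)"
  unfolding psdk_def ip_spec_self Re_complex_of_real by (auto intro!: sum_nonneg herk_spec)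

lemma spec_mult:
  assumes "ons I v"
  shows "(\<Sum>z\<in>I. spec I v a x z * spec I v b z y) = spec I v (\<lambda>k. a k * b k) x y"
proof -
  have "(\<Sum>z\<in>I. spec I v a x z * spec I v b z y) = app I (spec I v a) (\<lambda>z. spec I v b z y) x"
    by (simp add: app_def)
  also have "\<dots> = (\<Sum>k<card I. of_real (a k) * ip I (v k) (\<lambda>z. spec I v b z y) * v k x)"
    by (rule app_spec)
  also have "\<dots> = (\<Sum>k<card I. of_real (a k) * (of_real (b k) * cnj (v k y)) * v k x)"
  proof (intro sum.cong refl arg_cong2[where f="(*)"])
    fix k assume k: "k \<in> {..<card I}"
    have "ip I (v k) (\<lambda>z. spec I v b z y) = ip I (v k) (\<lambda>z. \<Sum>j<card I. (of_real (b j) * cnj (v j y)) * v j z)"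
      by (simp add: spec_def mult_ac)
    also have "\<dots> = (\<Sum>j<card I. of_real (b j) * cnj (v j y) * ip I (v k) (v j))"
      unfolding ip_sum ip_linear ..
    also have "\<dots> = (\<Sum>j<card I. of_real (b j) * cnj (v j y) * (if k = j then 1 else 0))"
      using k by (intro sum.cong refl arg_cong2[where f="(*)"] onsD(1)[OF assms]) auto
    also have "\<dots> = of_real (b k) * cnj (v k y)" using k by (simp add: sum_delta_mult)
    finally show "ip I (v k) (\<lambda>z. spec I v b z y) = of_real (b k) * cnj (v k y)" .
  qed
  finally show ?thesis by (simp add: spec_def mult_ac)
qed

lemma spec_trace:
  assumes "finite I" "ons I v"
  shows "(\<Sum>x\<in>I. spec I v l x x) = of_real (\<Sum>k<card I. l k)"
proof -
  have "(\<Sum>x\<in>I. spec I v l x x) = (\<Sum>k<card I. of_real (l k) * ip I (v k) (v k))"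
    unfolding spec_def ip_def by (subst sum.swap) (simp add: sum_distrib_left mult_ac)
  then show ?thesis by (simp add: onsD(1)[OF assms(2)])
qed

lemma frob_herk:
  assumes "herk I A"
  shows "complex_of_real (\<Sum>x\<in>I. \<Sum>y\<in>I. (cmod (A x y))\<^sup>2) = (\<Sum>x\<in>I. \<Sum>y\<in>I. A x y * A y x)"
  unfolding of_real_sum
proof (intro sum.cong refl)
  fix x y assume "x \<in> I" "y \<in> I"
  then have e: "A y x = cnj (A x y)" using assms unfolding herk_def by blast
  show "complex_of_real ((cmod (A x y))\<^sup>2) = A x y * A y x"
    unfolding e by (rule mult_cnj_eq(1)[symmetric])
qed

lemma spec_frob:
  assumes "finite I" "ons I v"
  shows "(\<Sum>x\<in>I. \<Sum>y\<in>I. (cmod (spec I v l x y))\<^sup>2) = (\<Sum>k<card I. (l k)\<^sup>2)"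
proof -
  have "complex_of_real (\<Sum>x\<in>I. \<Sum>y\<in>I. (cmod (spec I v l x y))\<^sup>2) = of_real (\<Sum>k<card I. (l k)\<^sup>2)"
    unfolding frob_herk[OF herk_spec] spec_mult[OF assms(2)] spec_trace[OF assms] by (simp add: power2_eq_square)
  then show ?thesis by (simp only: of_real_eq_iff)
qed

lemma psdk_spectral:
  assumes "finite I" "psdk I A"
  obtains v l where "ons I v" "\<And>x y. x \<in> I \<Longrightarrow> y \<in> I \<Longrightarrow> A x y = spec I v l x y"
    "\<And>k. k < card I \<Longrightarrow> 0 \<le> l k"
proof -
  from assms(2) have "herk I A" by (simp add: psdk_def)
  from herk_spectral[OF assms(1) this] obtain v l where v: "ons I v"
    and A: "\<And>x y. x \<in> I \<Longrightarrow> y \<in> I \<Longrightarrow> A x y = spec I v l x y" by blast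
  have "0 \<le> l k" if k: "k < card I" for k
  proof -
    have "ip I (v k) (app I A (v k)) = ip I (v k) (app I (spec I v l) (v k))"
      unfolding app_def by (intro ip_cong refl sum.cong) (simp add: A)
    also have "\<dots> = of_real (\<Sum>j<card I. l j * (cmod (if j = k then 1 else 0))\<^sup>2)"
      unfolding ip_spec_self using k by (simp add: onsD(1)[OF v])
    also have "\<dots> = of_real (\<Sum>j<card I. l j * (if j = k then 1 else 0))"
      by (intro arg_cong[where f=of_real] sum.cong refl) auto
    also have "\<dots> = of_real (l k)" using k by (simp add: sum_delta_mult)
    finally show ?thesis using assms(2) by (simp add: psdk_def) (metis Re_complex_of_real)
  qed
  with v A show thesis by (rule that)
qed

lemma psdk_cong: "(\<And>x y. x \<in> I \<Longrightarrow> y \<in> I \<Longrightarrow> A x y = B x y) \<Longrightarrow> psdk I A = psdk I B"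
proof -
  assume e: "\<And>x y. x \<in> I \<Longrightarrow> y \<in> I \<Longrightarrow> A x y = B x y"
  have "herk I A = herk I B" using e unfolding herk_def by simp
  moreover have "ip I u (app I A u) = ip I u (app I B u)" for u
    unfolding app_def by (intro ip_cong refl sum.cong) (simp add: e)
  ultimately show ?thesis by (simp add: psdk_def)
qed

text \<open>The quadratic form is a sum of squared moduli. Positivity of rank-one matrices, Kraus
  images, partial traces and tensor powers is obtained in this way.\<close>

lemma psdk_gram: "psdk I (\<lambda>x y. \<Sum>z\<in>Z. M x z * cnj (M y z))"
proof -
  have "ip I u (app I (\<lambda>x y. \<Sum>z\<in>Z. M x z * cnj (M y z)) u)
    = of_real (\<Sum>z\<in>Z. (cmod (ip I u (\<lambda>x. M x z)))\<^sup>2)" for u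
  proof -
    have "app I (\<lambda>x y. \<Sum>z\<in>Z. M x z * cnj (M y z)) u = (\<lambda>x. \<Sum>z\<in>Z. ip I (\<lambda>x. M x z) u * M x z)"
    proof
      fix x
      have "app I (\<lambda>x y. \<Sum>z\<in>Z. M x z * cnj (M y z)) u x = (\<Sum>y\<in>I. \<Sum>z\<in>Z. cnj (M y z) * u y * M x z)"
        unfolding app_def by (simp add: sum_distrib_left sum_distrib_right mult_ac)
      also have "\<dots> = (\<Sum>z\<in>Z. \<Sum>y\<in>I. cnj (M y z) * u y * M x z)" by (rule sum.swap)
      finally show "app I (\<lambda>x y. \<Sum>z\<in>Z. M x z * cnj (M y z)) u x = (\<Sum>z\<in>Z. ip I (\<lambda>x. M x z) u * M x z)"
        unfolding ip_def sum_distrib_right .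
    qed
    then have "ip I u (app I (\<lambda>x y. \<Sum>z\<in>Z. M x z * cnj (M y z)) u)
      = (\<Sum>z\<in>Z. ip I (\<lambda>x. M x z) u * ip I u (\<lambda>x. M x z))" by (simp only: ip_sum ip_linear)
    also have "\<dots> = (\<Sum>z\<in>Z. of_real ((cmod (ip I u (\<lambda>x. M x z)))\<^sup>2))"
      by (intro sum.cong refl) (simp only: ip_cnj[of I u, symmetric] mult_cnj_eq)
    finally show ?thesis by simp
  qed
  then show ?thesis unfolding psdk_def herk_def by (auto simp: mult.commute intro!: sum_nonneg simp del: of_real_sum)
qed

lemma psdk_sqrt:
  assumes "finite I" "psdk I A"
  obtains B where "psdk I B" "\<And>x y. x \<in> I \<Longrightarrow> y \<in> I \<Longrightarrow> (\<Sum>z\<in>I. B x z * B z y) = A x y"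
proof -
  from psdk_spectral[OF assms] obtain v l where v: "ons I v"
    and A: "\<And>x y. x \<in> I \<Longrightarrow> y \<in> I \<Longrightarrow> A x y = spec I v l x y" and l: "\<And>k. k < card I \<Longrightarrow> 0 \<le> l k" by metis
  show thesis
  proof (rule that[of "spec I v (\<lambda>k. sqrt (l k))"])
    show "psdk I (spec I v (\<lambda>k. sqrt (l k)))" using l by (intro psdk_spec) simp
    fix x y assume xy: "x \<in> I" "y \<in> I"
    have "(\<Sum>z\<in>I. spec I v (\<lambda>k. sqrt (l k)) x z * spec I v (\<lambda>k. sqrt (l k)) z y)
      = spec I v (\<lambda>k. sqrt (l k) * sqrt (l k)) x y" by (rule spec_mult[OF v])
    also have "\<dots> = spec I v l x y" unfolding spec_def using l by (intro sum.cong refl) simp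
    finally show "(\<Sum>z\<in>I. spec I v (\<lambda>k. sqrt (l k)) x z * spec I v (\<lambda>k. sqrt (l k)) z y) = A x y"
      using A[OF xy] by simp
  qed
qed

text \<open>Two consequences of a spectrum in [-1, 1]. The bound on the quadratic form serves the
  part of small trace; the Hilbert-Schmidt bound serves the part of small 2-norm, at the price of
  the dimension.\<close>

definition contr :: "'i set \<Rightarrow> ('i \<Rightarrow> 'i \<Rightarrow> complex) \<Rightarrow> bool" where
  "contr I H \<longleftrightarrow> (\<forall>u. cmod (ip I u (app I H u)) \<le> (\<Sum>x\<in>I. (cmod (u x))\<^sup>2)) \<and>
     (\<Sum>x\<in>I. \<Sum>y\<in>I. (cmod (H x y))\<^sup>2) \<le> real (card I)"

text \<open>The Powers--St{\o}rmer argument, with \<open>H\<close> the sign of \<open>A - B\<close>; keeping \<open>H\<close> explicit avoids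
  trace norms altogether.\<close>

lemma powers_stormer:
  assumes fin: "finite I" and A: "psdk I A" and B: "psdk I B"
  obtains H where "contr I H"
    "(\<Sum>x\<in>I. \<Sum>y\<in>I. (cmod (A x y - B x y))\<^sup>2) \<le>
       Re (\<Sum>x\<in>I. \<Sum>y\<in>I. H y x * ((\<Sum>z\<in>I. A x z * A z y) - (\<Sum>z\<in>I. B x z * B z y)))"
proof -
  have hA: "herk I A" and hB: "herk I B" using A B by (auto simp: psdk_def)
  have "herk I (\<lambda>x y. A x y - B x y)" using hA hB unfolding herk_def by (metis complex_cnj_diff)
  from herk_spectral[OF fin this] obtain v s where v: "ons I v"
    and S: "\<And>x y. x \<in> I \<Longrightarrow> y \<in> I \<Longrightarrow> A x y - B x y = spec I v s x y" by blast
  define H where "H = spec I v (\<lambda>k. sgn (s k))"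
  have "contr I H"
    unfolding contr_def
  proof (intro conjI allI)
    fix u
    have "cmod (ip I u (app I H u)) = \<bar>\<Sum>k<card I. sgn (s k) * (cmod (ip I (v k) u))\<^sup>2\<bar>"
      unfolding H_def ip_spec_self norm_of_real ..
    also have "\<dots> \<le> (\<Sum>k<card I. \<bar>sgn (s k) * (cmod (ip I (v k) u))\<^sup>2\<bar>)" by (rule sum_abs)
    also have "\<dots> \<le> (\<Sum>k<card I. (cmod (ip I (v k) u))\<^sup>2)"
      by (intro sum_mono) (auto simp: abs_mult abs_sgn_eq)
    also have "\<dots> = (\<Sum>x\<in>I. (cmod (u x))\<^sup>2)" by (rule parseval[OF fin v])
    finally show "cmod (ip I u (app I H u)) \<le> (\<Sum>x\<in>I. (cmod (u x))\<^sup>2)" .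
  next
    have "(\<Sum>k<card I. (sgn (s k))\<^sup>2) \<le> (\<Sum>k<card I. 1)" by (intro sum_mono) (auto simp: sgn_if)
    then show "(\<Sum>x\<in>I. \<Sum>y\<in>I. (cmod (H x y))\<^sup>2) \<le> real (card I)"
      unfolding H_def spec_frob[OF fin v] by simp
  qed
  \<comment> \<open>The trace of \<open>H\<close> times the square of \<open>C\<close>, written in
    the eigenbasis of the difference: each eigenvector contributes the squared norm of its image
    under \<open>C\<close>.\<close>
  have quad: "(\<Sum>x\<in>I. \<Sum>y\<in>I. H y x * (\<Sum>z\<in>I. C x z * C z y)) =
      of_real (\<Sum>k<card I. sgn (s k) * (\<Sum>z\<in>I. (cmod (app I C (v k) z))\<^sup>2))" if hC: "herk I C" for C
  proof -
    have gen: "(\<Sum>x\<in>I. \<Sum>y\<in>I. H y x * D x y)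
      = (\<Sum>k<card I. \<Sum>x\<in>I. \<Sum>y\<in>I. of_real (sgn (s k)) * (cnj (v k x) * (D x y * v k y)))" for D
    proof -
      have "(\<Sum>x\<in>I. \<Sum>y\<in>I. H y x * D x y)
        = (\<Sum>x\<in>I. \<Sum>y\<in>I. \<Sum>k<card I. of_real (sgn (s k)) * (cnj (v k x) * (D x y * v k y)))"
        unfolding H_def spec_def by (simp add: sum_distrib_left sum_distrib_right mult_ac)
      also have "\<dots> = (\<Sum>x\<in>I. \<Sum>k<card I. \<Sum>y\<in>I. of_real (sgn (s k)) * (cnj (v k x) * (D x y * v k y)))"
        by (intro sum.cong refl sum.swap)
      also have "\<dots> = (\<Sum>k<card I. \<Sum>x\<in>I. \<Sum>y\<in>I. of_real (sgn (s k)) * (cnj (v k x) * (D x y * v k y)))"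
        by (rule sum.swap)
      finally show ?thesis .
    qed
    have "(\<Sum>x\<in>I. \<Sum>y\<in>I. H y x * (\<Sum>z\<in>I. C x z * C z y))
      = (\<Sum>k<card I. \<Sum>x\<in>I. \<Sum>y\<in>I. of_real (sgn (s k)) * (cnj (v k x) * ((\<Sum>z\<in>I. C x z * C z y) * v k y)))"
      by (rule gen)
    also have "\<dots> = (\<Sum>k<card I. of_real (sgn (s k)) * ip I (v k) (app I C (app I C (v k))))"
    proof (intro sum.cong refl)
      fix k
      have "(\<Sum>y\<in>I. (\<Sum>z\<in>I. C x z * C z y) * v k y) = app I C (app I C (v k)) x" for x
        unfolding app_def sum_distrib_left sum_distrib_right by (subst sum.swap) (simp add: mult.assoc)
      then show "(\<Sum>x\<in>I. \<Sum>y\<in>I. of_real (sgn (s k)) * (cnj (v k x) * ((\<Sum>z\<in>I. C x z * C z y) * v k y)))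
        = of_real (sgn (s k)) * ip I (v k) (app I C (app I C (v k)))"
        unfolding sum_distrib_left[symmetric] by (simp add: ip_def)
    qed
    also have "\<dots> = (\<Sum>k<card I. of_real (sgn (s k)) * of_real (\<Sum>z\<in>I. (cmod (app I C (v k) z))\<^sup>2))"
      by (simp only: herk_ip[OF hC, of "v _"] ip_self)
    finally show ?thesis by (simp only: of_real_sum of_real_mult)
  qed
  \<comment> \<open>For a unit eigenvector of \<open>A - B\<close> with eigenvalue \<open>s\<close>,
    let \<alpha> and \<beta> be the expectations of \<open>A\<close> and \<open>B\<close>. The
    squared norms of its images under \<open>A\<close> and \<open>B\<close> differ by
    \<open>s * (\<alpha> + \<beta>)\<close>, and \<open>\<bar>s\<bar> = \<bar>\<alpha> -
    \<beta>\<bar> \<le> \<alpha> + \<beta>\<close> because both expectations are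
    nonnegative.\<close>
  have key: "(s k)\<^sup>2 \<le> sgn (s k) * (\<Sum>z\<in>I. (cmod (app I A (v k) z))\<^sup>2) - sgn (s k) * (\<Sum>z\<in>I. (cmod (app I B (v k) z))\<^sup>2)"
    if k: "k < card I" for k
  proof -
    let ?a = "app I A (v k)" and ?b = "app I B (v k)"
    define \<alpha> where "\<alpha> = Re (ip I (v k) ?a)"
    define \<beta> where "\<beta> = Re (ip I (v k) ?b)"
    have nn: "\<alpha> \<ge> 0" "\<beta> \<ge> 0" using A B by (auto simp: \<alpha>_def \<beta>_def psdk_def)
    have d: "?a x - ?b x = of_real (s k) * v k x" if "x \<in> I" for x
    proof -
      have "?a x - ?b x = app I (\<lambda>x y. A x y - B x y) (v k) x" by (simp add: app_linear)
      also have "\<dots> = app I (spec I v s) (v k) x" unfolding app_def using that by (intro sum.cong refl) (simp add: S)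
      also have "\<dots> = (\<Sum>j<card I. of_real (s j) * (if j = k then 1 else 0) * v j x)"
        unfolding app_spec using k by (intro sum.cong refl) (simp add: onsD(1)[OF v])
      also have "\<dots> = (\<Sum>j<card I. (of_real (s j) * v j x) * (if j = k then 1 else 0))" by (simp add: mult_ac)
      also have "\<dots> = of_real (s k) * v k x" using k by (simp add: sum_delta_mult)
      finally show ?thesis .
    qed
    have "ip I (v k) ?a - ip I (v k) ?b = ip I (v k) (\<lambda>x. of_real (s k) * v k x)"
      unfolding ip_linear(2)[symmetric] by (intro ip_cong d refl)
    then have "ip I (v k) ?a - ip I (v k) ?b = of_real (s k)" using k by (simp add: ip_linear onsD(1)[OF v])
    then have ab: "\<alpha> - \<beta> = s k" unfolding \<alpha>_def \<beta>_def by (metis Re_complex_of_real minus_complex.simps(1))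
    have "of_real ((\<Sum>z\<in>I. (cmod (?a z))\<^sup>2) - (\<Sum>z\<in>I. (cmod (?b z))\<^sup>2)) = ip I ?a ?a - ip I ?b ?b"
      by (simp add: ip_self)
    also have "\<dots> = ip I ?a (\<lambda>x. ?a x - ?b x) + ip I (\<lambda>x. ?a x - ?b x) ?b"
      by (simp add: ip_linear)
    also have "\<dots> = ip I ?a (\<lambda>x. of_real (s k) * v k x) + ip I (\<lambda>x. of_real (s k) * v k x) ?b"
      by (intro arg_cong2[where f="(+)"] ip_cong d refl)
    also have "\<dots> = of_real (s k) * (cnj (ip I (v k) ?a) + ip I (v k) ?b)"
      by (simp add: ip_linear ip_cnj algebra_simps)
    finally have "(\<Sum>z\<in>I. (cmod (?a z))\<^sup>2) - (\<Sum>z\<in>I. (cmod (?b z))\<^sup>2)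
      = Re (of_real (s k) * (cnj (ip I (v k) ?a) + ip I (v k) ?b))" by (metis Re_complex_of_real)
    also have "\<dots> = s k * (\<alpha> + \<beta>)" by (simp add: \<alpha>_def \<beta>_def)
    finally have "sgn (s k) * ((\<Sum>z\<in>I. (cmod (?a z))\<^sup>2) - (\<Sum>z\<in>I. (cmod (?b z))\<^sup>2)) = sgn (s k) * s k * (\<alpha> + \<beta>)"
      by simp
    then have "sgn (s k) * (\<Sum>z\<in>I. (cmod (?a z))\<^sup>2) - sgn (s k) * (\<Sum>z\<in>I. (cmod (?b z))\<^sup>2) = \<bar>s k\<bar> * (\<alpha> + \<beta>)"
      by (simp add: right_diff_distrib abs_sgn mult.commute)
    moreover have "(s k)\<^sup>2 = \<bar>s k\<bar> * \<bar>s k\<bar>" by (simp add: power2_eq_square)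
    moreover have "\<bar>s k\<bar> * \<bar>s k\<bar> \<le> \<bar>s k\<bar> * (\<alpha> + \<beta>)" using ab nn by (intro mult_left_mono) linarith+
    ultimately show ?thesis by linarith
  qed
  have "(\<Sum>x\<in>I. \<Sum>y\<in>I. (cmod (A x y - B x y))\<^sup>2) = (\<Sum>x\<in>I. \<Sum>y\<in>I. (cmod (spec I v s x y))\<^sup>2)"
    by (intro sum.cong refl) (simp add: S)
  also have "\<dots> = (\<Sum>k<card I. (s k)\<^sup>2)" by (rule spec_frob[OF fin v])
  also have "\<dots> \<le> (\<Sum>k<card I. sgn (s k) * (\<Sum>z\<in>I. (cmod (app I A (v k) z))\<^sup>2) - sgn (s k) * (\<Sum>z\<in>I. (cmod (app I B (v k) z))\<^sup>2))"
    by (intro sum_mono key) simp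
  also have "\<dots> = Re (\<Sum>x\<in>I. \<Sum>y\<in>I. H y x * ((\<Sum>z\<in>I. A x z * A z y) - (\<Sum>z\<in>I. B x z * B z y)))"
    unfolding right_diff_distrib sum_subtractf minus_complex.simps quad[OF hA] quad[OF hB] Re_complex_of_real ..
  finally have "(\<Sum>x\<in>I. \<Sum>y\<in>I. (cmod (A x y - B x y))\<^sup>2) \<le>
       Re (\<Sum>x\<in>I. \<Sum>y\<in>I. H y x * ((\<Sum>z\<in>I. A x z * A z y) - (\<Sum>z\<in>I. B x z * B z y)))" .
  with \<open>contr I H\<close> show thesis by (rule that)
qed

text \<open>If the squares agree, the right-hand side of \<open>powers_stormer\<close> is 0.\<close>

lemma psdk_sqrt_unique:
  assumes "finite I" "psdk I A" "psdk I B"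
    and "\<And>x y. x \<in> I \<Longrightarrow> y \<in> I \<Longrightarrow> (\<Sum>z\<in>I. A x z * A z y) = (\<Sum>z\<in>I. B x z * B z y)"
    and "x \<in> I" "y \<in> I"
  shows "A x y = B x y"
proof -
  from powers_stormer[OF assms(1-3)] obtain H where
    "(\<Sum>x\<in>I. \<Sum>y\<in>I. (cmod (A x y - B x y))\<^sup>2) \<le>
       Re (\<Sum>x\<in>I. \<Sum>y\<in>I. H y x * ((\<Sum>z\<in>I. A x z * A z y) - (\<Sum>z\<in>I. B x z * B z y)))" by blast
  also have "\<dots> = 0" using assms(4) by (simp add: sum.neutral)
  finally have "(\<Sum>x\<in>I. \<Sum>y\<in>I. (cmod (A x y - B x y))\<^sup>2) \<le> 0" .
  moreover have "(\<Sum>x\<in>I. \<Sum>y\<in>I. (cmod (A x y - B x y))\<^sup>2) \<ge> 0" by (intro sum_nonneg) auto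
  ultimately have "(\<Sum>x\<in>I. \<Sum>y\<in>I. (cmod (A x y - B x y))\<^sup>2) = 0" by linarith
  then have "(\<Sum>y\<in>I. (cmod (A x y - B x y))\<^sup>2) = 0"
    using assms by (subst (asm) sum_nonneg_eq_0_iff) (auto intro!: sum_nonneg)
  then have "(cmod (A x y - B x y))\<^sup>2 = 0"
    using assms by (subst (asm) sum_nonneg_eq_0_iff) auto
  then show ?thesis by simp
qed

text \<open>Read \<open>M\<close> as the amplitudes of a vector shared between \<open>I\<close> and
  the system \<open>Z\<close> of the decoder, and \<open>q\<close> as the diagonal of the desired
  marginal on \<open>I\<close>. \<open>W\<close> is the partial isometry in the polar decomposition
  of \<open>M\<close>: \<open>M\<close> times the adjoint of \<open>W\<close> is the root
  \<open>A\<close> of the marginal of \<open>M\<close>, and the last right-hand side is twice the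
  inner product of \<open>A\<close> with the root \<open>B\<close> of the desired marginal. The
  inequality is the Powers-Stoermer bound on the squared Hilbert-Schmidt norm of
  \<open>A - B\<close>, with the square expanded. The second conclusion says that the adjoint of
  \<open>W\<close> times \<open>W\<close> is a projection, which allows the decoder to be completed
  to an instrument.\<close>

lemma uhlmann_decoder:
  fixes M :: "'i \<Rightarrow> 'z \<Rightarrow> complex" and q :: "'i \<Rightarrow> real"
  assumes fin: "finite I" "finite Z" and q: "\<And>x. x \<in> I \<Longrightarrow> 0 \<le> q x"
  obtains W H where "contr I H"
    "\<And>z z'. (\<Sum>y\<in>Z. (\<Sum>x\<in>I. cnj (W x z) * W x y) * (\<Sum>x\<in>I. cnj (W x y) * W x z'))
       = (\<Sum>x\<in>I. cnj (W x z) * W x z')"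
    "(\<Sum>x\<in>I. \<Sum>z\<in>Z. (cmod (M x z))\<^sup>2) + (\<Sum>x\<in>I. q x)
       - Re (\<Sum>x\<in>I. \<Sum>y\<in>I. H y x * ((\<Sum>z\<in>Z. M x z * cnj (M y z)) - (if x = y then of_real (q x) else 0)))
       \<le> 2 * Re (\<Sum>x\<in>I. of_real (sqrt (q x)) * (\<Sum>z\<in>Z. M x z * cnj (W x z)))"
proof -
  define P where "P = (\<lambda>x y. \<Sum>z\<in>Z. M x z * cnj (M y z))"
  have "psdk I P" unfolding P_def by (rule psdk_gram)
  from psdk_spectral[OF fin(1) this] obtain v p where v: "ons I v"
    and Pe: "\<And>x y. x \<in> I \<Longrightarrow> y \<in> I \<Longrightarrow> P x y = spec I v p x y" and p: "\<And>k. k < card I \<Longrightarrow> 0 \<le> p k"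
    by blast
  \<comment> \<open>The inverse root of the eigenvalue on the support and 0 off it; this
    pseudo-inverse makes \<open>W\<close> a partial isometry.\<close>
  define c where "c k = (if p k > 0 then 1 / sqrt (p k) else 0)" for k
  define t where "t k z = (\<Sum>y\<in>I. cnj (v k y) * M y z)" for k z
  define W where "W x z = (\<Sum>k<card I. of_real (c k) * v k x * t k z)" for x z
  define A where "A = spec I v (\<lambda>k. sqrt (p k))"
  define B where "B x y = (if x = y then complex_of_real (sqrt (q x)) else 0)" for x y :: 'i
  have cp: "c k * p k = sqrt (p k)" if "k < card I" for k
    using p[OF that] by (auto simp: c_def real_div_sqrt)
  have c2: "c k * c k * p k * (c k * c k) = c k * c k" for k
    by (auto simp: c_def real_div_sqrt)
  have Mt: "(\<Sum>z\<in>Z. M x z * cnj (t k z)) = of_real (p k) * v k x" if "x \<in> I" "k < card I" for x k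
  proof -
    have "(\<Sum>z\<in>Z. M x z * cnj (t k z)) = (\<Sum>z\<in>Z. \<Sum>y\<in>I. M x z * cnj (M y z) * v k y)"
      unfolding t_def by (simp add: sum_distrib_left mult_ac)
    also have "\<dots> = (\<Sum>y\<in>I. P x y * v k y)" unfolding P_def sum_distrib_right by (rule sum.swap)
    also have "\<dots> = app I (spec I v p) (v k) x"
      unfolding app_def using that by (intro sum.cong refl) (simp add: Pe)
    also have "\<dots> = (\<Sum>j<card I. (of_real (p j) * v j x) * (if j = k then 1 else 0))"
      unfolding app_spec using that by (intro sum.cong refl) (simp add: onsD(1)[OF v])
    also have "\<dots> = of_real (p k) * v k x" using that by (simp add: sum_delta_mult)
    finally show ?thesis .
  qed
  have tt: "(\<Sum>z\<in>Z. t j z * cnj (t k z)) = (if j = k then of_real (p k) else 0)"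
    if "j < card I" "k < card I" for j k
  proof -
    have "(\<Sum>z\<in>Z. t j z * cnj (t k z)) = (\<Sum>z\<in>Z. \<Sum>y\<in>I. cnj (v j y) * (M y z * cnj (t k z)))"
      unfolding t_def[of j] by (simp add: sum_distrib_right mult.assoc)
    also have "\<dots> = (\<Sum>y\<in>I. cnj (v j y) * (\<Sum>z\<in>Z. M y z * cnj (t k z)))"
      unfolding sum_distrib_left by (rule sum.swap)
    also have "\<dots> = (\<Sum>y\<in>I. cnj (v j y) * (of_real (p k) * v k y))"
      using Mt that by (intro sum.cong refl) simp
    also have "\<dots> = of_real (p k) * ip I (v j) (v k)"
      unfolding ip_def sum_distrib_left by (simp add: mult_ac)
    finally show ?thesis using that by (simp add: onsD(1)[OF v])
  qed
  have WW: "(\<Sum>x\<in>I. cnj (W x z) * W x z') = (\<Sum>k<card I. of_real (c k * c k) * (cnj (t k z) * t k z'))" for z z'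
  proof -
    have "(\<Sum>x\<in>I. cnj (W x z) * W x z') = ip I (\<lambda>x. \<Sum>k<card I. (of_real (c k) * t k z) * v k x)
       (\<lambda>x. \<Sum>k<card I. (of_real (c k) * t k z') * v k x)"
      unfolding ip_def W_def by (simp only: mult_ac)
    also have "\<dots> = (\<Sum>j<card I. \<Sum>k<card I. of_real (c k) * t k z' * (cnj (of_real (c j) * t j z) * ip I (v j) (v k)))"
      unfolding ip_sum ip_linear by (rule sum.swap)
    also have "\<dots> = (\<Sum>j<card I. \<Sum>k<card I. (of_real (c k) * t k z' * cnj (of_real (c j) * t j z)) * (if j = k then 1 else 0))"
      by (intro sum.cong refl) (simp add: onsD(1)[OF v])
    also have "\<dots> = (\<Sum>j<card I. of_real (c j) * t j z' * cnj (of_real (c j) * t j z))"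
      by (simp add: sum_delta_mult)
    finally show ?thesis by (simp add: mult_ac)
  qed
  have idem: "(\<Sum>y\<in>Z. (\<Sum>x\<in>I. cnj (W x z) * W x y) * (\<Sum>x\<in>I. cnj (W x y) * W x z'))
       = (\<Sum>x\<in>I. cnj (W x z) * W x z')" for z z'
  proof -
    have "(\<Sum>y\<in>Z. (\<Sum>x\<in>I. cnj (W x z) * W x y) * (\<Sum>x\<in>I. cnj (W x y) * W x z'))
      = (\<Sum>y\<in>Z. \<Sum>k<card I. \<Sum>j<card I. of_real (c k * c k) * cnj (t k z) * (of_real (c j * c j) * t j z') * (t k y * cnj (t j y)))"
      unfolding WW sum_product by (intro sum.cong refl) (simp add: mult_ac)
    also have "\<dots> = (\<Sum>k<card I. \<Sum>y\<in>Z. \<Sum>j<card I. of_real (c k * c k) * cnj (t k z) * (of_real (c j * c j) * t j z') * (t k y * cnj (t j y)))"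
      by (rule sum.swap)
    also have "\<dots> = (\<Sum>k<card I. \<Sum>j<card I. of_real (c k * c k) * cnj (t k z) * (of_real (c j * c j) * t j z') * (\<Sum>y\<in>Z. t k y * cnj (t j y)))"
      unfolding sum_distrib_left by (intro sum.cong refl sum.swap)
    also have "\<dots> = (\<Sum>k<card I. \<Sum>j<card I. (of_real (c k * c k) * cnj (t k z) * (of_real (c j * c j) * t j z') * of_real (p j)) * (if k = j then 1 else 0))"
      by (intro sum.cong refl) (simp add: tt)
    also have "\<dots> = (\<Sum>k<card I. of_real (c k * c k) * cnj (t k z) * (of_real (c k * c k) * t k z') * of_real (p k))"
      by (simp add: sum_delta_mult)
    also have "\<dots> = (\<Sum>k<card I. of_real (c k * c k * p k * (c k * c k)) * (cnj (t k z) * t k z'))"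
      by (simp add: mult_ac)
    finally show ?thesis unfolding c2 WW .
  qed
  have MW: "(\<Sum>z\<in>Z. M x z * cnj (W x z)) = A x x" if "x \<in> I" for x
  proof -
    have "(\<Sum>z\<in>Z. M x z * cnj (W x z)) = (\<Sum>z\<in>Z. \<Sum>k<card I. of_real (c k) * cnj (v k x) * (M x z * cnj (t k z)))"
      unfolding W_def by (simp add: sum_distrib_left mult_ac)
    also have "\<dots> = (\<Sum>k<card I. of_real (c k) * cnj (v k x) * (\<Sum>z\<in>Z. M x z * cnj (t k z)))"
      unfolding sum_distrib_left by (rule sum.swap)
    also have "\<dots> = (\<Sum>k<card I. of_real (c k * p k) * v k x * cnj (v k x))"
      using that by (intro sum.cong refl) (simp add: Mt)
    also have "\<dots> = A x x" unfolding A_def spec_def by (intro sum.cong refl) (simp add: cp)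
    finally show ?thesis .
  qed
  have psdA: "psdk I A" unfolding A_def using p by (intro psdk_spec) simp
  have psdB: "psdk I B"
  proof -
    have "ip I u (app I B u) = of_real (\<Sum>x\<in>I. sqrt (q x) * (cmod (u x))\<^sup>2)" for u
    proof -
      have "app I B u x = of_real (sqrt (q x)) * u x" if "x \<in> I" for x
        unfolding app_def B_def using fin that by (simp add: if_distrib[of "\<lambda>t. t * _"] cong: if_cong)
      then have "ip I u (app I B u) = (\<Sum>x\<in>I. of_real (sqrt (q x)) * (cnj (u x) * u x))"
        unfolding ip_def by (intro sum.cong refl) simp
      then show ?thesis by (simp add: mult_cnj_eq)
    qed
    then have "0 \<le> Re (ip I u (app I B u))" for u
      using q by (auto intro!: sum_nonneg mult_nonneg_nonneg simp del: of_real_sum)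
    then show ?thesis by (auto simp: psdk_def herk_def B_def)
  qed
  have A2: "(\<Sum>z\<in>I. A x z * A z y) = P x y" if "x \<in> I" "y \<in> I" for x y
  proof -
    have "(\<Sum>z\<in>I. A x z * A z y) = spec I v (\<lambda>k. sqrt (p k) * sqrt (p k)) x y"
      unfolding A_def by (rule spec_mult[OF v])
    also have "\<dots> = spec I v p x y" unfolding spec_def using p by (intro sum.cong refl) simp
    finally show ?thesis using Pe[OF that] by simp
  qed
  have B2: "(\<Sum>z\<in>I. B x z * B z y) = (if x = y then of_real (q x) else 0)" if "x \<in> I" "y \<in> I" for x y
  proof -
    have "B x z * B z y = (if x = z then of_real (sqrt (q x)) * (if x = y then of_real (sqrt (q x)) else 0) else 0)" for z
      by (simp add: B_def)
    then have B: "(\<Sum>z\<in>I. B x z * B z y) = of_real (sqrt (q x)) * (if x = y then of_real (sqrt (q x)) else 0)"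
      using fin that by simp
    have "complex_of_real (sqrt (q x)) * of_real (sqrt (q x)) = of_real (q x)"
      unfolding of_real_mult[symmetric] using q[OF that(1)] by simp
    with B show ?thesis by (cases "x = y") simp_all
  qed
  from powers_stormer[OF fin(1) psdA psdB] obtain H where H: "contr I H"
    "(\<Sum>x\<in>I. \<Sum>y\<in>I. (cmod (A x y - B x y))\<^sup>2) \<le>
       Re (\<Sum>x\<in>I. \<Sum>y\<in>I. H y x * ((\<Sum>z\<in>I. A x z * A z y) - (\<Sum>z\<in>I. B x z * B z y)))" by blast
  have herA: "herk I A" and herB: "herk I B" using psdA psdB by (auto simp: psdk_def)
  have fA: "(\<Sum>x\<in>I. \<Sum>y\<in>I. (cmod (A x y))\<^sup>2) = (\<Sum>x\<in>I. \<Sum>z\<in>Z. (cmod (M x z))\<^sup>2)"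
  proof -
    have "complex_of_real (\<Sum>x\<in>I. \<Sum>y\<in>I. (cmod (A x y))\<^sup>2) = (\<Sum>x\<in>I. P x x)"
      unfolding frob_herk[OF herA] by (intro sum.cong refl A2)
    also have "\<dots> = of_real (\<Sum>x\<in>I. \<Sum>z\<in>Z. (cmod (M x z))\<^sup>2)"
      unfolding P_def mult_cnj_eq of_real_sum ..
    finally show ?thesis by (simp only: of_real_eq_iff)
  qed
  have fB: "(\<Sum>x\<in>I. \<Sum>y\<in>I. (cmod (B x y))\<^sup>2) = (\<Sum>x\<in>I. q x)"
  proof -
    have "complex_of_real (\<Sum>x\<in>I. \<Sum>y\<in>I. (cmod (B x y))\<^sup>2) = (\<Sum>x\<in>I. of_real (q x))"
      unfolding frob_herk[OF herB] by (intro sum.cong refl) (simp add: B2)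
    then show ?thesis by (simp only: of_real_eq_iff of_real_sum[symmetric])
  qed
  have cross: "(\<Sum>x\<in>I. \<Sum>y\<in>I. (cmod (A x y - B x y))\<^sup>2)
    = (\<Sum>x\<in>I. \<Sum>y\<in>I. (cmod (A x y))\<^sup>2) + (\<Sum>x\<in>I. \<Sum>y\<in>I. (cmod (B x y))\<^sup>2)
      - 2 * (\<Sum>x\<in>I. sqrt (q x) * Re (A x x))"
  proof -
    have e: "(cmod (a - b))\<^sup>2 = (cmod a)\<^sup>2 + (cmod b)\<^sup>2 - 2 * Re (a * cnj b)" for a b :: complex
      unfolding cmod_power2 by (simp add: power2_eq_square algebra_simps)
    have "(\<Sum>x\<in>I. \<Sum>y\<in>I. 2 * Re (A x y * cnj (B x y))) = (\<Sum>x\<in>I. \<Sum>y\<in>I. if x = y then 2 * (sqrt (q x) * Re (A x x)) else 0)"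
      by (intro sum.cong refl) (simp add: B_def)
    also have "\<dots> = 2 * (\<Sum>x\<in>I. sqrt (q x) * Re (A x x))" using fin by (simp add: sum_distrib_left)
    finally show ?thesis unfolding e by (simp add: sum_subtractf sum.distrib)
  qed
  show thesis
  proof (rule that[OF H(1) idem])
    have 1: "(\<Sum>x\<in>I. \<Sum>y\<in>I. H y x * ((\<Sum>z\<in>I. A x z * A z y) - (\<Sum>z\<in>I. B x z * B z y)))
      = (\<Sum>x\<in>I. \<Sum>y\<in>I. H y x * ((\<Sum>z\<in>Z. M x z * cnj (M y z)) - (if x = y then of_real (q x) else 0)))"
      by (intro sum.cong refl) (simp only: A2 B2 P_def)
    have 2: "Re (\<Sum>x\<in>I. of_real (sqrt (q x)) * (\<Sum>z\<in>Z. M x z * cnj (W x z))) = (\<Sum>x\<in>I. sqrt (q x) * Re (A x x))"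
      unfolding Re_sum by (intro sum.cong refl) (simp add: MW)
    show "(\<Sum>x\<in>I. \<Sum>z\<in>Z. (cmod (M x z))\<^sup>2) + (\<Sum>x\<in>I. q x)
       - Re (\<Sum>x\<in>I. \<Sum>y\<in>I. H y x * ((\<Sum>z\<in>Z. M x z * cnj (M y z)) - (if x = y then of_real (q x) else 0)))
       \<le> 2 * Re (\<Sum>x\<in>I. of_real (sqrt (q x)) * (\<Sum>z\<in>Z. M x z * cnj (W x z)))"
      using H(2) unfolding 1 2 cross fA fB by linarith
  qed
qed

section \<open>Matrices, fidelity and entropy\<close>

lemma adj_dim [simp]: "dim_row (mat_adjoint A) = dim_col A" "dim_col (mat_adjoint A) = dim_row A"
  by (simp_all add: mat_adjoint_def)

lemma adj_carrier [simp]: "A \<in> carrier_mat n k \<Longrightarrow> mat_adjoint A \<in> carrier_mat k n"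
  by (intro carrier_matI) (simp_all only: adj_dim carrier_matD)

lemma adj_index: "i < dim_col A \<Longrightarrow> j < dim_row A \<Longrightarrow> mat_adjoint A $$ (i,j) = cnj (A $$ (j,i) :: complex)"
  by (simp add: mat_adjoint_def mat_of_rows_index)

definition ker :: "complex mat \<Rightarrow> nat \<Rightarrow> nat \<Rightarrow> complex" where
  "ker A = (\<lambda>i j. A $$ (i,j))"

lemma psd_iff:
  assumes A: "A \<in> carrier_mat n n"
  shows "psd A \<longleftrightarrow> psdk {..<n} (ker A)"
proof -
  have hiff: "hermitian A \<longleftrightarrow> herk {..<n} (ker A)"
  proof
    assume "hermitian A"
    then have e: "mat_adjoint A = A" by (simp add: hermitian_def)
    have "A $$ (j,i) = cnj (A $$ (i,j))" if "i < n" "j < n" for i j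
    proof -
      have "mat_adjoint A $$ (j,i) = cnj (A $$ (i,j))" using that A by (intro adj_index) auto
      then show ?thesis unfolding e .
    qed
    then show "herk {..<n} (ker A)" unfolding herk_def ker_def by blast
  next
    assume h: "herk {..<n} (ker A)"
    have "mat_adjoint A = A"
    proof (rule eq_matI)
      fix i j assume "i < dim_row A" "j < dim_col A"
      then have ij: "i < n" "j < n" using A by auto
      have "A $$ (i,j) = cnj (A $$ (j,i))" using h ij unfolding herk_def ker_def by blast
      also have "\<dots> = mat_adjoint A $$ (i,j)" using ij A by (intro adj_index[symmetric]) auto
      finally show "mat_adjoint A $$ (i,j) = A $$ (i,j)" by (rule sym)
    qed (use A in auto)
    then show "hermitian A" using A by (simp add: hermitian_def)
  qed
  have q: "(A *\<^sub>v v) \<bullet>c v = ip {..<n} (\<lambda>i. v $ i) (app {..<n} (ker A) (\<lambda>i. v $ i))"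
    if "v \<in> carrier_vec n" for v
  proof -
    have "(A *\<^sub>v v) \<bullet>c v = (\<Sum>i<n. (A *\<^sub>v v) $ i * cnj (v $ i))"
      using that by (simp add: scalar_prod_def atLeast0LessThan)
    also have "\<dots> = (\<Sum>i<n. cnj (v $ i) * (\<Sum>j<n. A $$ (i,j) * v $ j))"
      by (intro sum.cong refl) (subst index_mult_vec_sum[OF A that], simp_all add: mult.commute)
    finally show ?thesis by (simp add: ip_def app_def ker_def)
  qed
  have qiff: "(\<forall>v\<in>carrier_vec n. 0 \<le> Re ((A *\<^sub>v v) \<bullet>c v))
    \<longleftrightarrow> (\<forall>u. 0 \<le> Re (ip {..<n} u (app {..<n} (ker A) u)))" (is "?L \<longleftrightarrow> ?R")
  proof
    assume L: ?L
    show ?R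
    proof
      fix u
      have "ip {..<n} u (app {..<n} (ker A) u)
        = ip {..<n} (\<lambda>i. vec n u $ i) (app {..<n} (ker A) (\<lambda>i. vec n u $ i))"
        unfolding app_def by (intro ip_cong sum.cong refl) auto
      also have "\<dots> = (A *\<^sub>v vec n u) \<bullet>c vec n u" by (rule q[symmetric]) simp
      finally show "0 \<le> Re (ip {..<n} u (app {..<n} (ker A) u))"
        using bspec[OF L vec_carrier[of n u]] by (simp only:)
    qed
  next
    assume ?R
    then show ?L using q by simp
  qed
  show ?thesis
    unfolding psd_def psdk_def carrier_matD(1)[OF A] hiff qiff ..
qed

lemma mult_ker:
  assumes "A \<in> carrier_mat n n" "B \<in> carrier_mat n n" "i < n" "j < n"
  shows "(A * B) $$ (i,j) = (\<Sum>x<n. ker A i x * ker B x j)"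
  using index_mult_sum[OF assms] by (simp add: ker_def)

text \<open>The description in \<open>msqrt\<close> ranges over matrices of every size;
  \<open>C * C = A\<close> fixes the size before uniqueness of the positive root can be
  applied.\<close>

lemma msqrt_eqI:
  assumes B: "B \<in> carrier_mat n n" "psd B" "B * B = A"
  shows "msqrt A = B"
  unfolding msqrt_def
proof (rule the_equality)
  show "psd B \<and> B * B = A" using B by simp
  fix C assume C: "psd C \<and> C * C = A"
  then have sq: "C \<in> carrier_mat (dim_row C) (dim_row C)" by (auto simp: psd_def hermitian_def)
  have "dim_row C = n" using C B(1,3) by (metis carrier_matD(1) index_mult_mat(2))
  then have Cn: "C \<in> carrier_mat n n" using sq by (simp only:)
  have "ker C i j = ker B i j" if "i \<in> {..<n}" "j \<in> {..<n}" for i j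
  proof (rule psdk_sqrt_unique[OF finite_lessThan])
    show "psdk {..<n} (ker C)" "psdk {..<n} (ker B)"
      using C B(2) psd_iff[OF Cn] psd_iff[OF B(1)] by blast+
    fix x y assume "x \<in> {..<n}" "y \<in> {..<n}"
    then show "(\<Sum>z\<in>{..<n}. ker C x z * ker C z y) = (\<Sum>z\<in>{..<n}. ker B x z * ker B z y)"
      using C B mult_ker[OF Cn Cn, of x y] mult_ker[OF B(1) B(1), of x y] by (metis lessThan_iff)
  qed (use that in auto)
  then show "C = B" using Cn B by (intro eq_matI) (auto simp: ker_def)
qed

lemma msqrt_props:
  assumes A: "A \<in> carrier_mat n n" "psd A"
  shows "msqrt A \<in> carrier_mat n n" "psd (msqrt A)" "msqrt A * msqrt A = A"
proof -
  have "psdk {..<n} (ker A)" using A psd_iff by simp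
  from psdk_sqrt[OF finite_lessThan this] obtain b where b: "psdk {..<n} b"
    "\<And>x y. x \<in> {..<n} \<Longrightarrow> y \<in> {..<n} \<Longrightarrow> (\<Sum>z\<in>{..<n}. b x z * b z y) = ker A x y" by metis
  define B where "B = mat n n (\<lambda>(i,j). b i j)"
  have B: "B \<in> carrier_mat n n" by (simp add: B_def)
  have "psdk {..<n} (ker B)"
    using b(1) by (subst psdk_cong[where B=b]) (auto simp: ker_def B_def)
  then have pB: "psd B" using psd_iff[OF B] by simp
  have "B * B = A"
  proof (rule eq_matI)
    fix i j assume "i < dim_row A" "j < dim_col A"
    then have ij: "i < n" "j < n" using A by auto
    have "(\<Sum>x<n. ker B i x * ker B x j) = (\<Sum>x<n. b i x * b x j)"
      using ij by (intro sum.cong refl) (simp add: ker_def B_def)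
    then show "(B * B) $$ (i,j) = A $$ (i,j)"
      unfolding mult_ker[OF B B ij] using b(2) ij by (simp add: ker_def)
  qed (use A B in auto)
  note e = msqrt_eqI[OF B pB this]
  show "msqrt A \<in> carrier_mat n n" "psd (msqrt A)" "msqrt A * msqrt A = A"
    unfolding e by (fact B pB \<open>B * B = A\<close>)+
qed

definition rank1 :: "nat \<Rightarrow> (nat \<Rightarrow> complex) \<Rightarrow> complex mat" where
  "rank1 n w = mat n n (\<lambda>(i,j). w i * cnj (w j))"

lemma psdk_rank1:
  assumes "0 \<le> c"
  shows "psdk I (\<lambda>i j. of_real c * (w i * cnj (w j)))"
proof -
  have s: "complex_of_real (sqrt c) * of_real (sqrt c) = of_real c"
    unfolding of_real_mult[symmetric] using assms by simp
  have "(\<Sum>z\<in>{()}. of_real (sqrt c) * w x * cnj (of_real (sqrt c) * w y)) = of_real c * (w x * cnj (w y))" for x y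
    unfolding s[symmetric] by simp
  then show ?thesis using psdk_gram[of I "\<lambda>x _. of_real (sqrt c) * w x" "{()}"] by (simp only:)
qed

text \<open>A rank-one matrix is a multiple of a projection, so its root differs from it by the
  factor \<open>1 / N\<close>. For \<open>w = 0\<close> this quotient is 0 and the formula gives the
  zero matrix, as it should.\<close>

lemma msqrt_rank1:
  assumes N: "N = sqrt (\<Sum>i<n. (cmod (w i))\<^sup>2)"
  shows "msqrt (rank1 n w) = mat n n (\<lambda>(i,j). of_real (1 / N) * (w i * cnj (w j)))"
proof (rule msqrt_eqI)
  let ?B = "mat n n (\<lambda>(i,j). complex_of_real (1 / N) * (w i * cnj (w j)))"
  show B: "?B \<in> carrier_mat n n" by simp
  have N0: "N \<ge> 0" unfolding N by (simp add: sum_nonneg)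
  have "psdk {..<n} (ker ?B)"
    using psdk_rank1[of "1/N" "{..<n}" w] N0 by (subst psdk_cong[where B="\<lambda>i j. of_real (1/N) * (w i * cnj (w j))"]) (auto simp: ker_def)
  then show "psd ?B" using psd_iff[OF B] by simp
  have NNr: "N * N = (\<Sum>i<n. (cmod (w i))\<^sup>2)" unfolding N by (simp add: sum_nonneg)
  have NN: "(\<Sum>x<n. cnj (w x) * w x) = of_real (N * N)"
    unfolding NNr of_real_sum mult_cnj_eq ..
  show "?B * ?B = rank1 n w"
  proof (rule eq_matI)
    fix i j assume "i < dim_row (rank1 n w)" "j < dim_col (rank1 n w)"
    then have ij: "i < n" "j < n" by (auto simp: rank1_def)
    have "(?B * ?B) $$ (i,j) = (\<Sum>x<n. of_real (1/N * (1/N)) * (w i * cnj (w j)) * (cnj (w x) * w x))"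
      unfolding mult_ker[OF B B ij] using ij by (intro sum.cong refl) (simp add: ker_def mult_ac)
    also have "\<dots> = of_real (1/N * (1/N) * (N * N)) * (w i * cnj (w j))"
      unfolding sum_distrib_left[symmetric] NN by simp
    also have "\<dots> = w i * cnj (w j)"
    proof (cases "N = 0")
      case True
      then have "(\<Sum>i<n. (cmod (w i))\<^sup>2) = 0" using N by simp
      then have "(cmod (w i))\<^sup>2 = 0" using ij by (subst (asm) sum_nonneg_eq_0_iff) auto
      then show ?thesis by simp
    qed simp
    finally show "(?B * ?B) $$ (i,j) = rank1 n w $$ (i,j)" using ij by (simp add: rank1_def)
  qed (auto simp: rank1_def)
qed

text \<open>The product of the two roots is the outer product of \<psi> with \<open>w\<close>, the
  root of \<sigma> applied to \<psi>. As \<psi> is a unit vector, its trace norm is the norm of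
  \<open>w\<close>, whose square is the expectation of \<sigma> in \<psi>.\<close>

lemma fidelity_pure:
  assumes \<sigma>: "\<sigma> \<in> carrier_mat n n" "psd \<sigma>" and \<psi>: "(\<Sum>i<n. (cmod (\<psi> i))\<^sup>2) = 1"
  shows "fidelity (rank1 n \<psi>) \<sigma> = sqrt (Re (ip {..<n} \<psi> (app {..<n} (ker \<sigma>) \<psi>)))"
proof -
  let ?I = "{..<n}"
  define R where "R = msqrt \<sigma>"
  note R = msqrt_props[OF \<sigma>, folded R_def]
  have hR: "herk ?I (ker R)" using R psd_iff by (auto simp: psdk_def)
  have P: "msqrt (rank1 n \<psi>) = rank1 n \<psi>"
    using msqrt_rank1[of 1 \<psi> n] \<psi> by (simp add: rank1_def)
  have Pc: "rank1 n \<psi> \<in> carrier_mat n n" by (simp add: rank1_def)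
  define w where "w = app ?I (ker R) \<psi>"
  have X: "(rank1 n \<psi> * R) $$ (i,j) = \<psi> i * cnj (w j)" if "i < n" "j < n" for i j
  proof -
    have "(rank1 n \<psi> * R) $$ (i,j) = (\<Sum>x<n. \<psi> i * (cnj (\<psi> x) * ker R x j))"
      unfolding mult_ker[OF Pc R(1) that] using that by (intro sum.cong refl) (simp add: ker_def rank1_def)
    also have "\<dots> = \<psi> i * cnj (\<Sum>x<n. ker R j x * \<psi> x)"
      unfolding sum_distrib_left[symmetric] cnj_sum
    proof (intro arg_cong[where f="(*) (\<psi> i)"] sum.cong refl)
      fix x assume "x \<in> ?I"
      then have "ker R x j = cnj (ker R j x)" using hR that unfolding herk_def by blast
      then show "cnj (\<psi> x) * ker R x j = cnj (ker R j x * \<psi> x)" by (simp only: complex_cnj_mult mult.commute)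
    qed
    finally show ?thesis by (simp add: w_def app_def)
  qed
  have XX: "mat_adjoint (rank1 n \<psi> * R) * (rank1 n \<psi> * R) = rank1 n w"
  proof (rule eq_matI)
    fix i j assume "i < dim_row (rank1 n w)" "j < dim_col (rank1 n w)"
    then have ij: "i < n" "j < n" by (auto simp: rank1_def)
    have c: "rank1 n \<psi> * R \<in> carrier_mat n n" using Pc R by simp
    have "(mat_adjoint (rank1 n \<psi> * R) * (rank1 n \<psi> * R)) $$ (i,j)
      = (\<Sum>x<n. cnj ((rank1 n \<psi> * R) $$ (x,i)) * (rank1 n \<psi> * R) $$ (x,j))"
      unfolding mult_ker[OF adj_carrier[OF c] c ij] ker_def using ij c
      by (intro sum.cong refl arg_cong2[where f="(*)"] adj_index) auto
    also have "\<dots> = (\<Sum>x<n. w i * cnj (w j) * (cnj (\<psi> x) * \<psi> x))"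
      using ij by (intro sum.cong refl) (simp add: X mult_ac del: index_mult_mat(1))
    also have "\<dots> = w i * cnj (w j) * of_real (\<Sum>i<n. (cmod (\<psi> i))\<^sup>2)"
      by (simp add: sum_distrib_left mult_cnj_eq)
    finally show "(mat_adjoint (rank1 n \<psi> * R) * (rank1 n \<psi> * R)) $$ (i,j) = rank1 n w $$ (i,j)"
      using ij \<psi> by (simp add: rank1_def)
  qed (use R Pc in \<open>auto simp: rank1_def\<close>)
  define N where "N = sqrt (\<Sum>i<n. (cmod (w i))\<^sup>2)"
  have "mtrace (mat n n (\<lambda>(i,j). of_real (1 / N) * (w i * cnj (w j)))) = of_real (1 / N) * (\<Sum>i<n. w i * cnj (w i))"
    unfolding mtrace_def sum_distrib_left by simp
  also have "\<dots> = of_real (1 / N * (N * N))"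
  proof -
    have NNr: "N * N = (\<Sum>i<n. (cmod (w i))\<^sup>2)" unfolding N_def by (simp add: sum_nonneg)
    show ?thesis unfolding of_real_mult[of "1 / N"] NNr of_real_sum mult_cnj_eq ..
  qed
  also have "1 / N * (N * N) = N" by simp
  finally have tr: "fidelity (rank1 n \<psi>) \<sigma> = N"
    unfolding fidelity_def trace_norm_def P R_def[symmetric] XX msqrt_rank1[OF N_def] by simp
  have "complex_of_real (\<Sum>i<n. (cmod (w i))\<^sup>2) = ip ?I (app ?I (ker R) \<psi>) (app ?I (ker R) \<psi>)"
    unfolding w_def ip_self ..
  also have "\<dots> = ip ?I \<psi> (app ?I (ker R) (app ?I (ker R) \<psi>))" by (simp only: herk_ip[OF hR, symmetric])
  also have "\<dots> = ip ?I \<psi> (app ?I (ker \<sigma>) \<psi>)"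
  proof (rule ip_cong[OF refl])
    fix x assume x: "x \<in> ?I"
    have "app ?I (ker R) (app ?I (ker R) \<psi>) x = (\<Sum>y<n. (\<Sum>z<n. ker R x z * ker R z y) * \<psi> y)"
      unfolding app_def sum_distrib_left sum_distrib_right by (subst sum.swap) (simp add: mult.assoc)
    also have "\<dots> = (\<Sum>y<n. ker \<sigma> x y * \<psi> y)"
      using x mult_ker[OF R(1,1)] R(3) by (intro sum.cong refl) (simp add: ker_def)
    finally show "app ?I (ker R) (app ?I (ker R) \<psi>) x = app ?I (ker \<sigma>) \<psi> x" by (simp add: app_def)
  qed
  finally have "(\<Sum>i<n. (cmod (w i))\<^sup>2) = Re (ip ?I \<psi> (app ?I (ker \<sigma>) \<psi>))" by (metis Re_complex_of_real)
  with tr show ?thesis by (simp add: N_def)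
qed

text \<open>The order of a root counts its occurrences in the list, which turns the weighting by
  multiplicity in \<open>vn_entropy\<close> into a plain sum over the list.\<close>

lemma sum_order_linear_factors:
  fixes f :: "complex \<Rightarrow> real"
  assumes "finite X" "set as \<subseteq> X"
  shows "(\<Sum>e\<in>X. real (order e (\<Prod>a\<leftarrow>as. [:- a, 1:])) * f e) = sum_list (map f as)"
  using assms(2)
proof (induction as)
  case Nil
  then show ?case by simp
next
  case (Cons a as)
  let ?q = "\<Prod>a\<leftarrow>as. [:- a, 1:]"
  have nz: "[:- a, 1:] * ?q \<noteq> 0" 
  proof -
    have "?q \<noteq> 0" by (auto simp: prod_list_zero_iff)
    then show ?thesis by (simp del: mult_pCons_left)
  qed
  have "order e ([:- a, 1:] * ?q) = (if e = a then 1 else 0) + order e ?q" for e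
    unfolding order_mult[OF nz] by (auto simp: order_linear')
  then have "(\<Sum>e\<in>X. real (order e (\<Prod>a\<leftarrow>a # as. [:- a, 1:])) * f e)
    = (\<Sum>e\<in>X. (if e = a then 1 else 0) * f e) + (\<Sum>e\<in>X. real (order e ?q) * f e)"
    unfolding sum.distrib[symmetric] by (intro sum.cong refl) (simp add: distrib_right del: mult_pCons_left)
  then show ?case using Cons assms(1) by (simp add: sum_delta_mult)
qed

text \<open>The eigenvectors are the columns of a unitary \<open>V\<close>, so \<open>A\<close> is
  similar to the diagonal matrix of the \<open>l k\<close>, and its characteristic polynomial has
  them as roots with multiplicity. The entropy becomes the Shannon expression in
  \<open>l\<close>.\<close>

lemma state_spectral:
  assumes A: "A \<in> carrier_mat n n" "psd A"
  obtains v l where "ons {..<n} v" "\<And>x y. x < n \<Longrightarrow> y < n \<Longrightarrow> A $$ (x,y) = spec {..<n} v l x y"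
    "\<And>k. k < n \<Longrightarrow> 0 \<le> l k" "mtrace A = of_real (\<Sum>k<n. l k)"
    "vn_entropy A = - (\<Sum>k<n. l k * log 2 (l k))"
proof -
  let ?I = "{..<n}"
  have "psdk ?I (ker A)" using A psd_iff by simp
  from psdk_spectral[OF finite_lessThan this] obtain v l where v: "ons ?I v"
    and e: "\<And>x y. x \<in> ?I \<Longrightarrow> y \<in> ?I \<Longrightarrow> ker A x y = spec ?I v l x y" and l: "\<And>k. k < card ?I \<Longrightarrow> 0 \<le> l k" by metis
  have tr: "mtrace A = of_real (\<Sum>k<n. l k)"
  proof -
    have "mtrace A = (\<Sum>x\<in>?I. spec ?I v l x x)"
      unfolding mtrace_def using A e by (intro sum.cong) (auto simp: ker_def)
    then show ?thesis using spec_trace[OF finite_lessThan v] by simp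
  qed
  define V where "V = mat n n (\<lambda>(i,k). v k i)"
  define Vd where "Vd = mat n n (\<lambda>(k,i). cnj (v k i))"
  define D where "D = mat n n (\<lambda>(i,j). if i = j then complex_of_real (l i) else 0)"
  have car: "V \<in> carrier_mat n n" "Vd \<in> carrier_mat n n" "D \<in> carrier_mat n n" by (simp_all add: V_def Vd_def D_def)
  have VVd: "V * Vd = 1\<^sub>m n"
  proof (rule eq_matI)
    fix i j assume "i < dim_row (1\<^sub>m n)" "j < dim_col (1\<^sub>m n)"
    then have ij: "i < n" "j < n" by auto
    have "(V * Vd) $$ (i,j) = (\<Sum>x<n. v x i * cnj (v x j))"
      unfolding index_mult_sum[OF car(1,2) ij] using ij by (intro sum.cong refl) (simp add: V_def Vd_def)
    then show "(V * Vd) $$ (i,j) = 1\<^sub>m n $$ (i,j)" using onsD(2)[OF v, of i j] ij by simp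
  qed (use car in auto)
  have VdV: "Vd * V = 1\<^sub>m n"
  proof (rule eq_matI)
    fix i j assume "i < dim_row (1\<^sub>m n)" "j < dim_col (1\<^sub>m n)"
    then have ij: "i < n" "j < n" by auto
    have "(Vd * V) $$ (i,j) = ip ?I (v i) (v j)"
      unfolding index_mult_sum[OF car(2,1) ij] ip_def using ij by (intro sum.cong refl) (simp add: V_def Vd_def)
    then show "(Vd * V) $$ (i,j) = 1\<^sub>m n $$ (i,j)" using onsD(1)[OF v, of i j] ij by simp
  qed (use car in auto)
  have "A = V * D * Vd"
  proof (rule eq_matI)
    fix i j assume "i < dim_row (V * D * Vd)" "j < dim_col (V * D * Vd)"
    then have ij: "i < n" "j < n" using car by auto
    have VD: "(V * D) $$ (i,x) = of_real (l x) * v x i" if "x < n" for x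
    proof -
      have "(V * D) $$ (i,x) = (\<Sum>y<n. if y = x then v y i * of_real (l y) else 0)"
        unfolding index_mult_sum[OF car(1,3) ij(1) that] using ij that by (intro sum.cong refl) (simp add: V_def D_def)
      then show ?thesis using that by simp
    qed
    have "(V * D * Vd) $$ (i,j) = (\<Sum>x<n. of_real (l x) * v x i * cnj (v x j))"
      unfolding index_mult_sum[OF mult_carrier_mat[OF car(1,3)] car(2) ij] using ij
      by (intro sum.cong refl) (simp add: VD Vd_def del: index_mult_mat(1))
    then show "A $$ (i,j) = (V * D * Vd) $$ (i,j)" using e[of i j] ij by (simp add: ker_def spec_def)
  qed (use A car in auto)
  then have "similar_mat A D"
    unfolding similar_mat_def using similar_mat_witI[OF VVd VdV _ A(1) car(3,1,2)] by blast
  then have "char_poly A = char_poly D" by (rule char_poly_similar)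
  also have "\<dots> = (\<Prod>a\<leftarrow>diag_mat D. [:- a, 1:])"
    by (rule char_poly_upper_triangular[OF car(3)]) (auto simp: upper_triangular_def D_def)
  also have "diag_mat D = map (\<lambda>k. complex_of_real (l k)) [0..<n]"
    by (simp add: diag_mat_def D_def)
  finally have cp: "char_poly A = (\<Prod>a\<leftarrow>map (\<lambda>k. complex_of_real (l k)) [0..<n]. [:- a, 1:])" (is "_ = (\<Prod>a\<leftarrow>?as. _)") .
  have roots: "{e. poly (char_poly A) e = 0} = set ?as"
    unfolding cp by (auto simp: poly_prod_list prod_list_zero_iff)
  have "vn_entropy A = - sum_list (map (\<lambda>e. Re e * log 2 (Re e)) ?as)"
    unfolding vn_entropy_def roots unfolding cp by (subst sum_order_linear_factors) auto
  also have "\<dots> = - (\<Sum>k<n. l k * log 2 (l k))"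
    by (simp add: o_def interv_sum_list_conv_sum_set_nat atLeast0LessThan)
  finally have "vn_entropy A = - (\<Sum>k<n. l k * log 2 (l k))" .
  moreover have "A $$ (x,y) = spec ?I v l x y" if "x < n" "y < n" for x y
    using e that by (simp add: ker_def)
  ultimately show thesis using v l tr by (intro that) auto
qed

section \<open>Evaluating LOCC protocols on pure targets\<close>

definition qform :: "nat \<Rightarrow> (nat \<Rightarrow> nat) \<Rightarrow> complex mat \<Rightarrow> ((nat \<Rightarrow> nat) \<Rightarrow> complex) \<Rightarrow> complex" where
  "qform m d \<rho> v = (\<Sum>x\<in>tuples m d. \<Sum>y\<in>tuples m d. cnj (v x) * \<rho> $$ (enc m d x, enc m d y) * v y)"

definition lop :: "(nat \<Rightarrow> nat) \<Rightarrow> nat \<Rightarrow> complex mat \<Rightarrow> ((nat \<Rightarrow> nat) \<Rightarrow> complex) \<Rightarrow> (nat \<Rightarrow> nat) \<Rightarrow> complex" where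
  "lop d i E \<phi> = (\<lambda>y. \<Sum>s<d i. E $$ (y i, s) * \<phi> (y(i := s)))"

text \<open>\<open>locc_value m dI dO \<psi> A\<close>: some LOCC channel with Kraus operators \<open>K\<^sub>\<omega>\<close> has
  \<open>A \<phi> = (\<Sum>\<omega>. |\<langle>\<psi>|K\<^sub>\<omega> \<phi>\<rangle>|\<^sup>2)\<close>; here \<open>v \<omega>\<close> is \<open>K\<^sub>\<omega>\<^sup>* \<psi>\<close>.\<close>

definition locc_value :: "nat \<Rightarrow> (nat \<Rightarrow> nat) \<Rightarrow> (nat \<Rightarrow> nat) \<Rightarrow> ((nat \<Rightarrow> nat) \<Rightarrow> complex) \<Rightarrow>
    (((nat \<Rightarrow> nat) \<Rightarrow> complex) \<Rightarrow> real) \<Rightarrow> bool" where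
  "locc_value m dI dO \<psi> A \<longleftrightarrow> (\<exists>\<Lambda> N v. locc m dI dO \<Lambda> \<and>
     (\<forall>\<rho>\<in>carrier_mat (tdim m dI) (tdim m dI). \<Lambda> \<rho> \<in> carrier_mat (tdim m dO) (tdim m dO) \<and>
        (psd \<rho> \<longrightarrow> psd (\<Lambda> \<rho>)) \<and> qform m dO (\<Lambda> \<rho>) \<psi> = (\<Sum>\<omega><N. qform m dI \<rho> (v \<omega>))) \<and>
     (\<forall>\<phi>. A \<phi> = (\<Sum>\<omega><(N::nat). (cmod (ip (tuples m dI) (v \<omega>) \<phi>))\<^sup>2)))"

lemma sandwich_index:
  assumes "L \<in> carrier_mat k n" "\<rho> \<in> carrier_mat n n" "i < k" "j < k"
  shows "(L * \<rho> * mat_adjoint L) $$ (i,j) = (\<Sum>a<n. \<Sum>b<n. L $$ (i,a) * \<rho> $$ (a,b) * cnj (L $$ (j,b)))"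
proof -
  have L\<rho>: "L * \<rho> \<in> carrier_mat k n" using assms by simp
  have "(L * \<rho> * mat_adjoint L) $$ (i,j) = (\<Sum>b<n. (L * \<rho>) $$ (i,b) * mat_adjoint L $$ (b,j))"
    by (rule index_mult_sum[OF L\<rho> adj_carrier[OF assms(1)] assms(3,4)])
  also have "\<dots> = (\<Sum>b<n. (\<Sum>a<n. L $$ (i,a) * \<rho> $$ (a,b)) * cnj (L $$ (j,b)))"
    using assms by (intro sum.cong refl arg_cong2[where f="(*)"] index_mult_sum[OF assms(1,2)] adj_index) auto
  also have "\<dots> = (\<Sum>a<n. \<Sum>b<n. L $$ (i,a) * \<rho> $$ (a,b) * cnj (L $$ (j,b)))"
    unfolding sum_distrib_right by (rule sum.swap)
  finally show ?thesis .
qed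

lemma psd_sandwich:
  assumes L: "L \<in> carrier_mat k n" and \<rho>: "\<rho> \<in> carrier_mat n n" "psd \<rho>"
  shows "psd (L * \<rho> * mat_adjoint L)"
proof -
  have "psdk {..<n} (ker \<rho>)" using \<rho> psd_iff by blast
  from psdk_spectral[OF finite_lessThan this] obtain v l where v: "ons {..<n} v"
    and e: "\<And>x y. x \<in> {..<n} \<Longrightarrow> y \<in> {..<n} \<Longrightarrow> ker \<rho> x y = spec {..<n} v l x y"
    and l: "\<And>k. k < card {..<n} \<Longrightarrow> 0 \<le> l k" by blast
  \<comment> \<open>Column \<open>z\<close> is the image under \<open>L\<close> of eigenvector
    \<open>z\<close>, scaled by the root of its eigenvalue; the product is the Gram kernel of these
    columns.\<close>
  define M where "M i z = (\<Sum>a<n. L $$ (i,a) * (of_real (sqrt (l z)) * v z a))" for i z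
  have "ker (L * \<rho> * mat_adjoint L) i j = (\<Sum>z<n. M i z * cnj (M j z))" if "i < k" "j < k" for i j
  proof -
    have "(\<Sum>z<n. M i z * cnj (M j z)) = (\<Sum>z<n. \<Sum>a<n. \<Sum>b<n. L $$ (i,a) * (of_real (l z) * v z a * cnj (v z b)) * cnj (L $$ (j,b)))"
    proof (intro sum.cong refl)
      fix z assume z: "z \<in> {..<n}"
      have s: "complex_of_real (sqrt (l z)) * of_real (sqrt (l z)) = of_real (l z)"
        unfolding of_real_mult[symmetric] using l[of z] z by simp
      show "M i z * cnj (M j z) = (\<Sum>a<n. \<Sum>b<n. L $$ (i,a) * (of_real (l z) * v z a * cnj (v z b)) * cnj (L $$ (j,b)))"
        unfolding M_def cnj_sum sum_product s[symmetric] by (simp add: mult_ac)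
    qed
    also have "\<dots> = (\<Sum>a<n. \<Sum>z<n. \<Sum>b<n. L $$ (i,a) * (of_real (l z) * v z a * cnj (v z b)) * cnj (L $$ (j,b)))"
      by (rule sum.swap)
    also have "\<dots> = (\<Sum>a<n. \<Sum>b<n. \<Sum>z<n. L $$ (i,a) * (of_real (l z) * v z a * cnj (v z b)) * cnj (L $$ (j,b)))"
      by (intro sum.cong refl sum.swap)
    also have "\<dots> = (\<Sum>a<n. \<Sum>b<n. L $$ (i,a) * \<rho> $$ (a,b) * cnj (L $$ (j,b)))"
      using e by (intro sum.cong refl) (simp add: sum_distrib_left[symmetric] sum_distrib_right[symmetric] ker_def spec_def)
    finally show ?thesis unfolding ker_def sandwich_index[OF L \<rho>(1) that] by (rule sym)
  qed
  then have "psdk {..<k} (ker (L * \<rho> * mat_adjoint L))"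
    by (subst psdk_cong[where B="\<lambda>i j. \<Sum>z<n. M i z * cnj (M j z)"]) (auto intro: psdk_gram)
  moreover have "L * \<rho> * mat_adjoint L \<in> carrier_mat k k" using L \<rho> by (intro mult_carrier_mat adj_carrier) auto
  ultimately show ?thesis using psd_iff by blast
qed

lemma psd_add:
  assumes "A \<in> carrier_mat n n" "B \<in> carrier_mat n n" "psd A" "psd B"
  shows "psd (A + B)"
proof -
  have A: "psdk {..<n} (ker A)" and B: "psdk {..<n} (ker B)" using assms psd_iff by blast+
  have k: "ker (A + B) i j = ker A i j + ker B i j" if "i < n" "j < n" for i j
    using that assms by (simp add: ker_def)
  have "herk {..<n} (\<lambda>i j. ker A i j + ker B i j)"
    using A B unfolding psdk_def herk_def by (metis complex_cnj_add)
  moreover have "ip {..<n} u (app {..<n} (\<lambda>i j. ker A i j + ker B i j) u)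
     = ip {..<n} u (app {..<n} (ker A) u) + ip {..<n} u (app {..<n} (ker B) u)" for u
    unfolding app_def ip_linear(1)[symmetric] by (simp add: distrib_right sum.distrib)
  ultimately have "psdk {..<n} (\<lambda>i j. ker A i j + ker B i j)"
    using A B unfolding psdk_def by simp
  then have "psdk {..<n} (ker (A + B))"
    by (subst psdk_cong[where B="\<lambda>i j. ker A i j + ker B i j"]) (auto simp: k)
  then show ?thesis using psd_iff[of "A + B" n] assms by simp
qed

lemma psd_zero: "psd (0\<^sub>m n n)"
proof -
  have "psdk {..<n} (\<lambda>i j. 0)" using psdk_gram[of "{..<n}" "\<lambda>_ _. 0" "{}"] by simp
  then have "psdk {..<n} (ker (0\<^sub>m n n))"
    by (subst psdk_cong[where B="\<lambda>i j. 0"]) (auto simp: ker_def)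
  then show ?thesis using psd_iff[of "0\<^sub>m n n" n] by simp
qed

lemma msum_carrier: "(\<And>x. x < N \<Longrightarrow> F x \<in> carrier_mat n n) \<Longrightarrow> msum n n F N \<in> carrier_mat n n"
  by (induction N) auto

lemma msum_psd:
  assumes "\<And>x. x < N \<Longrightarrow> F x \<in> carrier_mat n n" "\<And>x. x < N \<Longrightarrow> psd (F x)"
  shows "psd (msum n n F N)"
  using assms
proof (induction N)
  case (Suc N)
  have "psd (msum n n F N + F N)"
    by (rule psd_add[of _ n]) (use Suc in \<open>auto intro: msum_carrier\<close>)
  then show ?case by simp
qed (simp add: psd_zero)

lemma msum_index:
  assumes "\<And>x. x < N \<Longrightarrow> F x \<in> carrier_mat n n" "i < n" "j < n"
  shows "msum n n F N $$ (i,j) = (\<Sum>x<N. F x $$ (i,j))"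
  using assms(1)
proof (induction N)
  case (Suc N)
  have F: "F N \<in> carrier_mat n n" using Suc.prems by simp
  have "(msum n n F N + F N) $$ (i,j) = msum n n F N $$ (i,j) + F N $$ (i,j)"
    using F assms(2,3) by (intro index_add_mat(1)) auto
  then show ?case using Suc by simp
qed (use assms in simp)

lemma local_op_index:
  assumes "x \<in> tuples m dO" "y \<in> tuples m dI"
  shows "local_op m dI dO i E $$ (enc m dO x, enc m dI y)
    = (if \<forall>j<m. j \<noteq> i \<longrightarrow> x j = y j then E $$ (x i, y i) else 0)"
  unfolding local_op_def using enc_lt[OF assms(1)] enc_lt[OF assms(2)]
  by (simp add: dec_enc assms Let_def) auto

text \<open>Only the tuples that agree with \<open>x\<close> off party \<open>i\<close> survive, one
  for each \<open>s < dI i\<close>.\<close>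

lemma local_op_sum:
  assumes "i < m" "\<forall>j<m. j \<noteq> i \<longrightarrow> dN j = dI j" and x: "x \<in> tuples m dN"
  shows "(\<Sum>y\<in>tuples m dI. local_op m dI dN i E $$ (enc m dN x, enc m dI y) * \<phi> y) = lop dI i E \<phi> x"
proof -
  let ?T = "(\<lambda>s. x(i := s)) ` {..<dI i}"
  have upd: "x(i := s) \<in> tuples m dI" if "s < dI i" for s
    unfolding tuples_def
  proof (intro CollectI conjI allI impI)
    fix j assume "j < m"
    then show "(x(i := s)) j < dI j"
      using that tuplesD(1)[OF x, of j] assms(2) by (cases "j = i") auto
  next
    fix j assume "m \<le> j"
    then show "(x(i := s)) j = 0" using assms(1) tuplesD(2)[OF x, of j] by simp
  qed
  then have sub: "?T \<subseteq> tuples m dI" by blast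
  have "(\<Sum>y\<in>tuples m dI. local_op m dI dN i E $$ (enc m dN x, enc m dI y) * \<phi> y)
     = (\<Sum>y\<in>?T. local_op m dI dN i E $$ (enc m dN x, enc m dI y) * \<phi> y)"
  proof (rule sum.mono_neutral_right[OF finite_tuples sub], safe)
    fix y assume y: "y \<in> tuples m dI" and n: "y \<notin> ?T"
    have "\<not> (\<forall>j<m. j \<noteq> i \<longrightarrow> x j = y j)"
    proof
      assume "\<forall>j<m. j \<noteq> i \<longrightarrow> x j = y j"
      then have "y = x(i := y i)" using x y assms(1) unfolding tuples_def fun_eq_iff
        by (auto simp: not_less) (metis leI)
      then show False using n tuplesD(1)[OF y assms(1)] by blast
    qed
    then have "local_op m dI dN i E $$ (enc m dN x, enc m dI y) = 0"
      unfolding local_op_index[OF x y] by (rule if_not_P)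
    then show "local_op m dI dN i E $$ (enc m dN x, enc m dI y) * \<phi> y = 0" by simp
  qed
  also have "\<dots> = (\<Sum>s<dI i. local_op m dI dN i E $$ (enc m dN x, enc m dI (x(i := s))) * \<phi> (x(i := s)))"
    by (subst sum.reindex) (auto simp: inj_on_def fun_eq_iff)
  also have "\<dots> = lop dI i E \<phi> x"
    unfolding lop_def
  proof (intro sum.cong refl)
    fix s assume "s \<in> {..<dI i}"
    then have "x(i := s) \<in> tuples m dI" using sub by auto
    then show "local_op m dI dN i E $$ (enc m dN x, enc m dI (x(i := s))) * \<phi> (x(i := s)) = E $$ (x i, s) * \<phi> (x(i := s))"
      unfolding local_op_index[OF x \<open>x(i := s) \<in> tuples m dI\<close>] by simp
  qed
  finally show ?thesis .
qed

lemma locc_value_id: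
  assumes "\<forall>i<m. dI i = dO i"
  shows "locc_value m dI dO \<psi> (\<lambda>\<phi>. (cmod (ip (tuples m dI) \<psi> \<phi>))\<^sup>2)"
proof -
  have t: "tuples m dI = tuples m dO" using assms by (intro tuples_cong) auto
  have td: "tdim m dI = tdim m dO" using assms unfolding tdim_def by (intro prod.cong) auto
  have "enc m dI x = enc m dO x" for x using assms by (intro enc_cong) auto
  then have q: "qform m dI \<rho> v = qform m dO \<rho> v" for \<rho> v unfolding qform_def t by simp
  show ?thesis unfolding locc_value_def
    using locc.locc_id[OF assms]
    by (intro exI[of _ "\<lambda>\<rho>. \<rho>"] exI[of _ "1::nat"] exI[of _ "\<lambda>_. \<psi>"]) (simp add: td q)
qed

text \<open>The Heisenberg picture of one Kraus operator: instead of acting on the state it is moved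
  onto the test vector, \<open>w\<close> being the adjoint of \<open>L\<close> applied to
  \<open>v\<close>. In this way protocols are evaluated backwards from the target.\<close>

lemma qform_local_op:
  fixes E :: "complex mat" and v \<phi> :: "(nat \<Rightarrow> nat) \<Rightarrow> complex"
  assumes "i < m" "\<forall>j<m. j \<noteq> i \<longrightarrow> dN j = dI j" and \<rho>: "\<rho> \<in> carrier_mat (tdim m dI) (tdim m dI)"
  defines "L \<equiv> local_op m dI dN i E"
  defines "w \<equiv> (\<lambda>y. \<Sum>x\<in>tuples m dN. cnj (L $$ (enc m dN x, enc m dI y)) * v x)"
  shows "qform m dN (L * \<rho> * mat_adjoint L) v = qform m dI \<rho> w"
    and "ip (tuples m dI) w \<phi> = ip (tuples m dN) v (lop dI i E \<phi>)"
proof -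
  have L: "L \<in> carrier_mat (tdim m dN) (tdim m dI)" by (simp add: L_def local_op_def)
  let ?TN = "tuples m dN" and ?TI = "tuples m dI"
  let ?l = "\<lambda>x a. L $$ (enc m dN x, enc m dI a)" and ?r = "\<lambda>a b. \<rho> $$ (enc m dI a, enc m dI b)"
  have "qform m dN (L * \<rho> * mat_adjoint L) v = (\<Sum>x\<in>?TN. \<Sum>y\<in>?TN. \<Sum>a\<in>?TI. \<Sum>b\<in>?TI.
      cnj (v x) * ?l x a * ?r a b * (cnj (?l y b) * v y))"
    unfolding qform_def
  proof (intro sum.cong refl)
    fix x y assume xy: "x \<in> ?TN" "y \<in> ?TN"
    show "cnj (v x) * (L * \<rho> * mat_adjoint L) $$ (enc m dN x, enc m dN y) * v y =
      (\<Sum>a\<in>?TI. \<Sum>b\<in>?TI. cnj (v x) * ?l x a * ?r a b * (cnj (?l y b) * v y))"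
      unfolding sandwich_index[OF L \<rho> enc_lt[OF xy(1)] enc_lt[OF xy(2)]] sum_enc sum_distrib_left sum_distrib_right
      by (simp add: mult_ac)
  qed
  also have "\<dots> = (\<Sum>x\<in>?TN. \<Sum>a\<in>?TI. \<Sum>y\<in>?TN. \<Sum>b\<in>?TI. cnj (v x) * ?l x a * ?r a b * (cnj (?l y b) * v y))"
    by (intro sum.cong refl sum.swap)
  also have "\<dots> = (\<Sum>a\<in>?TI. \<Sum>x\<in>?TN. \<Sum>y\<in>?TN. \<Sum>b\<in>?TI. cnj (v x) * ?l x a * ?r a b * (cnj (?l y b) * v y))"
    by (rule sum.swap)
  also have "\<dots> = (\<Sum>a\<in>?TI. \<Sum>x\<in>?TN. \<Sum>b\<in>?TI. \<Sum>y\<in>?TN. cnj (v x) * ?l x a * ?r a b * (cnj (?l y b) * v y))"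
    by (intro sum.cong refl sum.swap)
  also have "\<dots> = (\<Sum>a\<in>?TI. \<Sum>b\<in>?TI. \<Sum>x\<in>?TN. \<Sum>y\<in>?TN. cnj (v x) * ?l x a * ?r a b * (cnj (?l y b) * v y))"
    by (intro sum.cong refl sum.swap)
  also have "\<dots> = qform m dI \<rho> w"
    unfolding qform_def
  proof (intro sum.cong refl)
    fix a b
    have "cnj (w a) * ?r a b * w b = (\<Sum>x\<in>?TN. cnj (v x) * ?l x a) * ?r a b * (\<Sum>y\<in>?TN. cnj (?l y b) * v y)"
      unfolding w_def cnj_sum by (simp add: mult.commute)
    then show "(\<Sum>x\<in>?TN. \<Sum>y\<in>?TN. cnj (v x) * ?l x a * ?r a b * (cnj (?l y b) * v y)) = cnj (w a) * ?r a b * w b"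
      by (simp add: sum_distrib_left sum_distrib_right mult_ac)
  qed
  finally show "qform m dN (L * \<rho> * mat_adjoint L) v = qform m dI \<rho> w" .
  have "ip ?TI w \<phi> = (\<Sum>y\<in>?TI. \<Sum>x\<in>?TN. cnj (v x) * (?l x y * \<phi> y))"
    unfolding ip_def w_def cnj_sum sum_distrib_right by (simp add: mult_ac)
  also have "\<dots> = (\<Sum>x\<in>?TN. cnj (v x) * (\<Sum>y\<in>?TI. ?l x y * \<phi> y))"
    unfolding sum_distrib_left by (rule sum.swap)
  also have "\<dots> = ip ?TN v (lop dI i E \<phi>)"
    unfolding ip_def L_def using local_op_sum[OF assms(1,2)] by (intro sum.cong refl) simp
  finally show "ip ?TI w \<phi> = ip ?TN v (lop dI i E \<phi>)" .
qed

text \<open>\<open>from_nat_into'\<close> is an arbitrary function here, constrained only to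
  enumerate the dependent pairs of an outcome and an inner index.\<close>

lemma sum_blocks: "(\<Sum>x<(N :: nat). \<Sum>\<omega><(n x :: nat). g x \<omega>) = (\<Sum>p<card (SIGMA x:{..<N}. {..<n x}). g (fst (from_nat_into' N n p)) (snd (from_nat_into' N n p)))"
  if "bij_betw (from_nat_into' N n) {..<card (SIGMA x:{..<N}. {..<n x})} (SIGMA x:{..<N}. {..<n x})" for from_nat_into'
proof -
  have "(\<Sum>x<N. \<Sum>\<omega><n x. g x \<omega>) = (\<Sum>p\<in>(SIGMA x:{..<N}. {..<n x}). g (fst p) (snd p))"
    by (subst sum.Sigma) (auto simp: case_prod_unfold)
  also have "\<dots> = (\<Sum>p<card (SIGMA x:{..<N}. {..<n x}). g (fst (from_nat_into' N n p)) (snd (from_nat_into' N n p)))"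
    by (rule sum.reindex_bij_betw[OF that, symmetric])
  finally show ?thesis .
qed

text \<open>The Kraus operators of the composed protocol are indexed by the outcome \<open>x\<close>
  together with an inner index of the protocol that follows \<open>x\<close>. The inner range
  depends on \<open>x\<close>, so the pairs are enumerated to fit the form
  \<open>\<omega> < N\<close> of \<open>locc_value\<close>.\<close>

lemma locc_value_step:
  assumes i: "i < m" and dN: "\<forall>j<m. j \<noteq> i \<longrightarrow> dN j = dI j" "dN i \<ge> 1"
    and E: "\<forall>x<N. E x \<in> carrier_mat (dN i) (dI i)"
    and comp: "msum (dI i) (dI i) (\<lambda>x. mat_adjoint (E x) * E x) N = 1\<^sub>m (dI i)"
    and IH: "\<And>x. x < N \<Longrightarrow> locc_value m dN dO \<psi> (A x)"
  shows "locc_value m dI dO \<psi> (\<lambda>\<phi>. \<Sum>x<N. A x (lop dI i (E x) \<phi>))"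
proof -
  let ?C = "\<lambda>d. carrier_mat (tdim m d) (tdim m d)"
  have "\<forall>x. \<exists>\<Lambda> n v. x < N \<longrightarrow> locc m dN dO \<Lambda> \<and>
     (\<forall>\<rho>\<in>?C dN. \<Lambda> \<rho> \<in> ?C dO \<and> (psd \<rho> \<longrightarrow> psd (\<Lambda> \<rho>)) \<and> qform m dO (\<Lambda> \<rho>) \<psi> = (\<Sum>\<omega><n. qform m dN \<rho> (v \<omega>))) \<and>
     (\<forall>\<phi>. A x \<phi> = (\<Sum>\<omega><(n::nat). (cmod (ip (tuples m dN) (v \<omega>) \<phi>))\<^sup>2))"
    using IH unfolding locc_value_def by blast
  then obtain \<Lambda> n v where S: "\<And>x. x < N \<Longrightarrow> locc m dN dO (\<Lambda> x) \<and>
     (\<forall>\<rho>\<in>?C dN. \<Lambda> x \<rho> \<in> ?C dO \<and> (psd \<rho> \<longrightarrow> psd (\<Lambda> x \<rho>)) \<and> qform m dO (\<Lambda> x \<rho>) \<psi> = (\<Sum>\<omega><n x. qform m dN \<rho> (v x \<omega>))) \<and>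
     (\<forall>\<phi>. A x \<phi> = (\<Sum>\<omega><(n x::nat). (cmod (ip (tuples m dN) (v x \<omega>) \<phi>))\<^sup>2))"
    by metis
  define L where "L x = local_op m dI dN i (E x)" for x
  define \<Lambda>' where "\<Lambda>' \<rho> = msum (tdim m dO) (tdim m dO) (\<lambda>x. \<Lambda> x (L x * \<rho> * mat_adjoint (L x))) N" for \<rho>
  define w where "w x \<omega> = (\<lambda>y. \<Sum>z\<in>tuples m dN. cnj (L x $$ (enc m dN z, enc m dI y)) * v x \<omega> z)" for x \<omega>
  have L: "L x \<in> carrier_mat (tdim m dN) (tdim m dI)" for x by (simp add: L_def local_op_def)
  have locc: "locc m dI dO \<Lambda>'"
    unfolding \<Lambda>'_def L_def using S by (intro locc.locc_step[OF i dN E comp]) blast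
  have main: "\<Lambda>' \<rho> \<in> ?C dO \<and> (psd \<rho> \<longrightarrow> psd (\<Lambda>' \<rho>)) \<and>
      qform m dO (\<Lambda>' \<rho>) \<psi> = (\<Sum>x<N. \<Sum>\<omega><n x. qform m dI \<rho> (w x \<omega>))" if \<rho>: "\<rho> \<in> ?C dI" for \<rho>
  proof (intro conjI impI)
    have LL: "L x * \<rho> * mat_adjoint (L x) \<in> ?C dN" for x
      using L \<rho> by (intro mult_carrier_mat adj_carrier) auto
    have c: "\<Lambda> x (L x * \<rho> * mat_adjoint (L x)) \<in> ?C dO" if "x < N" for x using S[OF that] LL by blast
    show "\<Lambda>' \<rho> \<in> ?C dO" unfolding \<Lambda>'_def by (rule msum_carrier[OF c])
    show "psd (\<Lambda>' \<rho>)" if "psd \<rho>"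
      unfolding \<Lambda>'_def
    proof (rule msum_psd[OF c])
      fix x assume "x < N"
      then show "psd (\<Lambda> x (L x * \<rho> * mat_adjoint (L x)))"
        using S LL psd_sandwich[OF L \<rho> that] by blast
    qed
    have "qform m dO (\<Lambda>' \<rho>) \<psi> = (\<Sum>a\<in>tuples m dO. \<Sum>b\<in>tuples m dO. \<Sum>x<N.
       cnj (\<psi> a) * \<Lambda> x (L x * \<rho> * mat_adjoint (L x)) $$ (enc m dO a, enc m dO b) * \<psi> b)"
      unfolding qform_def \<Lambda>'_def by (intro sum.cong refl) (simp add: msum_index[OF c] enc_lt sum_distrib_left sum_distrib_right)
    also have "\<dots> = (\<Sum>a\<in>tuples m dO. \<Sum>x<N. \<Sum>b\<in>tuples m dO.
       cnj (\<psi> a) * \<Lambda> x (L x * \<rho> * mat_adjoint (L x)) $$ (enc m dO a, enc m dO b) * \<psi> b)"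
      by (intro sum.cong refl sum.swap)
    also have "\<dots> = (\<Sum>x<N. qform m dO (\<Lambda> x (L x * \<rho> * mat_adjoint (L x))) \<psi>)"
      unfolding qform_def by (rule sum.swap)
    also have "\<dots> = (\<Sum>x<N. \<Sum>\<omega><n x. qform m dN (L x * \<rho> * mat_adjoint (L x)) (v x \<omega>))"
      using S LL by (intro sum.cong refl) blast
    also have "\<dots> = (\<Sum>x<N. \<Sum>\<omega><n x. qform m dI \<rho> (w x \<omega>))"
      unfolding w_def L_def by (intro sum.cong refl qform_local_op(1)[OF i dN(1) \<rho>])
    finally show "qform m dO (\<Lambda>' \<rho>) \<psi> = (\<Sum>x<N. \<Sum>\<omega><n x. qform m dI \<rho> (w x \<omega>))" .
  qed
  have val: "(\<Sum>x<N. A x (lop dI i (E x) \<phi>)) = (\<Sum>x<N. \<Sum>\<omega><n x. (cmod (ip (tuples m dI) (w x \<omega>) \<phi>))\<^sup>2)" for \<phi>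
  proof (intro sum.cong refl)
    fix x assume x: "x \<in> {..<N}"
    have "ip (tuples m dI) (w x \<omega>) \<phi> = ip (tuples m dN) (v x \<omega>) (lop dI i (E x) \<phi>)" for \<omega>
      unfolding w_def L_def by (rule qform_local_op(2)[OF i dN(1) zero_carrier_mat])
    then show "A x (lop dI i (E x) \<phi>) = (\<Sum>\<omega><n x. (cmod (ip (tuples m dI) (w x \<omega>) \<phi>))\<^sup>2)"
      using S x by simp
  qed
  let ?S = "SIGMA x:{..<N}. {..<n x}"
  obtain h where h: "bij_betw h {..<card ?S} ?S"
    using ex_bij_betw_nat_finite[of ?S] by (auto simp: atLeast0LessThan)
  have flat: "(\<Sum>x<N. \<Sum>\<omega><n x. g x \<omega>) = (\<Sum>p<card ?S. g (fst (h p)) (snd (h p)))" for g :: "nat \<Rightarrow> nat \<Rightarrow> 'b :: comm_monoid_add"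
    using sum_blocks[of "\<lambda>_ _. h" N n g] h by simp
  show ?thesis
    unfolding locc_value_def
  proof (intro exI[of _ \<Lambda>'] exI[of _ "card ?S"] exI[of _ "\<lambda>p. w (fst (h p)) (snd (h p))"] conjI ballI allI)
    show "locc m dI dO \<Lambda>'" by (rule locc)
    fix \<rho> :: "complex mat" assume "\<rho> \<in> ?C dI"
    from main[OF this] show "\<Lambda>' \<rho> \<in> ?C dO" "psd \<rho> \<longrightarrow> psd (\<Lambda>' \<rho>)"
      "qform m dO (\<Lambda>' \<rho>) \<psi> = (\<Sum>p<card ?S. qform m dI \<rho> (w (fst (h p)) (snd (h p))))"
      unfolding flat by blast+
  next
    fix \<phi>
    show "(\<Sum>x<N. A x (lop dI i (E x) \<phi>)) = (\<Sum>p<card ?S. (cmod (ip (tuples m dI) (w (fst (h p)) (snd (h p))) \<phi>))\<^sup>2)"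
      unfolding val flat ..
  qed
qed

text \<open>Local dimensions, or indices, at the stage when the parties below \<open>t\<close> have
  acted and the others have not.\<close>

definition mix :: "nat \<Rightarrow> (nat \<Rightarrow> 'a) \<Rightarrow> (nat \<Rightarrow> 'a) \<Rightarrow> nat \<Rightarrow> 'a" where
  "mix t a b = (\<lambda>j. if j < t then a j else b j)"

definition pop :: "nat \<Rightarrow> (nat \<Rightarrow> nat) \<Rightarrow> (nat \<Rightarrow> nat \<Rightarrow> complex mat) \<Rightarrow> (nat \<Rightarrow> nat) \<Rightarrow> ((nat \<Rightarrow> nat) \<Rightarrow> complex) \<Rightarrow> (nat \<Rightarrow> nat) \<Rightarrow> complex" where
  "pop t d E x \<phi> = (\<lambda>y. \<Sum>a\<in>tuples t d. (\<Prod>j<t. E j (x j) $$ (y j, a j)) * \<phi> (mix t a y))"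

text \<open>In \<open>locc\<close> one party acts per round, so the local measurements are run one
  after another. The continuation \<open>A x\<close> may depend on the whole tuple of outcomes,
  since each of them is broadcast.\<close>

lemma locc_value_parallel:
  assumes "\<And>j. j < t \<Longrightarrow> dN j \<ge> 1"
    and "\<And>j x. j < t \<Longrightarrow> x < N j \<Longrightarrow> E j x \<in> carrier_mat (dN j) (dI j)"
    and "\<And>j. j < t \<Longrightarrow> msum (dI j) (dI j) (\<lambda>x. mat_adjoint (E j x) * E j x) (N j) = 1\<^sub>m (dI j)"
    and "\<And>x. x \<in> tuples t N \<Longrightarrow> locc_value m (mix t dN dE) dO \<psi> (A x)" and "t \<le> m"
  shows "locc_value m (mix t dI dE) dO \<psi> (\<lambda>\<phi>. \<Sum>x\<in>tuples t N. A x (pop t dI E x \<phi>))"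
  using assms
proof (induction t arbitrary: dE A)
  case 0
  have "pop 0 dI E x \<phi> = \<phi>" for x \<phi> by (simp add: pop_def tuples_0 mix_def)
  then show ?case using "0.prems"(4)[of "\<lambda>_. 0"] by (simp add: tuples_0 mix_def)
next
  case (Suc t)
  \<comment> \<open>Party \<open>t\<close> has not acted yet when the parties below \<open>t\<close>
    are done; for the induction hypothesis it counts with its input dimension.\<close>
  let ?dE = "dE(t := dI t)"
  have step: "locc_value m (mix t dN ?dE) dO \<psi> (\<lambda>\<phi>. \<Sum>s<N t. A (x(t := s)) (lop (mix t dN ?dE) t (E t s) \<phi>))"
    if x: "x \<in> tuples t N" for x
  proof (rule locc_value_step[where dN="mix (Suc t) dN dE"])
    show "t < m" using Suc.prems by simp
    show "\<forall>j<m. j \<noteq> t \<longrightarrow> mix (Suc t) dN dE j = mix t dN ?dE j" by (auto simp: mix_def)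
    show "mix (Suc t) dN dE t \<ge> 1" using Suc.prems(1)[of t] by (simp add: mix_def)
    show "\<forall>x<N t. E t x \<in> carrier_mat (mix (Suc t) dN dE t) (mix t dN ?dE t)"
      using Suc.prems(2)[of t] by (simp add: mix_def)
    show "msum (mix t dN ?dE t) (mix t dN ?dE t) (\<lambda>x. mat_adjoint (E t x) * E t x) (N t) = 1\<^sub>m (mix t dN ?dE t)"
      using Suc.prems(3)[of t] by (simp add: mix_def)
    fix s assume "s < N t"
    then have "x(t := s) \<in> tuples (Suc t) N" using x by (auto simp: tuples_def less_Suc_eq)
    then show "locc_value m (mix (Suc t) dN dE) dO \<psi> (A (x(t := s)))" by (rule Suc.prems(4))
  qed
  have "locc_value m (mix t dI ?dE) dO \<psi> (\<lambda>\<phi>. \<Sum>x\<in>tuples t N. \<Sum>s<N t. A (x(t := s)) (lop (mix t dN ?dE) t (E t s) (pop t dI E x \<phi>)))"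
    by (rule Suc.IH[OF _ _ _ step]) (use Suc.prems(1-3,5) in simp_all)
  moreover have "mix t dI ?dE = mix (Suc t) dI dE" by (auto simp: mix_def less_Suc_eq)
  moreover have "lop (mix t dN ?dE) t (E t s) (pop t dI E x \<phi>) = pop (Suc t) dI E (x(t := s)) \<phi>" for x s \<phi>
  proof
    fix y
    have "lop (mix t dN ?dE) t (E t s) (pop t dI E x \<phi>) y
      = (\<Sum>b<dI t. \<Sum>a\<in>tuples t dI. E t s $$ (y t, b) * ((\<Prod>j<t. E j (x j) $$ (y j, a j)) * \<phi> (mix t a (y(t := b)))))"
      unfolding lop_def pop_def by (simp add: mix_def sum_distrib_left)
    also have "\<dots> = (\<Sum>a\<in>tuples t dI. \<Sum>b<dI t. E t s $$ (y t, b) * ((\<Prod>j<t. E j (x j) $$ (y j, a j)) * \<phi> (mix t a (y(t := b)))))"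
      by (rule sum.swap)
    also have "\<dots> = pop (Suc t) dI E (x(t := s)) \<phi> y"
      unfolding pop_def sum_tuples_Suc
    proof (intro sum.cong refl)
      fix a b
      have "mix t a (y(t := b)) = mix (Suc t) (a(t := b)) y" by (auto simp: mix_def)
      then show "E t s $$ (y t, b) * ((\<Prod>j<t. E j (x j) $$ (y j, a j)) * \<phi> (mix t a (y(t := b))))
        = (\<Prod>j<Suc t. E j ((x(t := s)) j) $$ (y j, (a(t := b)) j)) * \<phi> (mix (Suc t) (a(t := b)) y)"
        by (simp add: mult_ac)
    qed
    finally show "lop (mix t dN ?dE) t (E t s) (pop t dI E x \<phi>) y = pop (Suc t) dI E (x(t := s)) \<phi> y" .
  qed
  ultimately show ?case by (simp add: sum_tuples_Suc)
qed

text \<open>The vectors \<open>\<phi> e\<close> form an unnormalised ensemble for the state, that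
  is, a purification with environment label \<open>e\<close>. The expectation of the output in the
  target is linear in the state, so the values \<open>A (\<phi> e)\<close> add up.\<close>

lemma locc_value_fidelity:
  assumes lv: "locc_value m dI dO \<psi> A" and fin: "finite S"
    and \<rho>: "\<rho> \<in> carrier_mat (tdim m dI) (tdim m dI)" "psd \<rho>"
    and dec: "\<And>x y. x \<in> tuples m dI \<Longrightarrow> y \<in> tuples m dI \<Longrightarrow>
       \<rho> $$ (enc m dI x, enc m dI y) = (\<Sum>e\<in>S. \<phi> e x * cnj (\<phi> e y))"
    and \<psi>: "(\<Sum>x\<in>tuples m dO. (cmod (\<psi> x))\<^sup>2) = 1"
  obtains \<Lambda> where "locc m dI dO \<Lambda>"
    "fidelity (rank1 (tdim m dO) (\<lambda>a. \<psi> (dec m dO a))) (\<Lambda> \<rho>) = sqrt (\<Sum>e\<in>S. A (\<phi> e))"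
proof -
  from lv obtain \<Lambda> N v where L: "locc m dI dO \<Lambda>"
    and c: "\<Lambda> \<rho> \<in> carrier_mat (tdim m dO) (tdim m dO)" "psd (\<Lambda> \<rho>)"
    and q: "qform m dO (\<Lambda> \<rho>) \<psi> = (\<Sum>\<omega><(N::nat). qform m dI \<rho> (v \<omega>))"
    and A: "\<And>\<phi>. A \<phi> = (\<Sum>\<omega><N. (cmod (ip (tuples m dI) (v \<omega>) \<phi>))\<^sup>2)"
    unfolding locc_value_def using \<rho> by blast
  let ?\<psi> = "\<lambda>a. \<psi> (dec m dO a)"
  have n: "(\<Sum>a<tdim m dO. (cmod (?\<psi> a))\<^sup>2) = 1"
    unfolding sum_enc using \<psi> by (simp add: dec_enc)
  have 1: "ip {..<tdim m dO} ?\<psi> (app {..<tdim m dO} (ker (\<Lambda> \<rho>)) ?\<psi>) = qform m dO (\<Lambda> \<rho>) \<psi>"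
    unfolding ip_def app_def qform_def sum_enc sum_distrib_left
    by (intro sum.cong refl) (simp add: dec_enc ker_def mult_ac)
  have 2: "qform m dI \<rho> u = of_real (\<Sum>e\<in>S. (cmod (ip (tuples m dI) u (\<phi> e)))\<^sup>2)" for u
  proof -
    have "qform m dI \<rho> u = (\<Sum>x\<in>tuples m dI. \<Sum>y\<in>tuples m dI. \<Sum>e\<in>S. (cnj (u x) * \<phi> e x) * cnj (cnj (u y) * \<phi> e y))"
      unfolding qform_def by (intro sum.cong refl) (simp add: dec sum_distrib_left sum_distrib_right mult_ac)
    also have "\<dots> = (\<Sum>x\<in>tuples m dI. \<Sum>e\<in>S. \<Sum>y\<in>tuples m dI. (cnj (u x) * \<phi> e x) * cnj (cnj (u y) * \<phi> e y))"
      by (intro sum.cong refl sum.swap)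
    also have "\<dots> = (\<Sum>e\<in>S. \<Sum>x\<in>tuples m dI. \<Sum>y\<in>tuples m dI. (cnj (u x) * \<phi> e x) * cnj (cnj (u y) * \<phi> e y))"
      by (rule sum.swap)
    also have "\<dots> = (\<Sum>e\<in>S. ip (tuples m dI) u (\<phi> e) * cnj (ip (tuples m dI) u (\<phi> e)))"
      unfolding ip_def cnj_sum sum_product ..
    finally show ?thesis unfolding mult_cnj_eq of_real_sum .
  qed
  have "qform m dO (\<Lambda> \<rho>) \<psi> = of_real (\<Sum>\<omega><N. \<Sum>e\<in>S. (cmod (ip (tuples m dI) (v \<omega>) (\<phi> e)))\<^sup>2)"
    unfolding q 2 of_real_sum ..
  also have "(\<Sum>\<omega><N. \<Sum>e\<in>S. (cmod (ip (tuples m dI) (v \<omega>) (\<phi> e)))\<^sup>2) = (\<Sum>e\<in>S. A (\<phi> e))"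
    unfolding A by (rule sum.swap)
  finally have "fidelity (rank1 (tdim m dO) ?\<psi>) (\<Lambda> \<rho>) = sqrt (\<Sum>e\<in>S. A (\<phi> e))"
    unfolding fidelity_pure[OF c n] 1 by simp
  with L show thesis by (rule that)
qed

section \<open>Decoupling by random signs\<close>

text \<open>Toggling the membership of \<open>p\<close> is an involution of the power set that
  reverses every sign.\<close>

lemma sum_toggle_zero:
  fixes F :: "'a set \<Rightarrow> real"
  assumes "p \<in> S" and "\<And>U. F (sym_diff U {p}) = - F U"
  shows "(\<Sum>U\<in>Pow S. F U) = 0"
proof -
  have "bij_betw (\<lambda>U. sym_diff U {p}) (Pow S) (Pow S)"
    by (rule bij_betwI[where g="\<lambda>U. sym_diff U {p}"]) (use assms(1) in auto)
  then have "(\<Sum>U\<in>Pow S. F U) = (\<Sum>U\<in>Pow S. F (sym_diff U {p}))"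
    by (rule sum.reindex_bij_betw[symmetric])
  then show ?thesis by (simp add: assms(2) sum_negf)
qed

text \<open>An index that occurs only once lets \<open>sum_toggle_zero\<close> cancel the sum; if
  all indices are matched, the product of signs is constantly 1.\<close>

lemma sign_sums:
  fixes S :: "'a set"
  assumes "finite S"
  defines "s \<equiv> (\<lambda>U p. if p \<in> U then -1 else 1 :: real)"
  shows "p \<in> S \<Longrightarrow> q \<in> S \<Longrightarrow> (\<Sum>U\<in>Pow S. s U p * s U q) = (if p = q then 2 ^ card S else 0)"
    and "p \<in> S \<Longrightarrow> q \<in> S \<Longrightarrow> u \<in> S \<Longrightarrow> v \<in> S \<Longrightarrow> (\<Sum>U\<in>Pow S. s U p * s U q * s U u * s U v) =
      (if p = q \<and> u = v \<or> p = u \<and> q = v \<or> p = v \<and> q = u then 2 ^ card S else 0)"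
proof -
  have flip: "s (sym_diff U {p}) p = - s U p" for U p by (auto simp: s_def)
  have keep: "q \<noteq> p \<Longrightarrow> s (sym_diff U {p}) q = s U q" for U p q by (auto simp: s_def)
  have sq: "s U p * s U p = 1" for U p by (auto simp: s_def)
  have sq': "s U p * (s U p * t) = t" for U p t by (auto simp: s_def)
  have c: "(\<Sum>U\<in>Pow S. 1) = (2 ^ card S :: real)" using assms(1) by (simp add: card_Pow)
  show "(\<Sum>U\<in>Pow S. s U p * s U q) = (if p = q then 2 ^ card S else 0)" if "p \<in> S" "q \<in> S"
  proof (cases "p = q")
    case True
    then show ?thesis using c by (simp add: sq)
  next
    case False
    have "(\<Sum>U\<in>Pow S. s U p * s U q) = 0"
      by (rule sum_toggle_zero[OF that(1)]) (use False in \<open>simp add: flip keep[of q p]\<close>)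
    then show ?thesis using False by simp
  qed
  have one: "(\<Sum>U\<in>Pow S. s U w * (s U x * (s U y * s U z))) = 0" if "w \<in> S" "w \<notin> {x,y,z}" for w x y z
  proof (rule sum_toggle_zero[OF that(1)])
    have "x \<noteq> w" "y \<noteq> w" "z \<noteq> w" using that(2) by auto
    then show "s (sym_diff U {w}) w * (s (sym_diff U {w}) x * (s (sym_diff U {w}) y * s (sym_diff U {w}) z))
        = - (s U w * (s U x * (s U y * s U z)))" for U
      by (simp add: flip keep)
  qed
  assume S: "p \<in> S" "q \<in> S" "u \<in> S" "v \<in> S"
  show "(\<Sum>U\<in>Pow S. s U p * s U q * s U u * s U v) =
      (if p = q \<and> u = v \<or> p = u \<and> q = v \<or> p = v \<and> q = u then 2 ^ card S else 0)"
  proof (cases "p = q \<and> u = v \<or> p = u \<and> q = v \<or> p = v \<and> q = u")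
    case True
    then have "s U p * s U q * s U u * s U v = 1" for U by (auto simp: s_def)
    then show ?thesis using c True by simp
  next
    case False
    \<comment> \<open>If the four indices cannot be matched in pairs, one of them differs from the
      other three.\<close>
    then consider "p \<notin> {q,u,v}" | "q \<notin> {p,u,v}" | "u \<notin> {p,q,v}" | "v \<notin> {p,q,u}" by blast
    then have "(\<Sum>U\<in>Pow S. s U p * s U q * s U u * s U v) = 0"
    proof cases
      case 1 from one[OF S(1) 1] show ?thesis by (simp add: mult_ac)
    next
      case 2 from one[OF S(2) 2] show ?thesis by (simp add: mult_ac)
    next
      case 3 from one[OF S(3) 3] show ?thesis by (simp add: mult_ac)
    next
      case 4 from one[OF S(4) 4] show ?thesis by (simp add: mult_ac)
    qed
    then show ?thesis using False by simp
  qed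
qed

text \<open>All sign patterns on a \<open>K\<close> by \<open>D\<close> array are taken, one for
  each measurement outcome; communication is free in LOCC, so only the finiteness of their number
  matters. The fourth moment is stated for the positions \<open>(r,a)\<close>,
  \<open>(r',a')\<close>, \<open>(r,b)\<close>, \<open>(r',b')\<close> that occur in the squared
  modulus of a matrix entry.\<close>

lemma sign_family:
  fixes K D :: nat
  obtains N :: nat and g :: "nat \<Rightarrow> nat \<Rightarrow> nat \<Rightarrow> real" where "N \<ge> 1"
    "\<And>x r a. g x r a * g x r a = 1"
    "\<And>r r' a a'. r < K \<Longrightarrow> r' < K \<Longrightarrow> a < D \<Longrightarrow> a' < D \<Longrightarrow>
       (\<Sum>x<N. g x r a * g x r' a') = (if r = r' \<and> a = a' then real N else 0)"
    "\<And>r r' a a' b b'. r < K \<Longrightarrow> r' < K \<Longrightarrow> a < D \<Longrightarrow> a' < D \<Longrightarrow> b < D \<Longrightarrow> b' < D \<Longrightarrow>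
       (\<Sum>x<N. g x r a * g x r' a' * g x r b * g x r' b') =
       (if r = r' \<and> a = a' \<and> b = b' \<or> a = b \<and> a' = b' \<or> r = r' \<and> a = b' \<and> a' = b then real N else 0)"
proof -
  let ?S = "{..<K} \<times> {..<D}"
  have fin: "finite ?S" by simp
  let ?N = "card (Pow ?S)"
  obtain h where h: "bij_betw h {..<?N} (Pow ?S)"
    using ex_bij_betw_nat_finite[of "Pow ?S"] by (auto simp: atLeast0LessThan)
  let ?s = "\<lambda>U p. if p \<in> U then -1 else 1 :: real"
  have N: "real ?N = 2 ^ card ?S" by (simp add: card_Pow)
  show thesis
  proof (rule that[of ?N "\<lambda>x r a. ?s (h x) (r,a)"])
    show "?N \<ge> 1" by (simp add: card_Pow)
    fix r r' a a' assume *: "r < K" "r' < K" "a < D" "a' < D"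
    have "(\<Sum>x<?N. ?s (h x) (r,a) * ?s (h x) (r',a')) = (\<Sum>U\<in>Pow ?S. ?s U (r,a) * ?s U (r',a'))"
      by (rule sum.reindex_bij_betw[OF h])
    also have "\<dots> = (if (r,a) = (r',a') then 2 ^ card ?S else 0)"
      by (rule sign_sums(1)[OF fin]) (use * in auto)
    finally show "(\<Sum>x<?N. ?s (h x) (r,a) * ?s (h x) (r',a')) = (if r = r' \<and> a = a' then real ?N else 0)"
      unfolding N by (simp only: prod.inject)
  next
    fix r r' a a' b b' assume *: "r < K" "r' < K" "a < D" "a' < D" "b < D" "b' < D"
    have "(\<Sum>x<?N. ?s (h x) (r,a) * ?s (h x) (r',a') * ?s (h x) (r,b) * ?s (h x) (r',b'))
      = (\<Sum>U\<in>Pow ?S. ?s U (r,a) * ?s U (r',a') * ?s U (r,b) * ?s U (r',b'))"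
      by (rule sum.reindex_bij_betw[OF h])
    also have "\<dots> = (if (r,a) = (r',a') \<and> (r,b) = (r',b') \<or> (r,a) = (r,b) \<and> (r',a') = (r',b') \<or>
        (r,a) = (r',b') \<and> (r',a') = (r,b) then 2 ^ card ?S else 0)"
      by (rule sign_sums(2)[OF fin]) (use * in auto)
    also have "((r,a) = (r',a') \<and> (r,b) = (r',b') \<or> (r,a) = (r,b) \<and> (r',a') = (r',b') \<or>
        (r,a) = (r',b') \<and> (r',a') = (r,b)) = (r = r' \<and> a = a' \<and> b = b' \<or> a = b \<and> a' = b' \<or> r = r' \<and> a = b' \<and> a' = b)"
      by auto
    finally show "(\<Sum>x<?N. ?s (h x) (r,a) * ?s (h x) (r',a') * ?s (h x) (r,b) * ?s (h x) (r',b')) =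
      (if r = r' \<and> a = a' \<and> b = b' \<or> a = b \<and> a' = b' \<or> r = r' \<and> a = b' \<and> a' = b then real ?N else 0)"
      unfolding N .
  qed auto
qed

text \<open>Each product is bounded by half the sum of the two squared moduli; by symmetry of
  \<open>V\<close> both halves lead to row sums.\<close>

lemma schur_test:
  fixes V :: "'a \<Rightarrow> 'a \<Rightarrow> real" and X :: "'a \<Rightarrow> complex"
  assumes "finite A" and sym: "\<And>p q. p \<in> A \<Longrightarrow> q \<in> A \<Longrightarrow> V p q = V q p"
    and nn: "\<And>p q. p \<in> A \<Longrightarrow> q \<in> A \<Longrightarrow> 0 \<le> V p q"
    and row: "\<And>p. p \<in> A \<Longrightarrow> (\<Sum>q\<in>A. V p q) \<le> c"
  shows "Re (\<Sum>p\<in>A. \<Sum>q\<in>A. of_real (V p q) * (X p * cnj (X q))) \<le> c * (\<Sum>p\<in>A. (cmod (X p))\<^sup>2)"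
proof -
  have "Re (\<Sum>p\<in>A. \<Sum>q\<in>A. of_real (V p q) * (X p * cnj (X q))) = (\<Sum>p\<in>A. \<Sum>q\<in>A. V p q * Re (X p * cnj (X q)))"
    by simp
  also have "\<dots> \<le> (\<Sum>p\<in>A. \<Sum>q\<in>A. V p q * ((cmod (X p))\<^sup>2 / 2) + V p q * ((cmod (X q))\<^sup>2 / 2))"
  proof (intro sum_mono)
    fix p q assume pq: "p \<in> A" "q \<in> A"
    have "Re (X p * cnj (X q)) \<le> cmod (X p * cnj (X q))" by (rule complex_Re_le_cmod)
    also have "\<dots> = cmod (X p) * cmod (X q)" by (simp add: norm_mult)
    also have "\<dots> \<le> (cmod (X p))\<^sup>2 / 2 + (cmod (X q))\<^sup>2 / 2"
      using sum_squares_bound[of "cmod (X p)" "cmod (X q)"] by simp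
    finally have "V p q * Re (X p * cnj (X q)) \<le> V p q * ((cmod (X p))\<^sup>2 / 2 + (cmod (X q))\<^sup>2 / 2)"
      using nn[OF pq] by (rule mult_left_mono)
    then show "V p q * Re (X p * cnj (X q)) \<le> V p q * ((cmod (X p))\<^sup>2 / 2) + V p q * ((cmod (X q))\<^sup>2 / 2)"
      by (simp only: distrib_left)
  qed
  also have "\<dots> = (\<Sum>p\<in>A. \<Sum>q\<in>A. V p q * ((cmod (X p))\<^sup>2 / 2)) + (\<Sum>p\<in>A. \<Sum>q\<in>A. V p q * ((cmod (X q))\<^sup>2 / 2))"
    by (simp add: sum.distrib)
  also have "(\<Sum>p\<in>A. \<Sum>q\<in>A. V p q * ((cmod (X q))\<^sup>2 / 2)) = (\<Sum>q\<in>A. \<Sum>p\<in>A. V q p * ((cmod (X q))\<^sup>2 / 2))"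
    by (subst sum.swap) (intro sum.cong refl arg_cong2[where f="(*)"] sym)
  also have "(\<Sum>p\<in>A. \<Sum>q\<in>A. V p q * ((cmod (X p))\<^sup>2 / 2)) + (\<Sum>q\<in>A. \<Sum>p\<in>A. V q p * ((cmod (X q))\<^sup>2 / 2))
     = (\<Sum>p\<in>A. (\<Sum>q\<in>A. V p q) * (cmod (X p))\<^sup>2)"
    by (simp add: sum_distrib_right sum.distrib[symmetric])
  also have "\<dots> \<le> (\<Sum>p\<in>A. c * (cmod (X p))\<^sup>2)"
    by (intro sum_mono mult_right_mono row) auto
  finally show ?thesis by (simp add: sum_distrib_left)
qed

text \<open>Against a Gram kernel \<open>H\<close> gives a sum of quadratic forms, each bounded by a
  squared norm. The result is the trace of the Gram kernel, without any dimension factor.\<close>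

lemma contr_gram:
  assumes "contr I H"
  shows "cmod (\<Sum>x\<in>I. \<Sum>y\<in>I. H y x * (\<Sum>w\<in>W. u w x * cnj (u w y))) \<le> (\<Sum>w\<in>W. \<Sum>x\<in>I. (cmod (u w x))\<^sup>2)"
proof -
  have "(\<Sum>x\<in>I. \<Sum>y\<in>I. H y x * (\<Sum>w\<in>W. u w x * cnj (u w y))) = (\<Sum>w\<in>W. ip I (u w) (app I H (u w)))"
  proof -
    have "(\<Sum>x\<in>I. \<Sum>y\<in>I. H y x * (\<Sum>w\<in>W. u w x * cnj (u w y)))
      = (\<Sum>y\<in>I. \<Sum>x\<in>I. \<Sum>w\<in>W. cnj (u w y) * (H y x * u w x))"
      by (subst sum.swap) (simp add: sum_distrib_left mult_ac)
    also have "\<dots> = (\<Sum>y\<in>I. \<Sum>w\<in>W. \<Sum>x\<in>I. cnj (u w y) * (H y x * u w x))"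
      by (intro sum.cong refl sum.swap)
    also have "\<dots> = (\<Sum>w\<in>W. \<Sum>y\<in>I. \<Sum>x\<in>I. cnj (u w y) * (H y x * u w x))"
      by (rule sum.swap)
    finally show ?thesis by (simp add: ip_def app_def sum_distrib_left)
  qed
  also have "cmod \<dots> \<le> (\<Sum>w\<in>W. cmod (ip I (u w) (app I H (u w))))" by (rule norm_sum)
  also have "\<dots> \<le> (\<Sum>w\<in>W. \<Sum>x\<in>I. (cmod (u w x))\<^sup>2)"
    using assms unfolding contr_def by (intro sum_mono) blast
  finally show ?thesis .
qed

text \<open>Cauchy-Schwarz for the Hilbert-Schmidt inner product; the Hilbert-Schmidt norm of
  \<open>H\<close> costs the root of the dimension.\<close>

lemma contr_cauchy:
  assumes "contr I H"
  shows "cmod (\<Sum>x\<in>I. \<Sum>y\<in>I. H y x * Z x y) \<le> sqrt (real (card I)) * sqrt (\<Sum>x\<in>I. \<Sum>y\<in>I. (cmod (Z x y))\<^sup>2)"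
proof -
  have "cmod (\<Sum>x\<in>I. \<Sum>y\<in>I. H y x * Z x y) \<le> (\<Sum>x\<in>I. \<Sum>y\<in>I. cmod (H y x) * cmod (Z x y))"
    by (rule order_trans[OF norm_sum sum_mono[OF order_trans[OF norm_sum]]]) (simp add: norm_mult)
  also have "\<dots> = (\<Sum>p\<in>I\<times>I. cmod (H (snd p) (fst p)) * cmod (Z (fst p) (snd p)))"
    by (simp add: sum.cartesian_product case_prod_unfold)
  also have "\<dots> \<le> L2_set (\<lambda>p. cmod (H (snd p) (fst p))) (I\<times>I) * L2_set (\<lambda>p. cmod (Z (fst p) (snd p))) (I\<times>I)"
    using L2_set_mult_ineq[of "\<lambda>p. cmod (H (snd p) (fst p))" "\<lambda>p. cmod (Z (fst p) (snd p))" "I\<times>I"] by simp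
  also have "\<dots> = sqrt (\<Sum>x\<in>I. \<Sum>y\<in>I. (cmod (H y x))\<^sup>2) * sqrt (\<Sum>x\<in>I. \<Sum>y\<in>I. (cmod (Z x y))\<^sup>2)"
    unfolding L2_set_def by (simp add: sum.cartesian_product case_prod_unfold)
  also have "(\<Sum>x\<in>I. \<Sum>y\<in>I. (cmod (H y x))\<^sup>2) = (\<Sum>y\<in>I. \<Sum>x\<in>I. (cmod (H y x))\<^sup>2)" by (rule sum.swap)
  also have "sqrt (\<Sum>y\<in>I. \<Sum>x\<in>I. (cmod (H y x))\<^sup>2) * sqrt (\<Sum>x\<in>I. \<Sum>y\<in>I. (cmod (Z x y))\<^sup>2)
     \<le> sqrt (real (card I)) * sqrt (\<Sum>x\<in>I. \<Sum>y\<in>I. (cmod (Z x y))\<^sup>2)"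
    using assms unfolding contr_def by (intro mult_right_mono real_sqrt_le_mono) (auto intro!: sum_nonneg)
  finally show ?thesis .
qed

lemma sum_sqrt_le:
  assumes "\<And>x. x \<in> A \<Longrightarrow> 0 \<le> (f x :: real)"
  shows "(\<Sum>x\<in>A. sqrt (f x)) \<le> sqrt (real (card A) * (\<Sum>x\<in>A. f x))"
proof -
  have "(\<Sum>x\<in>A. sqrt (f x)) \<le> (\<Sum>x\<in>A. \<bar>1\<bar> * \<bar>sqrt (f x)\<bar>)" by (intro sum_mono) simp
  also have "\<dots> \<le> L2_set (\<lambda>_. 1) A * L2_set (\<lambda>x. sqrt (f x)) A" by (rule L2_set_mult_ineq)
  also have "\<dots> = sqrt (real (card A) * (\<Sum>x\<in>A. f x))"
    unfolding L2_set_def real_sqrt_mult using assms by simp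
  finally show ?thesis .
qed

lemma of_real_eqD: "complex_of_real x = z \<Longrightarrow> x = Re z"
  by auto

lemma sum3_tuples_prod:
  fixes h :: "nat \<Rightarrow> nat \<Rightarrow> nat \<Rightarrow> nat \<Rightarrow> real"
  shows "(\<Sum>x\<in>tuples m a. \<Sum>y\<in>tuples m b. \<Sum>z\<in>tuples m c. \<Prod>j<m. h j (x j) (y j) (z j))
    = (\<Prod>j<m. \<Sum>x<a j. \<Sum>y<b j. \<Sum>z<c j. h j x y z)"
proof -
  have "(\<Sum>z\<in>tuples m c. \<Prod>j<m. h j (x j) (y j) (z j)) = (\<Prod>j<m. \<Sum>z<c j. h j (x j) (y j) z)" for x y
    by (rule sum_tuples_prod)
  moreover have "(\<Sum>y\<in>tuples m b. \<Prod>j<m. \<Sum>z<c j. h j (x j) (y j) z) = (\<Prod>j<m. \<Sum>y<b j. \<Sum>z<c j. h j (x j) y z)" for x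
    by (rule sum_tuples_prod)
  moreover have "(\<Sum>x\<in>tuples m a. \<Prod>j<m. \<Sum>y<b j. \<Sum>z<c j. h j (x j) y z) = (\<Prod>j<m. \<Sum>x<a j. \<Sum>y<b j. \<Sum>z<c j. h j x y z)"
    by (rule sum_tuples_prod)
  ultimately show ?thesis by simp
qed

lemma sum2_tuples_prod:
  fixes h :: "nat \<Rightarrow> nat \<Rightarrow> nat \<Rightarrow> real"
  shows "(\<Sum>x\<in>tuples m a. \<Sum>y\<in>tuples m b. \<Prod>j<m. h j (x j) (y j)) = (\<Prod>j<m. \<Sum>x<a j. \<Sum>y<b j. h j x y)"
proof -
  have "(\<Sum>y\<in>tuples m b. \<Prod>j<m. h j (x j) (y j)) = (\<Prod>j<m. \<Sum>y<b j. h j (x j) y)" for x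
    by (rule sum_tuples_prod)
  moreover have "(\<Sum>x\<in>tuples m a. \<Prod>j<m. \<Sum>y<b j. h j (x j) y) = (\<Prod>j<m. \<Sum>x<a j. \<Sum>y<b j. h j x y)"
    by (rule sum_tuples_prod)
  ultimately show ?thesis by simp
qed

lemma sum_if_if:
  fixes c :: real and n :: nat
  assumes "p < n" "q < n"
  shows "(\<Sum>b<n. \<Sum>b'<n. if p = b then if q = b' then c else 0 else 0) = c"
proof -
  have "(\<Sum>b'<n. if p = b then if q = b' then c else 0 else 0) = (if p = b then c else 0)" for b
    using assms by (cases "p = b") simp_all
  then show ?thesis using assms by simp
qed

lemma sum_swap4:
  "(\<Sum>x\<in>A. \<Sum>y\<in>B. \<Sum>z\<in>C. \<Sum>p\<in>P. f x y z p) = (\<Sum>p\<in>P. \<Sum>x\<in>A. \<Sum>y\<in>B. \<Sum>z\<in>C. f x y z p)"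
proof -
  have "(\<Sum>z\<in>C. \<Sum>p\<in>P. f x y z p) = (\<Sum>p\<in>P. \<Sum>z\<in>C. f x y z p)" for x y by (rule sum.swap)
  moreover have "(\<Sum>y\<in>B. \<Sum>p\<in>P. \<Sum>z\<in>C. f x y z p) = (\<Sum>p\<in>P. \<Sum>y\<in>B. \<Sum>z\<in>C. f x y z p)" for x by (rule sum.swap)
  moreover have "(\<Sum>x\<in>A. \<Sum>p\<in>P. \<Sum>y\<in>B. \<Sum>z\<in>C. f x y z p) = (\<Sum>p\<in>P. \<Sum>x\<in>A. \<Sum>y\<in>B. \<Sum>z\<in>C. f x y z p)" by (rule sum.swap)
  ultimately show ?thesis by simp
qed

lemma if_conj_nested: "(if P \<and> Q then x else y) = (if P then if Q then x else y else y)"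
  by simp

lemma indicator_or_diff:
  "(if A \<or> B \<or> C then 1 else 0) - (if A then 1 else 0) \<le> (if B then 1 else 0) + (if C then 1 else (0::real))"
  "0 \<le> (if A \<or> B \<or> C then 1 else 0) - (if A then 1 else (0::real))"
  by auto

text \<open>Party \<open>i0\<close> does not measure. A single kept index and a single input index
  stand in for its system, so that all products run over \<open>j < m\<close>; its true index is
  carried separately, as \<open>z\<close>, in the lemmas below.\<close>

locale sign_measurement =
  fixes m i0 :: nat and K D N :: "nat \<Rightarrow> nat" and g :: "nat \<Rightarrow> nat \<Rightarrow> nat \<Rightarrow> nat \<Rightarrow> real"
  assumes i0: "i0 < m" "K i0 = 1" "D i0 = 1"
    and K1: "\<And>j. j < m \<Longrightarrow> K j \<ge> 1" and N1: "\<And>j. j < m \<Longrightarrow> N j \<ge> 1" and D1: "\<And>j. j < m \<Longrightarrow> D j \<ge> 1"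
    and sq: "\<And>j x r a. j < m \<Longrightarrow> g j x r a * g j x r a = 1"
    and two: "\<And>j r r' a a'. j < m \<Longrightarrow> r < K j \<Longrightarrow> r' < K j \<Longrightarrow> a < D j \<Longrightarrow> a' < D j \<Longrightarrow>
       (\<Sum>x<N j. g j x r a * g j x r' a') = (if r = r' \<and> a = a' then real (N j) else 0)"
    and four: "\<And>j r r' a a' b b'. j < m \<Longrightarrow> r < K j \<Longrightarrow> r' < K j \<Longrightarrow> a < D j \<Longrightarrow> a' < D j \<Longrightarrow> b < D j \<Longrightarrow> b' < D j \<Longrightarrow>
       (\<Sum>x<N j. g j x r a * g j x r' a' * g j x r b * g j x r' b') =
       (if r = r' \<and> a = a' \<and> b = b' \<or> a = b \<and> a' = b' \<or> r = r' \<and> a = b' \<and> a' = b then real (N j) else 0)"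
begin

text \<open>The coefficient, at the matrix positions \<open>(a,a')\<close> and
  \<open>(r,r')\<close>, of the map that sandwiches an operator with the Kraus operator of outcome
  \<open>x\<close>. The entries of that operator are
  \<open>g j x r a / sqrt (K j * N j)\<close>.\<close>

definition tau :: "nat \<Rightarrow> nat \<Rightarrow> nat \<Rightarrow> nat \<Rightarrow> nat \<Rightarrow> nat \<Rightarrow> real" where
  "tau j x r r' a a' = g j x r a * g j x r' a' / (real (K j) * real (N j))"

text \<open>The mean of \<open>tau\<close> over the outcomes, which is the ideal behaviour: the
  input is traced out, the kept index is uniform, and every outcome has weight
  \<open>1 / N j\<close>.\<close>

definition mu :: "nat \<Rightarrow> nat \<Rightarrow> nat \<Rightarrow> nat \<Rightarrow> nat \<Rightarrow> real" where
  "mu j r r' a a' = (if r = r' \<and> a = a' then 1 / (real (K j) * real (N j)) else 0)"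

lemma mu_nonneg: "0 \<le> mu j r r' a a'"
  by (simp add: mu_def)

definition delta :: "nat \<Rightarrow> nat \<Rightarrow> nat \<Rightarrow> nat \<Rightarrow> nat \<Rightarrow> nat \<Rightarrow> real" where
  "delta j x r r' a a' = tau j x r r' a a' - mu j r r' a a'"

definition part :: "nat set \<Rightarrow> nat \<Rightarrow> nat \<Rightarrow> nat \<Rightarrow> nat \<Rightarrow> nat \<Rightarrow> nat \<Rightarrow> real" where
  "part J j x r r' a a' = (if j \<in> J then delta j x r r' a a' else mu j r r' a a')"

lemma KN: "j < m \<Longrightarrow> real (K j) * real (N j) > 0" "j < m \<Longrightarrow> real (K j) > 0" "j < m \<Longrightarrow> real (N j) > 0"
  using K1[of j] N1[of j] by auto

lemma sum_tau:
  assumes "j < m" "r < K j" "r' < K j" "a < D j" "a' < D j"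
  shows "(\<Sum>x<N j. tau j x r r' a a') = real (N j) * mu j r r' a a'"
  unfolding tau_def mu_def sum_divide_distrib[symmetric] two[OF assms] using KN[OF assms(1)] by simp

text \<open>Subtracting the mean removes the pairing \<open>r = r'\<close>, \<open>a = a'\<close>,
  \<open>b = b'\<close> from the fourth moment. The pairing \<open>a = b\<close>,
  \<open>a' = b'\<close> survives for up to \<open>K ^ 2\<close> choices of \<open>r\<close> and
  \<open>r'\<close> and gives at most 1; the crossed pairing requires \<open>r = r'\<close> and
  gives at most \<open>1 / K\<close>. The factor \<open>N j\<close> anticipates Cauchy-Schwarz over
  the outcomes.\<close>

lemma delta_moment:
  assumes j: "j < m" and a: "a < D j" "a' < D j" "b < D j" "b' < D j"
  defines "V \<equiv> (\<Sum>x<N j. \<Sum>r<K j. \<Sum>r'<K j. real (N j) * (delta j x r r' a a' * delta j x r r' b b'))"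
  shows "0 \<le> V" and "V \<le> (if a = b \<and> a' = b' then 1 else 0) + (if a = b' \<and> a' = b then 1 / real (K j) else 0)"
proof -
  let ?K = "real (K j)" and ?N = "real (N j)"
  define c where "c r r' = (if r = r' \<and> a = a' \<and> b = b' \<or> a = b \<and> a' = b' \<or> r = r' \<and> a = b' \<and> a' = b then 1 else 0)
     - (if r = r' \<and> a = a' \<and> b = b' then 1 else 0 :: real)" for r r' :: nat
  have one: "(\<Sum>x<N j. ?N * (delta j x r r' a a' * delta j x r r' b b')) = c r r' / ?K\<^sup>2" if r: "r < K j" "r' < K j" for r r'
  proof -
    have "(\<Sum>x<N j. delta j x r r' a a' * delta j x r r' b b')
      = (\<Sum>x<N j. tau j x r r' a a' * tau j x r r' b b') - (\<Sum>x<N j. tau j x r r' a a') * mu j r r' b b'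
        - mu j r r' a a' * (\<Sum>x<N j. tau j x r r' b b') + ?N * (mu j r r' a a' * mu j r r' b b')"
      unfolding delta_def by (simp add: algebra_simps sum.distrib sum_subtractf sum_distrib_left)
    also have "\<dots> = (\<Sum>x<N j. tau j x r r' a a' * tau j x r r' b b') - ?N * (mu j r r' a a' * mu j r r' b b')"
      by (simp add: sum_tau j r a algebra_simps)
    finally have d: "(\<Sum>x<N j. delta j x r r' a a' * delta j x r r' b b')
      = (\<Sum>x<N j. tau j x r r' a a' * tau j x r r' b b') - ?N * (mu j r r' a a' * mu j r r' b b')" .
    define p where "p = (if r = r' \<and> a = a' \<and> b = b' \<or> a = b \<and> a' = b' \<or> r = r' \<and> a = b' \<and> a' = b then 1 else 0 :: real)"
    define q where "q = (if r = r' \<and> a = a' \<and> b = b' then 1 else 0 :: real)"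
    have "(\<Sum>x<N j. tau j x r r' a a' * tau j x r r' b b')
      = (\<Sum>x<N j. g j x r a * g j x r' a' * g j x r b * g j x r' b') / (?K * ?N)\<^sup>2"
      unfolding tau_def sum_divide_distrib by (intro sum.cong refl) (simp add: power2_eq_square)
    also have "\<dots> = ?N * p / (?K * ?N)\<^sup>2" unfolding four[OF j r a] p_def by simp
    finally have t: "(\<Sum>x<N j. tau j x r r' a a' * tau j x r r' b b') = ?N * p / (?K * ?N)\<^sup>2" .
    have u: "mu j r r' a a' * mu j r r' b b' = q / (?K * ?N)\<^sup>2"
      unfolding mu_def q_def by (simp add: power2_eq_square)
    have "?N * (?N * p / (?K * ?N)\<^sup>2 - ?N * (q / (?K * ?N)\<^sup>2)) = (p - q) / ?K\<^sup>2"
      using KN[OF j] by (simp add: power2_eq_square field_simps)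
    then have "?N * (\<Sum>x<N j. delta j x r r' a a' * delta j x r r' b b') = c r r' / ?K\<^sup>2"
      unfolding d t u c_def p_def[symmetric] q_def[symmetric] .
    then show ?thesis by (simp add: sum_distrib_left)
  qed
  have "V = (\<Sum>r<K j. \<Sum>r'<K j. \<Sum>x<N j. ?N * (delta j x r r' a a' * delta j x r r' b b'))"
    unfolding V_def by (subst sum.swap) (intro sum.cong refl sum.swap)
  also have "\<dots> = (\<Sum>r<K j. \<Sum>r'<K j. c r r' / ?K\<^sup>2)"
    using one by (intro sum.cong refl) simp
  finally have V: "V = (\<Sum>r<K j. \<Sum>r'<K j. c r r' / ?K\<^sup>2)" .
  show "0 \<le> V" unfolding V c_def by (intro sum_nonneg divide_nonneg_nonneg indicator_or_diff(2)) simp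
  have "V \<le> (\<Sum>r<K j. \<Sum>r'<K j. (if a = b \<and> a' = b' then 1 else 0) / ?K\<^sup>2 +
      (if r = r' \<and> a = b' \<and> a' = b then 1 else 0) / ?K\<^sup>2)"
    unfolding V c_def add_divide_distrib[symmetric]
    by (intro sum_mono divide_right_mono indicator_or_diff(1)) simp
  also have "\<dots> = (\<Sum>r<K j. \<Sum>r'<K j. (if a = b \<and> a' = b' then 1 else 0) / ?K\<^sup>2) +
      (\<Sum>r<K j. \<Sum>r'<K j. (if r = r' \<and> a = b' \<and> a' = b then 1 else 0) / ?K\<^sup>2)"
    unfolding sum.distrib ..
  also have "(\<Sum>r<K j. \<Sum>r'<K j. (if r = r' \<and> a = b' \<and> a' = b then 1 else 0) / ?K\<^sup>2)
     = (if a = b' \<and> a' = b then 1 / ?K else 0)"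
  proof (cases "a = b' \<and> a' = b")
    case True
    have "(if r = r' \<and> a = b' \<and> a' = b then 1 else 0) / ?K\<^sup>2 = (if r = r' then 1 / ?K\<^sup>2 else 0)" for r r' :: nat
      using True by simp
    then have "(\<Sum>r<K j. \<Sum>r'<K j. (if r = r' \<and> a = b' \<and> a' = b then 1 else 0) / ?K\<^sup>2) = ?K * (1 / ?K\<^sup>2)"
      by simp
    then show ?thesis unfolding if_P[OF True] by (simp add: power2_eq_square)
  next
    case False
    have "(if r = r' \<and> a = b' \<and> a' = b then 1 else 0) / ?K\<^sup>2 = 0" for r r' :: nat
    proof -
      have "\<not> (r = r' \<and> a = b' \<and> a' = b)" using False by blast
      then show ?thesis by (simp only: if_False div_0)
    qed
    then show ?thesis unfolding if_not_P[OF False] by (simp only: sum.neutral_const)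
  qed
  also have "(\<Sum>r<K j. \<Sum>r'<K j. (if a = b \<and> a' = b' then 1 else 0) / ?K\<^sup>2) = (if a = b \<and> a' = b' then 1 else 0)"
    using KN(2)[OF j] by (simp add: power2_eq_square)
  finally show "V \<le> (if a = b \<and> a' = b' then 1 else 0) + (if a = b' \<and> a' = b then 1 / ?K else 0)" .
qed

definition weight :: "nat set \<Rightarrow> nat \<Rightarrow> nat \<Rightarrow> nat \<Rightarrow> nat \<Rightarrow> nat \<Rightarrow> real" where
  "weight J j a a' b b' = (\<Sum>x<N j. \<Sum>r<K j. \<Sum>r'<K j. real (N j) * (part J j x r r' a a' * part J j x r r' b b'))"

lemma weight_sym: "weight J j a a' b b' = weight J j b b' a a'"
  unfolding weight_def by (simp add: mult.commute)

text \<open>Positivity and row sums for \<open>schur_test\<close>. A party in \<open>J\<close>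
  contributes at most \<open>1 + 1 / K \<le> 2\<close>, the origin of the 2 in the final factor
  \<open>(2 * K) ^ card J\<close>; an averaged party has a trivial input and contributes
  \<open>1 / K\<close>.\<close>

lemma weight_bounds:
  assumes j: "j < m" and a: "a < sub_dims J D j" "a' < sub_dims J D j"
  shows "b < sub_dims J D j \<Longrightarrow> b' < sub_dims J D j \<Longrightarrow> 0 \<le> weight J j a a' b b'"
    and "(\<Sum>b<sub_dims J D j. \<Sum>b'<sub_dims J D j. weight J j a a' b b') \<le> (if j \<in> J then 2 else 1 / real (K j))"
proof -
  show "0 \<le> weight J j a a' b b'" if b: "b < sub_dims J D j" "b' < sub_dims J D j"
  proof (cases "j \<in> J")
    case True
    then show ?thesis using delta_moment(1)[OF j, of a a' b b'] a b unfolding weight_def part_def by (simp add: sub_dims_def)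
  next
    case False
    then have "part J j x r r' c c' = mu j r r' c c'" for x r r' c c' by (simp add: part_def)
    then show ?thesis unfolding weight_def by (simp only:) (intro sum_nonneg mult_nonneg_nonneg mu_nonneg of_nat_0_le_iff)
  qed
  show "(\<Sum>b<sub_dims J D j. \<Sum>b'<sub_dims J D j. weight J j a a' b b') \<le> (if j \<in> J then 2 else 1 / real (K j))"
  proof (cases "j \<in> J")
    case True
    then have s: "sub_dims J D j = D j" by (simp add: sub_dims_def)
    have "(\<Sum>b<D j. \<Sum>b'<D j. weight J j a a' b b')
      \<le> (\<Sum>b<D j. \<Sum>b'<D j. (if a = b then if a' = b' then 1 else 0 else 0) + (if a' = b then if a = b' then 1 / real (K j) else 0 else 0))"
    proof (intro sum_mono)
      fix b b' assume "b \<in> {..<D j}" "b' \<in> {..<D j}"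
      then have "weight J j a a' b b' \<le> (if a = b \<and> a' = b' then 1 else 0) + (if a = b' \<and> a' = b then 1 / real (K j) else 0)"
        using delta_moment(2)[OF j, of a a' b b'] a True unfolding weight_def part_def s by simp
      then show "weight J j a a' b b' \<le> (if a = b then if a' = b' then 1 else 0 else 0) + (if a' = b then if a = b' then 1 / real (K j) else 0 else 0)"
        by (simp only: if_conj_nested conj_commute[of "a = b'"])
    qed
    also have "\<dots> = 1 + 1 / real (K j)"
      using a unfolding s sum.distrib by (simp only: sum_if_if)
    also have "\<dots> \<le> 2" using K1[OF j] by simp
    finally show ?thesis using True s by simp
  next
    case False
    then have s: "sub_dims J D j = 1" by (simp add: sub_dims_def)
    have "weight J j a a' 0 0 = (\<Sum>x<N j. \<Sum>r<K j. \<Sum>r'<K j. if r = r' then real (N j) * (1 / (real (K j) * real (N j)))\<^sup>2 else 0)"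
      using False a unfolding weight_def part_def mu_def s by (intro sum.cong refl) (simp add: power2_eq_square)
    also have "\<dots> = 1 / real (K j)" using KN[OF j] by (simp add: power2_eq_square field_simps)
    finally show ?thesis using False s by simp
  qed
qed

text \<open>Expanding the square gives a quadratic form in \<open>X\<close> whose coefficients
  \<open>V p q\<close> are products over the parties. Hence its row sums factorise into those of
  \<open>weight_bounds\<close>, and \<open>schur_test\<close> bounds the form whatever
  \<open>X\<close> is.\<close>

lemma second_moment:
  fixes X :: "(nat \<Rightarrow> nat) \<Rightarrow> (nat \<Rightarrow> nat) \<Rightarrow> complex"
  defines "A \<equiv> \<lambda>J. tuples m (sub_dims J D)"
  shows "real (\<Prod>j<m. N j) * (\<Sum>x\<in>tuples m N. \<Sum>r\<in>tuples m K. \<Sum>r'\<in>tuples m K.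
      (cmod (\<Sum>\<alpha>\<in>A J. \<Sum>\<alpha>'\<in>A J. of_real (\<Prod>j<m. part J j (x j) (r j) (r' j) (\<alpha> j) (\<alpha>' j)) * X \<alpha> \<alpha>'))\<^sup>2)
    \<le> (\<Prod>j<m. if j \<in> J then 2 else 1 / real (K j)) * (\<Sum>\<alpha>\<in>A J. \<Sum>\<alpha>'\<in>A J. (cmod (X \<alpha> \<alpha>'))\<^sup>2)"
proof -
  let ?P = "A J \<times> A J"
  define c where "c x r r' p = (\<Prod>j<m. part J j (x j) (r j) (r' j) (fst p j) (snd p j))" for x r r' :: "nat \<Rightarrow> nat" and p :: "(nat \<Rightarrow> nat) \<times> (nat \<Rightarrow> nat)"
  define V where "V p q = (\<Prod>j<m. weight J j (fst p j) (snd p j) (fst q j) (snd q j))" for p q :: "(nat \<Rightarrow> nat) \<times> (nat \<Rightarrow> nat)"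
  define Y where "Y p = X (fst p) (snd p)" for p
  have sq: "complex_of_real ((cmod (\<Sum>\<alpha>\<in>A J. \<Sum>\<alpha>'\<in>A J. of_real (\<Prod>j<m. part J j (x j) (r j) (r' j) (\<alpha> j) (\<alpha>' j)) * X \<alpha> \<alpha>'))\<^sup>2)
     = (\<Sum>p\<in>?P. \<Sum>q\<in>?P. of_real (c x r r' p * c x r r' q) * (Y p * cnj (Y q)))" for x r r'
  proof -
    have e: "(\<Sum>\<alpha>\<in>A J. \<Sum>\<alpha>'\<in>A J. of_real (\<Prod>j<m. part J j (x j) (r j) (r' j) (\<alpha> j) (\<alpha>' j)) * X \<alpha> \<alpha>')
      = (\<Sum>p\<in>?P. of_real (c x r r' p) * Y p)"
      unfolding sum.cartesian_product c_def Y_def by (simp add: case_prod_unfold)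
    show ?thesis unfolding e mult_cnj_eq(1)[symmetric] cnj_sum sum_product
      by (intro sum.cong refl) (simp add: mult_ac)
  qed
  define S where "S p q = (\<Sum>x\<in>tuples m N. \<Sum>r\<in>tuples m K. \<Sum>r'\<in>tuples m K. c x r r' p * c x r r' q)" for p q
  have Vc: "real (\<Prod>j<m. N j) * S p q = V p q" for p q
  proof -
    have "real (\<Prod>j<m. N j) * S p q
      = (\<Sum>x\<in>tuples m N. \<Sum>r\<in>tuples m K. \<Sum>r'\<in>tuples m K. \<Prod>j<m. real (N j) *
          (part J j (x j) (r j) (r' j) (fst p j) (snd p j) * part J j (x j) (r j) (r' j) (fst q j) (snd q j)))"
      unfolding S_def c_def sum_distrib_left of_nat_prod prod.distrib ..
    also have "\<dots> = V p q" unfolding V_def weight_def by (rule sum3_tuples_prod)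
    finally show ?thesis .
  qed
  have "complex_of_real (real (\<Prod>j<m. N j) * (\<Sum>x\<in>tuples m N. \<Sum>r\<in>tuples m K. \<Sum>r'\<in>tuples m K.
      (cmod (\<Sum>\<alpha>\<in>A J. \<Sum>\<alpha>'\<in>A J. of_real (\<Prod>j<m. part J j (x j) (r j) (r' j) (\<alpha> j) (\<alpha>' j)) * X \<alpha> \<alpha>'))\<^sup>2))
    = of_real (real (\<Prod>j<m. N j)) * (\<Sum>x\<in>tuples m N. \<Sum>r\<in>tuples m K. \<Sum>r'\<in>tuples m K. \<Sum>p\<in>?P. \<Sum>q\<in>?P. of_real (c x r r' p * c x r r' q) * (Y p * cnj (Y q)))"
    unfolding of_real_mult of_real_sum sq ..
  also have "\<dots> = (\<Sum>p\<in>?P. \<Sum>q\<in>?P. of_real (V p q) * (Y p * cnj (Y q)))"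
  proof -
    have "(\<Sum>x\<in>tuples m N. \<Sum>r\<in>tuples m K. \<Sum>r'\<in>tuples m K. \<Sum>p\<in>?P. \<Sum>q\<in>?P. of_real (c x r r' p * c x r r' q) * (Y p * cnj (Y q)))
      = (\<Sum>p\<in>?P. \<Sum>x\<in>tuples m N. \<Sum>r\<in>tuples m K. \<Sum>r'\<in>tuples m K. \<Sum>q\<in>?P. of_real (c x r r' p * c x r r' q) * (Y p * cnj (Y q)))"
      by (rule sum_swap4)
    also have "\<dots> = (\<Sum>p\<in>?P. \<Sum>q\<in>?P. \<Sum>x\<in>tuples m N. \<Sum>r\<in>tuples m K. \<Sum>r'\<in>tuples m K. of_real (c x r r' p * c x r r' q) * (Y p * cnj (Y q)))"
      by (intro sum.cong refl sum_swap4)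
    also have "\<dots> = (\<Sum>p\<in>?P. \<Sum>q\<in>?P. of_real (S p q) * (Y p * cnj (Y q)))"
      unfolding S_def of_real_sum sum_distrib_right ..
    finally have e: "(\<Sum>x\<in>tuples m N. \<Sum>r\<in>tuples m K. \<Sum>r'\<in>tuples m K. \<Sum>p\<in>?P. \<Sum>q\<in>?P. of_real (c x r r' p * c x r r' q) * (Y p * cnj (Y q)))
       = (\<Sum>p\<in>?P. \<Sum>q\<in>?P. of_real (S p q) * (Y p * cnj (Y q)))" .
    show ?thesis unfolding e unfolding Vc[symmetric] of_real_mult sum_distrib_left mult.assoc ..
  qed
  finally have eq: "real (\<Prod>j<m. N j) * (\<Sum>x\<in>tuples m N. \<Sum>r\<in>tuples m K. \<Sum>r'\<in>tuples m K.
      (cmod (\<Sum>\<alpha>\<in>A J. \<Sum>\<alpha>'\<in>A J. of_real (\<Prod>j<m. part J j (x j) (r j) (r' j) (\<alpha> j) (\<alpha>' j)) * X \<alpha> \<alpha>'))\<^sup>2)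
    = Re (\<Sum>p\<in>?P. \<Sum>q\<in>?P. of_real (V p q) * (Y p * cnj (Y q)))"
    by (rule of_real_eqD)
  have lt: "\<alpha> j < sub_dims J D j" if "\<alpha> \<in> A J" "j < m" for \<alpha> j using that unfolding A_def by (rule tuplesD(1))
  have "Re (\<Sum>p\<in>?P. \<Sum>q\<in>?P. of_real (V p q) * (Y p * cnj (Y q)))
     \<le> (\<Prod>j<m. if j \<in> J then 2 else 1 / real (K j)) * (\<Sum>p\<in>?P. (cmod (Y p))\<^sup>2)"
  proof (rule schur_test)
    show "finite ?P" by (simp add: A_def)
    show "V p q = V q p" for p q unfolding V_def by (intro prod.cong refl weight_sym)
    show "0 \<le> V p q" if "p \<in> ?P" "q \<in> ?P" for p q
      unfolding V_def using that by (intro prod_nonneg weight_bounds(1) lt ballI) auto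
    fix p assume p: "p \<in> ?P"
    have "(\<Sum>q\<in>?P. V p q) = (\<Sum>\<beta>\<in>A J. \<Sum>\<beta>'\<in>A J. \<Prod>j<m. weight J j (fst p j) (snd p j) (\<beta> j) (\<beta>' j))"
      unfolding V_def sum.cartesian_product by (simp add: case_prod_unfold)
    also have "\<dots> = (\<Prod>j<m. \<Sum>b<sub_dims J D j. \<Sum>b'<sub_dims J D j. weight J j (fst p j) (snd p j) b b')"
      unfolding A_def by (rule sum2_tuples_prod)
    also have "\<dots> \<le> (\<Prod>j<m. if j \<in> J then 2 else 1 / real (K j))"
    proof (intro prod_mono conjI)
      fix j assume "j \<in> {..<m}"
      then have j: "j < m" and pj: "fst p j < sub_dims J D j" "snd p j < sub_dims J D j" using p lt by auto
      show "0 \<le> (\<Sum>b<sub_dims J D j. \<Sum>b'<sub_dims J D j. weight J j (fst p j) (snd p j) b b')"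
        by (intro sum_nonneg weight_bounds(1)[OF j pj]) auto
      show "(\<Sum>b<sub_dims J D j. \<Sum>b'<sub_dims J D j. weight J j (fst p j) (snd p j) b b') \<le> (if j \<in> J then 2 else 1 / real (K j))"
        by (rule weight_bounds(2)[OF j pj])
    qed
    finally show "(\<Sum>q\<in>?P. V p q) \<le> (\<Prod>j<m. if j \<in> J then 2 else 1 / real (K j))" .
  qed
  also have "(\<Sum>p\<in>?P. (cmod (Y p))\<^sup>2) = (\<Sum>\<alpha>\<in>A J. \<Sum>\<alpha>'\<in>A J. (cmod (X \<alpha> \<alpha>'))\<^sup>2)"
    unfolding Y_def sum.cartesian_product by (simp add: case_prod_unfold)
  finally show ?thesis unfolding eq .
qed

end

lemma sum_pairs: "(\<Sum>p\<in>A \<times> B. h p) = (\<Sum>r\<in>A. \<Sum>e\<in>B. h (r,e))"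
  by (simp add: sum.cartesian_product case_prod_unfold)

lemma card_tuples_real: "real (card (tuples m d)) = real (\<Prod>j<m. d j)"
  by (simp add: card_tuples tdim_def)

context sign_measurement
begin

text \<open>The fluctuation \<open>delta\<close> is a difference of two completely positive maps.
  For trace estimates the two are separated: \<open>tau\<close> on \<open>I\<close>,
  \<open>mu\<close> elsewhere, both positive by \<open>gpart_gram\<close>.\<close>

definition gpart :: "nat set \<Rightarrow> nat \<Rightarrow> nat \<Rightarrow> nat \<Rightarrow> nat \<Rightarrow> nat \<Rightarrow> nat \<Rightarrow> real" where
  "gpart I j x r r' a a' = (if j \<in> I then tau j x r r' a a' else mu j r r' a a')"

text \<open>The differences \<open>tau - mu\<close> over \<open>J\<close> are multiplied out;
  \<open>I\<close> collects the parties that contribute \<open>tau\<close>.\<close>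

lemma prod_part:
  assumes "J \<subseteq> {..<m}"
  shows "(\<Prod>j<m. part J j (x j) (r j) (r' j) (a j) (a' j))
    = (\<Sum>I\<in>Pow J. (-1) ^ card (J - I) * (\<Prod>j<m. gpart I j (x j) (r j) (r' j) (a j) (a' j)))"
proof -
  let ?t = "\<lambda>j. tau j (x j) (r j) (r' j) (a j) (a' j)" and ?u = "\<lambda>j. mu j (r j) (r' j) (a j) (a' j)"
  have fJ: "finite J" using assms finite_subset by blast
  have s: "(\<Prod>j<m. h j) = (\<Prod>j\<in>J. h j) * (\<Prod>j\<in>{..<m} - J. h j)" for h :: "nat \<Rightarrow> real"
    using prod.subset_diff[OF assms, of h] by (simp add: mult.commute)
  have "(\<Prod>j\<in>J. part J j (x j) (r j) (r' j) (a j) (a' j)) = (\<Prod>j\<in>J. ?t j + - ?u j)"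
    by (intro prod.cong refl) (simp add: part_def delta_def)
  also have "\<dots> = (\<Sum>I\<in>Pow J. (\<Prod>j\<in>I. ?t j) * (\<Prod>j\<in>J - I. - ?u j))" by (rule prod_add[OF fJ])
  also have "\<dots> = (\<Sum>I\<in>Pow J. (-1) ^ card (J - I) * (\<Prod>j\<in>J. gpart I j (x j) (r j) (r' j) (a j) (a' j)))"
  proof (intro sum.cong refl)
    fix I assume "I \<in> Pow J"
    then have I: "I \<subseteq> J" by simp
    have "(\<Prod>j\<in>J. gpart I j (x j) (r j) (r' j) (a j) (a' j))
      = (\<Prod>j\<in>J - I. gpart I j (x j) (r j) (r' j) (a j) (a' j)) * (\<Prod>j\<in>I. gpart I j (x j) (r j) (r' j) (a j) (a' j))"
      by (rule prod.subset_diff[OF I fJ])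
    also have "(\<Prod>j\<in>J - I. gpart I j (x j) (r j) (r' j) (a j) (a' j)) = (\<Prod>j\<in>J - I. ?u j)"
      by (intro prod.cong refl) (simp add: gpart_def)
    also have "(\<Prod>j\<in>I. gpart I j (x j) (r j) (r' j) (a j) (a' j)) = (\<Prod>j\<in>I. ?t j)"
      by (intro prod.cong refl) (simp add: gpart_def)
    finally show "(\<Prod>j\<in>I. ?t j) * (\<Prod>j\<in>J - I. - ?u j) = (-1) ^ card (J - I) * (\<Prod>j\<in>J. gpart I j (x j) (r j) (r' j) (a j) (a' j))"
      by (simp add: prod_uminus mult_ac)
  qed
  finally have e: "(\<Prod>j\<in>J. part J j (x j) (r j) (r' j) (a j) (a' j)) =
    (\<Sum>I\<in>Pow J. (-1) ^ card (J - I) * (\<Prod>j\<in>J. gpart I j (x j) (r j) (r' j) (a j) (a' j)))" .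
  have "(\<Prod>j\<in>{..<m} - J. part J j (x j) (r j) (r' j) (a j) (a' j)) = (\<Prod>j\<in>{..<m} - J. ?u j)"
    by (intro prod.cong refl) (simp add: part_def)
  moreover have "(\<Prod>j\<in>{..<m} - J. gpart I j (x j) (r j) (r' j) (a j) (a' j)) = (\<Prod>j\<in>{..<m} - J. ?u j)" if "I \<in> Pow J" for I
    using that by (intro prod.cong refl) (auto simp: gpart_def)
  ultimately show ?thesis
    unfolding s[of "\<lambda>j. part J j (x j) (r j) (r' j) (a j) (a' j)"] s[of "\<lambda>j. gpart _ j (x j) (r j) (r' j) (a j) (a' j)"] e sum_distrib_right
    by (intro sum.cong refl) (simp add: mult.assoc)
qed

text \<open>Trace preservation, of the measurement and of its mean alike, once the outcomes are
  summed.\<close>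

lemma gpart_sum:
  assumes "j < m" "a < D j" "a' < D j"
  shows "(\<Sum>x<N j. \<Sum>r<K j. gpart I j x r r a a') = (if a = a' then 1 else 0)"
proof -
  have "(\<Sum>x<N j. \<Sum>r<K j. gpart I j x r r a a') = (\<Sum>r<K j. \<Sum>x<N j. gpart I j x r r a a')" by (rule sum.swap)
  also have "\<dots> = (\<Sum>r<K j. real (N j) * mu j r r a a')"
    using assms by (intro sum.cong refl) (cases "j \<in> I"; simp add: gpart_def sum_tau)
  also have "\<dots> = (if a = a' then 1 else 0)" using KN[OF assms(1)] by (simp add: mu_def)
  finally show ?thesis .
qed

text \<open>\<open>tau\<close> is a single rank-one kernel. \<open>mu\<close> is realised by a fresh
  outcome \<open>y\<close>: averaging the rank-one kernels over \<open>y\<close> cancels the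
  off-diagonal terms and uses up one factor \<open>1 / N\<close>, and the other one is the weight of
  the outcome \<open>x\<close>.\<close>

lemma gpart_gram:
  fixes I :: "nat set" and j x :: nat
  assumes "j < m" "r < K j" "r' < K j" "a < D j" "a' < D j"
  defines "n \<equiv> (if j \<in> I then 1 else N j)"
    and "\<kappa> \<equiv> \<lambda>y r a. if j \<in> I then g j x r a / sqrt (real (K j) * real (N j)) else g j y r a / (sqrt (real (K j)) * real (N j))"
  shows "gpart I j x r r' a a' = (\<Sum>y<n. \<kappa> y r a * \<kappa> y r' a')"
proof (cases "j \<in> I")
  case True
  have "sqrt (real (K j) * real (N j)) * sqrt (real (K j) * real (N j)) = real (K j) * real (N j)" by simp
  then show ?thesis using True by (simp add: gpart_def n_def \<kappa>_def tau_def)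
next
  case False
  have "(\<Sum>y<N j. g j y r a / (sqrt (real (K j)) * real (N j)) * (g j y r' a' / (sqrt (real (K j)) * real (N j))))
    = (\<Sum>y<N j. g j y r a * g j y r' a') / (real (K j) * (real (N j) * real (N j)))"
    unfolding sum_divide_distrib by (intro sum.cong refl) (simp add: mult_ac)
  also have "\<dots> = mu j r r' a a'" unfolding two[OF assms(1-5)] mu_def using KN[OF assms(1)] by simp
  finally show ?thesis using False by (simp add: gpart_def n_def \<kappa>_def)
qed

text \<open>By positivity the kernel is a Gram kernel, so for every outcome
  \<open>contr_gram\<close> bounds the pairing with \<open>H\<close> by a trace. Summed over the
  outcomes the maps preserve the trace, which leaves the trace of the part given by
  \<open>G\<close>. No dimension enters; an atypical part is small only in trace, so this is
  essential.\<close>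

lemma bound_gram:
  fixes H :: "(nat \<Rightarrow> nat) \<Rightarrow> (nat \<Rightarrow> nat) \<times> 'e \<Rightarrow> (nat \<Rightarrow> nat) \<times> 'e \<Rightarrow> complex"
    and G :: "'b \<Rightarrow> (nat \<Rightarrow> nat) \<Rightarrow> 'e \<Rightarrow> complex" and I J :: "nat set"
  assumes fin: "finite E" "finite B"
  defines "RE \<equiv> tuples m K \<times> E" and "A \<equiv> tuples m (sub_dims J D)"
  assumes H: "\<And>x. x \<in> tuples m N \<Longrightarrow> contr RE (H x)"
  shows "(\<Sum>x\<in>tuples m N. cmod (\<Sum>p\<in>RE. \<Sum>q\<in>RE. H x q p * (\<Sum>\<alpha>\<in>A. \<Sum>\<alpha>'\<in>A.
       of_real (\<Prod>j<m. gpart I j (x j) (fst p j) (fst q j) (\<alpha> j) (\<alpha>' j)) * (\<Sum>b\<in>B. G b \<alpha> (snd p) * cnj (G b \<alpha>' (snd q))))))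
     \<le> (\<Sum>b\<in>B. \<Sum>\<alpha>\<in>A. \<Sum>e\<in>E. (cmod (G b \<alpha> e))\<^sup>2)"
proof -
  have lt: "\<alpha> j < D j" if "\<alpha> \<in> A" "j < m" for \<alpha> j
    using tuplesD(1)[OF that[unfolded A_def]] D1[OF that(2)] by (auto simp: sub_dims_def split: if_splits)
  have ltr: "fst p j < K j" if "p \<in> RE" "j < m" for p j using that tuplesD(1)[of "fst p" m K j] by (auto simp: RE_def)
  define \<Xi> where "\<Xi> x p q = (\<Sum>\<alpha>\<in>A. \<Sum>\<alpha>'\<in>A. complex_of_real (\<Prod>j<m. gpart I j (x j) (fst p j) (fst q j) (\<alpha> j) (\<alpha>' j)) *
      (\<Sum>b\<in>B. G b \<alpha> (snd p) * cnj (G b \<alpha>' (snd q))))" for x p q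
  define n where "n j = (if j \<in> I then 1 else N j)" for j
  define \<kappa> where "\<kappa> x j y r a = (if j \<in> I then g j (x j) r a / sqrt (real (K j) * real (N j)) else g j y r a / (sqrt (real (K j)) * real (N j)))"
    for x :: "nat \<Rightarrow> nat" and j y r a
  define W where "W = tuples m n \<times> B"
  define u where "u x w p = (\<Sum>\<alpha>\<in>A. of_real (\<Prod>j<m. \<kappa> x j (fst w j) (fst p j) (\<alpha> j)) * G (snd w) \<alpha> (snd p))" for x w p
  have gram: "\<Xi> x p q = (\<Sum>w\<in>W. u x w p * cnj (u x w q))" if pq: "p \<in> RE" "q \<in> RE" for x p q
  proof -
    have k: "(\<Prod>j<m. gpart I j (x j) (fst p j) (fst q j) (\<alpha> j) (\<alpha>' j))
       = (\<Sum>y\<in>tuples m n. (\<Prod>j<m. \<kappa> x j (y j) (fst p j) (\<alpha> j)) * (\<Prod>j<m. \<kappa> x j (y j) (fst q j) (\<alpha>' j)))"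
      if "\<alpha> \<in> A" "\<alpha>' \<in> A" for \<alpha> \<alpha>'
    proof -
      have "(\<Prod>j<m. gpart I j (x j) (fst p j) (fst q j) (\<alpha> j) (\<alpha>' j))
        = (\<Prod>j<m. \<Sum>y<n j. \<kappa> x j y (fst p j) (\<alpha> j) * \<kappa> x j y (fst q j) (\<alpha>' j))"
        unfolding n_def \<kappa>_def by (intro prod.cong refl gpart_gram) (use that pq lt ltr in auto)
      also have "\<dots> = (\<Sum>y\<in>tuples m n. \<Prod>j<m. \<kappa> x j (y j) (fst p j) (\<alpha> j) * \<kappa> x j (y j) (fst q j) (\<alpha>' j))"
        by (rule sum_tuples_prod[symmetric])
      finally show ?thesis unfolding prod.distrib .
    qed
    have "\<Xi> x p q = (\<Sum>\<alpha>\<in>A. \<Sum>\<alpha>'\<in>A. \<Sum>y\<in>tuples m n. \<Sum>b\<in>B.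
       (of_real (\<Prod>j<m. \<kappa> x j (y j) (fst p j) (\<alpha> j)) * G b \<alpha> (snd p)) * cnj (of_real (\<Prod>j<m. \<kappa> x j (y j) (fst q j) (\<alpha>' j)) * G b \<alpha>' (snd q)))"
      unfolding \<Xi>_def
    proof (intro sum.cong refl)
      fix \<alpha> \<alpha>' assume a: "\<alpha> \<in> A" "\<alpha>' \<in> A"
      show "complex_of_real (\<Prod>j<m. gpart I j (x j) (fst p j) (fst q j) (\<alpha> j) (\<alpha>' j)) * (\<Sum>b\<in>B. G b \<alpha> (snd p) * cnj (G b \<alpha>' (snd q)))
        = (\<Sum>y\<in>tuples m n. \<Sum>b\<in>B. (of_real (\<Prod>j<m. \<kappa> x j (y j) (fst p j) (\<alpha> j)) * G b \<alpha> (snd p)) * cnj (of_real (\<Prod>j<m. \<kappa> x j (y j) (fst q j) (\<alpha>' j)) * G b \<alpha>' (snd q)))"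
        unfolding k[OF a] of_real_sum sum_product of_real_mult
        by (intro sum.cong refl) (simp add: mult_ac)
    qed
    also have "\<dots> = (\<Sum>\<alpha>\<in>A. \<Sum>\<alpha>'\<in>A. \<Sum>w\<in>W.
       (of_real (\<Prod>j<m. \<kappa> x j (fst w j) (fst p j) (\<alpha> j)) * G (snd w) \<alpha> (snd p)) * cnj (of_real (\<Prod>j<m. \<kappa> x j (fst w j) (fst q j) (\<alpha>' j)) * G (snd w) \<alpha>' (snd q)))"
      unfolding W_def sum.cartesian_product[of _ B] by (simp add: case_prod_unfold)
    also have "\<dots> = (\<Sum>\<alpha>\<in>A. \<Sum>w\<in>W. \<Sum>\<alpha>'\<in>A.
       (of_real (\<Prod>j<m. \<kappa> x j (fst w j) (fst p j) (\<alpha> j)) * G (snd w) \<alpha> (snd p)) * cnj (of_real (\<Prod>j<m. \<kappa> x j (fst w j) (fst q j) (\<alpha>' j)) * G (snd w) \<alpha>' (snd q)))"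
      by (intro sum.cong refl sum.swap)
    also have "\<dots> = (\<Sum>w\<in>W. \<Sum>\<alpha>\<in>A. \<Sum>\<alpha>'\<in>A.
       (of_real (\<Prod>j<m. \<kappa> x j (fst w j) (fst p j) (\<alpha> j)) * G (snd w) \<alpha> (snd p)) * cnj (of_real (\<Prod>j<m. \<kappa> x j (fst w j) (fst q j) (\<alpha>' j)) * G (snd w) \<alpha>' (snd q)))"
      by (rule sum.swap)
    also have "\<dots> = (\<Sum>w\<in>W. u x w p * cnj (u x w q))" unfolding u_def cnj_sum sum_product ..
    finally show ?thesis .
  qed
  have "(\<Sum>x\<in>tuples m N. cmod (\<Sum>p\<in>RE. \<Sum>q\<in>RE. H x q p * \<Xi> x p q)) \<le> (\<Sum>x\<in>tuples m N. \<Sum>w\<in>W. \<Sum>p\<in>RE. (cmod (u x w p))\<^sup>2)"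
  proof (intro sum_mono)
    fix x assume "x \<in> tuples m N"
    have "(\<Sum>p\<in>RE. \<Sum>q\<in>RE. H x q p * \<Xi> x p q) = (\<Sum>p\<in>RE. \<Sum>q\<in>RE. H x q p * (\<Sum>w\<in>W. u x w p * cnj (u x w q)))"
      by (intro sum.cong refl arg_cong2[where f="(*)"] gram)
    then show "cmod (\<Sum>p\<in>RE. \<Sum>q\<in>RE. H x q p * \<Xi> x p q) \<le> (\<Sum>w\<in>W. \<Sum>p\<in>RE. (cmod (u x w p))\<^sup>2)"
      using contr_gram[OF H[OF \<open>x \<in> tuples m N\<close>], where W=W and u="u x"] by simp
  qed
  also have "\<dots> = (\<Sum>b\<in>B. \<Sum>\<alpha>\<in>A. \<Sum>e\<in>E. (cmod (G b \<alpha> e))\<^sup>2)"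
  proof -
    define L where "L \<alpha> \<alpha>' = (\<Sum>x\<in>tuples m N. \<Sum>r\<in>tuples m K. \<Prod>j<m. gpart I j (x j) (r j) (r j) (\<alpha> j) (\<alpha>' j))" for \<alpha> \<alpha>'
    define T where "T \<alpha> \<alpha>' = (\<Sum>e\<in>E. \<Sum>b\<in>B. G b \<alpha> e * cnj (G b \<alpha>' e))" for \<alpha> \<alpha>'
    have L: "L \<alpha> \<alpha>' = (if \<alpha> = \<alpha>' then 1 else 0)" if a: "\<alpha> \<in> A" "\<alpha>' \<in> A" for \<alpha> \<alpha>'
    proof -
      have "L \<alpha> \<alpha>' = (\<Prod>j<m. \<Sum>x<N j. \<Sum>r<K j. gpart I j x r r (\<alpha> j) (\<alpha>' j))"
        unfolding L_def by (rule sum2_tuples_prod)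
      also have "\<dots> = (\<Prod>j<m. if \<alpha> j = \<alpha>' j then 1 else 0)"
        by (intro prod.cong refl gpart_sum) (use a lt in auto)
      also have "\<dots> = (if \<alpha> = \<alpha>' then 1 else 0)"
      proof (cases "\<alpha> = \<alpha>'")
        case False
        then obtain j where "\<alpha> j \<noteq> \<alpha>' j" by auto
        moreover then have "j < m" using a tuplesD(2) unfolding A_def by (metis not_less)
        ultimately show ?thesis using False by (auto intro!: prod_zero)
      qed simp
      finally show ?thesis .
    qed
    have "complex_of_real (\<Sum>x\<in>tuples m N. \<Sum>w\<in>W. \<Sum>p\<in>RE. (cmod (u x w p))\<^sup>2) = (\<Sum>x\<in>tuples m N. \<Sum>p\<in>RE. \<Xi> x p p)"
    proof -
      have "complex_of_real (\<Sum>x\<in>tuples m N. \<Sum>w\<in>W. \<Sum>p\<in>RE. (cmod (u x w p))\<^sup>2) = (\<Sum>x\<in>tuples m N. \<Sum>w\<in>W. \<Sum>p\<in>RE. u x w p * cnj (u x w p))"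
        unfolding mult_cnj_eq of_real_sum ..
      also have "\<dots> = (\<Sum>x\<in>tuples m N. \<Sum>p\<in>RE. \<Sum>w\<in>W. u x w p * cnj (u x w p))" by (intro sum.cong refl sum.swap)
      also have "\<dots> = (\<Sum>x\<in>tuples m N. \<Sum>p\<in>RE. \<Xi> x p p)" by (intro sum.cong refl gram[symmetric])
      finally show ?thesis .
    qed
    also have "\<dots> = (\<Sum>x\<in>tuples m N. \<Sum>r\<in>tuples m K. \<Sum>e\<in>E. \<Sum>\<alpha>\<in>A. \<Sum>\<alpha>'\<in>A.
       of_real (\<Prod>j<m. gpart I j (x j) (r j) (r j) (\<alpha> j) (\<alpha>' j)) * (\<Sum>b\<in>B. G b \<alpha> e * cnj (G b \<alpha>' e)))"
      unfolding \<Xi>_def RE_def sum_pairs fst_conv snd_conv ..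
    also have "\<dots> = (\<Sum>\<alpha>\<in>A. \<Sum>x\<in>tuples m N. \<Sum>r\<in>tuples m K. \<Sum>e\<in>E. \<Sum>\<alpha>'\<in>A.
       of_real (\<Prod>j<m. gpart I j (x j) (r j) (r j) (\<alpha> j) (\<alpha>' j)) * (\<Sum>b\<in>B. G b \<alpha> e * cnj (G b \<alpha>' e)))"
      by (rule sum_swap4)
    also have "\<dots> = (\<Sum>\<alpha>\<in>A. \<Sum>\<alpha>'\<in>A. \<Sum>x\<in>tuples m N. \<Sum>r\<in>tuples m K. \<Sum>e\<in>E.
       of_real (\<Prod>j<m. gpart I j (x j) (r j) (r j) (\<alpha> j) (\<alpha>' j)) * (\<Sum>b\<in>B. G b \<alpha> e * cnj (G b \<alpha>' e)))"
      by (intro sum.cong refl sum_swap4)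
    also have "\<dots> = (\<Sum>\<alpha>\<in>A. \<Sum>\<alpha>'\<in>A. of_real (L \<alpha> \<alpha>') * T \<alpha> \<alpha>')"
      unfolding L_def T_def of_real_sum sum_distrib_right unfolding sum_distrib_left ..
    also have "\<dots> = (\<Sum>\<alpha>\<in>A. \<Sum>\<alpha>'\<in>A. (if \<alpha> = \<alpha>' then 1 else 0) * T \<alpha> \<alpha>')"
      by (intro sum.cong refl) (simp add: L)
    also have "\<dots> = (\<Sum>\<alpha>\<in>A. T \<alpha> \<alpha>)" by (simp add: sum_delta_mult A_def)
    also have "\<dots> = of_real (\<Sum>\<alpha>\<in>A. \<Sum>e\<in>E. \<Sum>b\<in>B. (cmod (G b \<alpha> e))\<^sup>2)"
      unfolding T_def mult_cnj_eq of_real_sum ..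
    finally have "(\<Sum>x\<in>tuples m N. \<Sum>w\<in>W. \<Sum>p\<in>RE. (cmod (u x w p))\<^sup>2) = (\<Sum>\<alpha>\<in>A. \<Sum>e\<in>E. \<Sum>b\<in>B. (cmod (G b \<alpha> e))\<^sup>2)"
      by (simp only: of_real_eq_iff)
    also have "\<dots> = (\<Sum>\<alpha>\<in>A. \<Sum>b\<in>B. \<Sum>e\<in>E. (cmod (G b \<alpha> e))\<^sup>2)" by (intro sum.cong refl sum.swap)
    also have "\<dots> = (\<Sum>b\<in>B. \<Sum>\<alpha>\<in>A. \<Sum>e\<in>E. (cmod (G b \<alpha> e))\<^sup>2)" by (rule sum.swap)
    finally show ?thesis .
  qed
  finally show ?thesis unfolding \<Xi>_def .
qed

text \<open>Cauchy-Schwarz is applied twice: against \<open>H\<close>, which costs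
  \<open>card RE\<close>, and over the outcomes, which costs \<open>\<Prod>j<m. N j\<close>. The
  latter is the factor carried along in \<open>second_moment\<close>.\<close>

lemma bound_moment:
  fixes H :: "(nat \<Rightarrow> nat) \<Rightarrow> (nat \<Rightarrow> nat) \<times> 'e \<Rightarrow> (nat \<Rightarrow> nat) \<times> 'e \<Rightarrow> complex"
    and X :: "(nat \<Rightarrow> nat) \<Rightarrow> 'e \<Rightarrow> (nat \<Rightarrow> nat) \<Rightarrow> 'e \<Rightarrow> complex" and J :: "nat set"
  assumes fin: "finite E"
  defines "RE \<equiv> tuples m K \<times> E" and "A \<equiv> tuples m (sub_dims J D)"
  assumes H: "\<And>x. x \<in> tuples m N \<Longrightarrow> contr RE (H x)"
  shows "(\<Sum>x\<in>tuples m N. cmod (\<Sum>p\<in>RE. \<Sum>q\<in>RE. H x q p * (\<Sum>\<alpha>\<in>A. \<Sum>\<alpha>'\<in>A.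
       of_real (\<Prod>j<m. part J j (x j) (fst p j) (fst q j) (\<alpha> j) (\<alpha>' j)) * X \<alpha> (snd p) \<alpha>' (snd q))))
     \<le> sqrt (real (card RE) * ((\<Prod>j<m. if j \<in> J then 2 else 1 / real (K j)) *
         (\<Sum>e\<in>E. \<Sum>e'\<in>E. \<Sum>\<alpha>\<in>A. \<Sum>\<alpha>'\<in>A. (cmod (X \<alpha> e \<alpha>' e'))\<^sup>2)))"
proof -
  define Z where "Z x p q = (\<Sum>\<alpha>\<in>A. \<Sum>\<alpha>'\<in>A.
       complex_of_real (\<Prod>j<m. part J j (x j) (fst p j) (fst q j) (\<alpha> j) (\<alpha>' j)) * X \<alpha> (snd p) \<alpha>' (snd q))" for x p q
  define S where "S x = (\<Sum>p\<in>RE. \<Sum>q\<in>RE. (cmod (Z x p q))\<^sup>2)" for x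
  have S0: "0 \<le> S x" for x unfolding S_def by (intro sum_nonneg) auto
  have "(\<Sum>x\<in>tuples m N. cmod (\<Sum>p\<in>RE. \<Sum>q\<in>RE. H x q p * Z x p q)) \<le> (\<Sum>x\<in>tuples m N. sqrt (real (card RE)) * sqrt (S x))"
    unfolding S_def by (intro sum_mono contr_cauchy H)
  also have "\<dots> = sqrt (real (card RE)) * (\<Sum>x\<in>tuples m N. sqrt (S x))" by (simp add: sum_distrib_left)
  also have "\<dots> \<le> sqrt (real (card RE)) * sqrt (real (card (tuples m N)) * (\<Sum>x\<in>tuples m N. S x))"
    using S0 by (intro mult_left_mono sum_sqrt_le) auto
  also have "\<dots> = sqrt (real (card RE) * (real (\<Prod>j<m. N j) * (\<Sum>x\<in>tuples m N. S x)))"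
    unfolding card_tuples_real real_sqrt_mult[symmetric] ..
  also have "real (\<Prod>j<m. N j) * (\<Sum>x\<in>tuples m N. S x)
     = (\<Sum>e\<in>E. \<Sum>e'\<in>E. real (\<Prod>j<m. N j) * (\<Sum>x\<in>tuples m N. \<Sum>r\<in>tuples m K. \<Sum>r'\<in>tuples m K. (cmod (Z x (r,e) (r',e')))\<^sup>2))"
  proof -
    have "S x = (\<Sum>r\<in>tuples m K. \<Sum>e\<in>E. \<Sum>r'\<in>tuples m K. \<Sum>e'\<in>E. (cmod (Z x (r,e) (r',e')))\<^sup>2)" for x
      unfolding S_def RE_def sum_pairs ..
    also have "\<dots> x = (\<Sum>r\<in>tuples m K. \<Sum>e\<in>E. \<Sum>e'\<in>E. \<Sum>r'\<in>tuples m K. (cmod (Z x (r,e) (r',e')))\<^sup>2)" for x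
      by (intro sum.cong refl sum.swap)
    finally have "(\<Sum>x\<in>tuples m N. S x) = (\<Sum>x\<in>tuples m N. \<Sum>r\<in>tuples m K. \<Sum>e\<in>E. \<Sum>e'\<in>E. \<Sum>r'\<in>tuples m K. (cmod (Z x (r,e) (r',e')))\<^sup>2)"
      by simp
    also have "\<dots> = (\<Sum>x\<in>tuples m N. \<Sum>e\<in>E. \<Sum>r\<in>tuples m K. \<Sum>e'\<in>E. \<Sum>r'\<in>tuples m K. (cmod (Z x (r,e) (r',e')))\<^sup>2)"
      by (intro sum.cong refl sum.swap)
    also have "\<dots> = (\<Sum>e\<in>E. \<Sum>x\<in>tuples m N. \<Sum>r\<in>tuples m K. \<Sum>e'\<in>E. \<Sum>r'\<in>tuples m K. (cmod (Z x (r,e) (r',e')))\<^sup>2)"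
      by (rule sum.swap)
    also have "\<dots> = (\<Sum>e\<in>E. \<Sum>x\<in>tuples m N. \<Sum>e'\<in>E. \<Sum>r\<in>tuples m K. \<Sum>r'\<in>tuples m K. (cmod (Z x (r,e) (r',e')))\<^sup>2)"
      by (intro sum.cong refl sum.swap)
    also have "\<dots> = (\<Sum>e\<in>E. \<Sum>e'\<in>E. \<Sum>x\<in>tuples m N. \<Sum>r\<in>tuples m K. \<Sum>r'\<in>tuples m K. (cmod (Z x (r,e) (r',e')))\<^sup>2)"
      by (intro sum.cong refl sum.swap)
    finally show ?thesis by (simp add: sum_distrib_left)
  qed
  also have "sqrt (real (card RE) * \<dots>) \<le> sqrt (real (card RE) * (\<Sum>e\<in>E. \<Sum>e'\<in>E. (\<Prod>j<m. if j \<in> J then 2 else 1 / real (K j)) *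
         (\<Sum>\<alpha>\<in>A. \<Sum>\<alpha>'\<in>A. (cmod (X \<alpha> e \<alpha>' e'))\<^sup>2)))"
    unfolding Z_def fst_conv snd_conv A_def
    by (intro real_sqrt_le_mono mult_left_mono sum_mono second_moment of_nat_0_le_iff)
  finally show ?thesis unfolding Z_def by (simp add: sum_distrib_left)
qed

text \<open>On a trivial party the measurement coincides with its mean, so every set containing
  \<open>i0\<close> drops out of the expansion.\<close>

lemma delta_i0:
  assumes "i0 \<in> J" "x \<in> tuples m N" "r \<in> tuples m K" "r' \<in> tuples m K" "a \<in> tuples m D" "a' \<in> tuples m D"
  shows "(\<Prod>j<m. part J j (x j) (r j) (r' j) (a j) (a' j)) = 0"
proof -
  have "r i0 = 0" "r' i0 = 0" "a i0 = 0" "a' i0 = 0"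
    using tuplesD(1)[OF assms(3) i0(1)] tuplesD(1)[OF assms(4) i0(1)]
      tuplesD(1)[OF assms(5) i0(1)] tuplesD(1)[OF assms(6) i0(1)] i0(2,3) by simp_all
  then have "part J i0 (x i0) (r i0) (r' i0) (a i0) (a' i0) = 0"
    using assms(1) i0(1) by (simp add: part_def delta_def tau_def mu_def sq)
  then show ?thesis using i0(1) by (intro prod_zero) auto
qed

text \<open>Averaging contains a partial trace: \<open>mu\<close> vanishes off the diagonal of the
  input, so only the marginal on \<open>J\<close> is seen.\<close>

lemma part_merge:
  assumes J: "J \<subseteq> {..<m}" and a: "\<alpha> \<in> tuples m (sub_dims J D)" "\<alpha>' \<in> tuples m (sub_dims J D)"
    and b: "\<beta> \<in> tuples m (sub_dims ({..<m} - J) D)" "\<beta>' \<in> tuples m (sub_dims ({..<m} - J) D)"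
  shows "(\<Prod>j<m. part J j (x j) (r j) (r' j) (merge J \<alpha> \<beta> j) (merge J \<alpha>' \<beta>' j))
    = (if \<beta> = \<beta>' then \<Prod>j<m. part J j (x j) (r j) (r' j) (\<alpha> j) (\<alpha>' j) else 0)"
proof (cases "\<beta> = \<beta>'")
  case True
  have z: "\<alpha> j = 0" "\<alpha>' j = 0" if "j \<notin> J" for j
    using a that unfolding tuples_sub_dims[OF J] by auto
  have "part J j (x j) (r j) (r' j) (merge J \<alpha> \<beta> j) (merge J \<alpha>' \<beta>' j) = part J j (x j) (r j) (r' j) (\<alpha> j) (\<alpha>' j)" for j
    using True z[of j] by (cases "j \<in> J") (simp_all add: merge_def part_def mu_def)
  then show ?thesis using True by simp
next
  case False
  then obtain j where j: "\<beta> j \<noteq> \<beta>' j" by auto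
  have "j \<in> {..<m} - J"
  proof (rule ccontr)
    assume "j \<notin> {..<m} - J"
    then have "\<beta> j = 0" "\<beta>' j = 0" using b unfolding tuples_sub_dims[OF Diff_subset] by auto
    with j show False by simp
  qed
  then have "part J j (x j) (r j) (r' j) (merge J \<alpha> \<beta> j) (merge J \<alpha>' \<beta>' j) = 0" "j < m"
    using j by (simp_all add: part_def mu_def merge_def)
  then show ?thesis using False by (auto intro!: prod_zero)
qed

text \<open>Expanding the product of the local measurement kernels around their means leaves, for each set
  \<open>J\<close> of parties, a term that only sees the marginal on \<open>J\<close> and the environment. Hence the
  splitting of that marginal into a part of small 2-norm (\<open>Bg\<close>) and one of small trace (\<open>Bb\<close>)
  may be chosen separately for each \<open>J\<close>.\<close>

lemma decoupling:
  fixes H :: "(nat \<Rightarrow> nat) \<Rightarrow> (nat \<Rightarrow> nat) \<times> 'e \<Rightarrow> (nat \<Rightarrow> nat) \<times> 'e \<Rightarrow> complex"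
    and f :: "'e \<Rightarrow> (nat \<Rightarrow> nat) \<Rightarrow> nat \<Rightarrow> complex"
    and G :: "nat set \<Rightarrow> 'b \<Rightarrow> (nat \<Rightarrow> nat) \<Rightarrow> 'e \<Rightarrow> complex" and Z :: "nat set"
  assumes fin: "finite E" "\<And>J. finite (Bg J)" "\<And>J. finite (Bb J)" and dis: "\<And>J. Bg J \<inter> Bb J = {}"
  defines "RE \<equiv> tuples m K \<times> E" and "A \<equiv> \<lambda>J. tuples m (sub_dims J D)"
    and "Rk \<equiv> \<lambda>a e a' e'. \<Sum>z\<in>Z. f e a z * cnj (f e' a' z)"
    and "M \<equiv> \<lambda>x p z. \<Sum>a\<in>tuples m D. of_real (\<Prod>j<m. g j (x j) (fst p j) (a j) / sqrt (real (K j) * real (N j))) * f (snd p) a z"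
    and "\<J> \<equiv> Pow ({..<m} - {i0}) - {{}}"
  assumes H: "\<And>x. x \<in> tuples m N \<Longrightarrow> contr RE (H x)"
    and orth: "\<And>e e'. e \<in> E \<Longrightarrow> e' \<in> E \<Longrightarrow> (\<Sum>a\<in>tuples m D. Rk a e a e') = (if e = e' then of_real (lam e) else 0)"
    and dec: "\<And>J \<alpha> \<alpha>' e e'. J \<in> \<J> \<Longrightarrow> \<alpha> \<in> A J \<Longrightarrow> \<alpha>' \<in> A J \<Longrightarrow> e \<in> E \<Longrightarrow> e' \<in> E \<Longrightarrow>
       (\<Sum>\<beta>\<in>tuples m (sub_dims ({..<m} - J) D). Rk (merge J \<alpha> \<beta>) e (merge J \<alpha>' \<beta>) e') =
       (\<Sum>b\<in>Bg J \<union> Bb J. G J b \<alpha> e * cnj (G J b \<alpha>' e'))"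
    and good: "\<And>J. J \<in> \<J> \<Longrightarrow> (\<Sum>e\<in>E. \<Sum>e'\<in>E. \<Sum>\<alpha>\<in>A J. \<Sum>\<alpha>'\<in>A J. (cmod (\<Sum>b\<in>Bg J. G J b \<alpha> e * cnj (G J b \<alpha>' e')))\<^sup>2) \<le> t J"
    and bad: "\<And>J. J \<in> \<J> \<Longrightarrow> (\<Sum>b\<in>Bb J. \<Sum>\<alpha>\<in>A J. \<Sum>e\<in>E. (cmod (G J b \<alpha> e))\<^sup>2) \<le> \<epsilon>"
  shows "(\<Sum>x\<in>tuples m N. Re (\<Sum>p\<in>RE. \<Sum>q\<in>RE. H x q p *
       ((\<Sum>z\<in>Z. M x p z * cnj (M x q z)) - (if p = q then of_real (lam (snd p) / (\<Prod>j<m. real (K j) * real (N j))) else 0))))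
    \<le> (\<Sum>J\<in>\<J>. sqrt (real (card RE) * ((\<Prod>j<m. if j \<in> J then 2 else 1 / real (K j)) * t J)) + 2 ^ card J * \<epsilon>)"
proof -
  let ?T = "tuples m D"
  define \<Theta> where "\<Theta> J x p q = (\<Sum>a\<in>?T. \<Sum>a'\<in>?T. complex_of_real (\<Prod>j<m. part J j (x j) (fst p j) (fst q j) (a j) (a' j)) * Rk a (snd p) a' (snd q))"
    for J x p q
  have J_sub: "J \<subseteq> {..<m}" if "J \<in> \<J>" for J using that by (auto simp: \<J>_def)
  have expand: "(\<Sum>z\<in>Z. M x p z * cnj (M x q z)) - (if p = q then of_real (lam (snd p) / (\<Prod>j<m. real (K j) * real (N j))) else 0)
     = (\<Sum>J\<in>\<J>. \<Theta> J x p q)" if x: "x \<in> tuples m N" and pq: "p \<in> RE" "q \<in> RE" for x p q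
  proof -
    let ?h = "\<lambda>p a. \<Prod>j<m. g j (x j) (fst p j) (a j) / sqrt (real (K j) * real (N j))"
    have "(\<Sum>z\<in>Z. M x p z * cnj (M x q z)) = (\<Sum>z\<in>Z. \<Sum>a\<in>?T. \<Sum>a'\<in>?T. of_real (?h p a * ?h q a') * (f (snd p) a z * cnj (f (snd q) a' z)))"
      unfolding M_def cnj_sum sum_product by (intro sum.cong refl) (simp add: mult_ac)
    also have "\<dots> = (\<Sum>a\<in>?T. \<Sum>z\<in>Z. \<Sum>a'\<in>?T. of_real (?h p a * ?h q a') * (f (snd p) a z * cnj (f (snd q) a' z)))"
      by (rule sum.swap)
    also have "\<dots> = (\<Sum>a\<in>?T. \<Sum>a'\<in>?T. \<Sum>z\<in>Z. of_real (?h p a * ?h q a') * (f (snd p) a z * cnj (f (snd q) a' z)))"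
      by (intro sum.cong refl sum.swap)
    also have "\<dots> = (\<Sum>a\<in>?T. \<Sum>a'\<in>?T. of_real (?h p a * ?h q a') * Rk a (snd p) a' (snd q))"
      unfolding Rk_def sum_distrib_left ..
    also have "\<dots> = (\<Sum>a\<in>?T. \<Sum>a'\<in>?T. \<Sum>J\<in>Pow {..<m}. of_real (\<Prod>j<m. part J j (x j) (fst p j) (fst q j) (a j) (a' j)) * Rk a (snd p) a' (snd q))"
    proof (intro sum.cong refl)
      fix a a'
      have "?h p a * ?h q a' = (\<Prod>j<m. tau j (x j) (fst p j) (fst q j) (a j) (a' j))"
        unfolding prod.distrib[symmetric] tau_def times_divide_times_eq by (intro prod.cong refl) simp
      also have "\<dots> = (\<Prod>j<m. delta j (x j) (fst p j) (fst q j) (a j) (a' j) + mu j (fst p j) (fst q j) (a j) (a' j))"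
        by (intro prod.cong refl) (simp add: delta_def)
      also have "\<dots> = (\<Sum>J\<in>Pow {..<m}. (\<Prod>j\<in>J. delta j (x j) (fst p j) (fst q j) (a j) (a' j)) * (\<Prod>j\<in>{..<m} - J. mu j (fst p j) (fst q j) (a j) (a' j)))"
        by (rule prod_add) simp
      also have "\<dots> = (\<Sum>J\<in>Pow {..<m}. \<Prod>j<m. part J j (x j) (fst p j) (fst q j) (a j) (a' j))"
      proof (intro sum.cong refl)
        fix J assume "J \<in> Pow {..<m}"
        then have "(\<Prod>j<m. part J j (x j) (fst p j) (fst q j) (a j) (a' j)) =
          (\<Prod>j\<in>{..<m} - J. part J j (x j) (fst p j) (fst q j) (a j) (a' j)) * (\<Prod>j\<in>J. part J j (x j) (fst p j) (fst q j) (a j) (a' j))"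
          by (intro prod.subset_diff) auto
        then show "(\<Prod>j\<in>J. delta j (x j) (fst p j) (fst q j) (a j) (a' j)) * (\<Prod>j\<in>{..<m} - J. mu j (fst p j) (fst q j) (a j) (a' j))
          = (\<Prod>j<m. part J j (x j) (fst p j) (fst q j) (a j) (a' j))"
          by (simp add: part_def mult.commute)
      qed
      finally show "of_real (?h p a * ?h q a') * Rk a (snd p) a' (snd q) =
        (\<Sum>J\<in>Pow {..<m}. of_real (\<Prod>j<m. part J j (x j) (fst p j) (fst q j) (a j) (a' j)) * Rk a (snd p) a' (snd q))"
        by (simp only: of_real_sum sum_distrib_right)
    qed
    also have "\<dots> = (\<Sum>a\<in>?T. \<Sum>J\<in>Pow {..<m}. \<Sum>a'\<in>?T. of_real (\<Prod>j<m. part J j (x j) (fst p j) (fst q j) (a j) (a' j)) * Rk a (snd p) a' (snd q))"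
      by (intro sum.cong refl sum.swap)
    also have "\<dots> = (\<Sum>J\<in>Pow {..<m}. \<Theta> J x p q)" unfolding \<Theta>_def by (rule sum.swap)
    also have "\<dots> = (\<Sum>J\<in>insert {} \<J>. \<Theta> J x p q)"
    proof (rule sum.mono_neutral_right)
      show "insert {} \<J> \<subseteq> Pow {..<m}" by (auto simp: \<J>_def)
      show "\<forall>J\<in>Pow {..<m} - insert {} \<J>. \<Theta> J x p q = 0"
      proof
        fix J assume "J \<in> Pow {..<m} - insert {} \<J>"
        then have "i0 \<in> J" by (auto simp: \<J>_def)
        then have "(\<Prod>j<m. part J j (x j) (fst p j) (fst q j) (a j) (a' j)) = 0" if "a \<in> ?T" "a' \<in> ?T" for a a'
          using pq x that by (intro delta_i0) (auto simp: RE_def)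
        then show "\<Theta> J x p q = 0" unfolding \<Theta>_def by (intro sum.neutral ballI) (simp only: of_real_0 mult_zero_left)
      qed
    qed simp
    also have "\<dots> = \<Theta> {} x p q + (\<Sum>J\<in>\<J>. \<Theta> J x p q)" by (rule sum.insert) (auto simp: \<J>_def)
    \<comment> \<open>The term without fluctuations is the ideal state: the environment kernel is
      diagonal by \<open>orth\<close>, and all outcomes and kept indices have the same
      weight.\<close>
    also have "\<Theta> {} x p q = (if p = q then of_real (lam (snd p) / (\<Prod>j<m. real (K j) * real (N j))) else 0)"
    proof -
      let ?c = "\<Prod>j<m. real (K j) * real (N j)"
      have "(\<Prod>j<m. part {} j (x j) (fst p j) (fst q j) (a j) (a' j)) = (if a = a' then if fst p = fst q then 1 / ?c else 0 else 0)"
        if a: "a \<in> ?T" "a' \<in> ?T" for a a'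
      proof (cases "a = a' \<and> fst p = fst q")
        case True
        then show ?thesis by (simp add: part_def mu_def prod_dividef)
      next
        case False
        then obtain j where j: "a j \<noteq> a' j \<or> fst p j \<noteq> fst q j" by auto
        have "fst p \<in> tuples m K" "fst q \<in> tuples m K" using pq by (auto simp: RE_def)
        then have "j < m" using j a tuplesD(2) by (metis not_less)
        moreover have "part {} j (x j) (fst p j) (fst q j) (a j) (a' j) = 0" using j by (auto simp: part_def mu_def)
        ultimately have "(\<Prod>j<m. part {} j (x j) (fst p j) (fst q j) (a j) (a' j)) = 0" by (intro prod_zero) auto
        then show ?thesis using False by (simp only: if_conj_nested[symmetric] if_False)
      qed
      then have "\<Theta> {} x p q = (\<Sum>a\<in>?T. \<Sum>a'\<in>?T. if a = a' then (if fst p = fst q then of_real (1 / ?c) else 0) * Rk a (snd p) a (snd q) else 0)"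
        unfolding \<Theta>_def by (intro sum.cong refl) simp
      also have "\<dots> = (\<Sum>a\<in>?T. (if fst p = fst q then of_real (1 / ?c) else 0) * Rk a (snd p) a (snd q))" by simp
      also have "\<dots> = (if fst p = fst q then of_real (1 / ?c) else 0) * (if snd p = snd q then of_real (lam (snd p)) else 0)"
        unfolding sum_distrib_left[symmetric] using pq by (subst orth) (auto simp: RE_def)
      also have "\<dots> = (if p = q then of_real (lam (snd p) / ?c) else 0)" by (cases p; cases q) (simp del: of_real_prod)
      finally show ?thesis .
    qed
    finally show ?thesis by simp
  qed
  define \<Phi> where "\<Phi> J Y x p q = (\<Sum>\<alpha>\<in>A J. \<Sum>\<alpha>'\<in>A J. complex_of_real (\<Prod>j<m. part J j (x j) (fst p j) (fst q j) (\<alpha> j) (\<alpha>' j)) *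
     (\<Sum>b\<in>Y. G J b \<alpha> (snd p) * cnj (G J b \<alpha>' (snd q))))" for J Y x p q
  have reduce: "\<Theta> J x p q = \<Phi> J (Bg J) x p q + \<Phi> J (Bb J) x p q" if J: "J \<in> \<J>" and pq: "p \<in> RE" "q \<in> RE" for J x p q
  proof -
    let ?Z = "tuples m (sub_dims ({..<m} - J) D)"
    let ?p = "\<lambda>a a'. \<Prod>j<m. part J j (x j) (fst p j) (fst q j) (a j) (a' j)"
    have "\<Theta> J x p q = (\<Sum>\<alpha>\<in>A J. \<Sum>\<beta>\<in>?Z. \<Sum>\<alpha>'\<in>A J. \<Sum>\<beta>'\<in>?Z.
       complex_of_real (?p (merge J \<alpha> \<beta>) (merge J \<alpha>' \<beta>')) * Rk (merge J \<alpha> \<beta>) (snd p) (merge J \<alpha>' \<beta>') (snd q))"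
      unfolding \<Theta>_def A_def sum_tuples_merge[OF J_sub[OF J], of _ D] ..
    also have "\<dots> = (\<Sum>\<alpha>\<in>A J. \<Sum>\<beta>\<in>?Z. \<Sum>\<alpha>'\<in>A J. \<Sum>\<beta>'\<in>?Z.
       if \<beta> = \<beta>' then of_real (?p \<alpha> \<alpha>') * Rk (merge J \<alpha> \<beta>) (snd p) (merge J \<alpha>' \<beta>) (snd q) else 0)"
    proof (intro sum.cong refl)
      fix \<alpha> \<beta> \<alpha>' \<beta>' assume *: "\<alpha> \<in> A J" "\<beta> \<in> ?Z" "\<alpha>' \<in> A J" "\<beta>' \<in> ?Z"
      show "complex_of_real (?p (merge J \<alpha> \<beta>) (merge J \<alpha>' \<beta>')) * Rk (merge J \<alpha> \<beta>) (snd p) (merge J \<alpha>' \<beta>') (snd q)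
        = (if \<beta> = \<beta>' then of_real (?p \<alpha> \<alpha>') * Rk (merge J \<alpha> \<beta>) (snd p) (merge J \<alpha>' \<beta>) (snd q) else 0)"
        unfolding part_merge[OF J_sub[OF J] *(1,3)[unfolded A_def] *(2,4)] by (cases "\<beta> = \<beta>'") simp_all
    qed
    also have "\<dots> = (\<Sum>\<alpha>\<in>A J. \<Sum>\<beta>\<in>?Z. \<Sum>\<alpha>'\<in>A J. of_real (?p \<alpha> \<alpha>') * Rk (merge J \<alpha> \<beta>) (snd p) (merge J \<alpha>' \<beta>) (snd q))"
      by (intro sum.cong refl) simp
    also have "\<dots> = (\<Sum>\<alpha>\<in>A J. \<Sum>\<alpha>'\<in>A J. \<Sum>\<beta>\<in>?Z. of_real (?p \<alpha> \<alpha>') * Rk (merge J \<alpha> \<beta>) (snd p) (merge J \<alpha>' \<beta>) (snd q))"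
      by (intro sum.cong refl sum.swap)
    also have "\<dots> = \<Phi> J (Bg J \<union> Bb J) x p q"
      unfolding \<Phi>_def sum_distrib_left[symmetric] using pq
      by (intro sum.cong refl arg_cong2[where f="(*)"] dec J) (auto simp: RE_def)
    also have "\<dots> = \<Phi> J (Bg J) x p q + \<Phi> J (Bb J) x p q"
      unfolding \<Phi>_def sum.distrib[symmetric] distrib_left[symmetric]
      by (intro sum.cong refl arg_cong2[where f="(*)"] sum.union_disjoint fin dis)
    finally show ?thesis .
  qed
  define B where "B x Y = (\<Sum>p\<in>RE. \<Sum>q\<in>RE. H x q p * Y x p q)" for x and Y :: "(nat \<Rightarrow> nat) \<Rightarrow> (nat \<Rightarrow> nat) \<times> 'e \<Rightarrow> (nat \<Rightarrow> nat) \<times> 'e \<Rightarrow> complex"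
  have X: "(\<Sum>x\<in>tuples m N. cmod (B x (\<Phi> J (Bg J)))) \<le> sqrt (real (card RE) * ((\<Prod>j<m. if j \<in> J then 2 else 1 / real (K j)) * t J))"
    if J: "J \<in> \<J>" for J
  proof -
    have "(\<Sum>x\<in>tuples m N. cmod (B x (\<Phi> J (Bg J)))) \<le> sqrt (real (card RE) * ((\<Prod>j<m. if j \<in> J then 2 else 1 / real (K j)) *
       (\<Sum>e\<in>E. \<Sum>e'\<in>E. \<Sum>\<alpha>\<in>A J. \<Sum>\<alpha>'\<in>A J. (cmod (\<Sum>b\<in>Bg J. G J b \<alpha> e * cnj (G J b \<alpha>' e')))\<^sup>2)))"
      unfolding B_def \<Phi>_def A_def RE_def by (rule bound_moment[OF fin(1) H[unfolded RE_def]])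
    also have "\<dots> \<le> sqrt (real (card RE) * ((\<Prod>j<m. if j \<in> J then 2 else 1 / real (K j)) * t J))"
      by (intro real_sqrt_le_mono mult_left_mono good J prod_nonneg) auto
    finally show ?thesis .
  qed
  have Y: "(\<Sum>x\<in>tuples m N. cmod (B x (\<Phi> J (Bb J)))) \<le> 2 ^ card J * \<epsilon>" if J: "J \<in> \<J>" for J
  proof -
    have fJ: "finite J" using J_sub[OF J] finite_subset by blast
    define \<Xi> where "\<Xi> I x p q = (\<Sum>\<alpha>\<in>A J. \<Sum>\<alpha>'\<in>A J. complex_of_real (\<Prod>j<m. gpart I j (x j) (fst p j) (fst q j) (\<alpha> j) (\<alpha>' j)) *
     (\<Sum>b\<in>Bb J. G J b \<alpha> (snd p) * cnj (G J b \<alpha>' (snd q))))" for I x p q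
    \<comment> \<open>A kernel with fluctuations need not be positive, so \<open>contr_gram\<close>
      is applied to its expansion over the subsets of \<open>J\<close>. There are
      \<open>2 ^ card J\<close> of them, which explains that factor in front of
      \<open>\<epsilon>\<close>.\<close>
    have "\<Phi> J (Bb J) x p q = (\<Sum>I\<in>Pow J. (-1) ^ card (J - I) * \<Xi> I x p q)" for x p q
    proof -
      have "\<Phi> J (Bb J) x p q = (\<Sum>\<alpha>\<in>A J. \<Sum>\<alpha>'\<in>A J. \<Sum>I\<in>Pow J. (-1) ^ card (J - I) * (complex_of_real (\<Prod>j<m. gpart I j (x j) (fst p j) (fst q j) (\<alpha> j) (\<alpha>' j)) *
         (\<Sum>b\<in>Bb J. G J b \<alpha> (snd p) * cnj (G J b \<alpha>' (snd q)))))"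
        unfolding \<Phi>_def prod_part[OF J_sub[OF J]] of_real_sum sum_distrib_right[of _ _ "\<Sum>b\<in>Bb J. _ b"] by (simp add: mult.assoc)
      also have "\<dots> = (\<Sum>\<alpha>\<in>A J. \<Sum>I\<in>Pow J. \<Sum>\<alpha>'\<in>A J. (-1) ^ card (J - I) * (complex_of_real (\<Prod>j<m. gpart I j (x j) (fst p j) (fst q j) (\<alpha> j) (\<alpha>' j)) *
         (\<Sum>b\<in>Bb J. G J b \<alpha> (snd p) * cnj (G J b \<alpha>' (snd q)))))"
        by (intro sum.cong refl sum.swap)
      also have "\<dots> = (\<Sum>I\<in>Pow J. (-1) ^ card (J - I) * \<Xi> I x p q)"
        unfolding \<Xi>_def sum_distrib_left by (rule sum.swap)
      finally show ?thesis .
    qed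
    then have "B x (\<Phi> J (Bb J)) = (\<Sum>p\<in>RE. \<Sum>q\<in>RE. \<Sum>I\<in>Pow J. (-1) ^ card (J - I) * (H x q p * \<Xi> I x p q))" for x
      unfolding B_def by (simp add: sum_distrib_left mult_ac)
    also have "\<dots> x = (\<Sum>p\<in>RE. \<Sum>I\<in>Pow J. \<Sum>q\<in>RE. (-1) ^ card (J - I) * (H x q p * \<Xi> I x p q))" for x
      by (intro sum.cong refl sum.swap)
    also have "\<dots> x = (\<Sum>I\<in>Pow J. (-1) ^ card (J - I) * B x (\<Xi> I))" for x
      unfolding B_def sum_distrib_left by (rule sum.swap)
    finally have "cmod (B x (\<Phi> J (Bb J))) \<le> (\<Sum>I\<in>Pow J. cmod (B x (\<Xi> I)))" for x
      by (simp only:) (rule order_trans[OF norm_sum], simp add: norm_mult norm_power)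
    then have "(\<Sum>x\<in>tuples m N. cmod (B x (\<Phi> J (Bb J)))) \<le> (\<Sum>x\<in>tuples m N. \<Sum>I\<in>Pow J. cmod (B x (\<Xi> I)))"
      by (intro sum_mono)
    also have "\<dots> = (\<Sum>I\<in>Pow J. \<Sum>x\<in>tuples m N. cmod (B x (\<Xi> I)))" by (rule sum.swap)
    also have "\<dots> \<le> (\<Sum>I\<in>Pow J. \<epsilon>)"
    proof (intro sum_mono)
      fix I
      have "(\<Sum>x\<in>tuples m N. cmod (B x (\<Xi> I))) \<le> (\<Sum>b\<in>Bb J. \<Sum>\<alpha>\<in>A J. \<Sum>e\<in>E. (cmod (G J b \<alpha> e))\<^sup>2)"
        unfolding B_def \<Xi>_def A_def RE_def by (rule bound_gram[OF fin(1) fin(3) H[unfolded RE_def]])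
      also have "\<dots> \<le> \<epsilon>" by (rule bad[OF J])
      finally show "(\<Sum>x\<in>tuples m N. cmod (B x (\<Xi> I))) \<le> \<epsilon>" .
    qed
    also have "\<dots> = 2 ^ card J * \<epsilon>" using fJ by (simp add: card_Pow)
    finally show ?thesis .
  qed
  have fin\<J>: "finite \<J>" by (simp add: \<J>_def)
  have "(\<Sum>x\<in>tuples m N. Re (\<Sum>p\<in>RE. \<Sum>q\<in>RE. H x q p *
       ((\<Sum>z\<in>Z. M x p z * cnj (M x q z)) - (if p = q then of_real (lam (snd p) / (\<Prod>j<m. real (K j) * real (N j))) else 0))))
    = (\<Sum>x\<in>tuples m N. Re (\<Sum>p\<in>RE. \<Sum>q\<in>RE. \<Sum>J\<in>\<J>. H x q p * \<Phi> J (Bg J) x p q + H x q p * \<Phi> J (Bb J) x p q))"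
  proof (intro sum.cong refl arg_cong[where f=Re])
    fix x p q assume *: "x \<in> tuples m N" "p \<in> RE" "q \<in> RE"
    show "H x q p * ((\<Sum>z\<in>Z. M x p z * cnj (M x q z)) - (if p = q then of_real (lam (snd p) / (\<Prod>j<m. real (K j) * real (N j))) else 0))
      = (\<Sum>J\<in>\<J>. H x q p * \<Phi> J (Bg J) x p q + H x q p * \<Phi> J (Bb J) x p q)"
      unfolding expand[OF *] sum_distrib_left using * by (intro sum.cong refl) (simp add: reduce distrib_left)
  qed
  also have "\<dots> = (\<Sum>x\<in>tuples m N. Re (\<Sum>J\<in>\<J>. B x (\<Phi> J (Bg J)) + B x (\<Phi> J (Bb J))))"
  proof (intro sum.cong refl arg_cong[where f=Re])
    fix x
    have "(\<Sum>p\<in>RE. \<Sum>q\<in>RE. \<Sum>J\<in>\<J>. H x q p * \<Phi> J (Bg J) x p q + H x q p * \<Phi> J (Bb J) x p q)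
      = (\<Sum>p\<in>RE. \<Sum>J\<in>\<J>. \<Sum>q\<in>RE. H x q p * \<Phi> J (Bg J) x p q + H x q p * \<Phi> J (Bb J) x p q)"
      by (intro sum.cong refl sum.swap)
    also have "\<dots> = (\<Sum>J\<in>\<J>. \<Sum>p\<in>RE. \<Sum>q\<in>RE. H x q p * \<Phi> J (Bg J) x p q + H x q p * \<Phi> J (Bb J) x p q)"
      by (rule sum.swap)
    finally show "(\<Sum>p\<in>RE. \<Sum>q\<in>RE. \<Sum>J\<in>\<J>. H x q p * \<Phi> J (Bg J) x p q + H x q p * \<Phi> J (Bb J) x p q)
      = (\<Sum>J\<in>\<J>. B x (\<Phi> J (Bg J)) + B x (\<Phi> J (Bb J)))"
      unfolding B_def sum.distrib .
  qed
  also have "\<dots> \<le> (\<Sum>x\<in>tuples m N. \<Sum>J\<in>\<J>. cmod (B x (\<Phi> J (Bg J))) + cmod (B x (\<Phi> J (Bb J))))"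
    unfolding Re_sum by (intro sum_mono) (simp add: add_mono complex_Re_le_cmod)
  also have "\<dots> = (\<Sum>J\<in>\<J>. \<Sum>x\<in>tuples m N. cmod (B x (\<Phi> J (Bg J))) + cmod (B x (\<Phi> J (Bb J))))"
    by (rule sum.swap)
  also have "\<dots> \<le> (\<Sum>J\<in>\<J>. sqrt (real (card RE) * ((\<Prod>j<m. if j \<in> J then 2 else 1 / real (K j)) * t J)) + 2 ^ card J * \<epsilon>)"
    unfolding sum.distrib by (intro add_mono sum_mono X Y)
  finally show ?thesis .
qed

end

context sign_measurement
begin

text \<open>The outcome probabilities add up: for \<open>I = UNIV\<close> the kernels
  \<open>gpart\<close> are all \<open>tau\<close>, and \<open>gpart_sum\<close> makes the
  measurement trace preserving.\<close>

lemma total_trace: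
  fixes f :: "'e \<Rightarrow> (nat \<Rightarrow> nat) \<Rightarrow> nat \<Rightarrow> complex" and Z :: "nat set"
  defines "M \<equiv> \<lambda>x p z. \<Sum>a\<in>tuples m D. of_real (\<Prod>j<m. g j (x j) (fst p j) (a j) / sqrt (real (K j) * real (N j))) * f (snd p) a z"
  assumes norm: "\<And>e. e \<in> E \<Longrightarrow> (\<Sum>a\<in>tuples m D. \<Sum>z\<in>Z. f e a z * cnj (f e a z)) = of_real (lam e)"
  shows "(\<Sum>x\<in>tuples m N. \<Sum>p\<in>tuples m K \<times> E. \<Sum>z\<in>Z. (cmod (M x p z))\<^sup>2) = (\<Sum>e\<in>E. lam e)"
proof -
  let ?T = "tuples m D"
  define L where "L a a' = (\<Sum>x\<in>tuples m N. \<Sum>r\<in>tuples m K. \<Prod>j<m. gpart UNIV j (x j) (r j) (r j) (a j) (a' j))" for a a'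
  have L: "L a a' = (if a = a' then 1 else 0)" if a: "a \<in> ?T" "a' \<in> ?T" for a a'
  proof -
    have "L a a' = (\<Prod>j<m. \<Sum>x<N j. \<Sum>r<K j. gpart UNIV j x r r (a j) (a' j))"
      unfolding L_def by (rule sum2_tuples_prod)
    also have "\<dots> = (\<Prod>j<m. if a j = a' j then 1 else 0)"
      by (intro prod.cong refl gpart_sum) (use a tuplesD(1) in auto)
    also have "\<dots> = (if a = a' then 1 else 0)"
    proof (cases "a = a'")
      case False
      then obtain j where "a j \<noteq> a' j" by auto
      moreover then have "j < m" using a tuplesD(2) by (metis not_less)
      ultimately show ?thesis using False by (auto intro!: prod_zero)
    qed simp
    finally show ?thesis .
  qed
  have one: "complex_of_real (\<Sum>x\<in>tuples m N. \<Sum>r\<in>tuples m K. (cmod (M x (r,e) z))\<^sup>2)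
     = (\<Sum>a\<in>?T. f e a z * cnj (f e a z))" for e z
  proof -
    have "complex_of_real (\<Sum>x\<in>tuples m N. \<Sum>r\<in>tuples m K. (cmod (M x (r,e) z))\<^sup>2)
      = (\<Sum>x\<in>tuples m N. \<Sum>r\<in>tuples m K. \<Sum>a\<in>?T. \<Sum>a'\<in>?T.
          of_real (\<Prod>j<m. gpart UNIV j (x j) (r j) (r j) (a j) (a' j)) * (f e a z * cnj (f e a' z)))"
      unfolding of_real_sum mult_cnj_eq(1)[symmetric]
    proof (intro sum.cong refl)
      fix x r
      have t: "(\<Prod>j<m. g j (x j) (r j) (a j) / sqrt (real (K j) * real (N j))) * (\<Prod>j<m. g j (x j) (r j) (a' j) / sqrt (real (K j) * real (N j)))
         = (\<Prod>j<m. gpart UNIV j (x j) (r j) (r j) (a j) (a' j))" for a a'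
        unfolding prod.distrib[symmetric] gpart_def tau_def times_divide_times_eq by (intro prod.cong refl) simp
      show "M x (r,e) z * cnj (M x (r,e) z) = (\<Sum>a\<in>?T. \<Sum>a'\<in>?T.
          of_real (\<Prod>j<m. gpart UNIV j (x j) (r j) (r j) (a j) (a' j)) * (f e a z * cnj (f e a' z)))"
        unfolding M_def fst_conv snd_conv cnj_sum sum_product t[symmetric] of_real_mult
        by (intro sum.cong refl) (simp add: mult_ac)
    qed
    also have "\<dots> = (\<Sum>x\<in>tuples m N. \<Sum>a\<in>?T. \<Sum>r\<in>tuples m K. \<Sum>a'\<in>?T.
          of_real (\<Prod>j<m. gpart UNIV j (x j) (r j) (r j) (a j) (a' j)) * (f e a z * cnj (f e a' z)))"
      by (intro sum.cong refl sum.swap)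
    also have "\<dots> = (\<Sum>a\<in>?T. \<Sum>x\<in>tuples m N. \<Sum>r\<in>tuples m K. \<Sum>a'\<in>?T.
          of_real (\<Prod>j<m. gpart UNIV j (x j) (r j) (r j) (a j) (a' j)) * (f e a z * cnj (f e a' z)))"
      by (rule sum.swap)
    also have "\<dots> = (\<Sum>a\<in>?T. \<Sum>x\<in>tuples m N. \<Sum>a'\<in>?T. \<Sum>r\<in>tuples m K.
          of_real (\<Prod>j<m. gpart UNIV j (x j) (r j) (r j) (a j) (a' j)) * (f e a z * cnj (f e a' z)))"
      by (intro sum.cong refl sum.swap)
    also have "\<dots> = (\<Sum>a\<in>?T. \<Sum>a'\<in>?T. \<Sum>x\<in>tuples m N. \<Sum>r\<in>tuples m K.
          of_real (\<Prod>j<m. gpart UNIV j (x j) (r j) (r j) (a j) (a' j)) * (f e a z * cnj (f e a' z)))"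
      by (intro sum.cong refl sum.swap)
    also have "\<dots> = (\<Sum>a\<in>?T. \<Sum>a'\<in>?T. of_real (L a a') * (f e a z * cnj (f e a' z)))"
      unfolding L_def of_real_sum sum_distrib_right ..
    also have "\<dots> = (\<Sum>a\<in>?T. \<Sum>a'\<in>?T. (if a = a' then 1 else 0) * (f e a z * cnj (f e a' z)))"
      by (intro sum.cong refl) (simp add: L)
    finally show ?thesis by (simp add: sum_delta_mult)
  qed
  have "(\<Sum>x\<in>tuples m N. \<Sum>p\<in>tuples m K \<times> E. \<Sum>z\<in>Z. (cmod (M x p z))\<^sup>2)
    = (\<Sum>x\<in>tuples m N. \<Sum>r\<in>tuples m K. \<Sum>e\<in>E. \<Sum>z\<in>Z. (cmod (M x (r,e) z))\<^sup>2)"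
    unfolding sum_pairs ..
  also have "\<dots> = (\<Sum>e\<in>E. \<Sum>x\<in>tuples m N. \<Sum>r\<in>tuples m K. \<Sum>z\<in>Z. (cmod (M x (r,e) z))\<^sup>2)"
    by (subst sum.swap[of _ E "tuples m K"], rule sum.swap)
  also have "\<dots> = (\<Sum>e\<in>E. \<Sum>x\<in>tuples m N. \<Sum>z\<in>Z. \<Sum>r\<in>tuples m K. (cmod (M x (r,e) z))\<^sup>2)"
    by (intro sum.cong refl sum.swap)
  also have "\<dots> = (\<Sum>e\<in>E. \<Sum>z\<in>Z. \<Sum>x\<in>tuples m N. \<Sum>r\<in>tuples m K. (cmod (M x (r,e) z))\<^sup>2)"
    by (intro sum.cong refl sum.swap)
  finally have "complex_of_real (\<Sum>x\<in>tuples m N. \<Sum>p\<in>tuples m K \<times> E. \<Sum>z\<in>Z. (cmod (M x p z))\<^sup>2)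
    = (\<Sum>e\<in>E. \<Sum>z\<in>Z. \<Sum>a\<in>?T. f e a z * cnj (f e a z))"
    by (simp only: of_real_sum[of _ E] of_real_sum[of _ Z] one)
  also have "\<dots> = (\<Sum>e\<in>E. \<Sum>a\<in>?T. \<Sum>z\<in>Z. f e a z * cnj (f e a z))"
    by (intro sum.cong refl sum.swap)
  also have "\<dots> = of_real (\<Sum>e\<in>E. lam e)" by (simp add: norm)
  finally show ?thesis by (simp only: of_real_eq_iff)
qed

end

section \<open>Instruments of the decoder and the GHZ target\<close>

lemma instrument_completeI:
  assumes E: "\<And>x. x < N \<Longrightarrow> E x \<in> carrier_mat k n"
    and s: "\<And>a a'. a < n \<Longrightarrow> a' < n \<Longrightarrow> (\<Sum>x<N. \<Sum>r<k. cnj (E x $$ (r,a)) * E x $$ (r,a')) = (if a = a' then 1 else 0)"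
  shows "msum n n (\<lambda>x. mat_adjoint (E x) * E x) N = 1\<^sub>m n"
proof (rule eq_matI)
  have c: "mat_adjoint (E x) * E x \<in> carrier_mat n n" if "x < N" for x
    using E[OF that] by (intro mult_carrier_mat adj_carrier) auto
  have mc: "msum n n (\<lambda>x. mat_adjoint (E x) * E x) N \<in> carrier_mat n n"
    by (rule msum_carrier) (rule c)
  show "dim_row (msum n n (\<lambda>x. mat_adjoint (E x) * E x) N) = dim_row (1\<^sub>m n)"
    "dim_col (msum n n (\<lambda>x. mat_adjoint (E x) * E x) N) = dim_col (1\<^sub>m n)"
    using mc by auto
  fix a a' assume "a < dim_row (1\<^sub>m n)" "a' < dim_col (1\<^sub>m n)"
  then have a: "a < n" "a' < n" by auto
  have "msum n n (\<lambda>x. mat_adjoint (E x) * E x) N $$ (a,a') = (\<Sum>x<N. (mat_adjoint (E x) * E x) $$ (a,a'))"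
    by (rule msum_index[OF c a])
  also have "\<dots> = (\<Sum>x<N. \<Sum>r<k. cnj (E x $$ (r,a)) * E x $$ (r,a'))"
  proof (intro sum.cong refl)
    fix x assume "x \<in> {..<N}"
    then have Ex: "E x \<in> carrier_mat k n" using E by simp
    show "(mat_adjoint (E x) * E x) $$ (a,a') = (\<Sum>r<k. cnj (E x $$ (r,a)) * E x $$ (r,a'))"
      unfolding index_mult_sum[OF adj_carrier[OF Ex] Ex a] using Ex a
      by (intro sum.cong refl arg_cong2[where f="(*)"] adj_index) auto
  qed
  also have "\<dots> = (if a = a' then 1 else 0)" by (rule s[OF a])
  finally show "msum n n (\<lambda>x. mat_adjoint (E x) * E x) N $$ (a,a') = 1\<^sub>m n $$ (a,a')" using a by simp
qed

text \<open>The index tuple of the other parties whose offsets relative to the register value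
  \<open>t\<close> are \<open>c\<close>. The entry of \<open>i0\<close> is 0, as its register holds
  \<open>t\<close> itself.\<close>

definition shift :: "nat \<Rightarrow> nat \<Rightarrow> nat \<Rightarrow> nat \<Rightarrow> (nat \<Rightarrow> nat) \<Rightarrow> nat \<Rightarrow> nat" where
  "shift m i0 K t c = (\<lambda>j. if j < m \<and> j \<noteq> i0 then (t + c j) mod K else 0)"

lemma bij_shift:
  fixes K :: nat
  assumes t: "t < K" and i0: "i0 < m"
  shows "bij_betw (shift m i0 K t) (tuples m ((\<lambda>_. K)(i0 := 1))) (tuples m ((\<lambda>_. K)(i0 := 1)))"
\<comment> \<open>For \<open>t = 0\<close> the inverse shifts by \<open>K\<close>, which is trivial
  modulo \<open>K\<close>.\<close>
proof (rule bij_betwI[where g="shift m i0 K (K - t)"])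
  have K: "K > 0" using t by simp
  show "shift m i0 K t \<in> tuples m ((\<lambda>_. K)(i0 := 1)) \<rightarrow> tuples m ((\<lambda>_. K)(i0 := 1))"
    "shift m i0 K (K - t) \<in> tuples m ((\<lambda>_. K)(i0 := 1)) \<rightarrow> tuples m ((\<lambda>_. K)(i0 := 1))"
    using K by (auto simp: shift_def tuples_def)
  have inv: "(u + (v + c) mod K) mod K = c" if "c < K" "u + v = K" for u v c
  proof -
    have "(u + (v + c) mod K) mod K = (u + (v + c)) mod K" by (simp add: mod_add_right_eq)
    also have "u + (v + c) = K + c" using that by simp
    finally show ?thesis using that by simp
  qed
  fix c assume c: "c \<in> tuples m ((\<lambda>_. K)(i0 := 1))"
  have cK: "c j < K" if "j < m" "j \<noteq> i0" for j using tuplesD(1)[OF c that(1)] that by simp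
  have c0: "c j = 0" if "\<not> (j < m \<and> j \<noteq> i0)" for j
    using tuplesD(1)[OF c i0] tuplesD(2)[OF c, of j] that by (cases "j < m") auto
  show "shift m i0 K (K - t) (shift m i0 K t c) = c"
  proof
    fix j
    show "shift m i0 K (K - t) (shift m i0 K t c) j = c j"
      using inv[OF cK[of j], of "K - t" t] c0[of j] t by (cases "j < m \<and> j \<noteq> i0") (auto simp: shift_def)
  qed
  show "shift m i0 K t (shift m i0 K (K - t) c) = c"
  proof
    fix j
    show "shift m i0 K t (shift m i0 K (K - t) c) j = c j"
      using inv[OF cK[of j], of t "K - t"] c0[of j] t by (cases "j < m \<and> j \<noteq> i0") (auto simp: shift_def)
  qed
qed

text \<open>The decoder: first apply the partial isometry \<open>W\<close>, then measure the environment label \<open>e\<close>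
  and the offsets \<open>c\<close> of the other parties' systems relative to a register \<open>b\<close> that is kept. The
  offsets are measured redundantly, whence the factor \<open>1 / sqrt K\<close>. The remaining operators
  complete the instrument.\<close>

lemma decoder_instrument:
  fixes W :: "(nat \<Rightarrow> nat) \<times> 'e \<Rightarrow> nat \<Rightarrow> complex" and K :: nat
  assumes fin: "finite E" and K: "K \<ge> 1" and i0: "i0 < m"
  defines "C \<equiv> tuples m ((\<lambda>_. K)(i0 := 1))"
  defines "RE \<equiv> C \<times> E"
  assumes idem: "\<And>z z'. (\<Sum>y<dz. (\<Sum>p\<in>RE. cnj (W p z) * W p y) * (\<Sum>p\<in>RE. cnj (W p y) * W p z')) = (\<Sum>p\<in>RE. cnj (W p z) * W p z')"
  obtains n1 n2 :: nat and b :: "nat \<Rightarrow> (nat \<Rightarrow> nat) \<times> 'e" and \<kappa> where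
    "n1 \<le> n2" "bij_betw b {..<n1} RE" "\<And>y. y < n2 \<Longrightarrow> \<kappa> y \<in> carrier_mat K dz"
    "msum dz dz (\<lambda>y. mat_adjoint (\<kappa> y) * \<kappa> y) n2 = 1\<^sub>m dz"
    "\<And>y t z. y < n1 \<Longrightarrow> t < K \<Longrightarrow> z < dz \<Longrightarrow>
       \<kappa> y $$ (t,z) = cnj (W (shift m i0 K t (fst (b y)), snd (b y)) z) / of_real (sqrt (real K))"
proof -
  define G where "G z z' = (\<Sum>p\<in>RE. W p z * cnj (W p z'))" for z z'
  \<comment> \<open>\<open>G\<close> is the projection onto the support of the decoder and
    \<open>T\<close> the complementary one; the rows of \<open>T\<close> become the operators that
    complete the instrument.\<close>
  define T where "T z z' = (if z = z' then 1 else 0) - G z z'" for z z'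
  have G_cnj: "cnj (G z z') = G z' z" for z z' by (simp add: G_def mult.commute)
  have T_cnj: "cnj (T z z') = T z' z" for z z' by (simp add: T_def G_cnj)
  have GG: "(\<Sum>y<dz. G z y * G y z') = G z z'" for z z'
  proof -
    have "(\<Sum>y<dz. G z' y * G y z) = G z' z" for z z'
    proof -
      have "(\<Sum>y<dz. G z' y * G y z) = cnj (\<Sum>y<dz. (\<Sum>p\<in>RE. cnj (W p z') * W p y) * (\<Sum>p\<in>RE. cnj (W p y) * W p z))"
        unfolding G_def by (simp add: mult.commute)
      also have "\<dots> = G z' z" unfolding idem by (simp add: G_def)
      finally show ?thesis .
    qed
    then show ?thesis by blast
  qed
  have TT: "(\<Sum>y<dz. T z y * T y z') = T z z'" if "z < dz" "z' < dz" for z z'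
  proof -
    have "(\<Sum>y<dz. T z y * T y z') = (\<Sum>y<dz. (if z = y then 1 else 0) * (if y = z' then 1 else 0) - (if z = y then 1 else 0) * G y z'
       - G z y * (if y = z' then 1 else 0) + G z y * G y z')"
    proof -
      have e: "(a - c) * (b - d) = a * b - a * d - c * b + c * d" for a b c d :: complex
        by (simp add: algebra_simps)
      show ?thesis unfolding T_def e ..
    qed
    also have "\<dots> = T z z'"
      using that by (simp only: sum.distrib sum_subtractf sum_delta_mult finite_lessThan GG) (simp add: T_def)
    finally show ?thesis .
  qed
  have finRE: "finite RE" using fin by (simp add: RE_def C_def)
  obtain b where b: "bij_betw b {..<card RE} RE"
    using ex_bij_betw_nat_finite[OF finRE] by (auto simp: atLeast0LessThan)
  define \<kappa> where "\<kappa> y = mat K dz (\<lambda>(t,z). if y < card RE then cnj (W (shift m i0 K t (fst (b y)), snd (b y)) z) / of_real (sqrt (real K))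
     else if t = 0 then T (y - card RE) z else 0)" for y
  have sK: "complex_of_real (sqrt (real K)) * of_real (sqrt (real K)) = of_nat K"
    unfolding of_real_mult[symmetric] by simp
  have main: "(\<Sum>y<card RE + dz. \<Sum>t<K. cnj (\<kappa> y $$ (t,z)) * \<kappa> y $$ (t,z')) = (if z = z' then 1 else 0)"
    if z: "z < dz" "z' < dz" for z z'
  proof -
    have "(\<Sum>y<card RE. \<Sum>t<K. cnj (\<kappa> y $$ (t,z)) * \<kappa> y $$ (t,z'))
      = (\<Sum>y<card RE. \<Sum>t<K. W (shift m i0 K t (fst (b y)), snd (b y)) z * cnj (W (shift m i0 K t (fst (b y)), snd (b y)) z') / of_nat K)"
      using z by (intro sum.cong refl) (simp add: \<kappa>_def sK)
    also have "\<dots> = (\<Sum>p\<in>RE. \<Sum>t<K. W (shift m i0 K t (fst p), snd p) z * cnj (W (shift m i0 K t (fst p), snd p) z') / of_nat K)"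
      by (rule sum.reindex_bij_betw[OF b])
    also have "\<dots> = (\<Sum>t<K. \<Sum>p\<in>RE. W (shift m i0 K t (fst p), snd p) z * cnj (W (shift m i0 K t (fst p), snd p) z') / of_nat K)"
      by (rule sum.swap)
    \<comment> \<open>For every \<open>t\<close> the shift only permutes the offsets, so each of the
      \<open>K\<close> register values contributes the same share.\<close>
    also have "\<dots> = (\<Sum>t<K. G z z' / of_nat K)"
    proof (intro sum.cong refl)
      fix t assume "t \<in> {..<K}"
      then have bs: "bij_betw (shift m i0 K t) C C" unfolding C_def by (intro bij_shift i0) simp
      have "(\<Sum>p\<in>RE. W (shift m i0 K t (fst p), snd p) z * cnj (W (shift m i0 K t (fst p), snd p) z'))
        = (\<Sum>c\<in>C. \<Sum>e\<in>E. W (shift m i0 K t c, e) z * cnj (W (shift m i0 K t c, e) z'))"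
        unfolding RE_def sum_pairs fst_conv snd_conv ..
      also have "\<dots> = (\<Sum>c\<in>C. \<Sum>e\<in>E. W (c, e) z * cnj (W (c, e) z'))"
        by (rule sum.reindex_bij_betw[OF bs])
      also have "\<dots> = G z z'" unfolding G_def RE_def sum_pairs ..
      finally show "(\<Sum>p\<in>RE. W (shift m i0 K t (fst p), snd p) z * cnj (W (shift m i0 K t (fst p), snd p) z') / of_nat K) = G z z' / of_nat K"
        by (simp only: sum_divide_distrib[symmetric])
    qed
    also have "\<dots> = G z z'" using K by simp
    finally have 1: "(\<Sum>y<card RE. \<Sum>t<K. cnj (\<kappa> y $$ (t,z)) * \<kappa> y $$ (t,z')) = G z z'" .
    have "(\<Sum>s<dz. \<Sum>t<K. cnj (\<kappa> (card RE + s) $$ (t,z)) * \<kappa> (card RE + s) $$ (t,z'))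
      = (\<Sum>s<dz. \<Sum>t<K. if t = 0 then T z s * T s z' else 0)"
      using z by (intro sum.cong refl) (simp add: \<kappa>_def T_cnj)
    also have "\<dots> = T z z'" using K z by (simp add: TT)
    finally have 2: "(\<Sum>s<dz. \<Sum>t<K. cnj (\<kappa> (card RE + s) $$ (t,z)) * \<kappa> (card RE + s) $$ (t,z')) = T z z'" .
    have sp: "(\<Sum>y<k + l. h y) = (\<Sum>y<k. h y) + (\<Sum>s<l. h (k + s))" for k l :: nat and h :: "nat \<Rightarrow> complex"
      by (induction l) (simp_all add: add.assoc)
    show ?thesis unfolding sp 1 2 by (simp add: T_def)
  qed
  show thesis
  proof (rule that[of "card RE" "card RE + dz" b \<kappa>])
    show "msum dz dz (\<lambda>y. mat_adjoint (\<kappa> y) * \<kappa> y) (card RE + dz) = 1\<^sub>m dz"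
      by (rule instrument_completeI[where k=K]) (simp_all add: main, simp add: \<kappa>_def)
  qed (simp_all add: b \<kappa>_def)
qed

definition diag :: "nat \<Rightarrow> nat \<Rightarrow> nat \<Rightarrow> nat" where
  "diag m t = (\<lambda>j. if j < m then t else 0)"

text \<open>The \<open>K\<close>-level GHZ vector. For \<open>K = 2 ^ k\<close> it is the product of
  \<open>k\<close> qubit GHZ vectors read digitwise (\<open>ghz_vec_digits\<close>), so the one-shot
  protocol never handles qubits.\<close>

definition ghz_vec :: "nat \<Rightarrow> nat \<Rightarrow> (nat \<Rightarrow> nat) \<Rightarrow> complex" where
  "ghz_vec m K y = (if y \<in> diag m ` {..<K} then 1 / of_real (sqrt (real K)) else 0)"

lemma diag_inj: "m \<ge> 1 \<Longrightarrow> inj_on (diag m) S"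
  unfolding inj_on_def diag_def by (metis One_nat_def Suc_le_eq)

lemma diag_tuples: "t < K \<Longrightarrow> diag m t \<in> tuples m (\<lambda>_. K)"
  by (auto simp: diag_def tuples_def)

lemma ghz_vec_sum:
  assumes "m \<ge> 1"
  shows "(\<Sum>y\<in>tuples m (\<lambda>_. K). ghz_vec m K y * F y) = (\<Sum>t<K. F (diag m t)) / of_real (sqrt (real K))"
proof -
  have "(\<Sum>y\<in>tuples m (\<lambda>_. K). ghz_vec m K y * F y) = (\<Sum>y\<in>diag m ` {..<K}. ghz_vec m K y * F y)"
    by (rule sum.mono_neutral_right) (auto simp: ghz_vec_def diag_tuples)
  also have "\<dots> = (\<Sum>t<K. ghz_vec m K (diag m t) * F (diag m t))"
    using sum.reindex[OF diag_inj[OF assms]] by simp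
  also have "\<dots> = (\<Sum>t<K. F (diag m t) / of_real (sqrt (real K)))"
    by (intro sum.cong refl) (simp add: ghz_vec_def)
  finally show ?thesis by (simp only: sum_divide_distrib)
qed

lemma ghz_vec_norm:
  assumes "m \<ge> 1" "K \<ge> 1"
  shows "(\<Sum>y\<in>tuples m (\<lambda>_. K). (cmod (ghz_vec m K y))\<^sup>2) = 1"
proof -
  have "complex_of_real (\<Sum>y\<in>tuples m (\<lambda>_. K). (cmod (ghz_vec m K y))\<^sup>2) = (\<Sum>y\<in>tuples m (\<lambda>_. K). ghz_vec m K y * cnj (ghz_vec m K y))"
    unfolding mult_cnj_eq of_real_sum ..
  also have "\<dots> = (\<Sum>t<K. cnj (ghz_vec m K (diag m t))) / of_real (sqrt (real K))" by (rule ghz_vec_sum[OF assms(1)])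
  also have "\<dots> = (\<Sum>t<K. 1 / of_real (sqrt (real K))) / of_real (sqrt (real K))"
    by (intro arg_cong2[where f="(/)"] sum.cong refl) (simp add: ghz_vec_def)
  also have "\<dots> = of_nat K / (of_real (sqrt (real K)) * of_real (sqrt (real K)))" by simp
  also have "\<dots> = of_real 1" unfolding of_real_mult[symmetric] using assms(2) by simp
  finally show ?thesis by (simp only: of_real_eq_iff)
qed

lemma pop_perm:
  assumes s: "\<And>j y. j < m \<Longrightarrow> y < K \<Longrightarrow> s j y < K" and y: "y \<in> tuples m (\<lambda>_. K)"
  shows "pop m (\<lambda>_. K) (\<lambda>j _. mat K K (\<lambda>(y,r). if r = s j y then 1 else 0)) x \<phi> y = \<phi> (\<lambda>j. if j < m then s j (y j) else 0)"
proof -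
  let ?a = "\<lambda>j. if j < m then s j (y j) else 0"
  have a: "?a \<in> tuples m (\<lambda>_. K)" using s tuplesD(1)[OF y] by (auto simp: tuples_def)
  have "pop m (\<lambda>_. K) (\<lambda>j _. mat K K (\<lambda>(y,r). if r = s j y then 1 else 0)) x \<phi> y
    = (\<Sum>b\<in>tuples m (\<lambda>_. K). (if b = ?a then 1 else 0) * \<phi> b)"
    unfolding pop_def
  proof (intro sum.cong refl arg_cong2[where f="(*)"])
    fix b assume b: "b \<in> tuples m (\<lambda>_. K)"
    show "\<phi> (mix m b y) = \<phi> b"
    proof (rule arg_cong[where f=\<phi>], rule ext)
      show "mix m b y j = b j" for j using tuplesD(2)[OF b, of j] tuplesD(2)[OF y, of j] by (simp add: mix_def)
    qed
    have "(\<Prod>j<m. mat K K (\<lambda>(y,r). if r = s j y then 1 else 0) $$ (y j, b j)) = (\<Prod>j<m. if b j = s j (y j) then 1 else (0::complex))"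
      using tuplesD(1)[OF b] tuplesD(1)[OF y] by (intro prod.cong refl) simp
    also have "\<dots> = (if b = ?a then 1 else 0)"
    proof (cases "b = ?a")
      case False
      then obtain j where "b j \<noteq> ?a j" by blast
      moreover then have "j < m" using tuplesD(2)[OF b, of j] by (cases "j < m") auto
      ultimately show ?thesis using False by (auto intro!: prod_zero)
    qed simp
    finally show "(\<Prod>j<m. mat K K (\<lambda>(y,r). if r = s j y then 1 else 0) $$ (y j, b j)) = (if b = ?a then 1 else (0::complex))" .
  qed
  then show ?thesis using a by (simp add: sum_delta_mult)
qed

text \<open>\<open>i0\<close> applies the identity, so its index \<open>z\<close> passes through and
  only the indices of the other parties are summed. Replacing its dimension by 1, with
  \<open>h i0 0 0 = 1\<close>, puts the result into the form used in
  \<open>sign_measurement\<close>.\<close>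

lemma pop_except_identity:
  assumes i0: "i0 < m" and r: "r \<in> tuples m (K(i0 := 1))" and z: "z < d i0"
    and id: "\<And>a. a < d i0 \<Longrightarrow> E i0 (x i0) $$ (z, a) = (if a = z then 1 else 0)"
    and c: "\<And>j a. j < m \<Longrightarrow> j \<noteq> i0 \<Longrightarrow> a < d j \<Longrightarrow> E j (x j) $$ (r j, a) = of_real (h j (r j) a)"
    and h0: "h i0 0 0 = 1"
  shows "pop m d E x \<phi> (r(i0 := z)) = (\<Sum>a\<in>tuples m (d(i0 := 1)). of_real (\<Prod>j<m. h j (r j) (a j)) * \<phi> (a(i0 := z)))"
proof -
  let ?T = "(\<lambda>a. a(i0 := z)) ` tuples m (d(i0 := 1))"
  have r0: "r i0 = 0" using tuplesD(1)[OF r i0] by simp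
  have mx: "mix m a (r(i0 := z)) = a" if "a \<in> tuples m d" for a
    using tuplesD(2)[OF that] tuplesD(2)[OF r] i0 by (auto simp: mix_def fun_eq_iff not_less)
  have sub: "?T \<subseteq> tuples m d"
  proof safe
    fix a assume a: "a \<in> tuples m (d(i0 := 1))"
    show "a(i0 := z) \<in> tuples m d"
      unfolding tuples_def
    proof (intro CollectI conjI allI impI)
      fix j assume "j < m" then show "(a(i0 := z)) j < d j" using tuplesD(1)[OF a, of j] z by (cases "j = i0") auto
    next
      fix j assume "m \<le> j" then show "(a(i0 := z)) j = 0" using tuplesD(2)[OF a, of j] i0 by simp
    qed
  qed
  have "pop m d E x \<phi> (r(i0 := z)) = (\<Sum>a\<in>tuples m d. (\<Prod>j<m. E j (x j) $$ ((r(i0 := z)) j, a j)) * \<phi> a)"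
    unfolding pop_def by (intro sum.cong refl) (simp add: mx)
  also have "\<dots> = (\<Sum>a\<in>?T. (\<Prod>j<m. E j (x j) $$ ((r(i0 := z)) j, a j)) * \<phi> a)"
  proof (rule sum.mono_neutral_right[OF finite_tuples sub], rule ballI)
    fix a assume a: "a \<in> tuples m d - ?T"
    have "a i0 \<noteq> z"
    proof
      assume e: "a i0 = z"
      have "a(i0 := 0) \<in> tuples m (d(i0 := 1))" using a by (auto simp: tuples_def)
      moreover have "a = (a(i0 := 0))(i0 := z)" using e by auto
      ultimately show False using a by blast
    qed
    then have "E i0 (x i0) $$ ((r(i0 := z)) i0, a i0) = 0" using id[of "a i0"] a tuplesD(1)[of a m d i0] i0 by simp
    then have "(\<Prod>j<m. E j (x j) $$ ((r(i0 := z)) j, a j)) = 0" using i0 by (intro prod_zero) auto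
    then show "(\<Prod>j<m. E j (x j) $$ ((r(i0 := z)) j, a j)) * \<phi> a = 0" by simp
  qed
  also have "\<dots> = (\<Sum>a\<in>tuples m (d(i0 := 1)). (\<Prod>j<m. E j (x j) $$ ((r(i0 := z)) j, (a(i0 := z)) j)) * \<phi> (a(i0 := z)))"
  proof -
    have "inj_on (\<lambda>a. a(i0 := z)) (tuples m (d(i0 := 1)))"
    proof (rule inj_onI)
      fix a a' assume *: "a \<in> tuples m (d(i0 := 1))" "a' \<in> tuples m (d(i0 := 1))" "a(i0 := z) = a'(i0 := z)"
      have "a i0 = 0" "a' i0 = 0" using tuplesD(1)[OF *(1) i0] tuplesD(1)[OF *(2) i0] by simp_all
      then show "a = a'" using *(3) by (metis fun_upd_triv fun_upd_upd)
    qed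
    then show ?thesis by (rule sum.reindex[unfolded o_def])
  qed
  also have "\<dots> = (\<Sum>a\<in>tuples m (d(i0 := 1)). of_real (\<Prod>j<m. h j (r j) (a j)) * \<phi> (a(i0 := z)))"
  proof (intro sum.cong refl arg_cong2[where f="(*)"])
    fix a assume a: "a \<in> tuples m (d(i0 := 1))"
    show "(\<Prod>j<m. E j (x j) $$ ((r(i0 := z)) j, (a(i0 := z)) j)) = of_real (\<Prod>j<m. h j (r j) (a j))"
      unfolding of_real_prod
    proof (intro prod.cong refl)
      fix j assume "j \<in> {..<m}"
      then show "E j (x j) $$ ((r(i0 := z)) j, (a(i0 := z)) j) = of_real (h j (r j) (a j))"
        using id[OF z] c[of j "a j"] tuplesD(1)[OF a, of j] r0 h0 by (cases "j = i0") auto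
    qed
  qed
  finally show ?thesis .
qed

section \<open>The one-shot protocol\<close>

lemma sum_tuples_upd:
  assumes "i0 < m"
  shows "(\<Sum>x\<in>tuples m d. h x) = (\<Sum>a\<in>tuples m (d(i0 := 1)). \<Sum>z<d i0. h (a(i0 := z)))"
proof -
  have "bij_betw (\<lambda>(a,z). a(i0 := z)) (tuples m (d(i0 := 1)) \<times> {..<d i0}) (tuples m d)"
  proof (rule bij_betwI[where g="\<lambda>x. (x(i0 := 0), x i0)"])
    show "(\<lambda>(a,z). a(i0 := z)) \<in> tuples m (d(i0 := 1)) \<times> {..<d i0} \<rightarrow> tuples m d"
    proof (clarsimp simp del: fun_upd_apply)
      fix a z assume a: "a \<in> tuples m (d(i0 := Suc 0))" and z: "z < d i0"
      show "a(i0 := z) \<in> tuples m d"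
        unfolding tuples_def
      proof (intro CollectI conjI allI impI)
        fix j assume "j < m" then show "(a(i0 := z)) j < d j" using tuplesD(1)[OF a, of j] z by (cases "j = i0") auto
      next
        fix j assume "m \<le> j" then show "(a(i0 := z)) j = 0" using tuplesD(2)[OF a, of j] assms by simp
      qed
    qed
    show "(\<lambda>x. (x(i0 := 0), x i0)) \<in> tuples m d \<rightarrow> tuples m (d(i0 := 1)) \<times> {..<d i0}"
      using assms by (auto simp: tuples_def)
    fix p assume "p \<in> tuples m (d(i0 := 1)) \<times> {..<d i0}"
    then obtain a z where p: "p = (a,z)" and a: "a \<in> tuples m (d(i0 := 1))" by auto
    have "a i0 = 0" using tuplesD(1)[OF a assms] by simp
    then show "(\<lambda>x. (x(i0 := 0), x i0)) ((\<lambda>(a,z). a(i0 := z)) p) = p" by (auto simp: p)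
  qed auto
  from sum.reindex_bij_betw[OF this, of h] show ?thesis
    by (simp add: sum.cartesian_product case_prod_unfold)
qed

lemma tuples_one: "tuples m (\<lambda>_. 1) = {\<lambda>_. 0}"
proof -
  have "x = (\<lambda>_. 0)" if "x \<in> tuples m (\<lambda>_. 1)" for x
  proof
    fix i show "x i = 0" using tuplesD[OF that, of i] by (cases "i < m") auto
  qed
  then show ?thesis by (auto simp: tuples_def)
qed

lemma bij_add_mod:
  fixes K c :: nat
  assumes "0 < K"
  shows "bij_betw (\<lambda>v. (v + c) mod K) {..<K} {..<K}"
proof (rule bij_betwI[where g="\<lambda>v. (v + (K - c mod K)) mod K"])
  have e: "c + (K - c mod K) = K * (c div K + 1)"
  proof -
    have "K * (c div K) + c mod K = c" by simp
    moreover have "c mod K < K" using assms by simp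
    ultimately have "c + (K - c mod K) = K * (c div K) + K" by linarith
    then show ?thesis by (simp only: distrib_left mult_1_right)
  qed
  fix v assume "v \<in> {..<K}"
  then have v: "v < K" by simp
  have "((v + c) mod K + (K - c mod K)) mod K = (v + (c + (K - c mod K))) mod K"
    by (simp only: mod_add_left_eq add.assoc)
  also have "\<dots> = v" unfolding e using v by (simp only: mod_mult_self2 mod_less)
  finally show "((v + c) mod K + (K - c mod K)) mod K = v" .
  have "((v + (K - c mod K)) mod K + c) mod K = (v + (c + (K - c mod K))) mod K"
    by (simp only: mod_add_left_eq add.assoc add.commute[of c])
  also have "\<dots> = v" unfolding e using v by (simp only: mod_mult_self2 mod_less)
  finally show "((v + (K - c mod K)) mod K + c) mod K = v" .
qed (use assms in auto)

lemma mix_self: "mix t a a = a"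
  by (auto simp: mix_def)

text \<open>Summing over offsets and averaging over the register value visits every index tuple with
  total weight 1. This compensates the redundancy of the measured offsets.\<close>

lemma sum_shift_average:
  fixes h :: "(nat \<Rightarrow> nat) \<Rightarrow> complex"
  assumes "i0 < m" "K \<ge> 1"
  defines "C \<equiv> tuples m ((\<lambda>_. K)(i0 := 1))"
  shows "(\<Sum>c\<in>C. (\<Sum>t<K. h (shift m i0 K t c)) / of_nat K) = (\<Sum>r\<in>C. h r)"
proof -
  have "(\<Sum>c\<in>C. (\<Sum>t<K. h (shift m i0 K t c)) / of_nat K) = (\<Sum>t<K. \<Sum>c\<in>C. h (shift m i0 K t c)) / of_nat K"
    unfolding sum_divide_distrib[symmetric] by (subst sum.swap) (rule refl)
  also have "(\<Sum>t<K. \<Sum>c\<in>C. h (shift m i0 K t c)) = (\<Sum>t<K. \<Sum>r\<in>C. h r)"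
    unfolding C_def by (intro sum.cong refl sum.reindex_bij_betw bij_shift assms(1)) simp
  finally show ?thesis using assms(2) by simp
qed

lemma cauchy_schwarz_weighted:
  fixes \<alpha> :: "'a \<Rightarrow> complex" and q :: "'a \<Rightarrow> real"
  assumes "\<And>p. p \<in> S \<Longrightarrow> 0 \<le> q p"
  shows "Re (\<Sum>p\<in>S. of_real (sqrt (q p)) * \<alpha> p) \<le> sqrt (\<Sum>p\<in>S. q p) * sqrt (\<Sum>p\<in>S. (cmod (\<alpha> p))\<^sup>2)"
proof -
  have "Re (\<Sum>p\<in>S. of_real (sqrt (q p)) * \<alpha> p) \<le> cmod (\<Sum>p\<in>S. of_real (sqrt (q p)) * \<alpha> p)" by (rule complex_Re_le_cmod)
  also have "\<dots> \<le> (\<Sum>p\<in>S. cmod (of_real (sqrt (q p)) * \<alpha> p))" by (rule norm_sum)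
  also have "\<dots> = (\<Sum>p\<in>S. \<bar>sqrt (q p)\<bar> * \<bar>cmod (\<alpha> p)\<bar>)" by (simp add: norm_mult)
  also have "\<dots> \<le> L2_set (\<lambda>p. sqrt (q p)) S * L2_set (\<lambda>p. cmod (\<alpha> p)) S" by (rule L2_set_mult_ineq)
  also have "\<dots> = sqrt (\<Sum>p\<in>S. q p) * sqrt (\<Sum>p\<in>S. (cmod (\<alpha> p))\<^sup>2)"
    unfolding L2_set_def using assms by simp
  finally show ?thesis .
qed

text \<open>The ensemble may be subnormalised, since for many copies only typical environment labels
  are put into \<open>E\<close>. For every outcome \<open>x\<close>, \<open>uhlmann_decoder\<close>
  bounds twice the overlap \<open>F x\<close> from below; summed over \<open>x\<close> both of its
  traces give the sum of \<open>lam\<close>, and \<open>decoupling\<close> bounds the deviation.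
  Cauchy-Schwarz then turns the summed overlap into the root of the expectation in the target, which
  is the form of the fidelity.\<close>

theorem one_shot:
  fixes m i0 K :: nat and d :: "nat \<Rightarrow> nat" and \<phi> :: "'e \<Rightarrow> (nat \<Rightarrow> nat) \<Rightarrow> complex"
    and G :: "nat set \<Rightarrow> 'b \<Rightarrow> (nat \<Rightarrow> nat) \<Rightarrow> 'e \<Rightarrow> complex"
  assumes i0: "i0 < m" and K: "K \<ge> 1" and d: "\<And>j. j < m \<Longrightarrow> d j \<ge> 1"
    and fin: "finite E" "\<And>J. finite (Bg J)" "\<And>J. finite (Bb J)" and dis: "\<And>J. Bg J \<inter> Bb J = {}"
    and lam: "\<And>e. e \<in> E \<Longrightarrow> 0 \<le> lam e" "(\<Sum>e\<in>E. lam e) \<le> 1"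
    and orth: "\<And>e e'. e \<in> E \<Longrightarrow> e' \<in> E \<Longrightarrow> (\<Sum>x\<in>tuples m d. \<phi> e x * cnj (\<phi> e' x)) = (if e = e' then of_real (lam e) else 0)"
  defines "\<J> \<equiv> Pow ({..<m} - {i0}) - {{}}" and "A \<equiv> \<lambda>J. tuples m (sub_dims J d)"
  assumes dec: "\<And>J \<alpha> \<alpha>' e e'. J \<in> \<J> \<Longrightarrow> \<alpha> \<in> A J \<Longrightarrow> \<alpha>' \<in> A J \<Longrightarrow> e \<in> E \<Longrightarrow> e' \<in> E \<Longrightarrow>
       (\<Sum>\<gamma>\<in>A ({..<m} - J). \<phi> e (merge J \<alpha> \<gamma>) * cnj (\<phi> e' (merge J \<alpha>' \<gamma>))) =
       (\<Sum>b\<in>Bg J \<union> Bb J. G J b \<alpha> e * cnj (G J b \<alpha>' e'))"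
    and good: "\<And>J. J \<in> \<J> \<Longrightarrow> (\<Sum>e\<in>E. \<Sum>e'\<in>E. \<Sum>\<alpha>\<in>A J. \<Sum>\<alpha>'\<in>A J. (cmod (\<Sum>b\<in>Bg J. G J b \<alpha> e * cnj (G J b \<alpha>' e')))\<^sup>2) \<le> t J"
    and bad: "\<And>J. J \<in> \<J> \<Longrightarrow> (\<Sum>b\<in>Bb J. \<Sum>\<alpha>\<in>A J. \<Sum>e\<in>E. (cmod (G J b \<alpha> e))\<^sup>2) \<le> \<epsilon>"
  obtains V where "locc_value m d (\<lambda>_. K) (ghz_vec m K) V" "\<And>\<phi>. 0 \<le> V \<phi>"
    "(\<Sum>e\<in>E. lam e) - (\<Sum>J\<in>\<J>. sqrt (real ((2 * K) ^ card J * card E) * t J) + 2 ^ card J * \<epsilon>) / 2 \<le> sqrt (\<Sum>e\<in>E. V (\<phi> e))"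
proof -
  define Kd where "Kd = (\<lambda>_::nat. K)(i0 := 1)"
  define D where "D = d(i0 := 1)"
  \<comment> \<open>Bundled into one predicate so that a family can be chosen for all parties at
    once. \<open>P2\<close> and \<open>P3\<close> below do the same for the outcomes.\<close>
  define P1 where "P1 j N g \<longleftrightarrow> N \<ge> 1 \<and> (\<forall>x r a. g x r a * g x r a = 1) \<and>
    (\<forall>r r' a a'. r < K \<longrightarrow> r' < K \<longrightarrow> a < d j \<longrightarrow> a' < d j \<longrightarrow>
       (\<Sum>x<N. g x r a * g x r' a') = (if r = r' \<and> a = a' then real N else 0)) \<and>
    (\<forall>r r' a a' b b'. r < K \<longrightarrow> r' < K \<longrightarrow> a < d j \<longrightarrow> a' < d j \<longrightarrow> b < d j \<longrightarrow> b' < d j \<longrightarrow>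
       (\<Sum>x<N. g x r a * g x r' a' * g x r b * g x r' b') =
       (if r = r' \<and> a = a' \<and> b = b' \<or> a = b \<and> a' = b' \<or> r = r' \<and> a = b' \<and> a' = b then real N else 0))"
    for j N :: nat and g :: "nat \<Rightarrow> nat \<Rightarrow> nat \<Rightarrow> real"
  have "\<exists>N g. P1 j N g" for j
  proof (rule sign_family[of K "d j"])
    fix N :: nat and g :: "nat \<Rightarrow> nat \<Rightarrow> nat \<Rightarrow> real"
    assume s: "1 \<le> N" "\<And>x r a. g x r a * g x r a = 1"
      "\<And>r r' a a'. r < K \<Longrightarrow> r' < K \<Longrightarrow> a < d j \<Longrightarrow> a' < d j \<Longrightarrow>
         (\<Sum>x<N. g x r a * g x r' a') = (if r = r' \<and> a = a' then real N else 0)"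
      "\<And>r r' a a' b b'. r < K \<Longrightarrow> r' < K \<Longrightarrow> a < d j \<Longrightarrow> a' < d j \<Longrightarrow> b < d j \<Longrightarrow> b' < d j \<Longrightarrow>
         (\<Sum>x<N. g x r a * g x r' a' * g x r b * g x r' b') =
         (if r = r' \<and> a = a' \<and> b = b' \<or> a = b \<and> a' = b' \<or> r = r' \<and> a = b' \<and> a' = b then real N else 0)"
    show ?thesis unfolding P1_def by (intro exI[of _ N] exI[of _ g] conjI allI impI s)
  qed
  then obtain N' g' where P1: "\<And>j. P1 j (N' j) (g' j)" by metis
  note s = P1[unfolded P1_def, THEN conjunct1] P1[unfolded P1_def, THEN conjunct2, THEN conjunct1, rule_format]
    P1[unfolded P1_def, THEN conjunct2, THEN conjunct2, THEN conjunct1, rule_format]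
    P1[unfolded P1_def, THEN conjunct2, THEN conjunct2, THEN conjunct2, rule_format]
  \<comment> \<open>The one-outcome measurement of \<open>i0\<close> with constant sign 1 satisfies
    the moment conditions because both of its index ranges have size 1.\<close>
  define N where "N j = (if j = i0 then 1 else N' j)" for j
  define g where "g j = (if j = i0 then \<lambda>_ _ _. 1 else g' j)" for j
  interpret S: sign_measurement m i0 Kd D N g
  proof
    show "i0 < m" by (rule i0)
    show "Kd i0 = 1" "D i0 = 1" by (simp_all add: Kd_def D_def)
    fix j assume j: "j < m"
    show "1 \<le> Kd j" "1 \<le> N j" "1 \<le> D j" using K d[OF j] s(1) by (simp_all add: Kd_def N_def D_def)
    show "g j x r a * g j x r a = 1" for x r a by (simp add: g_def s(2))
    fix r r' a a' assume *: "r < Kd j" "r' < Kd j" "a < D j" "a' < D j"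
    show "(\<Sum>x<N j. g j x r a * g j x r' a') = (if r = r' \<and> a = a' then real (N j) else 0)"
      using * s(3)[of r r' a j a'] by (cases "j = i0") (auto simp: Kd_def D_def N_def g_def)
    fix b b' assume **: "b < D j" "b' < D j"
    show "(\<Sum>x<N j. g j x r a * g j x r' a' * g j x r b * g j x r' b') =
       (if r = r' \<and> a = a' \<and> b = b' \<or> a = b \<and> a' = b' \<or> r = r' \<and> a = b' \<and> a' = b then real (N j) else 0)"
    proof (cases "j = i0")
      case True
      then show ?thesis using * ** by (simp add: Kd_def D_def N_def g_def)
    next
      case False
      then show ?thesis using s(4)[of r r' a j a' b b'] * ** by (simp add: Kd_def D_def N_def g_def)
    qed
  qed
  define c where "c = (\<Prod>j<m. real (Kd j) * real (N j))"
  have c0: "c > 0" unfolding c_def by (intro prod_pos) (use S.KN in auto)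
  define RE where "RE = tuples m Kd \<times> E"
  have finRE: "finite RE" using fin by (simp add: RE_def)
  define f where "f e a z = \<phi> e (a(i0 := z))" for e a z
  define h where "h x j r a = g j (x j) r a / sqrt (real (Kd j) * real (N j))" for x :: "nat \<Rightarrow> nat" and j r a
  define M where "M x p z = (\<Sum>a\<in>tuples m D. of_real (\<Prod>j<m. h x j (fst p j) (a j)) * f (snd p) a z)" for x p z
  \<comment> \<open>The ideal weights: the eigenvalue of the environment label, spread uniformly
    over the \<open>c\<close> combinations of outcomes and kept indices.\<close>
  define q where "q p = lam (snd p) / c" for p :: "(nat \<Rightarrow> nat) \<times> 'e"
  have q0: "0 \<le> q p" if "p \<in> RE" for p using that lam c0 by (auto simp: q_def RE_def)
  let ?Z = "{..<d i0}"
  define P2 where "P2 x W H \<longleftrightarrow> contr RE H \<and>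
    (\<forall>z z'. (\<Sum>y\<in>?Z. (\<Sum>p\<in>RE. cnj (W p z) * W p y) * (\<Sum>p\<in>RE. cnj (W p y) * W p z')) = (\<Sum>p\<in>RE. cnj (W p z) * W p z')) \<and>
    (\<Sum>p\<in>RE. \<Sum>z\<in>?Z. (cmod (M x p z))\<^sup>2) + (\<Sum>p\<in>RE. q p)
       - Re (\<Sum>p\<in>RE. \<Sum>y\<in>RE. H y p * ((\<Sum>z\<in>?Z. M x p z * cnj (M x y z)) - (if p = y then of_real (q p) else 0)))
       \<le> 2 * Re (\<Sum>p\<in>RE. of_real (sqrt (q p)) * (\<Sum>z\<in>?Z. M x p z * cnj (W p z)))"
    for x and W :: "(nat \<Rightarrow> nat) \<times> 'e \<Rightarrow> nat \<Rightarrow> complex" and H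
  have "\<exists>W H. P2 x W H" for x
  proof (rule uhlmann_decoder[of RE ?Z q "M x", OF finRE _ q0])
    fix W H
    assume "contr RE H" "\<And>z z'. (\<Sum>y\<in>?Z. (\<Sum>p\<in>RE. cnj (W p z) * W p y) * (\<Sum>p\<in>RE. cnj (W p y) * W p z')) = (\<Sum>p\<in>RE. cnj (W p z) * W p z')"
      "(\<Sum>p\<in>RE. \<Sum>z\<in>?Z. (cmod (M x p z))\<^sup>2) + (\<Sum>p\<in>RE. q p)
       - Re (\<Sum>p\<in>RE. \<Sum>y\<in>RE. H y p * ((\<Sum>z\<in>?Z. M x p z * cnj (M x y z)) - (if p = y then of_real (q p) else 0)))
       \<le> 2 * Re (\<Sum>p\<in>RE. of_real (sqrt (q p)) * (\<Sum>z\<in>?Z. M x p z * cnj (W p z)))"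
    then show ?thesis unfolding P2_def by (intro exI[of _ W] exI[of _ H] conjI allI)
  qed simp_all
  then obtain W H where P2: "\<And>x. P2 x (W x) (H x)" by metis
  note H = P2[unfolded P2_def, THEN conjunct1]
    and idem = P2[unfolded P2_def, THEN conjunct2, THEN conjunct1, rule_format]
    and dcd = P2[unfolded P2_def, THEN conjunct2, THEN conjunct2]
  define mm where "mm x p = (\<Sum>z\<in>?Z. M x p z * cnj (W x p z))" for x p
  define F where "F x = Re (\<Sum>p\<in>RE. of_real (sqrt (q p)) * mm x p)" for x

  have orth': "(\<Sum>a\<in>tuples m D. \<Sum>z\<in>?Z. f e a z * cnj (f e' a z)) = (if e = e' then of_real (lam e) else 0)"
    if "e \<in> E" "e' \<in> E" for e e'
    using orth[OF that] unfolding sum_tuples_upd[OF i0, of _ d] D_def f_def .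
  have Jd: "J \<subseteq> {..<m}" "i0 \<notin> J" if "J \<in> \<J>" for J using that by (auto simp: \<J>_def)
  have AJ: "tuples m (sub_dims J D) = A J" if "J \<in> \<J>" for J
    unfolding A_def by (intro tuples_cong) (use Jd[OF that] in \<open>auto simp: sub_dims_def D_def\<close>)
  have dec': "(\<Sum>\<beta>\<in>tuples m (sub_dims ({..<m} - J) D). \<Sum>z\<in>?Z. f e (merge J \<alpha> \<beta>) z * cnj (f e' (merge J \<alpha>' \<beta>) z)) =
       (\<Sum>b\<in>Bg J \<union> Bb J. G J b \<alpha> e * cnj (G J b \<alpha>' e'))"
    if J: "J \<in> \<J>" and a: "\<alpha> \<in> tuples m (sub_dims J D)" "\<alpha>' \<in> tuples m (sub_dims J D)" and e: "e \<in> E" "e' \<in> E" for J \<alpha> \<alpha>' e e'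
  proof -
    have "sub_dims ({..<m} - J) D = (sub_dims ({..<m} - J) d)(i0 := 1)"
      using Jd[OF J] i0 by (auto simp: sub_dims_def D_def)
    moreover have "sub_dims ({..<m} - J) d i0 = d i0" using Jd[OF J] i0 by (auto simp: sub_dims_def)
    moreover have "f e (merge J \<alpha> \<beta>) z = \<phi> e (merge J \<alpha> (\<beta>(i0 := z)))" for e \<alpha> \<beta> z
    proof -
      have "(merge J \<alpha> \<beta>)(i0 := z) = merge J \<alpha> (\<beta>(i0 := z))" using Jd[OF J] by (auto simp: merge_def)
      then show ?thesis by (simp add: f_def)
    qed
    ultimately show ?thesis
      using dec[OF J a[unfolded AJ[OF J]] e] unfolding A_def sum_tuples_upd[OF i0, of _ "sub_dims ({..<m} - J) d"] by simp
  qed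
  have bound: "(\<Sum>x\<in>tuples m N. Re (\<Sum>p\<in>RE. \<Sum>y\<in>RE. H x y p * ((\<Sum>z\<in>?Z. M x p z * cnj (M x y z)) - (if p = y then of_real (q p) else 0))))
     \<le> (\<Sum>J\<in>\<J>. sqrt (real ((2 * K) ^ card J * card E) * t J) + 2 ^ card J * \<epsilon>)"
  proof -
    have "(\<Sum>x\<in>tuples m N. Re (\<Sum>p\<in>RE. \<Sum>y\<in>RE. H x y p * ((\<Sum>z\<in>?Z. M x p z * cnj (M x y z)) - (if p = y then of_real (q p) else 0))))
      \<le> (\<Sum>J\<in>\<J>. sqrt (real (card RE) * ((\<Prod>j<m. if j \<in> J then 2 else 1 / real (Kd j)) * t J)) + 2 ^ card J * \<epsilon>)"
      unfolding q_def c_def M_def h_def RE_def \<J>_def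
    proof (rule S.decoupling[where Bg=Bg and Bb=Bb and G=G])
      fix J assume "J \<in> Pow ({..<m} - {i0}) - {{}}"
      then have J: "J \<in> \<J>" by (simp add: \<J>_def)
      show "(\<Sum>e\<in>E. \<Sum>e'\<in>E. \<Sum>\<alpha>\<in>tuples m (sub_dims J D). \<Sum>\<alpha>'\<in>tuples m (sub_dims J D). (cmod (\<Sum>b\<in>Bg J. G J b \<alpha> e * cnj (G J b \<alpha>' e')))\<^sup>2) \<le> t J"
        unfolding AJ[OF J] by (rule good[OF J])
      show "(\<Sum>b\<in>Bb J. \<Sum>\<alpha>\<in>tuples m (sub_dims J D). \<Sum>e\<in>E. (cmod (G J b \<alpha> e))\<^sup>2) \<le> \<epsilon>"
        unfolding AJ[OF J] by (rule bad[OF J])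
    qed (use fin dis H dec' orth' in \<open>simp_all add: RE_def \<J>_def\<close>)
    also have "\<dots> = (\<Sum>J\<in>\<J>. sqrt (real ((2 * K) ^ card J * card E) * t J) + 2 ^ card J * \<epsilon>)"
    proof (intro sum.cong refl arg_cong2[where f="(+)"] arg_cong[where f=sqrt])
      fix J assume J: "J \<in> \<J>"
      \<comment> \<open>\<open>card RE\<close> supplies one factor \<open>Kd j\<close> per party. It
        cancels the \<open>1 / Kd j\<close> of a party outside \<open>J\<close> and turns the 2 of a
        party in \<open>J\<close> into \<open>2 * K\<close>.\<close>
      have "real (card RE) * (\<Prod>j<m. if j \<in> J then 2 else 1 / real (Kd j))
        = real (card E) * (\<Prod>j<m. real (Kd j) * (if j \<in> J then 2 else 1 / real (Kd j)))"
        unfolding RE_def card_cartesian_product of_nat_mult card_tuples_real prod.distrib of_nat_prod by simp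
      also have "(\<Prod>j<m. real (Kd j) * (if j \<in> J then 2 else 1 / real (Kd j))) = (\<Prod>j<m. if j \<in> J then real (2 * K) else 1)"
      proof (intro prod.cong refl)
        fix j assume "j \<in> {..<m}"
        then have "real (Kd j) > 0" using S.KN(2)[of j] by simp
        then show "real (Kd j) * (if j \<in> J then 2 else 1 / real (Kd j)) = (if j \<in> J then real (2 * K) else 1)"
          using Jd(2)[OF J] by (auto simp: Kd_def)
      qed
      also have "\<dots> = (\<Prod>j\<in>J. real (2 * K))"
        using Jd(1)[OF J] by (simp add: prod.If_cases Int_absorb1)
      finally show "real (card RE) * ((\<Prod>j<m. if j \<in> J then 2 else 1 / real (Kd j)) * t J) = real ((2 * K) ^ card J * card E) * t J"
        by (simp add: mult_ac)
    qed
    finally show ?thesis .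
  qed
  have trM: "(\<Sum>x\<in>tuples m N. \<Sum>p\<in>RE. \<Sum>z\<in>?Z. (cmod (M x p z))\<^sup>2) = (\<Sum>e\<in>E. lam e)"
    unfolding M_def h_def RE_def by (rule S.total_trace) (simp add: orth')
  have cN: "real (card (tuples m N)) * real (card (tuples m Kd)) = c"
    unfolding card_tuples_real c_def by (simp add: prod.distrib mult.commute)
  have trq: "(\<Sum>x\<in>tuples m N. \<Sum>p\<in>RE. q p) = (\<Sum>e\<in>E. lam e)"
  proof -
    have "(\<Sum>x\<in>tuples m N. \<Sum>p\<in>RE. q p) = real (card (tuples m N)) * real (card (tuples m Kd)) * ((\<Sum>e\<in>E. lam e) / c)"
      unfolding RE_def sum_pairs q_def snd_conv by (simp add: sum_divide_distrib)
    then show ?thesis unfolding cN using c0 by simp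
  qed
  have sumF: "2 * (\<Sum>e\<in>E. lam e) - (\<Sum>J\<in>\<J>. sqrt (real ((2 * K) ^ card J * card E) * t J) + 2 ^ card J * \<epsilon>) \<le> 2 * (\<Sum>x\<in>tuples m N. F x)"
  proof -
    have "(\<Sum>x\<in>tuples m N. (\<Sum>p\<in>RE. \<Sum>z\<in>?Z. (cmod (M x p z))\<^sup>2) + (\<Sum>p\<in>RE. q p)
       - Re (\<Sum>p\<in>RE. \<Sum>y\<in>RE. H x y p * ((\<Sum>z\<in>?Z. M x p z * cnj (M x y z)) - (if p = y then of_real (q p) else 0)))) \<le> (\<Sum>x\<in>tuples m N. 2 * F x)"
      unfolding F_def mm_def by (intro sum_mono dcd)
    then show ?thesis using bound trM trq by (simp add: sum.distrib sum_subtractf sum_distrib_left[symmetric] del: Re_sum)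
  qed

  define P3 where "P3 x n1 n2 b \<kappa> \<longleftrightarrow> n1 \<le> n2 \<and> bij_betw b {..<n1} RE \<and> (\<forall>y<n2. \<kappa> y \<in> carrier_mat K (d i0)) \<and>
    msum (d i0) (d i0) (\<lambda>y. mat_adjoint (\<kappa> y) * \<kappa> y) n2 = 1\<^sub>m (d i0) \<and>
    (\<forall>y t z. y < n1 \<longrightarrow> t < K \<longrightarrow> z < d i0 \<longrightarrow> \<kappa> y $$ (t,z) = cnj (W x (shift m i0 K t (fst (b y)), snd (b y)) z) / of_real (sqrt (real K)))"
    for x and n1 n2 :: nat and b :: "nat \<Rightarrow> (nat \<Rightarrow> nat) \<times> 'e" and \<kappa>
  have "\<exists>n1 n2 b \<kappa>. P3 x n1 n2 b \<kappa>" for x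
  proof (rule decoder_instrument[OF fin(1) K i0 idem[unfolded RE_def Kd_def, of x]])
    fix n1 n2 :: nat and b :: "nat \<Rightarrow> (nat \<Rightarrow> nat) \<times> 'e" and \<kappa> :: "nat \<Rightarrow> complex mat"
    assume *: "n1 \<le> n2" "bij_betw b {..<n1} (tuples m ((\<lambda>_. K)(i0 := 1)) \<times> E)" "\<And>y. y < n2 \<Longrightarrow> \<kappa> y \<in> carrier_mat K (d i0)"
      "msum (d i0) (d i0) (\<lambda>y. mat_adjoint (\<kappa> y) * \<kappa> y) n2 = 1\<^sub>m (d i0)"
      "\<And>y t z. y < n1 \<Longrightarrow> t < K \<Longrightarrow> z < d i0 \<Longrightarrow>
        \<kappa> y $$ (t,z) = cnj (W x (shift m i0 K t (fst (b y)), snd (b y)) z) / of_real (sqrt (real K))"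
    show ?thesis
      unfolding P3_def RE_def Kd_def by (intro exI[of _ n1] exI[of _ n2] exI[of _ b] exI[of _ \<kappa>] conjI allI impI *)
  qed
  then obtain n1 n2 b \<kappa> where P3: "\<And>x. P3 x (n1 x) (n2 x) (b x) (\<kappa> x)" by metis
  note P3 = P3[unfolded P3_def]
  note n12 = P3[THEN conjunct1] and b = P3[THEN conjunct2, THEN conjunct1]
    and \<kappa>c = P3[THEN conjunct2, THEN conjunct2, THEN conjunct1, rule_format]
    and \<kappa>1 = P3[THEN conjunct2, THEN conjunct2, THEN conjunct2, THEN conjunct1]
    and \<kappa> = P3[THEN conjunct2, THEN conjunct2, THEN conjunct2, THEN conjunct2, rule_format]

  define T where "T = tuples m (\<lambda>_. K)"
  \<comment> \<open>The other parties undo the offsets announced by the decoder. Outcomes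
    \<open>y \<ge> n1 x\<close> come from the completion of the instrument; any correction would do
    there, and 0 is chosen.\<close>
  define corr where "corr x y = (if y < n1 x then fst (b x y) else (\<lambda>_. 0))" for x y
  define sh where "sh x y j v = (if j = i0 then v else (v + corr x y j) mod K)" for x y and j v :: nat
  define E3 where "E3 x y = (\<lambda>j (_::nat). mat K K (\<lambda>(v,r). if r = sh x y j v then 1 else (0::complex)))" for x y
  define E1 where "E1 j v = (if j = i0 then 1\<^sub>m (d i0) else mat K (d j) (\<lambda>(r,a). complex_of_real (g j v r a / sqrt (real (Kd j) * real (N j)))))" for j v
  define dN where "dN j = (if j = i0 then d i0 else K)" for j
  \<comment> \<open>Values of what remains of the protocol: \<open>V3\<close> from the corrections
    on, \<open>V2\<close> from the decoder on, \<open>V\<close> from the local measurements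
    on.\<close>
  define V3 where "V3 x y \<phi>' = (cmod (ip T (ghz_vec m K) (pop m (\<lambda>_. K) (E3 x y) (\<lambda>_. 0) \<phi>')))\<^sup>2" for x y \<phi>'
  define V2 where "V2 x \<phi>' = (\<Sum>y<n2 x. V3 x y (lop (mix m dN d) i0 (\<kappa> x y) \<phi>'))" for x \<phi>'
  define V where "V \<phi>' = (\<Sum>x\<in>tuples m N. V2 x (pop m d E1 x \<phi>'))" for \<phi>'
  have shK: "sh x y j v < K" if "v < K" for x y j v using that by (auto simp: sh_def)
  have L3: "locc_value m (mix m (\<lambda>_. K) d) (\<lambda>_. K) (ghz_vec m K) (V3 x y)" for x y
  proof -
    have "locc_value m (mix m (\<lambda>_. K) d) (\<lambda>_. K) (ghz_vec m K) (\<lambda>\<phi>'. \<Sum>s\<in>tuples m (\<lambda>_. 1).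
       (\<lambda>\<phi>'. (cmod (ip (tuples m (mix m (\<lambda>_. K) d)) (ghz_vec m K) \<phi>'))\<^sup>2) (pop m (\<lambda>_. K) (E3 x y) s \<phi>'))"
    proof (rule locc_value_parallel[where dN="\<lambda>_. K"])
      show "locc_value m (mix m (\<lambda>_. K) d) (\<lambda>_. K) (ghz_vec m K) (\<lambda>\<phi>'. (cmod (ip (tuples m (mix m (\<lambda>_. K) d)) (ghz_vec m K) \<phi>'))\<^sup>2)"
        by (rule locc_value_id) (simp add: mix_def)
      fix j assume "j < m"
      show "msum K K (\<lambda>s. mat_adjoint (E3 x y j s) * E3 x y j s) 1 = 1\<^sub>m K"
      proof (rule instrument_completeI)
        show "E3 x y j s \<in> carrier_mat K K" for s by (simp add: E3_def)
        fix a a' assume a: "a < K" "a' < K"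
        have "bij_betw (sh x y j) {..<K} {..<K}"
        proof (cases "j = i0")
          case True
          then have "sh x y j = (\<lambda>v. v)" by (auto simp: sh_def)
          then show ?thesis by (simp add: bij_betw_def)
        next
          case False
          then have "sh x y j = (\<lambda>v. (v + corr x y j) mod K)" by (auto simp: sh_def)
          then show ?thesis using bij_add_mod[of K "corr x y j"] K by simp
        qed
        then have "(\<Sum>v<K. (if a = sh x y j v then if a' = sh x y j v then 1 else 0 else 0)) = (\<Sum>v<K. (if a = v then if a' = v then 1 else 0 else (0::complex)))"
          by (rule sum.reindex_bij_betw)
        also have "\<dots> = (if a = a' then 1 else 0)" using a by auto
        finally have e: "(\<Sum>v<K. (if a = sh x y j v then if a' = sh x y j v then 1 else 0 else 0)) = (if a = a' then 1 else (0::complex))" .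
        have "(\<Sum>s<1::nat. \<Sum>v<K. cnj (E3 x y j s $$ (v,a)) * E3 x y j s $$ (v,a'))
          = (\<Sum>v<K. (if a = sh x y j v then if a' = sh x y j v then 1 else 0 else 0))"
          using a by (simp add: E3_def) (intro sum.cong refl, simp)
        then show "(\<Sum>s<1::nat. \<Sum>v<K. cnj (E3 x y j s $$ (v,a)) * E3 x y j s $$ (v,a')) = (if a = a' then 1 else 0)"
          unfolding e .
      qed
    qed (use K in \<open>simp_all add: E3_def\<close>)
    moreover have "tuples m (mix m (\<lambda>_. K) d) = T" unfolding T_def by (intro tuples_cong) (simp add: mix_def)
    ultimately show ?thesis unfolding tuples_one V3_def[abs_def] by simp
  qed
  have L2: "locc_value m (mix m dN d) (\<lambda>_. K) (ghz_vec m K) (V2 x)" for x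
    unfolding V2_def
  proof (rule locc_value_step[where dN="mix m (\<lambda>_. K) d"])
    show "\<forall>y<n2 x. \<kappa> x y \<in> carrier_mat (mix m (\<lambda>_. K) d i0) (mix m dN d i0)"
      using \<kappa>c i0 by (simp add: mix_def dN_def)
    show "msum (mix m dN d i0) (mix m dN d i0) (\<lambda>y. mat_adjoint (\<kappa> x y) * \<kappa> x y) (n2 x) = 1\<^sub>m (mix m dN d i0)"
      using \<kappa>1 i0 by (simp add: mix_def dN_def)
  qed (use i0 K L3 in \<open>auto simp: mix_def dN_def\<close>)
  have L1: "locc_value m d (\<lambda>_. K) (ghz_vec m K) V"
  proof -
    have "locc_value m (mix m d d) (\<lambda>_. K) (ghz_vec m K) (\<lambda>\<phi>'. \<Sum>x\<in>tuples m N. V2 x (pop m d E1 x \<phi>'))"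
    proof (rule locc_value_parallel[where dN=dN])
      fix j assume j: "j < m"
      show "1 \<le> dN j" using K d[OF i0] by (simp add: dN_def)
      show "E1 j v \<in> carrier_mat (dN j) (d j)" for v by (simp add: E1_def dN_def)
      show "msum (d j) (d j) (\<lambda>v. mat_adjoint (E1 j v) * E1 j v) (N j) = 1\<^sub>m (d j)"
      proof (rule instrument_completeI)
        show "E1 j v \<in> carrier_mat (dN j) (d j)" for v by (simp add: E1_def dN_def)
        fix a a' assume a: "a < d j" "a' < d j"
        show "(\<Sum>v<N j. \<Sum>r<dN j. cnj (E1 j v $$ (r,a)) * E1 j v $$ (r,a')) = (if a = a' then 1 else 0)"
        proof (cases "j = i0")
          case True
          have "(\<Sum>v<N j. \<Sum>r<dN j. cnj (E1 j v $$ (r,a)) * E1 j v $$ (r,a')) = (\<Sum>r<d i0. (if r = a then 1 else 0) * (if r = a' then 1 else 0))"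
            using True a by (simp add: N_def dN_def E1_def) (intro sum.cong refl, simp)
          also have "\<dots> = (if a = a' then 1 else 0)" using a True by (simp add: sum_delta_mult)
          finally show ?thesis .
        next
          case False
          have s2: "sqrt (real (Kd j) * real (N j)) * sqrt (real (Kd j) * real (N j)) = real (Kd j) * real (N j)" by simp
          have "(\<Sum>v<N j. \<Sum>r<dN j. cnj (E1 j v $$ (r,a)) * E1 j v $$ (r,a'))
            = (\<Sum>v<N j. \<Sum>r<K. of_real (S.gpart UNIV j v r r a a'))"
          proof (intro sum.cong)
            show "{..<dN j} = {..<K}" using False by (simp add: dN_def)
            fix v r assume "r \<in> {..<K}"
            then have "E1 j v $$ (r,a) = of_real (g j v r a / sqrt (real (Kd j) * real (N j)))"
              "E1 j v $$ (r,a') = of_real (g j v r a' / sqrt (real (Kd j) * real (N j)))"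
              using False a by (simp_all add: E1_def)
            then show "cnj (E1 j v $$ (r,a)) * E1 j v $$ (r,a') = of_real (S.gpart UNIV j v r r a a')"
              unfolding S.gpart_def S.tau_def
              by (simp only: complex_cnj_complex_of_real of_real_mult[symmetric] times_divide_times_eq s2 UNIV_I if_True)
          qed (rule refl)
          also have "\<dots> = of_real (\<Sum>v<N j. \<Sum>r<Kd j. S.gpart UNIV j v r r a a')"
            using False by (simp add: Kd_def)
          also have "\<dots> = (if a = a' then 1 else 0)"
            using a False by (subst S.gpart_sum[OF j]) (simp_all add: D_def)
          finally show ?thesis .
        qed
      qed
    qed (use L2 in simp_all)
    then show ?thesis by (simp add: mix_self V_def[abs_def])
  qed
  have V3_nn: "0 \<le> V3 x y \<phi>'" for x y \<phi>' by (simp add: V3_def)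
  have V_nn: "0 \<le> V \<phi>'" for \<phi>' unfolding V_def V2_def by (intro sum_nonneg V3_nn)

  \<comment> \<open>The overlap with the GHZ vector for the decoder outcome \<open>p\<close>: the
    amplitudes \<open>mm\<close>, averaged over the register value. Of the factor
    \<open>1 / K\<close>, one root normalises the GHZ vector and the other one the decoder.\<close>
  define \<alpha> where "\<alpha> x p = (\<Sum>t<K. mm x (shift m i0 K t (fst p), snd p)) / of_nat K" for x p
  have amp: "V3 x y (lop (mix m dN d) i0 (\<kappa> x y) (pop m d E1 x (\<phi> (snd (b x y))))) = (cmod (\<alpha> x (b x y)))\<^sup>2"
    if x: "x \<in> tuples m N" and y: "y < n1 x" for x y
  proof -
    define cc e where "cc = fst (b x y)" and "e = snd (b x y)"
    have bRE: "b x y \<in> RE" using b[of x] y by (auto simp: bij_betw_def)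
    then have cT: "cc \<in> tuples m Kd" by (auto simp: cc_def RE_def)
    let ?L = "lop (mix m dN d) i0 (\<kappa> x y) (pop m d E1 x (\<phi> e))"
    have K0: "K > 0" using K by simp
    have at: "pop m (\<lambda>_. K) (E3 x y) (\<lambda>_. 0) ?L (diag m t) = mm x (shift m i0 K t cc, e) / of_real (sqrt (real K))" if t: "t < K" for t
    proof -
      let ?r = "shift m i0 K t cc"
      have rT: "?r \<in> tuples m Kd" using bij_shift[OF t i0] cT unfolding Kd_def by (auto simp: bij_betw_def)
      have "pop m (\<lambda>_. K) (E3 x y) (\<lambda>_. 0) ?L (diag m t) = ?L (\<lambda>j. if j < m then sh x y j (diag m t j) else 0)"
        unfolding E3_def by (rule pop_perm[OF shK diag_tuples[OF t]])
      also have "(\<lambda>j. if j < m then sh x y j (diag m t j) else 0) = ?r(i0 := t)"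
        using y i0 by (auto simp: sh_def diag_def shift_def corr_def cc_def)
      also have "?L (?r(i0 := t)) = (\<Sum>z<d i0. \<kappa> x y $$ (t,z) * pop m d E1 x (\<phi> e) (?r(i0 := z)))"
        unfolding lop_def using i0 by (simp add: mix_def dN_def)
      also have "\<dots> = (\<Sum>z<d i0. M x (?r, e) z * cnj (W x (?r, e) z) / of_real (sqrt (real K)))"
      proof (intro sum.cong refl)
        fix z assume "z \<in> {..<d i0}"
        then have z: "z < d i0" by simp
        have "pop m d E1 x (\<phi> e) (?r(i0 := z)) = (\<Sum>a\<in>tuples m (d(i0 := 1)). of_real (\<Prod>j<m. h x j (?r j) (a j)) * \<phi> e (a(i0 := z)))"
        proof (rule pop_except_identity[where K="\<lambda>_. K" and h="h x" and r="?r" and d=d, OF i0 rT[unfolded Kd_def] z])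
          show "E1 i0 (x i0) $$ (z, a) = (if a = z then 1 else 0)" if "a < d i0" for a using that z by (simp add: E1_def)
          show "h x i0 0 0 = 1" by (simp add: h_def g_def Kd_def N_def)
          fix j a assume "j < m" "j \<noteq> i0" "a < d j"
          moreover then have "?r j < K" using tuplesD(1)[OF rT, of j] by (simp add: Kd_def)
          ultimately show "E1 j (x j) $$ (?r j, a) = of_real (h x j (?r j) a)" by (simp add: E1_def h_def)
        qed
        then have "pop m d E1 x (\<phi> e) (?r(i0 := z)) = M x (?r, e) z" by (simp add: M_def f_def D_def)
        then show "\<kappa> x y $$ (t,z) * pop m d E1 x (\<phi> e) (?r(i0 := z)) = M x (?r, e) z * cnj (W x (?r, e) z) / of_real (sqrt (real K))"
          using \<kappa>[OF y t z] by (simp add: cc_def e_def)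
      qed
      also have "\<dots> = mm x (?r, e) / of_real (sqrt (real K))" unfolding mm_def sum_divide_distrib ..
      finally show ?thesis .
    qed
    have "ip T (ghz_vec m K) (pop m (\<lambda>_. K) (E3 x y) (\<lambda>_. 0) ?L) = (\<Sum>v\<in>T. ghz_vec m K v * pop m (\<lambda>_. K) (E3 x y) (\<lambda>_. 0) ?L v)"
      unfolding ip_def by (intro sum.cong refl) (simp add: ghz_vec_def)
    also have "\<dots> = (\<Sum>t<K. pop m (\<lambda>_. K) (E3 x y) (\<lambda>_. 0) ?L (diag m t)) / of_real (sqrt (real K))"
      unfolding T_def by (rule ghz_vec_sum) (use i0 in simp)
    also have "\<dots> = (\<Sum>t<K. mm x (shift m i0 K t cc, e)) / (of_real (sqrt (real K)) * of_real (sqrt (real K)))"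
      by (simp add: at sum_divide_distrib)
    also have "\<dots> = \<alpha> x (b x y)"
      unfolding of_real_mult[symmetric] \<alpha>_def cc_def e_def by simp
    finally show ?thesis unfolding V3_def e_def by simp
  qed
  have lower: "(\<Sum>x\<in>tuples m N. \<Sum>p\<in>RE. (cmod (\<alpha> x p))\<^sup>2) \<le> (\<Sum>e\<in>E. V (\<phi> e))"
  proof -
    let ?v = "\<lambda>x e y. V3 x y (lop (mix m dN d) i0 (\<kappa> x y) (pop m d E1 x (\<phi> e)))"
    have "(\<Sum>x\<in>tuples m N. \<Sum>p\<in>RE. (cmod (\<alpha> x p))\<^sup>2) = (\<Sum>x\<in>tuples m N. \<Sum>y<n1 x. ?v x (snd (b x y)) y)"
    proof (intro sum.cong refl)
      fix x assume x: "x \<in> tuples m N"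
      have "(\<Sum>p\<in>RE. (cmod (\<alpha> x p))\<^sup>2) = (\<Sum>y<n1 x. (cmod (\<alpha> x (b x y)))\<^sup>2)"
        by (rule sum.reindex_bij_betw[OF b, symmetric])
      then show "(\<Sum>p\<in>RE. (cmod (\<alpha> x p))\<^sup>2) = (\<Sum>y<n1 x. ?v x (snd (b x y)) y)"
        using amp[OF x] by simp
    qed
    \<comment> \<open>The left-hand side has only the environment label announced by the decoder;
      the terms for the other labels are nonnegative.\<close>
    also have "\<dots> \<le> (\<Sum>x\<in>tuples m N. \<Sum>y<n1 x. \<Sum>e\<in>E. ?v x e y)"
    proof (intro sum_mono)
      fix x y assume "y \<in> {..<n1 x}"
      then have "b x y \<in> RE" using bij_betw_apply[OF b[of x]] by blast
      then have "snd (b x y) \<in> E" by (auto simp: RE_def)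
      then show "?v x (snd (b x y)) y \<le> (\<Sum>e\<in>E. ?v x e y)"
        using fin(1) V3_nn by (intro member_le_sum) auto
    qed
    also have "\<dots> \<le> (\<Sum>x\<in>tuples m N. \<Sum>y<n2 x. \<Sum>e\<in>E. ?v x e y)"
      using n12 V3_nn by (intro sum_mono sum_mono2 sum_nonneg) auto
    also have "\<dots> = (\<Sum>x\<in>tuples m N. \<Sum>e\<in>E. \<Sum>y<n2 x. ?v x e y)" by (intro sum.cong refl sum.swap)
    also have "\<dots> = (\<Sum>e\<in>E. V (\<phi> e))" unfolding V_def V2_def by (rule sum.swap)
    finally show ?thesis .
  qed
  have "(\<Sum>x\<in>tuples m N. F x) \<le> sqrt (\<Sum>e\<in>E. V (\<phi> e))"
  proof -
    \<comment> \<open>The average over the register value may be undone here because the weights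
      \<open>q\<close> do not depend on the kept indices.\<close>
    have "F x = Re (\<Sum>p\<in>RE. of_real (sqrt (q p)) * \<alpha> x p)" for x
    proof -
      have "(\<Sum>p\<in>RE. of_real (sqrt (q p)) * \<alpha> x p) = (\<Sum>e\<in>E. of_real (sqrt (lam e / c)) * (\<Sum>r\<in>tuples m Kd. \<alpha> x (r,e)))"
        unfolding RE_def sum_pairs q_def snd_conv sum_distrib_left by (rule sum.swap)
      also have "\<dots> = (\<Sum>e\<in>E. of_real (sqrt (lam e / c)) * (\<Sum>r\<in>tuples m Kd. mm x (r,e)))"
        unfolding \<alpha>_def fst_conv snd_conv Kd_def sum_shift_average[OF i0 K, of "\<lambda>r. mm x (r, _)"] ..
      also have "\<dots> = (\<Sum>p\<in>RE. of_real (sqrt (q p)) * mm x p)"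
        unfolding RE_def sum_pairs q_def snd_conv sum_distrib_left by (rule sum.swap)
      finally show ?thesis by (simp only: F_def)
    qed
    then have "(\<Sum>x\<in>tuples m N. F x) = Re (\<Sum>w\<in>tuples m N \<times> RE. of_real (sqrt (q (snd w))) * \<alpha> (fst w) (snd w))"
      unfolding sum_pairs by simp
    also have "\<dots> \<le> sqrt (\<Sum>w\<in>tuples m N \<times> RE. q (snd w)) * sqrt (\<Sum>w\<in>tuples m N \<times> RE. (cmod (\<alpha> (fst w) (snd w)))\<^sup>2)"
      by (rule cauchy_schwarz_weighted) (use q0 in auto)
    also have "\<dots> = sqrt (\<Sum>e\<in>E. lam e) * sqrt (\<Sum>x\<in>tuples m N. \<Sum>p\<in>RE. (cmod (\<alpha> x p))\<^sup>2)"
      unfolding sum_pairs fst_conv snd_conv trq ..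
    also have "\<dots> \<le> 1 * sqrt (\<Sum>e\<in>E. V (\<phi> e))"
      using lam lower by (intro mult_mono real_sqrt_le_mono) (auto intro!: sum_nonneg real_sqrt_ge_zero V_nn)
    finally show ?thesis by simp
  qed
  then have "(\<Sum>e\<in>E. lam e) - (\<Sum>J\<in>\<J>. sqrt (real ((2 * K) ^ card J * card E) * t J) + 2 ^ card J * \<epsilon>) / 2 \<le> sqrt (\<Sum>e\<in>E. V (\<phi> e))"
    using sumF by linarith
  with L1 V_nn show thesis by (rule that)
qed

section \<open>Independent copies\<close>

lemma sum_iid_one:
  fixes p :: "nat \<Rightarrow> real"
  assumes "(\<Sum>k<T. p k) = 1"
  shows "(\<Sum>e\<in>tuples n (\<lambda>_. T). \<Prod>t<n. p (e t)) = 1"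
  using sum_tuples_prod[of "\<lambda>_. p" n "\<lambda>_. T"] assms by simp

text \<open>The mixed terms vanish because \<open>g\<close> is centred, so the variances
  add.\<close>

lemma iid_variance:
  fixes p g :: "nat \<Rightarrow> real"
  assumes p: "(\<Sum>k<T. p k) = 1" and g: "(\<Sum>k<T. p k * g k) = 0"
  shows "(\<Sum>e\<in>tuples n (\<lambda>_. T). (\<Prod>t<n. p (e t)) * (\<Sum>t<n. g (e t))\<^sup>2) = real n * (\<Sum>k<T. p k * (g k)\<^sup>2)"
proof (induction n)
  case 0
  then show ?case by (simp add: tuples_0)
next
  case (Suc n)
  let ?P = "\<lambda>e. \<Prod>t<n. p (e t)" and ?S = "\<lambda>e. \<Sum>t<n. g (e t)" and ?v = "\<Sum>k<T. p k * (g k)\<^sup>2"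
  have "(\<Sum>e\<in>tuples (Suc n) (\<lambda>_. T). (\<Prod>t<Suc n. p (e t)) * (\<Sum>t<Suc n. g (e t))\<^sup>2)
    = (\<Sum>e\<in>tuples n (\<lambda>_. T). \<Sum>s<T. ?P e * p s * (?S e + g s)\<^sup>2)"
    unfolding sum_tuples_Suc by (intro sum.cong refl) simp
  also have "\<dots> = (\<Sum>e\<in>tuples n (\<lambda>_. T). ?P e * (?S e)\<^sup>2 + ?P e * ?v)"
  proof (intro sum.cong refl)
    fix e
    have expand: "P * a * (S + b)\<^sup>2 = P * S\<^sup>2 * a + 2 * P * S * (a * b) + P * (a * b\<^sup>2)" for P S a b :: real
      by (simp add: power2_eq_square algebra_simps)
    have "(\<Sum>s<T. ?P e * p s * (?S e + g s)\<^sup>2)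
      = ?P e * (?S e)\<^sup>2 * (\<Sum>s<T. p s) + 2 * ?P e * ?S e * (\<Sum>s<T. p s * g s) + ?P e * ?v"
      unfolding sum_distrib_left[where A="{..<T}"] sum.distrib[symmetric]
      by (intro sum.cong refl) (rule expand)
    then show "(\<Sum>s<T. ?P e * p s * (?S e + g s)\<^sup>2) = ?P e * (?S e)\<^sup>2 + ?P e * ?v"
      using p g by simp
  qed
  also have "\<dots> = real n * ?v + ?v"
    unfolding sum.distrib sum_distrib_right[symmetric] Suc.IH sum_iid_one[OF p] by simp
  finally show ?case by (simp add: algebra_simps)
qed

text \<open>Chebyshev's inequality for the sum of the \<open>- log 2 (p (e t))\<close>. The two
  tails are kept apart: eigenvalues of the environment must not be too small, which bounds their
  number, and those of the complement of \<open>J\<close> must not be too large, which bounds a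
  purity. Strings of probability 0 carry no mass and are exempt from the deviation estimate.\<close>

lemma typicality:
  fixes p :: "nat \<Rightarrow> real"
  assumes p0: "\<And>k. k < T \<Longrightarrow> 0 \<le> p k" and p1: "(\<Sum>k<T. p k) = 1"
  defines "h \<equiv> - (\<Sum>k<T. p k * log 2 (p k))"
  obtains c where "0 \<le> c" "\<And>n \<delta>. 0 < \<delta> \<Longrightarrow>
      (\<Sum>e\<in>{e\<in>tuples n (\<lambda>_. T). \<not> 2 powr (- real n * (h + \<delta>)) \<le> (\<Prod>t<n. p (e t))}. \<Prod>t<n. p (e t)) \<le> c / (real n * \<delta>\<^sup>2)"
    "\<And>n \<delta>. 0 < \<delta> \<Longrightarrow>
      (\<Sum>e\<in>{e\<in>tuples n (\<lambda>_. T). \<not> (\<Prod>t<n. p (e t)) \<le> 2 powr (- real n * (h - \<delta>))}. \<Prod>t<n. p (e t)) \<le> c / (real n * \<delta>\<^sup>2)"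
proof -
  define g where "g k = - log 2 (p k) - h" for k
  define c where "c = (\<Sum>k<T. p k * (g k)\<^sup>2)"
  have c0: "0 \<le> c" unfolding c_def using p0 by (intro sum_nonneg) auto
  have g: "(\<Sum>k<T. p k * g k) = 0"
    unfolding g_def right_diff_distrib sum_subtractf sum_distrib_right[symmetric] p1 h_def by (simp add: sum_negf)
  let ?P = "\<lambda>n e. \<Prod>t<n. p (e t)" and ?X = "\<lambda>n e. \<Sum>t<n. g (e t)"
  have P0: "0 \<le> ?P n e" if "e \<in> tuples n (\<lambda>_. T)" for n e
    using that by (intro prod_nonneg) (auto intro: p0 dest: tuplesD(1))
  have logP: "log 2 (?P n e) = - (?X n e + real n * h)" if "?P n e > 0" "e \<in> tuples n (\<lambda>_. T)" for n e
  proof -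
    have pos: "p (e t) > 0" if "t < n" for t
      using p0[OF tuplesD(1)[OF \<open>e \<in> tuples n (\<lambda>_. T)\<close> that]] \<open>?P n e > 0\<close> that
      by (metis finite_lessThan lessThan_iff less_eq_real_def order_less_irrefl prod_zero)
    have "log 2 (\<Prod>t<k. p (e t)) = (\<Sum>t<k. log 2 (p (e t))) \<and> (\<Prod>t<k. p (e t)) > 0" if "k \<le> n" for k
      using that
    proof (induction k)
      case (Suc k)
      then show ?case using pos[of k] by (simp add: log_mult_pos)
    qed simp
    from this[of n] show ?thesis by (simp add: g_def sum_subtractf sum_negf)
  qed
  have cheb: "(\<Sum>e\<in>B. ?P n e) \<le> c / (real n * \<delta>\<^sup>2)"
    if \<delta>: "0 < \<delta>" and B: "B \<subseteq> tuples n (\<lambda>_. T)" and far: "\<And>e. e \<in> B \<Longrightarrow> ?P n e > 0 \<Longrightarrow> real n * \<delta> < \<bar>?X n e\<bar>" for n \<delta> B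
  proof (cases "n = 0")
    \<comment> \<open>The bound reads \<open>c / 0 = 0\<close> here; it holds because the strict
      deviation leaves no string.\<close>
    case True
    have "e \<notin> B" for e
    proof
      assume "e \<in> B"
      from far[OF this] show False using True by simp
    qed
    then have "B = {}" by blast
    then show ?thesis using True by simp
  next
    case False
    then have n: "real n > 0" by simp
    have "(\<Sum>e\<in>B. ?P n e) \<le> (\<Sum>e\<in>B. ?P n e * (?X n e)\<^sup>2 / (real n * \<delta>)\<^sup>2)"
    proof (intro sum_mono)
      fix e assume e: "e \<in> B"
      show "?P n e \<le> ?P n e * (?X n e)\<^sup>2 / (real n * \<delta>)\<^sup>2"
      proof (cases "?P n e > 0")
        case True
        have "(real n * \<delta>)\<^sup>2 \<le> (\<bar>?X n e\<bar>)\<^sup>2" using far[OF e True] n \<delta> by (intro power_mono) auto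
        then have "?P n e * (real n * \<delta>)\<^sup>2 \<le> ?P n e * (?X n e)\<^sup>2" using True by (intro mult_left_mono) auto
        then show ?thesis using n \<delta> by (simp add: pos_le_divide_eq)
      next
        case False
        have "0 \<le> ?P n e" by (rule P0) (use e B in blast)
        then have "?P n e = 0" using False by linarith
        then show ?thesis by (simp only: mult_zero_left div_0 order_refl)
      qed
    qed
    also have "\<dots> \<le> (\<Sum>e\<in>tuples n (\<lambda>_. T). ?P n e * (?X n e)\<^sup>2 / (real n * \<delta>)\<^sup>2)"
      using B P0 by (intro sum_mono2) auto
    also have "\<dots> = real n * c / (real n * \<delta>)\<^sup>2"
      unfolding sum_divide_distrib[symmetric] iid_variance[OF p1 g] c_def ..
    also have "\<dots> = c / (real n * \<delta>\<^sup>2)" using n by (simp add: power2_eq_square)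
    finally show ?thesis .
  qed
  show thesis
  proof (rule that[OF c0])
    fix n and \<delta> :: real assume \<delta>: "0 < \<delta>"
    show "(\<Sum>e\<in>{e\<in>tuples n (\<lambda>_. T). \<not> 2 powr (- real n * (h + \<delta>)) \<le> ?P n e}. ?P n e) \<le> c / (real n * \<delta>\<^sup>2)"
    proof (rule cheb[OF \<delta>])
      fix e assume e: "e \<in> {e\<in>tuples n (\<lambda>_. T). \<not> 2 powr (- real n * (h + \<delta>)) \<le> ?P n e}" and pos: "?P n e > 0"
      then have "?P n e < 2 powr (- real n * (h + \<delta>))" by simp
      then have "log 2 (?P n e) < - real n * (h + \<delta>)" using pos by (simp add: log_less_iff)
      then have "real n * \<delta> < ?X n e" unfolding logP[OF pos, of] using e by (subst (asm) logP) (auto simp: pos algebra_simps)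
      then show "real n * \<delta> < \<bar>?X n e\<bar>" by linarith
    qed auto
    show "(\<Sum>e\<in>{e\<in>tuples n (\<lambda>_. T). \<not> ?P n e \<le> 2 powr (- real n * (h - \<delta>))}. ?P n e) \<le> c / (real n * \<delta>\<^sup>2)"
    proof (rule cheb[OF \<delta>])
      fix e assume e: "e \<in> {e\<in>tuples n (\<lambda>_. T). \<not> ?P n e \<le> 2 powr (- real n * (h - \<delta>))}" and pos: "?P n e > 0"
      then have "2 powr (- real n * (h - \<delta>)) < ?P n e" by simp
      then have "- real n * (h - \<delta>) < log 2 (?P n e)" using pos by (simp add: less_log_iff)
      moreover have "log 2 (?P n e) = - (?X n e + real n * h)" using e by (intro logP pos) simp
      ultimately have "?X n e < - (real n * \<delta>)" by (simp add: algebra_simps)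
      then show "real n * \<delta> < \<bar>?X n e\<bar>" by linarith
    qed auto
  qed
qed

text \<open>A matrix times its adjoint has the same Hilbert-Schmidt norm in either order. This
  replaces the marginal on \<open>J\<close> and the environment by a kernel on the complement of
  \<open>J\<close>, which is diagonal.\<close>

lemma gram_swap:
  fixes g :: "'b \<Rightarrow> 'p \<Rightarrow> complex"
  shows "(\<Sum>p\<in>P. \<Sum>q\<in>P. (cmod (\<Sum>b\<in>B. g b p * cnj (g b q)))\<^sup>2) = (\<Sum>b\<in>B. \<Sum>b'\<in>B. (cmod (\<Sum>p\<in>P. g b p * cnj (g b' p)))\<^sup>2)"
proof -
  let ?f = "\<lambda>p q b b'. g b p * cnj (g b q) * (cnj (g b' p) * g b' q)"
  have "complex_of_real (\<Sum>p\<in>P. \<Sum>q\<in>P. (cmod (\<Sum>b\<in>B. g b p * cnj (g b q)))\<^sup>2) = (\<Sum>p\<in>P. \<Sum>q\<in>P. \<Sum>b\<in>B. \<Sum>b'\<in>B. ?f p q b b')"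
    unfolding of_real_sum mult_cnj_eq(1)[symmetric] cnj_sum sum_product by simp
  also have "\<dots> = (\<Sum>p\<in>P. \<Sum>b\<in>B. \<Sum>q\<in>P. \<Sum>b'\<in>B. ?f p q b b')" by (intro sum.cong refl sum.swap)
  also have "\<dots> = (\<Sum>b\<in>B. \<Sum>p\<in>P. \<Sum>q\<in>P. \<Sum>b'\<in>B. ?f p q b b')" by (rule sum.swap)
  also have "\<dots> = (\<Sum>b\<in>B. \<Sum>p\<in>P. \<Sum>b'\<in>B. \<Sum>q\<in>P. ?f p q b b')" by (intro sum.cong refl sum.swap)
  also have "\<dots> = (\<Sum>b\<in>B. \<Sum>b'\<in>B. \<Sum>p\<in>P. \<Sum>q\<in>P. ?f p q b b')" by (intro sum.cong refl sum.swap)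
  also have "\<dots> = of_real (\<Sum>b\<in>B. \<Sum>b'\<in>B. (cmod (\<Sum>p\<in>P. g b p * cnj (g b' p)))\<^sup>2)"
    unfolding of_real_sum mult_cnj_eq(1)[symmetric] cnj_sum sum_product by (intro sum.cong refl) (simp add: mult_ac)
  finally show ?thesis by (simp only: of_real_eq_iff)
qed

text \<open>The all-ones tuple is the binary numeral \<open>2 ^ m - 1\<close>, the index that occurs
  in \<open>ghz\<close>.\<close>

lemma enc_diag2: "enc m (\<lambda>_. 2) (diag m t) = t * (2 ^ m - 1)"
proof (induction m)
  case 0
  then show ?case by (simp add: enc_def)
next
  case (Suc m)
  have "enc (Suc m) (\<lambda>_. 2) (diag (Suc m) t) = enc m (\<lambda>_. 2) (diag m t) + t * 2 ^ m"
    unfolding enc_Suc by (simp add: tdim_def diag_def enc_cong[of m "\<lambda>j. if j < Suc m then t else 0" "\<lambda>j. if j < m then t else 0" "\<lambda>_. 2" "\<lambda>_. 2"])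
  also have "\<dots> = t * (2 ^ m - 1) + t * 2 ^ m" by (simp only: Suc)
  also have "\<dots> = t * (2 ^ m - 1 + 2 ^ m)" by (rule add_mult_distrib2[symmetric])
  also have "2 ^ m - 1 + 2 ^ m = (2::nat) ^ Suc m - 1" using one_le_power[of "2::nat" m] by simp
  finally show ?case .
qed

lemma ghz_index:
  assumes "x \<in> tuples m (\<lambda>_. 2)" "y \<in> tuples m (\<lambda>_. 2)"
  shows "ghz m $$ (enc m (\<lambda>_. 2) x, enc m (\<lambda>_. 2) y) = ghz_vec m 2 x * ghz_vec m 2 y"
proof -
  have d: "(enc m (\<lambda>_. 2) x = 0 \<or> enc m (\<lambda>_. 2) x = 2 ^ m - 1) = (x \<in> diag m ` {..<2})" if x: "x \<in> tuples m (\<lambda>_. 2)" for x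
  proof -
    have "enc m (\<lambda>_. 2) x = t * (2 ^ m - 1) \<longleftrightarrow> x = diag m t" if "t < 2" for t
      unfolding enc_diag2[symmetric] by (rule enc_eq_iff[OF x diag_tuples[OF that]])
    from this[of 0] this[of 1] show ?thesis by (auto simp: lessThan_def numeral_2_eq_2 less_Suc_eq)
  qed
  have t: "tdim m (\<lambda>_. 2) = 2 ^ m" by (simp add: tdim_def)
  have s: "complex_of_real (sqrt 2) * of_real (sqrt 2) = 2" unfolding of_real_mult[symmetric] by simp
  have "ghz m $$ (enc m (\<lambda>_. 2) x, enc m (\<lambda>_. 2) y) = (if x \<in> diag m ` {..<2} \<and> y \<in> diag m ` {..<2} then 1 / 2 else 0)"
  proof -
    have idx: "ghz m $$ (a,b) = (if (a = 0 \<or> a = 2 ^ m - 1) \<and> (b = 0 \<or> b = 2 ^ m - 1) then 1 / 2 else 0)"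
      if "a < 2 ^ m" "b < 2 ^ m" for a b using that by (simp add: ghz_def)
    show ?thesis unfolding idx[OF enc_lt[OF assms(1), unfolded t] enc_lt[OF assms(2), unfolded t]] d[OF assms(1)] d[OF assms(2)] ..
  qed
  then show ?thesis by (simp add: ghz_vec_def s)
qed

text \<open>A tuple is constant over the parties iff each of its digits is, and the normalisations
  multiply to \<open>1 / sqrt (2 ^ k)\<close>.\<close>

lemma ghz_vec_digits:
  assumes x: "x \<in> tuples m (\<lambda>_. 2 ^ k)" and m: "m \<ge> 1"
  shows "(\<Prod>t<k. ghz_vec m 2 (dig (\<lambda>_. 2) t x)) = ghz_vec m (2 ^ k) x"
proof -
  have dd: "dig (\<lambda>_. 2) t (diag m u) = diag m (u div 2 ^ t mod 2)" for t u by (auto simp: dig_def diag_def)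
  show ?thesis
  proof (cases "x \<in> diag m ` {..<2 ^ k}")
    case True
    then obtain u where u: "x = diag m u" by blast
    have "ghz_vec m 2 (dig (\<lambda>_. 2) t x) = 1 / of_real (sqrt 2)" for t
      unfolding u dd ghz_vec_def by simp
    then have "(\<Prod>t<k. ghz_vec m 2 (dig (\<lambda>_. 2) t x)) = 1 / of_real (sqrt 2 ^ k)" by (simp add: power_one_over)
    also have "sqrt 2 ^ k = sqrt (real (2 ^ k))" by (simp add: real_sqrt_power)
    finally show ?thesis using True by (simp add: ghz_vec_def)
  next
    case False
    have "\<exists>t<k. dig (\<lambda>_. 2) t x \<notin> diag m ` {..<2}"
    proof (rule ccontr)
      assume "\<not> ?thesis"
      then have a: "dig (\<lambda>_. 2) t x \<in> diag m ` {..<2}" if "t < k" for t using that by blast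
      have x0: "x 0 < 2 ^ k" using tuplesD(1)[OF x, of 0] m by simp
      have "x = diag m (x 0)"
      proof (rule dig_eqD[of x m "\<lambda>_. 2" k])
        show "x \<in> tuples m (\<lambda>i. 2 ^ k)" by (rule x)
        show "diag m (x 0) \<in> tuples m (\<lambda>i. 2 ^ k)" by (rule diag_tuples[OF x0])
        fix t assume "t < k"
        from a[OF this] obtain s where s: "dig (\<lambda>_. 2) t x = diag m s" by blast
        have "s = x 0 div 2 ^ t mod 2" using fun_cong[OF s, of 0] m by (simp add: dig_def diag_def)
        then show "dig (\<lambda>_. 2) t x = dig (\<lambda>_. 2) t (diag m (x 0))" unfolding dd s by simp
      qed
      then show False using False x0 by blast
    qed
    then obtain t where "t < k" "ghz_vec m 2 (dig (\<lambda>_. 2) t x) = 0" by (auto simp: ghz_vec_def)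
    then have "(\<Prod>t<k. ghz_vec m 2 (dig (\<lambda>_. 2) t x)) = 0" by (intro prod_zero) auto
    then show ?thesis using False by (simp add: ghz_vec_def)
  qed
qed

lemma tensor_pow_index:
  assumes "x \<in> tuples m (\<lambda>i. d i ^ n)" "y \<in> tuples m (\<lambda>i. d i ^ n)"
  shows "tensor_pow m d n \<rho> $$ (enc m (\<lambda>i. d i ^ n) x, enc m (\<lambda>i. d i ^ n) y)
    = (\<Prod>t<n. \<rho> $$ (enc m d (dig d t x), enc m d (dig d t y)))"
  unfolding tensor_pow_def dig_def using enc_lt[OF assms(1)] enc_lt[OF assms(2)] by (simp add: dec_enc assms)

lemma tensor_pow_ghz:
  assumes m: "m \<ge> 1"
  shows "tensor_pow m (\<lambda>_. 2) k (ghz m) = rank1 (tdim m (\<lambda>_. 2 ^ k)) (\<lambda>a. ghz_vec m (2 ^ k) (dec m (\<lambda>_. 2 ^ k) a))"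
proof (rule eq_matI)
  fix a b assume "a < dim_row (rank1 (tdim m (\<lambda>_. 2 ^ k)) (\<lambda>a. ghz_vec m (2 ^ k) (dec m (\<lambda>_. 2 ^ k) a)))"
    "b < dim_col (rank1 (tdim m (\<lambda>_. 2 ^ k)) (\<lambda>a. ghz_vec m (2 ^ k) (dec m (\<lambda>_. 2 ^ k) a)))"
  then have ab: "a < tdim m (\<lambda>_. 2 ^ k)" "b < tdim m (\<lambda>_. 2 ^ k)" by (simp_all add: rank1_def)
  define x y where "x = dec m (\<lambda>_. 2 ^ k) a" and "y = dec m (\<lambda>_. 2 ^ k) b"
  have xy: "x \<in> tuples m (\<lambda>_. 2 ^ k)" "y \<in> tuples m (\<lambda>_. 2 ^ k)"
    using ab by (simp_all add: x_def y_def dec_in_tuples)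
  have e: "a = enc m (\<lambda>_. 2 ^ k) x" "b = enc m (\<lambda>_. 2 ^ k) y" using ab by (simp_all add: x_def y_def enc_dec)
  have "tensor_pow m (\<lambda>_. 2) k (ghz m) $$ (a,b) = (\<Prod>t<k. ghz m $$ (enc m (\<lambda>_. 2) (dig (\<lambda>_. 2) t x), enc m (\<lambda>_. 2) (dig (\<lambda>_. 2) t y)))"
    unfolding e by (rule tensor_pow_index[OF xy])
  also have "\<dots> = (\<Prod>t<k. ghz_vec m 2 (dig (\<lambda>_. 2) t x) * ghz_vec m 2 (dig (\<lambda>_. 2) t y))"
    by (intro prod.cong refl ghz_index dig_in_tuples[where n=k]) (use xy in auto)
  also have "\<dots> = ghz_vec m (2 ^ k) x * ghz_vec m (2 ^ k) y"
    unfolding prod.distrib ghz_vec_digits[OF xy(1) m] ghz_vec_digits[OF xy(2) m] ..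
  finally show "tensor_pow m (\<lambda>_. 2) k (ghz m) $$ (a,b) = rank1 (tdim m (\<lambda>_. 2 ^ k)) (\<lambda>a. ghz_vec m (2 ^ k) (dec m (\<lambda>_. 2 ^ k) a)) $$ (a,b)"
    using ab by (simp add: rank1_def x_def[symmetric] y_def[symmetric]) (simp add: ghz_vec_def)
qed (simp_all add: tensor_pow_def rank1_def)

text \<open>The eigenvectors, scaled by the roots of their eigenvalues: \<open>\<phi> k\<close> is
  the component of the purification at environment label \<open>k\<close>.\<close>

lemma state_ensemble:
  assumes st: "is_state m d \<rho>"
  obtains T :: nat and l :: "nat \<Rightarrow> real" and \<phi> where "\<And>k. k < T \<Longrightarrow> 0 \<le> l k" "(\<Sum>k<T. l k) = 1"
    "vn_entropy \<rho> = - (\<Sum>k<T. l k * log 2 (l k))"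
    "\<And>x y. x \<in> tuples m d \<Longrightarrow> y \<in> tuples m d \<Longrightarrow> \<rho> $$ (enc m d x, enc m d y) = (\<Sum>k<T. \<phi> k x * cnj (\<phi> k y))"
    "\<And>k k'. k < T \<Longrightarrow> k' < T \<Longrightarrow> (\<Sum>x\<in>tuples m d. \<phi> k x * cnj (\<phi> k' x)) = (if k = k' then of_real (l k) else 0)"
proof -
  define T where "T = tdim m d"
  have \<rho>: "\<rho> \<in> carrier_mat T T" "psd \<rho>" "mtrace \<rho> = 1" using st by (auto simp: is_state_def T_def)
  show thesis
  proof (rule state_spectral[OF \<rho>(1,2)])
    fix v l
    assume v: "ons {..<T} v" and e: "\<And>x y. x < T \<Longrightarrow> y < T \<Longrightarrow> \<rho> $$ (x,y) = spec {..<T} v l x y"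
      and l: "\<And>k. k < T \<Longrightarrow> 0 \<le> l k" and tr: "mtrace \<rho> = of_real (\<Sum>k<T. l k)"
      and S: "vn_entropy \<rho> = - (\<Sum>k<T. l k * log 2 (l k))"
    let ?\<phi> = "\<lambda>k x. of_real (sqrt (l k)) * v k (enc m d x)"
    have sq: "complex_of_real (sqrt (l k)) * of_real (sqrt (l k)) = of_real (l k)" if "k < T" for k
      unfolding of_real_mult[symmetric] using l[OF that] by simp
    show thesis
    proof (rule that[of T l ?\<phi>])
      show "(\<Sum>k<T. l k) = 1" using tr unfolding \<rho>(3) by (metis of_real_eq_1_iff)
      show "\<rho> $$ (enc m d x, enc m d y) = (\<Sum>k<T. ?\<phi> k x * cnj (?\<phi> k y))" if "x \<in> tuples m d" "y \<in> tuples m d" for x y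
        unfolding e[OF enc_lt[OF that(1), folded T_def] enc_lt[OF that(2), folded T_def]] spec_def card_lessThan
        by (intro sum.cong refl) (simp add: sq[symmetric] mult_ac)
      show "(\<Sum>x\<in>tuples m d. ?\<phi> k x * cnj (?\<phi> k' x)) = (if k = k' then of_real (l k) else 0)" if k: "k < T" "k' < T" for k k'
      proof -
        have "(\<Sum>x\<in>tuples m d. ?\<phi> k x * cnj (?\<phi> k' x)) = of_real (sqrt (l k)) * of_real (sqrt (l k')) * ip {..<T} (v k') (v k)"
          unfolding ip_def T_def sum_enc sum_distrib_left by (intro sum.cong refl) (simp add: mult_ac)
        then show ?thesis using onsD(1)[OF v, of k' k] k by (auto simp: sq)
      qed
    qed (use l S in auto)
  qed
qed

lemma sub_dims_all: "tuples m (sub_dims {..<m} d) = tuples m d" "tdim m (sub_dims {..<m} d) = tdim m d"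
  by (intro tuples_cong) (auto simp: sub_dims_def tdim_def)

lemma ptrace_keep_all:
  assumes "\<rho> \<in> carrier_mat (tdim m d) (tdim m d)"
  shows "ptrace_keep m d {..<m} \<rho> = \<rho>"
proof (rule eq_matI)
  fix a b assume "a < dim_row \<rho>" "b < dim_col \<rho>"
  then have ab: "a < tdim m d" "b < tdim m d" using assms by auto
  have z: "tuples m (sub_dims ({..<m} - {..<m}) d) = {\<lambda>_. 0}" using tuples_one by (simp add: sub_dims_def)
  have e: "enc m d (\<lambda>i. if i \<in> {..<m} then dec m (sub_dims {..<m} d) a i else z i) = a" if "a < tdim m d" for a z
  proof -
    have "enc m d (\<lambda>i. if i \<in> {..<m} then dec m (sub_dims {..<m} d) a i else z i) = enc m (sub_dims {..<m} d) (dec m (sub_dims {..<m} d) a)"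
      by (rule enc_cong) (auto simp: sub_dims_def)
    also have "\<dots> = a" using that by (intro enc_dec) (simp add: sub_dims_all)
    finally show ?thesis .
  qed
  show "ptrace_keep m d {..<m} \<rho> $$ (a,b) = \<rho> $$ (a,b)"
    unfolding ptrace_keep_def using ab by (simp only: index_mat sub_dims_all prod.case z e) simp
qed (use assms in \<open>auto simp: ptrace_keep_def sub_dims_all\<close>)

lemma merge_swap:
  assumes "J \<subseteq> {..<m}" "\<alpha> \<in> tuples m (sub_dims J d)" "\<gamma> \<in> tuples m (sub_dims ({..<m} - J) d)"
  shows "merge ({..<m} - J) \<gamma> \<alpha> = merge J \<alpha> \<gamma>"
proof
  fix i
  have "\<alpha> i = \<gamma> i" if "i \<notin> J" "\<not> i < m" using that tuplesD(2)[OF assms(2), of i] tuplesD(2)[OF assms(3), of i] by simp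
  then show "merge ({..<m} - J) \<gamma> \<alpha> i = merge J \<alpha> \<gamma> i" using assms(1) by (auto simp: merge_def)
qed

text \<open>The Schmidt decomposition of the purification between the complement \<open>C\<close> of
  \<open>J\<close> and all the rest. \<open>G b \<alpha> k\<close> is the coefficient of the
  purification along eigenvector \<open>b\<close> of the reduced state on \<open>C\<close>; hence
  the \<open>G b\<close> are orthogonal with squared norms \<open>\<mu> b\<close>, and the marginal
  on \<open>J\<close> and the environment is the sum of their outer products. Through this the
  entropy of \<open>C\<close> governs the term for \<open>J\<close>.\<close>

lemma reduced_ensemble:
  fixes T :: nat
  assumes d: "\<And>i. i < m \<Longrightarrow> d i \<ge> 1" and J: "J \<subseteq> {..<m}"
    and \<phi>: "\<And>x y. x \<in> tuples m d \<Longrightarrow> y \<in> tuples m d \<Longrightarrow> \<rho> $$ (enc m d x, enc m d y) = (\<Sum>k<T. \<phi> k x * cnj (\<phi> k y))"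
    and tr: "(\<Sum>k<T. \<Sum>x\<in>tuples m d. \<phi> k x * cnj (\<phi> k x)) = 1"
  defines "C \<equiv> {..<m} - J"
  obtains U :: nat and \<mu> :: "nat \<Rightarrow> real" and G where "\<And>b. b < U \<Longrightarrow> 0 \<le> \<mu> b" "(\<Sum>b<U. \<mu> b) = 1"
    "entropy_of m d C \<rho> = - (\<Sum>b<U. \<mu> b * log 2 (\<mu> b))"
    "\<And>\<alpha> \<alpha>' k k'. \<alpha> \<in> tuples m (sub_dims J d) \<Longrightarrow> \<alpha>' \<in> tuples m (sub_dims J d) \<Longrightarrow>
       (\<Sum>\<gamma>\<in>tuples m (sub_dims C d). \<phi> k (merge J \<alpha> \<gamma>) * cnj (\<phi> k' (merge J \<alpha>' \<gamma>))) = (\<Sum>b<U. G b \<alpha> k * cnj (G b \<alpha>' k'))"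
    "\<And>b b'. b < U \<Longrightarrow> b' < U \<Longrightarrow> (\<Sum>k<T. \<Sum>\<alpha>\<in>tuples m (sub_dims J d). G b \<alpha> k * cnj (G b' \<alpha> k)) = (if b = b' then of_real (\<mu> b) else 0)"
proof -
  define s where "s = sub_dims C d"
  define A where "A = tuples m (sub_dims J d)"
  define U where "U = tdim m s"
  define Z where "Z = tuples m s"
  have CJ: "{..<m} - C = J" and CS: "C \<subseteq> {..<m}" using J by (auto simp: C_def)
  let ?R = "ptrace_keep m d C \<rho>"
  have mT: "merge J \<alpha> \<gamma> \<in> tuples m d" if "\<alpha> \<in> A" "\<gamma> \<in> Z" for \<alpha> \<gamma>
    using merge_in_tuples[OF J] that unfolding A_def Z_def s_def C_def .
  have idx: "?R $$ (enc m s z, enc m s z') = (\<Sum>\<alpha>\<in>A. \<Sum>k<T. \<phi> k (merge J \<alpha> z) * cnj (\<phi> k (merge J \<alpha> z')))"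
    if z: "z \<in> Z" "z' \<in> Z" for z z'
  proof -
    have "?R $$ (enc m s z, enc m s z') = (\<Sum>\<alpha>\<in>A. \<rho> $$ (enc m d (merge C z \<alpha>), enc m d (merge C z' \<alpha>)))"
      unfolding ptrace_keep_def merge_def CJ A_def
      using enc_lt[OF z(1)[unfolded Z_def]] enc_lt[OF z(2)[unfolded Z_def]] z
      by (simp add: s_def dec_enc Z_def cong: if_cong)
    also have "\<dots> = (\<Sum>\<alpha>\<in>A. \<rho> $$ (enc m d (merge J \<alpha> z), enc m d (merge J \<alpha> z')))"
      using merge_swap[OF J] z unfolding A_def Z_def s_def C_def by (intro sum.cong refl) simp
    also have "\<dots> = (\<Sum>\<alpha>\<in>A. \<Sum>k<T. \<phi> k (merge J \<alpha> z) * cnj (\<phi> k (merge J \<alpha> z')))"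
      by (intro sum.cong refl \<phi> mT z)
    finally show ?thesis .
  qed
  have Rc: "?R \<in> carrier_mat U U" by (simp add: ptrace_keep_def U_def s_def)
  have entry: "?R $$ (a,b) = (\<Sum>p\<in>A \<times> {..<T}. \<phi> (snd p) (merge J (fst p) (dec m s a)) * cnj (\<phi> (snd p) (merge J (fst p) (dec m s b))))"
    if ab: "a < U" "b < U" for a b
    using idx[of "dec m s a" "dec m s b"] ab dec_in_tuples[of _ m s] enc_dec[of _ m s] unfolding sum_pairs U_def Z_def by simp
  have "psdk {..<U} (ker ?R)"
  proof (subst psdk_cong)
    show "ker ?R a b = (\<Sum>p\<in>A \<times> {..<T}. \<phi> (snd p) (merge J (fst p) (dec m s a)) * cnj (\<phi> (snd p) (merge J (fst p) (dec m s b))))"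
      if "a \<in> {..<U}" "b \<in> {..<U}" for a b using entry that by (simp add: ker_def)
  qed (rule psdk_gram)
  then have Rp: "psd ?R" using psd_iff[OF Rc] by blast
  have "mtrace ?R = (\<Sum>a<U. ?R $$ (a,a))" using Rc by (simp add: mtrace_def)
  also have "\<dots> = (\<Sum>z\<in>Z. \<Sum>\<alpha>\<in>A. \<Sum>k<T. \<phi> k (merge J \<alpha> z) * cnj (\<phi> k (merge J \<alpha> z)))"
    unfolding U_def sum_enc Z_def[symmetric] by (intro sum.cong refl idx)
  also have "\<dots> = (\<Sum>\<alpha>\<in>A. \<Sum>z\<in>Z. \<Sum>k<T. \<phi> k (merge J \<alpha> z) * cnj (\<phi> k (merge J \<alpha> z)))" by (rule sum.swap)
  also have "\<dots> = (\<Sum>x\<in>tuples m d. \<Sum>k<T. \<phi> k x * cnj (\<phi> k x))"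
    unfolding sum_tuples_merge[OF J, of _ d] A_def Z_def s_def C_def ..
  also have "\<dots> = 1" using tr by (subst sum.swap)
  finally have Rt: "mtrace ?R = 1" .
  show thesis
  proof (rule state_spectral[OF Rc Rp])
    fix v \<mu>
    assume v: "ons {..<U} v" and e: "\<And>x y. x < U \<Longrightarrow> y < U \<Longrightarrow> ?R $$ (x,y) = spec {..<U} v \<mu> x y"
      and \<mu>: "\<And>k. k < U \<Longrightarrow> 0 \<le> \<mu> k" and t: "mtrace ?R = of_real (\<Sum>k<U. \<mu> k)"
      and S: "vn_entropy ?R = - (\<Sum>k<U. \<mu> k * log 2 (\<mu> k))"
    let ?w = "\<lambda>b z. v b (enc m s z)"
    define G where "G b \<alpha> k = (\<Sum>z\<in>Z. cnj (?w b z) * \<phi> k (merge J \<alpha> z))" for b \<alpha> k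
    have fU: "finite Z" by (simp add: Z_def)
    have orth: "(\<Sum>z\<in>Z. cnj (?w b z) * ?w b' z) = (if b = b' then 1 else 0)" if "b < U" "b' < U" for b b'
      using onsD(1)[OF v, of b b'] that unfolding ip_def U_def sum_enc Z_def by simp
    have comp: "(\<Sum>b<U. ?w b z * cnj (?w b z')) = (if z = z' then 1 else 0)" if "z \<in> Z" "z' \<in> Z" for z z'
      using onsD(2)[OF v, of "enc m s z" "enc m s z'"] that enc_lt[of z m s] enc_lt[of z' m s] enc_eq_iff[of z m s z']
      unfolding Z_def U_def by simp
    show thesis
    proof (rule that[of U \<mu> G])
      show "(\<Sum>b<U. \<mu> b) = 1" using t unfolding Rt by (metis of_real_eq_1_iff)
      show "entropy_of m d C \<rho> = - (\<Sum>b<U. \<mu> b * log 2 (\<mu> b))" unfolding entropy_of_def by (rule S)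
      fix \<alpha> \<alpha>' k k' assume "\<alpha> \<in> tuples m (sub_dims J d)" "\<alpha>' \<in> tuples m (sub_dims J d)"
      have "(\<Sum>b<U. G b \<alpha> k * cnj (G b \<alpha>' k'))
        = (\<Sum>b<U. \<Sum>z\<in>Z. \<Sum>z'\<in>Z. \<phi> k (merge J \<alpha> z) * cnj (\<phi> k' (merge J \<alpha>' z')) * (?w b z' * cnj (?w b z)))"
        unfolding G_def cnj_sum sum_product by (intro sum.cong refl) simp
      also have "\<dots> = (\<Sum>z\<in>Z. \<Sum>z'\<in>Z. \<Sum>b<U. \<phi> k (merge J \<alpha> z) * cnj (\<phi> k' (merge J \<alpha>' z')) * (?w b z' * cnj (?w b z)))"
        by (subst sum.swap, intro sum.cong refl, rule sum.swap)
      also have "\<dots> = (\<Sum>z\<in>Z. \<Sum>z'\<in>Z. \<phi> k (merge J \<alpha> z) * cnj (\<phi> k' (merge J \<alpha>' z')) * (if z' = z then 1 else 0))"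
        unfolding sum_distrib_left[symmetric] by (intro sum.cong refl arg_cong2[where f="(*)"] comp)
      also have "\<dots> = (\<Sum>z\<in>Z. \<phi> k (merge J \<alpha> z) * cnj (\<phi> k' (merge J \<alpha>' z)))"
        using fU by (intro sum.cong refl) (simp add: if_distrib cong: if_cong)
      finally show "(\<Sum>\<gamma>\<in>tuples m (sub_dims C d). \<phi> k (merge J \<alpha> \<gamma>) * cnj (\<phi> k' (merge J \<alpha>' \<gamma>))) = (\<Sum>b<U. G b \<alpha> k * cnj (G b \<alpha>' k'))"
        unfolding Z_def s_def by (rule sym)
    next
      fix b b' assume b: "b < U" "b' < U"
      let ?X = "\<lambda>z z'. \<Sum>k<T. \<Sum>\<alpha>\<in>A. \<phi> k (merge J \<alpha> z) * cnj (\<phi> k (merge J \<alpha> z'))"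
      have X: "?X z z' = (\<Sum>c<U. of_real (\<mu> c) * ?w c z * cnj (?w c z'))" if "z \<in> Z" "z' \<in> Z" for z z'
      proof -
        have "?X z z' = ?R $$ (enc m s z, enc m s z')" unfolding idx[OF that] by (rule sum.swap)
        also have "\<dots> = (\<Sum>c<U. of_real (\<mu> c) * ?w c z * cnj (?w c z'))"
          using e that enc_lt[of _ m s] unfolding spec_def Z_def U_def by simp
        finally show ?thesis .
      qed
      have "(\<Sum>k<T. \<Sum>\<alpha>\<in>A. G b \<alpha> k * cnj (G b' \<alpha> k))
        = (\<Sum>k<T. \<Sum>\<alpha>\<in>A. \<Sum>z\<in>Z. \<Sum>z'\<in>Z. cnj (?w b z) * ?w b' z' * (\<phi> k (merge J \<alpha> z) * cnj (\<phi> k (merge J \<alpha> z'))))"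
        unfolding G_def cnj_sum sum_product by (intro sum.cong refl) simp
      also have "\<dots> = (\<Sum>z\<in>Z. \<Sum>z'\<in>Z. cnj (?w b z) * ?w b' z' * ?X z z')"
        unfolding sum_distrib_left by (rule trans[OF sum_swap4 sum_swap4])
      also have "\<dots> = (\<Sum>z\<in>Z. \<Sum>z'\<in>Z. \<Sum>c<U. of_real (\<mu> c) * (cnj (?w b z) * ?w c z) * (cnj (?w c z') * ?w b' z'))"
      proof (intro sum.cong refl)
        fix z z' assume z: "z \<in> Z" "z' \<in> Z"
        show "cnj (?w b z) * ?w b' z' * ?X z z' = (\<Sum>c<U. of_real (\<mu> c) * (cnj (?w b z) * ?w c z) * (cnj (?w c z') * ?w b' z'))"
          unfolding X[OF z] sum_distrib_left by (intro sum.cong refl) (simp only: mult_ac)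
      qed
      also have "\<dots> = (\<Sum>z\<in>Z. \<Sum>c<U. \<Sum>z'\<in>Z. of_real (\<mu> c) * (cnj (?w b z) * ?w c z) * (cnj (?w c z') * ?w b' z'))"
        by (intro sum.cong refl sum.swap)
      also have "\<dots> = (\<Sum>c<U. \<Sum>z\<in>Z. \<Sum>z'\<in>Z. of_real (\<mu> c) * (cnj (?w b z) * ?w c z) * (cnj (?w c z') * ?w b' z'))"
        by (rule sum.swap)
      also have "\<dots> = (\<Sum>c<U. of_real (\<mu> c) * (\<Sum>z\<in>Z. cnj (?w b z) * ?w c z) * (\<Sum>z'\<in>Z. cnj (?w c z') * ?w b' z'))"
        unfolding sum_distrib_left[symmetric] sum_distrib_right[symmetric] ..
      also have "\<dots> = (\<Sum>c<U. of_real (\<mu> c) * (if b = c then 1 else 0) * (if c = b' then 1 else 0))"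
        using b by (intro sum.cong refl) (simp add: orth)
      also have "\<dots> = (\<Sum>c<U. (if c = b then 1 else 0) * (if b = b' then of_real (\<mu> b) else 0))"
        by (intro sum.cong refl) auto
      also have "\<dots> = (if b = b' then of_real (\<mu> b) else 0)"
        using b by (subst sum_delta_mult) simp_all
      finally show "(\<Sum>k<T. \<Sum>\<alpha>\<in>tuples m (sub_dims J d). G b \<alpha> k * cnj (G b' \<alpha> k)) = (if b = b' then of_real (\<mu> b) else 0)"
        unfolding A_def .
    qed (use \<mu> in auto)
  qed
qed

definition iid_vec :: "(nat \<Rightarrow> nat) \<Rightarrow> (nat \<Rightarrow> (nat \<Rightarrow> nat) \<Rightarrow> complex) \<Rightarrow> nat \<Rightarrow> (nat \<Rightarrow> nat) \<Rightarrow> (nat \<Rightarrow> nat) \<Rightarrow> complex" where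
  "iid_vec d \<phi> n e x = (\<Prod>t<n. \<phi> (e t) (dig d t x))"

definition iid_coeff :: "(nat \<Rightarrow> nat) \<Rightarrow> (nat \<Rightarrow> (nat \<Rightarrow> nat) \<Rightarrow> nat \<Rightarrow> complex) \<Rightarrow> nat \<Rightarrow> (nat \<Rightarrow> nat) \<Rightarrow> (nat \<Rightarrow> nat) \<Rightarrow> (nat \<Rightarrow> nat) \<Rightarrow> complex" where
  "iid_coeff s G n b \<alpha> e = (\<Prod>t<n. G (b t) (dig s t \<alpha>) (e t))"

lemma prod_delta_tuples:
  fixes l :: "nat \<Rightarrow> real"
  assumes "e \<in> tuples n D" "e' \<in> tuples n D"
  shows "(\<Prod>t<n. if e t = e' t then complex_of_real (l (e t)) else 0) = (if e = e' then of_real (\<Prod>t<n. l (e t)) else 0)"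
proof (cases "e = e'")
  case False
  then obtain t where t: "e t \<noteq> e' t" by blast
  then have "t < n" using tuplesD(2)[OF assms(1), of t] tuplesD(2)[OF assms(2), of t] by (cases "t < n") auto
  then show ?thesis using t False by (auto intro!: prod_zero)
qed simp

lemma sub_dims_power: "sub_dims J (\<lambda>i. d i ^ n) = (\<lambda>i. sub_dims J d i ^ n)"
  by (auto simp: sub_dims_def)

lemma dig_merge:
  assumes "J \<subseteq> {..<m}" "\<gamma> \<in> tuples m s"
  shows "dig d t (merge J \<alpha> \<gamma>) = merge J (dig (sub_dims J d) t \<alpha>) (dig (sub_dims ({..<m} - J) d) t \<gamma>)"
proof
  fix i show "dig d t (merge J \<alpha> \<gamma>) i = merge J (dig (sub_dims J d) t \<alpha>) (dig (sub_dims ({..<m} - J) d) t \<gamma>) i"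
    using tuplesD(2)[OF assms(2), of i] by (cases "i < m") (auto simp: dig_def merge_def sub_dims_def)
qed

lemma iid_vec_orth:
  assumes orth: "\<And>k k'. k < T \<Longrightarrow> k' < T \<Longrightarrow> (\<Sum>x\<in>tuples m d. \<phi> k x * cnj (\<phi> k' x)) = (if k = k' then of_real (l k) else 0)"
    and e: "e \<in> tuples n (\<lambda>_. T)" "e' \<in> tuples n (\<lambda>_. T)"
  shows "(\<Sum>x\<in>tuples m (\<lambda>i. d i ^ n). iid_vec d \<phi> n e x * cnj (iid_vec d \<phi> n e' x))
    = (if e = e' then of_real (\<Prod>t<n. l (e t)) else 0)"
proof -
  have "(\<Sum>x\<in>tuples m (\<lambda>i. d i ^ n). iid_vec d \<phi> n e x * cnj (iid_vec d \<phi> n e' x))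
    = (\<Sum>x\<in>tuples m (\<lambda>i. d i ^ n). \<Prod>t<n. \<phi> (e t) (dig d t x) * cnj (\<phi> (e' t) (dig d t x)))"
    unfolding iid_vec_def prod.distrib cnj_prod ..
  also have "\<dots> = (\<Prod>t<n. \<Sum>y\<in>tuples m d. \<phi> (e t) y * cnj (\<phi> (e' t) y))"
    by (rule sum_tuples_digits[of "\<lambda>t y. \<phi> (e t) y * cnj (\<phi> (e' t) y)"])
  also have "\<dots> = (\<Prod>t<n. if e t = e' t then of_real (l (e t)) else 0)"
    by (intro prod.cong refl orth) (use tuplesD(1)[OF e(1)] tuplesD(1)[OF e(2)] in auto)
  finally show ?thesis unfolding prod_delta_tuples[OF e] .
qed

lemma iid_tensor_pow:
  assumes d: "\<And>i. i < m \<Longrightarrow> d i \<ge> 1"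
    and \<phi>: "\<And>x y. x \<in> tuples m d \<Longrightarrow> y \<in> tuples m d \<Longrightarrow> \<rho> $$ (enc m d x, enc m d y) = (\<Sum>k<T. \<phi> k x * cnj (\<phi> k y))"
    and xy: "x \<in> tuples m (\<lambda>i. d i ^ n)" "y \<in> tuples m (\<lambda>i. d i ^ n)"
  shows "tensor_pow m d n \<rho> $$ (enc m (\<lambda>i. d i ^ n) x, enc m (\<lambda>i. d i ^ n) y)
    = (\<Sum>e\<in>tuples n (\<lambda>_. T). iid_vec d \<phi> n e x * cnj (iid_vec d \<phi> n e y))"
proof -
  have "tensor_pow m d n \<rho> $$ (enc m (\<lambda>i. d i ^ n) x, enc m (\<lambda>i. d i ^ n) y)
    = (\<Prod>t<n. \<Sum>k<T. \<phi> k (dig d t x) * cnj (\<phi> k (dig d t y)))"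
    unfolding tensor_pow_index[OF xy]
    by (intro prod.cong refl \<phi> dig_in_tuples[OF d xy(1)] dig_in_tuples[OF d xy(2)])
  also have "\<dots> = (\<Sum>e\<in>tuples n (\<lambda>_. T). \<Prod>t<n. \<phi> (e t) (dig d t x) * cnj (\<phi> (e t) (dig d t y)))"
    by (rule sum_tuples_prod[of "\<lambda>t k. \<phi> k (dig d t x) * cnj (\<phi> k (dig d t y))" n "\<lambda>_. T", symmetric])
  finally show ?thesis unfolding iid_vec_def prod.distrib cnj_prod .
qed

lemma tensor_pow_psd:
  fixes T :: nat
  assumes d: "\<And>i. i < m \<Longrightarrow> d i \<ge> 1"
    and \<phi>: "\<And>x y. x \<in> tuples m d \<Longrightarrow> y \<in> tuples m d \<Longrightarrow> \<rho> $$ (enc m d x, enc m d y) = (\<Sum>k<T. \<phi> k x * cnj (\<phi> k y))"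
  shows "psd (tensor_pow m d n \<rho>)"
proof -
  let ?s = "\<lambda>i. d i ^ n"
  have c: "tensor_pow m d n \<rho> \<in> carrier_mat (tdim m ?s) (tdim m ?s)" by (simp add: tensor_pow_def)
  have "psdk {..<tdim m ?s} (ker (tensor_pow m d n \<rho>))"
  proof (subst psdk_cong)
    fix a b assume "a \<in> {..<tdim m ?s}" "b \<in> {..<tdim m ?s}"
    then have ab: "a < tdim m ?s" "b < tdim m ?s" by auto
    show "ker (tensor_pow m d n \<rho>) a b = (\<Sum>e\<in>tuples n (\<lambda>_. T). iid_vec d \<phi> n e (dec m ?s a) * cnj (iid_vec d \<phi> n e (dec m ?s b)))"
      using iid_tensor_pow[OF d \<phi> dec_in_tuples[OF ab(1)] dec_in_tuples[OF ab(2)]]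
      unfolding enc_dec[OF ab(1)] enc_dec[OF ab(2)] ker_def .
  qed (rule psdk_gram)
  then show ?thesis using psd_iff[OF c] by blast
qed

lemma iid_reduced:
  assumes d: "\<And>i. i < m \<Longrightarrow> d i \<ge> 1" and J: "J \<subseteq> {..<m}"
    and dec: "\<And>\<alpha> \<alpha>' k k'. \<alpha> \<in> tuples m (sub_dims J d) \<Longrightarrow> \<alpha>' \<in> tuples m (sub_dims J d) \<Longrightarrow>
       (\<Sum>\<gamma>\<in>tuples m (sub_dims ({..<m} - J) d). \<phi> k (merge J \<alpha> \<gamma>) * cnj (\<phi> k' (merge J \<alpha>' \<gamma>))) = (\<Sum>b<U. G b \<alpha> k * cnj (G b \<alpha>' k'))"
    and \<alpha>: "\<alpha> \<in> tuples m (sub_dims J (\<lambda>i. d i ^ n))" "\<alpha>' \<in> tuples m (sub_dims J (\<lambda>i. d i ^ n))"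
  shows "(\<Sum>\<gamma>\<in>tuples m (sub_dims ({..<m} - J) (\<lambda>i. d i ^ n)). iid_vec d \<phi> n e (merge J \<alpha> \<gamma>) * cnj (iid_vec d \<phi> n e' (merge J \<alpha>' \<gamma>)))
     = (\<Sum>b\<in>tuples n (\<lambda>_. U). iid_coeff (sub_dims J d) G n b \<alpha> e * cnj (iid_coeff (sub_dims J d) G n b \<alpha>' e'))"
proof -
  let ?s = "sub_dims J d" and ?c = "sub_dims ({..<m} - J) d"
  let ?h = "\<lambda>t y. \<phi> (e t) (merge J (dig ?s t \<alpha>) y) * cnj (\<phi> (e' t) (merge J (dig ?s t \<alpha>') y))"
  have "(\<Sum>\<gamma>\<in>tuples m (sub_dims ({..<m} - J) (\<lambda>i. d i ^ n)). iid_vec d \<phi> n e (merge J \<alpha> \<gamma>) * cnj (iid_vec d \<phi> n e' (merge J \<alpha>' \<gamma>)))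
    = (\<Sum>\<gamma>\<in>tuples m (\<lambda>i. ?c i ^ n). \<Prod>t<n. ?h t (dig ?c t \<gamma>))"
    unfolding iid_vec_def prod.distrib cnj_prod sub_dims_power by (intro sum.cong refl) (simp only: dig_merge[OF J])
  also have "\<dots> = (\<Prod>t<n. \<Sum>y\<in>tuples m ?c. ?h t y)" by (rule sum_tuples_digits)
  also have "\<dots> = (\<Prod>t<n. \<Sum>b<U. G b (dig ?s t \<alpha>) (e t) * cnj (G b (dig ?s t \<alpha>') (e' t)))"
    by (intro prod.cong refl dec dig_in_tuples[where n=n] \<alpha>[unfolded sub_dims_power])
      (use d in \<open>auto simp: sub_dims_def\<close>)
  also have "\<dots> = (\<Sum>b\<in>tuples n (\<lambda>_. U). \<Prod>t<n. G (b t) (dig ?s t \<alpha>) (e t) * cnj (G (b t) (dig ?s t \<alpha>') (e' t)))"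
    by (rule sum_tuples_prod[of "\<lambda>t b. G b (dig ?s t \<alpha>) (e t) * cnj (G b (dig ?s t \<alpha>') (e' t))" n "\<lambda>_. U", symmetric])
  finally show ?thesis unfolding iid_coeff_def prod.distrib cnj_prod .
qed

lemma iid_coeff_orth:
  assumes orth: "\<And>b b'. b < U \<Longrightarrow> b' < U \<Longrightarrow>
       (\<Sum>k<T. \<Sum>\<alpha>\<in>tuples m s. G b \<alpha> k * cnj (G b' \<alpha> k)) = (if b = b' then of_real (\<mu> b) else 0)"
    and b: "b \<in> tuples n (\<lambda>_. U)" "b' \<in> tuples n (\<lambda>_. U)"
  shows "(\<Sum>e\<in>tuples n (\<lambda>_. T). \<Sum>\<alpha>\<in>tuples m (\<lambda>i. s i ^ n). iid_coeff s G n b \<alpha> e * cnj (iid_coeff s G n b' \<alpha> e))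
    = (if b = b' then of_real (\<Prod>t<n. \<mu> (b t)) else 0)"
proof -
  have "(\<Sum>e\<in>tuples n (\<lambda>_. T). \<Sum>\<alpha>\<in>tuples m (\<lambda>i. s i ^ n). iid_coeff s G n b \<alpha> e * cnj (iid_coeff s G n b' \<alpha> e))
    = (\<Sum>e\<in>tuples n (\<lambda>_. T). \<Sum>\<alpha>\<in>tuples m (\<lambda>i. s i ^ n). \<Prod>t<n. G (b t) (dig s t \<alpha>) (e t) * cnj (G (b' t) (dig s t \<alpha>) (e t)))"
    unfolding iid_coeff_def prod.distrib cnj_prod ..
  also have "\<dots> = (\<Sum>e\<in>tuples n (\<lambda>_. T). \<Prod>t<n. \<Sum>y\<in>tuples m s. G (b t) y (e t) * cnj (G (b' t) y (e t)))"
    by (intro sum.cong refl) (rule sum_tuples_digits)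
  also have "\<dots> = (\<Prod>t<n. \<Sum>k<T. \<Sum>y\<in>tuples m s. G (b t) y k * cnj (G (b' t) y k))"
    by (rule sum_tuples_prod)
  also have "\<dots> = (\<Prod>t<n. if b t = b' t then of_real (\<mu> (b t)) else 0)"
    by (intro prod.cong refl orth) (use tuplesD(1)[OF b(1)] tuplesD(1)[OF b(2)] in auto)
  finally show ?thesis unfolding prod_delta_tuples[OF b] .
qed

text \<open>The typical parts for \<open>one_shot\<close> are given by thresholds. Environment
  strings of eigenvalue at least \<open>a\<close> number at most \<open>1 / a\<close>, which
  replaces \<open>card E\<close>; for each \<open>J\<close>, strings \<open>b\<close> of weight at
  most \<open>g J\<close> make a good part of purity at most \<open>g J\<close>. The discarded
  weights are bounded by \<open>\<tau>\<close> and \<open>\<epsilon>\<close>.\<close>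

theorem iid_protocol:
  fixes m i0 K n T :: nat and d :: "nat \<Rightarrow> nat" and l :: "nat \<Rightarrow> real" and \<mu> :: "nat set \<Rightarrow> nat \<Rightarrow> real"
    and G :: "nat set \<Rightarrow> nat \<Rightarrow> (nat \<Rightarrow> nat) \<Rightarrow> nat \<Rightarrow> complex" and g :: "nat set \<Rightarrow> real"
  assumes i0: "i0 < m" and K: "K \<ge> 1" and d: "\<And>i. i < m \<Longrightarrow> d i \<ge> 1"
    and l: "\<And>k. k < T \<Longrightarrow> 0 \<le> l k" "(\<Sum>k<T. l k) = 1"
    and orth: "\<And>k k'. k < T \<Longrightarrow> k' < T \<Longrightarrow> (\<Sum>x\<in>tuples m d. \<phi> k x * cnj (\<phi> k' x)) = (if k = k' then of_real (l k) else 0)"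
  defines "\<J> \<equiv> Pow ({..<m} - {i0}) - {{}}"
  assumes \<mu>: "\<And>J b. J \<in> \<J> \<Longrightarrow> b < U J \<Longrightarrow> 0 \<le> \<mu> J b" "\<And>J. J \<in> \<J> \<Longrightarrow> (\<Sum>b<U J. \<mu> J b) = 1"
    and dec: "\<And>J \<alpha> \<alpha>' k k'. J \<in> \<J> \<Longrightarrow> \<alpha> \<in> tuples m (sub_dims J d) \<Longrightarrow> \<alpha>' \<in> tuples m (sub_dims J d) \<Longrightarrow>
       (\<Sum>\<gamma>\<in>tuples m (sub_dims ({..<m} - J) d). \<phi> k (merge J \<alpha> \<gamma>) * cnj (\<phi> k' (merge J \<alpha>' \<gamma>))) = (\<Sum>b<U J. G J b \<alpha> k * cnj (G J b \<alpha>' k'))"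
    and Gorth: "\<And>J b b'. J \<in> \<J> \<Longrightarrow> b < U J \<Longrightarrow> b' < U J \<Longrightarrow>
       (\<Sum>k<T. \<Sum>\<alpha>\<in>tuples m (sub_dims J d). G J b \<alpha> k * cnj (G J b' \<alpha> k)) = (if b = b' then of_real (\<mu> J b) else 0)"
    and a: "0 < a" and g: "\<And>J. 0 \<le> g J"
    and tail: "(\<Sum>e\<in>{e\<in>tuples n (\<lambda>_. T). \<not> a \<le> (\<Prod>t<n. l (e t))}. \<Prod>t<n. l (e t)) \<le> \<tau>"
    and tail': "\<And>J. J \<in> \<J> \<Longrightarrow> (\<Sum>b\<in>{b\<in>tuples n (\<lambda>_. U J). \<not> (\<Prod>t<n. \<mu> J (b t)) \<le> g J}. \<Prod>t<n. \<mu> J (b t)) \<le> \<epsilon>"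
  obtains V where "locc_value m (\<lambda>i. d i ^ n) (\<lambda>_. K) (ghz_vec m K) V"
    "1 - \<tau> - (\<Sum>J\<in>\<J>. sqrt (real ((2 * K) ^ card J) * (g J / a)) + 2 ^ card J * \<epsilon>) / 2
      \<le> sqrt (\<Sum>e\<in>tuples n (\<lambda>_. T). V (iid_vec d \<phi> n e))"
proof -
  define S where "S = tuples n (\<lambda>_. T)"
  define E where "E = {e\<in>S. a \<le> (\<Prod>t<n. l (e t))}"
  define Bg where "Bg J = {b\<in>tuples n (\<lambda>_. U J). (\<Prod>t<n. \<mu> J (b t)) \<le> g J}" for J
  define Bb where "Bb J = {b\<in>tuples n (\<lambda>_. U J). \<not> (\<Prod>t<n. \<mu> J (b t)) \<le> g J}" for J
  define lam where "lam e = (\<Prod>t<n. l (e t))" for e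
  define om where "om J b = (\<Prod>t<n. \<mu> J (b t))" for J b
  define H where "H J = iid_coeff (sub_dims J d) (G J) n" for J
  define A where "A J = tuples m (sub_dims J (\<lambda>i. d i ^ n))" for J
  have fS: "finite S" and ES: "E \<subseteq> S" by (auto simp: S_def E_def)
  have fE: "finite E" using fS ES by (rule rev_finite_subset)
  have fA: "finite (A J)" for J by (simp add: A_def)
  have lam0: "0 \<le> lam e" if "e \<in> S" for e
    unfolding lam_def using that l(1) tuplesD(1)[of e n "\<lambda>_. T"] by (intro prod_nonneg) (auto simp: S_def)
  have lamS: "(\<Sum>e\<in>S. lam e) = 1" unfolding S_def lam_def by (rule sum_iid_one[OF l(2)])
  have om0: "0 \<le> om J b" if "J \<in> \<J>" "b \<in> tuples n (\<lambda>_. U J)" for J b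
    unfolding om_def using that \<mu>(1) tuplesD(1)[of b n "\<lambda>_. U J"] by (intro prod_nonneg) auto
  have lamE1: "(\<Sum>e\<in>E. lam e) \<le> 1"
    unfolding lamS[symmetric] by (rule sum_mono2) (use fS ES lam0 in auto)
  have split: "(\<Sum>e\<in>E. lam e) + (\<Sum>e\<in>{e\<in>S. \<not> a \<le> lam e}. lam e) = 1"
  proof -
    have "S = E \<union> {e\<in>S. \<not> a \<le> lam e}" by (auto simp: E_def lam_def)
    moreover have "E \<inter> {e\<in>S. \<not> a \<le> lam e} = {}" by (auto simp: E_def lam_def)
    ultimately show ?thesis using lamS sum.union_disjoint[of E "{e\<in>S. \<not> a \<le> lam e}" lam] fE fS by simp
  qed
  have cardE: "real (card E) \<le> 1 / a"
  proof -
    have "real (card E) * a = (\<Sum>e\<in>E. a)" by simp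
    also have "\<dots> \<le> (\<Sum>e\<in>E. lam e)" by (intro sum_mono) (auto simp: E_def lam_def)
    also have "\<dots> \<le> 1" by (rule lamE1)
    finally show ?thesis using a by (simp add: pos_le_divide_eq)
  qed
  have Hmass: "(\<Sum>e\<in>S. \<Sum>\<alpha>\<in>A J. H J b \<alpha> e * cnj (H J b' \<alpha> e)) = (if b = b' then of_real (om J b) else 0)"
    if "J \<in> \<J>" "b \<in> tuples n (\<lambda>_. U J)" "b' \<in> tuples n (\<lambda>_. U J)" for J b b'
    unfolding S_def A_def H_def om_def sub_dims_power by (rule iid_coeff_orth[OF Gorth that(2,3)]) (use that in auto)
  have good: "(\<Sum>e\<in>E. \<Sum>e'\<in>E. \<Sum>\<alpha>\<in>A J. \<Sum>\<alpha>'\<in>A J. (cmod (\<Sum>b\<in>Bg J. H J b \<alpha> e * cnj (H J b \<alpha>' e')))\<^sup>2) \<le> g J"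
    if J: "J \<in> \<J>" for J
  proof -
    let ?q = "\<lambda>e e' \<alpha> \<alpha>'. (cmod (\<Sum>b\<in>Bg J. H J b \<alpha> e * cnj (H J b \<alpha>' e')))\<^sup>2"
    \<comment> \<open>The coefficient vectors are orthogonal only over all environment strings, so
      \<open>E\<close> is first enlarged to \<open>S\<close>. Then \<open>gram_swap\<close> leaves
      the sum of the squares of \<open>om J b\<close>, and the threshold takes out one factor
      \<open>g J\<close>.\<close>
    have "(\<Sum>e\<in>E. \<Sum>e'\<in>E. \<Sum>\<alpha>\<in>A J. \<Sum>\<alpha>'\<in>A J. ?q e e' \<alpha> \<alpha>') \<le> (\<Sum>e\<in>E. \<Sum>e'\<in>S. \<Sum>\<alpha>\<in>A J. \<Sum>\<alpha>'\<in>A J. ?q e e' \<alpha> \<alpha>')"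
      by (intro sum_mono sum_mono2 fS ES sum_nonneg) auto
    also have "\<dots> \<le> (\<Sum>e\<in>S. \<Sum>e'\<in>S. \<Sum>\<alpha>\<in>A J. \<Sum>\<alpha>'\<in>A J. ?q e e' \<alpha> \<alpha>')"
      by (intro sum_mono2 fS ES sum_nonneg) auto
    also have "\<dots> = (\<Sum>e\<in>S. \<Sum>\<alpha>\<in>A J. \<Sum>e'\<in>S. \<Sum>\<alpha>'\<in>A J. ?q e e' \<alpha> \<alpha>')"
      by (intro sum.cong refl sum.swap)
    also have "\<dots> = (\<Sum>p\<in>S \<times> A J. \<Sum>p'\<in>S \<times> A J. (cmod (\<Sum>b\<in>Bg J. H J b (snd p) (fst p) * cnj (H J b (snd p') (fst p'))))\<^sup>2)"
      unfolding sum_pairs fst_conv snd_conv ..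
    also have "\<dots> = (\<Sum>b\<in>Bg J. \<Sum>b'\<in>Bg J. (cmod (\<Sum>p\<in>S \<times> A J. H J b (snd p) (fst p) * cnj (H J b' (snd p) (fst p))))\<^sup>2)"
      by (rule gram_swap[of "\<lambda>b p. H J b (snd p) (fst p)"])
    also have "\<dots> = (\<Sum>b\<in>Bg J. \<Sum>b'\<in>Bg J. if b' = b then (om J b)\<^sup>2 else 0)"
    proof (intro sum.cong refl)
      fix b b' assume b: "b \<in> Bg J" "b' \<in> Bg J"
      then have bt: "b \<in> tuples n (\<lambda>_. U J)" "b' \<in> tuples n (\<lambda>_. U J)" by (auto simp: Bg_def)
      show "(cmod (\<Sum>p\<in>S \<times> A J. H J b (snd p) (fst p) * cnj (H J b' (snd p) (fst p))))\<^sup>2 = (if b' = b then (om J b)\<^sup>2 else 0)"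
        unfolding sum_pairs fst_conv snd_conv Hmass[OF J bt] by auto
    qed
    also have "\<dots> = (\<Sum>b\<in>Bg J. (om J b)\<^sup>2)" by (intro sum.cong refl) (simp add: Bg_def)
    also have "\<dots> \<le> (\<Sum>b\<in>Bg J. g J * om J b)"
      unfolding power2_eq_square by (intro sum_mono mult_right_mono) (use om0[OF J] in \<open>auto simp: Bg_def om_def\<close>)
    also have "\<dots> \<le> (\<Sum>b\<in>tuples n (\<lambda>_. U J). g J * om J b)"
      by (intro sum_mono2) (use om0[OF J] g in \<open>auto simp: Bg_def\<close>)
    also have "\<dots> = g J" unfolding sum_distrib_left[symmetric] om_def sum_iid_one[OF \<mu>(2)[OF J]] by simp
    finally show ?thesis .
  qed
  have bad: "(\<Sum>b\<in>Bb J. \<Sum>\<alpha>\<in>A J. \<Sum>e\<in>E. (cmod (H J b \<alpha> e))\<^sup>2) \<le> \<epsilon>" if J: "J \<in> \<J>" for J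
  proof -
    have "(\<Sum>\<alpha>\<in>A J. \<Sum>e\<in>E. (cmod (H J b \<alpha> e))\<^sup>2) \<le> om J b" if b: "b \<in> Bb J" for b
    proof -
      have bt: "b \<in> tuples n (\<lambda>_. U J)" using b by (simp add: Bb_def)
      have "complex_of_real (\<Sum>e\<in>S. \<Sum>\<alpha>\<in>A J. (cmod (H J b \<alpha> e))\<^sup>2) = of_real (om J b)"
        unfolding of_real_sum mult_cnj_eq(1)[symmetric] Hmass[OF J bt bt] by simp
      then have s: "(\<Sum>e\<in>S. \<Sum>\<alpha>\<in>A J. (cmod (H J b \<alpha> e))\<^sup>2) = om J b" by (simp only: of_real_eq_iff)
      have "(\<Sum>\<alpha>\<in>A J. \<Sum>e\<in>E. (cmod (H J b \<alpha> e))\<^sup>2) = (\<Sum>e\<in>E. \<Sum>\<alpha>\<in>A J. (cmod (H J b \<alpha> e))\<^sup>2)" by (rule sum.swap)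
      also have "\<dots> \<le> om J b" unfolding s[symmetric] by (intro sum_mono2 fS ES sum_nonneg) auto
      finally show ?thesis .
    qed
    then have "(\<Sum>b\<in>Bb J. \<Sum>\<alpha>\<in>A J. \<Sum>e\<in>E. (cmod (H J b \<alpha> e))\<^sup>2) \<le> (\<Sum>b\<in>Bb J. om J b)" by (rule sum_mono)
    also have "\<dots> \<le> \<epsilon>" using tail'[OF J] by (simp add: Bb_def om_def)
    finally show ?thesis .
  qed
  have BB: "Bg J \<union> Bb J = tuples n (\<lambda>_. U J)" for J by (auto simp: Bg_def Bb_def)
  have Jsub: "J \<subseteq> {..<m}" if "J \<in> \<J>" for J using that by (auto simp: \<J>_def)
  show thesis
  proof (rule one_shot[of i0 m K "\<lambda>i. d i ^ n" E Bg Bb lam "iid_vec d \<phi> n" H g \<epsilon>])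
    fix V assume V: "locc_value m (\<lambda>i. d i ^ n) (\<lambda>_. K) (ghz_vec m K) V" "\<And>\<phi>. 0 \<le> V \<phi>"
      "(\<Sum>e\<in>E. lam e) - (\<Sum>J\<in>Pow ({..<m} - {i0}) - {{}}. sqrt (real ((2 * K) ^ card J * card E) * g J) + 2 ^ card J * \<epsilon>) / 2
        \<le> sqrt (\<Sum>e\<in>E. V (iid_vec d \<phi> n e))"
    have t: "sqrt (real ((2 * K) ^ card J * card E) * g J) \<le> sqrt (real ((2 * K) ^ card J) * (g J / a))" for J
    proof -
      have "real ((2 * K) ^ card J * card E) * g J = real ((2 * K) ^ card J) * (real (card E) * g J)" by simp
      also have "\<dots> \<le> real ((2 * K) ^ card J) * (1 / a * g J)"
        by (intro mult_left_mono mult_right_mono cardE g) simp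
      finally show ?thesis by (intro real_sqrt_le_mono) simp
    qed
    have "1 - \<tau> \<le> (\<Sum>e\<in>E. lam e)" using split tail unfolding S_def lam_def by linarith
    moreover have "(\<Sum>J\<in>\<J>. sqrt (real ((2 * K) ^ card J * card E) * g J) + 2 ^ card J * \<epsilon>)
      \<le> (\<Sum>J\<in>\<J>. sqrt (real ((2 * K) ^ card J) * (g J / a)) + 2 ^ card J * \<epsilon>)"
      by (intro sum_mono add_right_mono t)
    moreover have "sqrt (\<Sum>e\<in>E. V (iid_vec d \<phi> n e)) \<le> sqrt (\<Sum>e\<in>S. V (iid_vec d \<phi> n e))"
      by (intro real_sqrt_le_mono sum_mono2 fS ES V(2))
    ultimately have "1 - \<tau> - (\<Sum>J\<in>\<J>. sqrt (real ((2 * K) ^ card J) * (g J / a)) + 2 ^ card J * \<epsilon>) / 2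
      \<le> sqrt (\<Sum>e\<in>S. V (iid_vec d \<phi> n e))"
      using V(3) unfolding \<J>_def[symmetric] by linarith
    then show thesis unfolding S_def by (rule that[OF V(1)])
  next
    fix j assume "j < m" then show "1 \<le> d j ^ n" using d[of j] by simp
  next
    fix e e' assume "e \<in> E" "e' \<in> E"
    then show "(\<Sum>x\<in>tuples m (\<lambda>i. d i ^ n). iid_vec d \<phi> n e x * cnj (iid_vec d \<phi> n e' x)) = (if e = e' then of_real (lam e) else 0)"
      unfolding lam_def using ES by (intro iid_vec_orth[OF orth]) (auto simp: S_def)
  next
    fix J \<alpha> \<alpha>' e e' assume J: "J \<in> Pow ({..<m} - {i0}) - {{}}" and \<alpha>: "\<alpha> \<in> tuples m (sub_dims J (\<lambda>i. d i ^ n))" "\<alpha>' \<in> tuples m (sub_dims J (\<lambda>i. d i ^ n))"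
    note J' = J[folded \<J>_def]
    show "(\<Sum>\<gamma>\<in>tuples m (sub_dims ({..<m} - J) (\<lambda>i. d i ^ n)). iid_vec d \<phi> n e (merge J \<alpha> \<gamma>) * cnj (iid_vec d \<phi> n e' (merge J \<alpha>' \<gamma>))) =
       (\<Sum>b\<in>Bg J \<union> Bb J. H J b \<alpha> e * cnj (H J b \<alpha>' e'))"
      unfolding BB H_def by (rule iid_reduced[OF d Jsub[OF J'] dec[OF J'] \<alpha>])
  qed (use i0 K fE lam0 lamE1 ES good bad in \<open>auto simp: Bg_def Bb_def A_def \<J>_def\<close>)
qed

section \<open>From protocols to achievable rates\<close>

lemma ghz_achievableI:
  fixes T :: nat
  assumes m: "m \<ge> 1" and d: "\<And>i. i < m \<Longrightarrow> d i \<ge> 1"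
    and \<phi>: "\<And>x y. x \<in> tuples m d \<Longrightarrow> y \<in> tuples m d \<Longrightarrow> \<rho> $$ (enc m d x, enc m d y) = (\<Sum>k<T. \<phi> k x * cnj (\<phi> k y))"
    and V: "\<And>n. \<exists>V. locc_value m (\<lambda>i. d i ^ n) (\<lambda>_. 2 ^ k n) (ghz_vec m (2 ^ k n)) V \<and>
       1 - \<epsilon> n \<le> sqrt (\<Sum>e\<in>tuples n (\<lambda>_. T). V (iid_vec d \<phi> n e))"
    and lim: "\<epsilon> \<longlonglongrightarrow> 0" "(\<lambda>n. real (k n) / real n) \<longlonglongrightarrow> R"
  shows "ghz_achievable m d \<rho> R"
proof -
  have "\<exists>\<Lambda>. locc m (\<lambda>i. d i ^ n) (\<lambda>_. 2 ^ k n) \<Lambda> \<and>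
      1 - \<epsilon> n \<le> fidelity (tensor_pow m (\<lambda>_. 2) (k n) (ghz m)) (\<Lambda> (tensor_pow m d n \<rho>))" for n
  proof -
    from V[of n] obtain V where lv: "locc_value m (\<lambda>i. d i ^ n) (\<lambda>_. 2 ^ k n) (ghz_vec m (2 ^ k n)) V"
      and b: "1 - \<epsilon> n \<le> sqrt (\<Sum>e\<in>tuples n (\<lambda>_. T). V (iid_vec d \<phi> n e))" by blast
    show ?thesis
    proof (rule locc_value_fidelity[OF lv finite_tuples, of "tensor_pow m d n \<rho>" "iid_vec d \<phi> n" n "\<lambda>_. T"])
      show "tensor_pow m d n \<rho> \<in> carrier_mat (tdim m (\<lambda>i. d i ^ n)) (tdim m (\<lambda>i. d i ^ n))" by (simp add: tensor_pow_def)
      show "psd (tensor_pow m d n \<rho>)" by (rule tensor_pow_psd[OF d \<phi>])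
      show "(\<Sum>x\<in>tuples m (\<lambda>_. 2 ^ k n). (cmod (ghz_vec m (2 ^ k n) x))\<^sup>2) = 1" using m by (intro ghz_vec_norm) simp_all
      fix \<Lambda> assume "locc m (\<lambda>i. d i ^ n) (\<lambda>_. 2 ^ k n) \<Lambda>"
        "fidelity (rank1 (tdim m (\<lambda>_. 2 ^ k n)) (\<lambda>a. ghz_vec m (2 ^ k n) (dec m (\<lambda>_. 2 ^ k n) a))) (\<Lambda> (tensor_pow m d n \<rho>))
          = sqrt (\<Sum>e\<in>tuples n (\<lambda>_. T). V (iid_vec d \<phi> n e))"
      then show ?thesis using b unfolding tensor_pow_ghz[OF m] by (intro exI[of _ \<Lambda>]) simp
    qed (rule iid_tensor_pow[OF d \<phi>])
  qed
  then obtain \<Lambda> where "\<And>n. locc m (\<lambda>i. d i ^ n) (\<lambda>_. 2 ^ k n) (\<Lambda> n) \<and>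
      1 - \<epsilon> n \<le> fidelity (tensor_pow m (\<lambda>_. 2) (k n) (ghz m)) (\<Lambda> n (tensor_pow m d n \<rho>))" by metis
  then show ?thesis unfolding ghz_achievable_def
    by (intro exI[of _ k] exI[of _ \<epsilon>] exI[of _ \<Lambda>] conjI allI lim) simp_all
qed

lemma floor_rate:
  fixes R :: real
  assumes "0 \<le> R"
  shows "(\<lambda>n. real (nat \<lfloor>real n * R\<rfloor>) / real n) \<longlonglongrightarrow> R"
proof (rule real_tendsto_sandwich)
  have f: "real (nat \<lfloor>real n * R\<rfloor>) = of_int \<lfloor>real n * R\<rfloor>" for n using assms by simp
  show "\<forall>\<^sub>F n in sequentially. R - 1 / real n \<le> real (nat \<lfloor>real n * R\<rfloor>) / real n"
  proof (rule eventually_sequentiallyI[of 1])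
    fix n :: nat assume n: "1 \<le> n"
    have "R - 1 / real n = (real n * R - 1) / real n" using n by (simp add: field_simps)
    also have "\<dots> \<le> real (nat \<lfloor>real n * R\<rfloor>) / real n" unfolding f by (intro divide_right_mono) linarith+
    finally show "R - 1 / real n \<le> real (nat \<lfloor>real n * R\<rfloor>) / real n" .
  qed
  show "\<forall>\<^sub>F n in sequentially. real (nat \<lfloor>real n * R\<rfloor>) / real n \<le> R"
  proof (rule eventually_sequentiallyI[of 1])
    fix n :: nat assume n: "1 \<le> n"
    have "real (nat \<lfloor>real n * R\<rfloor>) / real n \<le> (real n * R) / real n" unfolding f by (intro divide_right_mono) linarith+
    then show "real (nat \<lfloor>real n * R\<rfloor>) / real n \<le> R" using n by simp
  qed
  show "(\<lambda>n. R - 1 / real n) \<longlonglongrightarrow> R" using tendsto_diff[OF tendsto_const[of R] lim_1_over_n] by simp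
qed simp

text \<open>The kept dimension is \<open>K = 2 ^ k n\<close> with \<open>k n\<close> the floor of
  \<open>n * R\<close>, and the thresholds are \<open>2 powr (- n * (h + \<delta>))\<close> for the
  environment and \<open>2 powr (- n * (hJ J - \<delta>))\<close> for \<open>J\<close>, with
  \<open>h\<close> the entropy of the state and \<open>hJ J\<close> that of the complement of
  \<open>J\<close>. The term for \<open>J\<close> is then at most the root of \<open>2 ^ m\<close>
  times 2 to the power \<open>n * (R * card J + 2 * \<delta> + h - hJ J)\<close>, while the
  discarded weights are of order \<open>1 / n\<close>.\<close>

lemma achievable_positive:
  assumes i0: "i0 < m" and st: "is_state m d \<rho>" and R: "0 < R"
    and less: "\<And>J. J \<subseteq> {..<m} - {i0} \<Longrightarrow> J \<noteq> {} \<Longrightarrow> R * real (card J) < coh_info m d J \<rho>"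
  shows "ghz_achievable m d \<rho> R"
proof (rule state_ensemble[OF st])
  fix T :: nat and l :: "nat \<Rightarrow> real" and \<phi>
  assume l: "\<And>k. k < T \<Longrightarrow> 0 \<le> l k" "(\<Sum>k<T. l k) = 1" and S: "vn_entropy \<rho> = - (\<Sum>k<T. l k * log 2 (l k))"
    and \<phi>: "\<And>x y. x \<in> tuples m d \<Longrightarrow> y \<in> tuples m d \<Longrightarrow> \<rho> $$ (enc m d x, enc m d y) = (\<Sum>k<T. \<phi> k x * cnj (\<phi> k y))"
    and orth: "\<And>k k'. k < T \<Longrightarrow> k' < T \<Longrightarrow> (\<Sum>x\<in>tuples m d. \<phi> k x * cnj (\<phi> k' x)) = (if k = k' then of_real (l k) else 0)"
  have d: "d i \<ge> 1" if "i < m" for i using st that by (simp add: is_state_def)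
  define \<J> where "\<J> = Pow ({..<m} - {i0}) - {{}}"
  have finJ: "finite \<J>" by (simp add: \<J>_def)
  have Jsub: "J \<subseteq> {..<m}" "J \<subseteq> {..<m} - {i0}" "J \<noteq> {}" if "J \<in> \<J>" for J using that by (auto simp: \<J>_def)
  define h where "h = - (\<Sum>k<T. l k * log 2 (l k))"
  define hJ where "hJ J = entropy_of m d ({..<m} - J) \<rho>" for J
  have coh: "coh_info m d J \<rho> = hJ J - h" for J
    using st S unfolding coh_info_def hJ_def h_def is_state_def entropy_of_def by (simp add: ptrace_keep_all)
  define Red where "Red J U \<mu> G c \<longleftrightarrow> (\<forall>b<U. 0 \<le> \<mu> b) \<and> (\<Sum>b<U. \<mu> b) = (1::real) \<and>
    (\<forall>\<alpha> \<alpha>' k k'. \<alpha> \<in> tuples m (sub_dims J d) \<longrightarrow> \<alpha>' \<in> tuples m (sub_dims J d) \<longrightarrow>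
       (\<Sum>\<gamma>\<in>tuples m (sub_dims ({..<m} - J) d). \<phi> k (merge J \<alpha> \<gamma>) * cnj (\<phi> k' (merge J \<alpha>' \<gamma>))) = (\<Sum>b<U. G b \<alpha> k * cnj (G b \<alpha>' k'))) \<and>
    (\<forall>b b'. b < U \<longrightarrow> b' < U \<longrightarrow> (\<Sum>k<T. \<Sum>\<alpha>\<in>tuples m (sub_dims J d). G b \<alpha> k * cnj (G b' \<alpha> k)) = (if b = b' then of_real (\<mu> b) else 0)) \<and>
    0 \<le> c \<and> (\<forall>n \<delta>. 0 < \<delta> \<longrightarrow> (\<Sum>b\<in>{b\<in>tuples n (\<lambda>_. U). \<not> (\<Prod>t<n. \<mu> (b t)) \<le> 2 powr (- real n * (hJ J - \<delta>))}. \<Prod>t<n. \<mu> (b t)) \<le> c / (real n * \<delta>\<^sup>2))"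
    for J and U :: nat and \<mu> :: "nat \<Rightarrow> real" and G :: "nat \<Rightarrow> (nat \<Rightarrow> nat) \<Rightarrow> nat \<Rightarrow> complex" and c :: real
  have tr: "(\<Sum>k<T. \<Sum>x\<in>tuples m d. \<phi> k x * cnj (\<phi> k x)) = 1"
  proof -
    have "(\<Sum>k<T. \<Sum>x\<in>tuples m d. \<phi> k x * cnj (\<phi> k x)) = (\<Sum>k<T. of_real (l k))"
      by (intro sum.cong refl) (simp add: orth)
    also have "\<dots> = 1" unfolding of_real_sum[symmetric] l(2) by simp
    finally show ?thesis .
  qed
  have "\<exists>U \<mu> G c. Red J U \<mu> G c" if J: "J \<in> \<J>" for J
  proof (rule reduced_ensemble[OF d Jsub(1)[OF J] \<phi> tr])
    fix U :: nat and \<mu> :: "nat \<Rightarrow> real" and G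
    assume \<mu>: "\<And>b. b < U \<Longrightarrow> 0 \<le> \<mu> b" "(\<Sum>b<U. \<mu> b) = 1" and e: "entropy_of m d ({..<m} - J) \<rho> = - (\<Sum>b<U. \<mu> b * log 2 (\<mu> b))"
      and q: "\<And>\<alpha> \<alpha>' k k'. \<alpha> \<in> tuples m (sub_dims J d) \<Longrightarrow> \<alpha>' \<in> tuples m (sub_dims J d) \<Longrightarrow>
       (\<Sum>\<gamma>\<in>tuples m (sub_dims ({..<m} - J) d). \<phi> k (merge J \<alpha> \<gamma>) * cnj (\<phi> k' (merge J \<alpha>' \<gamma>))) = (\<Sum>b<U. G b \<alpha> k * cnj (G b \<alpha>' k'))"
      "\<And>b b'. b < U \<Longrightarrow> b' < U \<Longrightarrow> (\<Sum>k<T. \<Sum>\<alpha>\<in>tuples m (sub_dims J d). G b \<alpha> k * cnj (G b' \<alpha> k)) = (if b = b' then of_real (\<mu> b) else 0)"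
    show ?thesis
    proof (rule typicality[OF \<mu>])
      fix c :: real assume c: "0 \<le> c" "\<And>n \<delta>. 0 < \<delta> \<Longrightarrow>
        (\<Sum>b\<in>{b\<in>tuples n (\<lambda>_. U). \<not> (\<Prod>t<n. \<mu> (b t)) \<le> 2 powr (- real n * (- (\<Sum>b<U. \<mu> b * log 2 (\<mu> b)) - \<delta>))}. \<Prod>t<n. \<mu> (b t)) \<le> c / (real n * \<delta>\<^sup>2)"
      have "Red J U \<mu> G c"
        unfolding Red_def hJ_def e by (intro conjI allI impI \<mu> q c)
      then show ?thesis by blast
    qed
  qed
  then obtain U \<mu> G c where Red: "\<And>J. J \<in> \<J> \<Longrightarrow> Red J (U J) (\<mu> J) (G J) (c J)" by metis
  note r = Red[unfolded Red_def, THEN conjunct1, rule_format]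
    Red[unfolded Red_def, THEN conjunct2, THEN conjunct1]
    Red[unfolded Red_def, THEN conjunct2, THEN conjunct2, THEN conjunct1, rule_format]
    Red[unfolded Red_def, THEN conjunct2, THEN conjunct2, THEN conjunct2, THEN conjunct1, rule_format]
    Red[unfolded Red_def, THEN conjunct2, THEN conjunct2, THEN conjunct2, THEN conjunct2, THEN conjunct1]
    Red[unfolded Red_def, THEN conjunct2, THEN conjunct2, THEN conjunct2, THEN conjunct2, THEN conjunct2, rule_format]
  obtain c0 :: real where c0: "0 \<le> c0" "\<And>n \<delta>. 0 < \<delta> \<Longrightarrow>
      (\<Sum>e\<in>{e\<in>tuples n (\<lambda>_. T). \<not> 2 powr (- real n * (h + \<delta>)) \<le> (\<Prod>t<n. l (e t))}. \<Prod>t<n. l (e t)) \<le> c0 / (real n * \<delta>\<^sup>2)"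
  proof (rule typicality[OF l])
    fix c :: real assume "0 \<le> c" "\<And>n \<delta>. 0 < \<delta> \<Longrightarrow>
      (\<Sum>e\<in>{e\<in>tuples n (\<lambda>_. T). \<not> 2 powr (- real n * (- (\<Sum>k<T. l k * log 2 (l k)) + \<delta>)) \<le> (\<Prod>t<n. l (e t))}. \<Prod>t<n. l (e t)) \<le> c / (real n * \<delta>\<^sup>2)"
    then show thesis by (rule that[unfolded h_def])
  qed
  \<comment> \<open>One constant for all \<open>J\<close>, as \<open>iid_protocol\<close> takes a
    single \<open>\<epsilon>\<close>.\<close>
  define c1 where "c1 = (\<Sum>J\<in>\<J>. c J)"
  have c1: "c J \<le> c1" if "J \<in> \<J>" for J unfolding c1_def using that finJ r(5) by (intro member_le_sum) auto
  \<comment> \<open>At most a third of the smallest gap: the two thresholds consume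
    \<open>2 * \<delta>\<close>, and the remaining \<delta> makes the error decay. The
    \<open>1\<close> keeps the minimum defined if \<open>i0\<close> is the only party.\<close>
  define \<delta> where "\<delta> = Min (insert 1 ((\<lambda>J. (hJ J - h - R * real (card J)) / 3) ` \<J>))"
  have \<delta>: "0 < \<delta>" unfolding \<delta>_def using finJ less[OF Jsub(2,3)] by (subst Min_gr_iff) (auto simp: coh)
  have gap: "R * real (card J) + 2 * \<delta> + h - hJ J \<le> - \<delta>" if "J \<in> \<J>" for J
  proof -
    have "\<delta> \<le> (hJ J - h - R * real (card J)) / 3" unfolding \<delta>_def using finJ that by (intro Min_le) auto
    then show ?thesis by simp
  qed
  define k where "k n = nat \<lfloor>real n * R\<rfloor>" for n :: nat
  have Kle: "real (2 ^ k n) \<le> 2 powr (real n * R)" for n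
  proof -
    have "real (k n) \<le> real n * R" using R unfolding k_def by simp
    moreover have "real (2 ^ k n) = 2 powr real (k n)" by (simp add: powr_realpow)
    ultimately show ?thesis by simp
  qed
  define s where "s n = sqrt (2 ^ m * 2 powr (- (real n * \<delta>)))" for n :: nat
  define \<epsilon> where "\<epsilon> n = c0 / (real n * \<delta>\<^sup>2) + (\<Sum>J\<in>\<J>. s n + 2 ^ card J * (c1 / (real n * \<delta>\<^sup>2))) / 2" for n
  show ?thesis
  proof (rule ghz_achievableI[OF _ d \<phi>])
    show "1 \<le> m" using i0 by simp
    show "(\<lambda>n. real (k n) / real n) \<longlonglongrightarrow> R" unfolding k_def using R by (intro floor_rate) simp
    have z: "(\<lambda>n. C / (real n * \<delta>\<^sup>2)) \<longlonglongrightarrow> 0" for C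
      using tendsto_mult_right_zero[OF lim_1_over_n, of "C / \<delta>\<^sup>2"] by (simp add: mult.commute)
    have "(\<lambda>n. (2 powr (- \<delta>)) ^ n) \<longlonglongrightarrow> 0" using \<delta> by (intro LIMSEQ_realpow_zero) (auto simp: powr_less_one)
    moreover have "(2 powr (- \<delta>)) ^ n = 2 powr (- (real n * \<delta>))" for n
      by (simp add: powr_realpow[symmetric] powr_powr mult.commute)
    ultimately have "(\<lambda>n. 2 powr (- (real n * \<delta>))) \<longlonglongrightarrow> 0" by simp
    from tendsto_real_sqrt[OF tendsto_mult_right_zero[OF this, of "2 ^ m"]] have "s \<longlonglongrightarrow> 0" unfolding s_def by simp
    then have "(\<lambda>n. \<Sum>J\<in>\<J>. s n + 2 ^ card J * (c1 / (real n * \<delta>\<^sup>2))) \<longlonglongrightarrow> 0"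
      by (intro tendsto_null_sum tendsto_add_zero tendsto_mult_right_zero z)
    from tendsto_add_zero[OF z tendsto_divide_zero[OF this, of 2]] show "\<epsilon> \<longlonglongrightarrow> 0" unfolding \<epsilon>_def .
    fix n
    let ?g = "\<lambda>J. 2 powr (- real n * (hJ J - \<delta>))" and ?a = "2 powr (- real n * (h + \<delta>))"
    show "\<exists>V. locc_value m (\<lambda>i. d i ^ n) (\<lambda>_. 2 ^ k n) (ghz_vec m (2 ^ k n)) V \<and>
       1 - \<epsilon> n \<le> sqrt (\<Sum>e\<in>tuples n (\<lambda>_. T). V (iid_vec d \<phi> n e))"
    proof (rule iid_protocol[of i0 m "2 ^ k n" d T l \<phi> U \<mu> G ?a ?g n "c0 / (real n * \<delta>\<^sup>2)" "c1 / (real n * \<delta>\<^sup>2)"])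
      fix V assume V: "locc_value m (\<lambda>i. d i ^ n) (\<lambda>_. 2 ^ k n) (ghz_vec m (2 ^ k n)) V"
        "1 - c0 / (real n * \<delta>\<^sup>2) - (\<Sum>J\<in>Pow ({..<m} - {i0}) - {{}}. sqrt (real ((2 * 2 ^ k n) ^ card J) * (?g J / ?a)) + 2 ^ card J * (c1 / (real n * \<delta>\<^sup>2))) / 2
          \<le> sqrt (\<Sum>e\<in>tuples n (\<lambda>_. T). V (iid_vec d \<phi> n e))"
      have "sqrt (real ((2 * 2 ^ k n) ^ card J) * (?g J / ?a)) \<le> s n" if J: "J \<in> \<J>" for J
        unfolding s_def
      proof (rule real_sqrt_le_mono)
        have cJ: "card J \<le> m" using card_mono[OF finite_lessThan Jsub(1)[OF J]] by simp
        have "real ((2 * 2 ^ k n) ^ card J) = 2 ^ card J * real (2 ^ k n) ^ card J" by (simp add: power_mult_distrib)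
        also have "\<dots> \<le> 2 ^ m * (2 powr (real n * R)) ^ card J"
          using cJ Kle by (intro mult_mono power_increasing power_mono) auto
        also have "(2 powr (real n * R)) ^ card J = 2 powr (real n * R * real (card J))"
          by (simp add: powr_realpow[symmetric] powr_powr)
        finally have "real ((2 * 2 ^ k n) ^ card J) * (?g J / ?a) \<le> 2 ^ m * 2 powr (real n * R * real (card J)) * (?g J / ?a)"
          by (intro mult_right_mono) auto
        also have "\<dots> = 2 ^ m * 2 powr (real n * (R * real (card J) + 2 * \<delta> + h - hJ J))"
          by (simp add: powr_diff[symmetric] powr_add[symmetric] algebra_simps)
        also have "\<dots> \<le> 2 ^ m * 2 powr (real n * (- \<delta>))"
          by (intro mult_left_mono powr_mono gap J) auto
        finally show "real ((2 * 2 ^ k n) ^ card J) * (?g J / ?a) \<le> 2 ^ m * 2 powr (- (real n * \<delta>))" by simp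
      qed
      then have "(\<Sum>J\<in>\<J>. sqrt (real ((2 * 2 ^ k n) ^ card J) * (?g J / ?a)) + 2 ^ card J * (c1 / (real n * \<delta>\<^sup>2)))
        \<le> (\<Sum>J\<in>\<J>. s n + 2 ^ card J * (c1 / (real n * \<delta>\<^sup>2)))" by (intro sum_mono add_right_mono)
      then have "1 - \<epsilon> n \<le> sqrt (\<Sum>e\<in>tuples n (\<lambda>_. T). V (iid_vec d \<phi> n e))"
        using V(2) unfolding \<J>_def[symmetric] \<epsilon>_def by linarith
      with V(1) show ?thesis by blast
    next
      fix J assume "J \<in> Pow ({..<m} - {i0}) - {{}}"
      then have J: "J \<in> \<J>" by (simp only: \<J>_def)
      have "c J / (real n * \<delta>\<^sup>2) \<le> c1 / (real n * \<delta>\<^sup>2)" using c1[OF J] by (intro divide_right_mono) auto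
      with r(6)[OF J \<delta>, of n]
      show "(\<Sum>b\<in>{b\<in>tuples n (\<lambda>_. U J). \<not> (\<Prod>t<n. \<mu> J (b t)) \<le> ?g J}. \<Prod>t<n. \<mu> J (b t)) \<le> c1 / (real n * \<delta>\<^sup>2)"
        by (rule order_trans)
    next
      show "(\<Sum>e\<in>{e\<in>tuples n (\<lambda>_. T). \<not> ?a \<le> (\<Prod>t<n. l (e t))}. \<Prod>t<n. l (e t)) \<le> c0 / (real n * \<delta>\<^sup>2)" by (rule c0(2)[OF \<delta>])
    qed ((rule i0 d l orth r[unfolded \<J>_def]; assumption) | simp)+
  qed
qed

text \<open>With \<open>k = 0\<close> the target lives on one-dimensional systems, and the parties
  reach it with fidelity 1 by measuring their systems away in the computational basis. This covers a
  minimum that is not positive.\<close>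

lemma achievable_zero:
  assumes m: "m \<ge> 1" and st: "is_state m d \<rho>"
  shows "ghz_achievable m d \<rho> 0"
proof (rule state_ensemble[OF st])
  fix T :: nat and l :: "nat \<Rightarrow> real" and \<phi>
  assume l: "\<And>k. k < T \<Longrightarrow> 0 \<le> l k" "(\<Sum>k<T. l k) = 1"
    and \<phi>: "\<And>x y. x \<in> tuples m d \<Longrightarrow> y \<in> tuples m d \<Longrightarrow> \<rho> $$ (enc m d x, enc m d y) = (\<Sum>k<T. \<phi> k x * cnj (\<phi> k y))"
    and orth: "\<And>k k'. k < T \<Longrightarrow> k' < T \<Longrightarrow> (\<Sum>x\<in>tuples m d. \<phi> k x * cnj (\<phi> k' x)) = (if k = k' then of_real (l k) else 0)"
  have d: "d i \<ge> 1" if "i < m" for i using st that by (simp add: is_state_def)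
  show ?thesis
  proof (rule ghz_achievableI[OF m d \<phi>, where k="\<lambda>_. 0" and \<epsilon>="\<lambda>_. 0"])
    fix n
    let ?D = "\<lambda>i. d i ^ n" and ?one = "\<lambda>_::nat. 1::nat"
    define E where "E j v = mat 1 (d j ^ n) (\<lambda>(r,a). if a = v then 1 else 0 :: complex)" for j v
    define A where "A x \<psi> = (cmod (ip (tuples m (mix m ?one ?D)) (ghz_vec m 1) \<psi>))\<^sup>2" for x :: "nat \<Rightarrow> nat" and \<psi>
    have gv: "ghz_vec m 1 (\<lambda>_. 0) = 1" by (auto simp: ghz_vec_def diag_def image_iff)
    have "tuples m (mix m ?one ?D) = tuples m ?one" by (rule tuples_cong) (simp add: mix_def)
    then have tm: "tuples m (mix m ?one ?D) = {\<lambda>_. 0}" by (simp only: tuples_one)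
    have lv: "locc_value m (mix m ?D ?D) ?one (ghz_vec m 1) (\<lambda>\<psi>. \<Sum>x\<in>tuples m ?D. A x (pop m ?D E x \<psi>))"
    proof (rule locc_value_parallel)
      fix j assume j: "j < m"
      show "msum (d j ^ n) (d j ^ n) (\<lambda>x. mat_adjoint (E j x) * E j x) (d j ^ n) = 1\<^sub>m (d j ^ n)"
      proof (rule instrument_completeI)
        show "E j x \<in> carrier_mat 1 (d j ^ n)" for x by (simp add: E_def)
        fix a a' assume a: "a < d j ^ n" "a' < d j ^ n"
        have "(\<Sum>x<d j ^ n. \<Sum>r<1. cnj (E j x $$ (r, a)) * E j x $$ (r, a')) = (\<Sum>x<d j ^ n. (if x = a then 1 else 0) * (if x = a' then 1 else 0))"
          using a by (intro sum.cong refl) (simp add: E_def)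
        also have "\<dots> = (if a = a' then 1 else 0)" using a by (subst sum_delta_mult) simp_all
        finally show "(\<Sum>x<d j ^ n. \<Sum>r<1. cnj (E j x $$ (r, a)) * E j x $$ (r, a')) = (if a = a' then 1 else 0)" .
      qed
    next
      fix x
      show "locc_value m (mix m ?one ?D) ?one (ghz_vec m 1) (A x)"
        unfolding A_def[abs_def] by (rule locc_value_id) (simp add: mix_def)
    qed (simp_all add: E_def)
    have val: "(\<Sum>x\<in>tuples m ?D. A x (pop m ?D E x \<psi>)) = (\<Sum>x\<in>tuples m ?D. (cmod (\<psi> x))\<^sup>2)" for \<psi>
    proof (intro sum.cong refl)
      fix x assume x: "x \<in> tuples m ?D"
      have "pop m ?D E x \<psi> (\<lambda>_. 0) = (\<Sum>a\<in>tuples m ?D. (if a = x then 1 else 0) * \<psi> (mix m a (\<lambda>_. 0)))"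
        unfolding pop_def
      proof (intro sum.cong refl arg_cong2[where f="(*)"])
        fix a assume a: "a \<in> tuples m ?D"
        have "(\<Prod>j<m. E j (x j) $$ (0, a j)) = (\<Prod>j<m. if a j = x j then complex_of_real 1 else 0)"
          using tuplesD(1)[OF a] by (intro prod.cong refl) (simp add: E_def)
        also have "\<dots> = (if a = x then 1 else 0)"
          using prod_delta_tuples[OF a x, of "\<lambda>_. 1"] by simp
        finally show "(\<Prod>j<m. E j (x j) $$ (0, a j)) = (if a = x then 1 else 0)" .
      qed
      also have "\<dots> = \<psi> (mix m x (\<lambda>_. 0))" using x by (subst sum_delta_mult) simp_all
      also have "mix m x (\<lambda>_. 0) = x" using tuplesD(2)[OF x] by (auto simp: mix_def)
      finally have "pop m ?D E x \<psi> (\<lambda>_. 0) = \<psi> x" .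
      then show "A x (pop m ?D E x \<psi>) = (cmod (\<psi> x))\<^sup>2" unfolding A_def ip_def tm by (simp add: gv[unfolded One_nat_def])
    qed
    have tot: "(\<Sum>e\<in>tuples n (\<lambda>_. T). \<Sum>x\<in>tuples m ?D. (cmod (iid_vec d \<phi> n e x))\<^sup>2) = 1"
    proof -
      have "(\<Sum>x\<in>tuples m ?D. (cmod (iid_vec d \<phi> n e x))\<^sup>2) = (\<Prod>t<n. l (e t))" if "e \<in> tuples n (\<lambda>_. T)" for e
      proof -
        have "complex_of_real (\<Sum>x\<in>tuples m ?D. (cmod (iid_vec d \<phi> n e x))\<^sup>2) = of_real (\<Prod>t<n. l (e t))"
          using iid_vec_orth[where \<phi>=\<phi> and l=l and T=T, OF orth that that] unfolding of_real_sum mult_cnj_eq(1)[symmetric] by simp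
        then show ?thesis by (simp only: of_real_eq_iff)
      qed
      then show ?thesis using sum_iid_one[OF l(2), of n] by simp
    qed
    show "\<exists>V. locc_value m ?D (\<lambda>_. 2 ^ 0) (ghz_vec m (2 ^ 0)) V \<and>
       1 - 0 \<le> sqrt (\<Sum>e\<in>tuples n (\<lambda>_. T). V (iid_vec d \<phi> n e))"
      by (intro exI[of _ "\<lambda>\<psi>. \<Sum>x\<in>tuples m ?D. A x (pop m ?D E x \<psi>)"] conjI)
        (use lv[unfolded mix_self] in \<open>simp_all only: val tot power_0 real_sqrt_one diff_zero order_refl\<close>)
  qed simp_all
qed

theorem theorem3:
  fixes m :: nat and d :: "nat \<Rightarrow> nat" and \<rho> :: "complex mat"
  assumes "m \<ge> 2"
    and "is_state m d \<rho>"
  shows "ghz_capacity m d \<rho> \<ge>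
    ereal (Max ((\<lambda>i. Min ((\<lambda>J. coh_info m d J \<rho> / real (card J))
                     ` {J. J \<subseteq> {..<m} - {i} \<and> J \<noteq> {}})) ` {..<m}))"
proof -
  let ?F = "\<lambda>i. Min ((\<lambda>J. coh_info m d J \<rho> / real (card J)) ` {J. J \<subseteq> {..<m} - {i} \<and> J \<noteq> {}})"
  have up: "ereal R \<le> ghz_capacity m d \<rho>" if "ghz_achievable m d \<rho> R" for R
    unfolding ghz_capacity_def using that by (intro Sup_upper) simp
  have key: "ereal (?F i) \<le> ghz_capacity m d \<rho>" if i: "i < m" for i
  proof (cases "?F i \<le> 0")
    case True
    have "ereal (?F i) \<le> ereal 0" using True by simp
    also have "\<dots> \<le> ghz_capacity m d \<rho>" using achievable_zero[OF _ assms(2)] assms(1) by (intro up) simp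
    finally show ?thesis .
  next
    case False
    show ?thesis
    \<comment> \<open>The rate condition of \<open>achievable_positive\<close> is strict, so the
      minimum is approached from below; the supremum in the capacity reaches it.\<close>
    proof (rule ereal_le_epsilon2)
      fix e :: real assume e: "0 < e"
      \<comment> \<open>The second argument keeps the rate positive when \<open>e\<close> exceeds
        the minimum.\<close>
      define R where "R = max (?F i - e) (?F i / 2)"
      have R: "0 < R" "R < ?F i" using False e by (auto simp: R_def)
      have "ghz_achievable m d \<rho> R"
      proof (rule achievable_positive[OF i assms(2) R(1)])
        fix J assume J: "J \<subseteq> {..<m} - {i}" "J \<noteq> {}"
        have fin: "finite {J. J \<subseteq> {..<m} - {i} \<and> J \<noteq> {}}" by (rule finite_subset[of _ "Pow {..<m}"]) auto
        have "?F i \<le> coh_info m d J \<rho> / real (card J)" using J fin by (intro Min_le) auto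
        moreover have "0 < real (card J)" using J finite_subset[OF J(1)] by (simp add: card_gt_0_iff)
        ultimately show "R * real (card J) < coh_info m d J \<rho>" using R(2) by (simp add: pos_less_divide_eq[symmetric])
      qed
      from up[OF this] have "ereal R + ereal e \<le> ghz_capacity m d \<rho> + ereal e" by (rule add_right_mono)
      moreover have "ereal (?F i) \<le> ereal R + ereal e"
      proof -
        have "?F i - e \<le> R" unfolding R_def by (rule max.cobounded1)
        then have "ereal (?F i) \<le> ereal (R + e)" unfolding ereal_less_eq by linarith
        then show ?thesis by (simp only: plus_ereal.simps)
      qed
      ultimately show "ereal (?F i) \<le> ghz_capacity m d \<rho> + ereal e" by (rule order_trans[rotated])
    qed
  qed
  have "0 \<in> {..<m}" using assms(1) by simp
  then have "Max (?F ` {..<m}) \<in> ?F ` {..<m}" by (intro Max_in) auto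
  then obtain i where i: "Max (?F ` {..<m}) = ?F i" "i \<in> {..<m}" by (rule imageE)
  show ?thesis unfolding i(1) by (rule key) (use i(2) in simp)
qed

end
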